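(* Let $\mathcal{Q}_1$ be a set of prime powers with the following property: every $q\in\mathcal{Q}_1$ can be written as $q=r_1^{e_1}\cdots r_m^{e_m}+1$, where $r_1,\ldots,r_m$ are distinct primes and $e_1,\ldots,e_m\geq 1$, such that $r_1+\cdots+r_m=O(\mathrm{poly}(\log q))$, and such that for each $1\leq j\leq m$ a primitive $z_j$-th root of unity in $\mathbb{F}_q$ can be computed in time polynomial in $\log q$, where $z_j=4$ if $r_j=2$ and $z_j=r_j$ otherwise. Then for $q\in\mathcal{Q}_1$ there is a deterministic algorithm running in $\tilde{O}(\mathrm{poly}(d\log q))$ bit operations that solves the polynomial equation $f(x)=0$ over $\mathbb{F}_q$ (i.e. finds its solutions in $\mathbb{F}_q$) for any polynomial $f(x)\in\mathbb{F}_q[x]$ of degree $d$.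
   Context: $\mathbb{F}_q$ denotes the finite field with $q$ elements. The notation $\tilde{O}(\cdot)$ is the $O(\cdot)$ notation with logarithmic factors ignored. *)

theory Defs
  imports
    Complex_Main
    "HOL-Library.Log_Nat"
    "HOL-Computational_Algebra.Polynomial"
    "HOL-Number_Theory.Prime_Powers"
    "HOL-Number_Theory.Residues"
    "HOL-Algebra.Polynomial_Divisibility"
begin

hide_const (open) Divisibility.prime

section \<open>Deterministic algorithms and their number of bit operations\<close>

text \<open>
  An algorithm is a structured program that works on finitely many registers, each holding a
  natural number, and finitely many stacks of natural numbers; this is a random access machine
  without indirect addressing, the stacks being its unbounded memory.  Integers have arbitrary
  size, and every instruction is charged the bit operations it takes (logarithmic cost):
  linear in the binary lengths of the operands for moving, adding, subtracting and testing, the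
  product of the lengths for schoolbook multiplication and division.
\<close>

datatype binop = OpAdd | OpSub | OpMul | OpDiv | OpMod

text \<open>Subtraction on \<^typ>\<open>nat\<close> is truncated, and \<open>a div 0 = 0\<close>, \<open>a mod 0 = a\<close>.\<close>

fun binop_val :: "binop \<Rightarrow> nat \<Rightarrow> nat \<Rightarrow> nat" where
  "binop_val OpAdd a b = a + b"
| "binop_val OpSub a b = a - b"
| "binop_val OpMul a b = a * b"
| "binop_val OpDiv a b = a div b"
| "binop_val OpMod a b = a mod b"

text \<open>Number of binary digits, where \<open>0\<close> is written with one digit.\<close>

definition bit_size :: "nat \<Rightarrow> nat" where
  "bit_size a = max 1 (floorlog 2 a)"

fun binop_cost :: "binop \<Rightarrow> nat \<Rightarrow> nat \<Rightarrow> nat" where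
  "binop_cost OpAdd a b = bit_size a + bit_size b"
| "binop_cost OpSub a b = bit_size a + bit_size b"
| "binop_cost OpMul a b = bit_size a * bit_size b"
| "binop_cost OpDiv a b = bit_size a * bit_size b"
| "binop_cost OpMod a b = bit_size a * bit_size b"

text \<open>
  \<open>Load x a\<close>: \<open>x := a\<close>;
  \<open>Op bop x y z\<close>: \<open>x := y bop z\<close>;
  \<open>Push s x\<close>: push the value of register \<open>x\<close> onto stack \<open>s\<close>;
  \<open>Pop x s\<close>: move the top of stack \<open>s\<close> to register \<open>x\<close> (\<open>x := 0\<close> if \<open>s\<close> is empty);
  \<open>Empty x s\<close>: \<open>x := 1\<close> if stack \<open>s\<close> is empty, \<open>x := 0\<close> otherwise.
  The conditions of \<open>IfNZ\<close> and \<open>WhileNZ\<close> are \<open>x \<noteq> 0\<close>.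
\<close>

datatype program =
    Skip
  | Load nat nat
  | Op binop nat nat nat
  | Push nat nat
  | Pop nat nat
  | Empty nat nat
  | Seq program program
  | IfNZ nat program program
  | WhileNZ nat program

text \<open>Contents of the registers and of the stacks; the top of a stack is the head of the list.\<close>

type_synonym state = "(nat \<Rightarrow> nat) \<times> (nat \<Rightarrow> nat list)"

text \<open>
  \<open>exec c \<sigma> t \<sigma>'\<close>: started in \<open>\<sigma>\<close>, the program \<open>c\<close> halts in \<open>\<sigma>'\<close> after exactly \<open>t\<close> bit
  operations.
\<close>

inductive exec :: "program \<Rightarrow> state \<Rightarrow> nat \<Rightarrow> state \<Rightarrow> bool" where
  Skip: "exec Skip \<sigma> 1 \<sigma>"
| Load: "exec (Load x a) (R, S) (bit_size a) (R(x := a), S)"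
| Op: "exec (Op bop x y z) (R, S) (binop_cost bop (R y) (R z))
         (R(x := binop_val bop (R y) (R z)), S)"
| Push: "exec (Push s x) (R, S) (bit_size (R x)) (R, S(s := R x # S s))"
| Pop_Nil: "S s = [] \<Longrightarrow> exec (Pop x s) (R, S) 1 (R(x := 0), S)"
| Pop_Cons: "S s = a # as \<Longrightarrow> exec (Pop x s) (R, S) (bit_size a) (R(x := a), S(s := as))"
| Empty: "exec (Empty x s) (R, S) 1 (R(x := (if S s = [] then 1 else 0)), S)"
| Seq: "exec c \<sigma> t \<sigma>' \<Longrightarrow> exec d \<sigma>' u \<sigma>'' \<Longrightarrow> exec (Seq c d) \<sigma> (t + u) \<sigma>''"
| IfNZ_True: "R x \<noteq> 0 \<Longrightarrow> exec c (R, S) t \<sigma>' \<Longrightarrow> exec (IfNZ x c d) (R, S) (bit_size (R x) + t) \<sigma>'"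
| IfNZ_False: "R x = 0 \<Longrightarrow> exec d (R, S) t \<sigma>' \<Longrightarrow> exec (IfNZ x c d) (R, S) (bit_size (R x) + t) \<sigma>'"
| WhileNZ_True: "R x \<noteq> 0 \<Longrightarrow> exec c (R, S) t \<sigma>' \<Longrightarrow> exec (WhileNZ x c) \<sigma>' u \<sigma>'' \<Longrightarrow>
    exec (WhileNZ x c) (R, S) (bit_size (R x) + t + u) \<sigma>''"
| WhileNZ_False: "R x = 0 \<Longrightarrow> exec (WhileNZ x c) (R, S) (bit_size (R x)) (R, S)"

inductive_cases exec_cases:
  "exec Skip \<sigma> t \<sigma>'" "exec (Load x a) \<sigma> t \<sigma>'" "exec (Op bop x y z) \<sigma> t \<sigma>'"
  "exec (Push s x) \<sigma> t \<sigma>'" "exec (Pop x s) \<sigma> t \<sigma>'" "exec (Empty x s) \<sigma> t \<sigma>'"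

inductive_cases exec_Seq_cases: "exec (Seq c d) \<sigma> t \<sigma>'"
inductive_cases exec_IfNZ_cases: "exec (IfNZ x c d) \<sigma> t \<sigma>'"
inductive_cases exec_WhileNZ_cases: "exec (WhileNZ x c) \<sigma> t \<sigma>'"

lemma exec_deterministic:
  "exec c \<sigma> t \<sigma>' \<Longrightarrow> exec c \<sigma> u \<sigma>'' \<Longrightarrow> u = t \<and> \<sigma>'' = \<sigma>'"
proof (induction arbitrary: u \<sigma>'' rule: exec.induct)
  case (Seq c \<sigma> t \<sigma>' d v \<tau>)
  from Seq.prems obtain t1 \<rho> t2 where "exec c \<sigma> t1 \<rho>" "exec d \<rho> t2 \<sigma>''" "u = t1 + t2"
    by (rule exec_Seq_cases)
  with Seq.IH show ?case by blast
next
  case (IfNZ_True R x c S t \<sigma>' d)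
  from IfNZ_True.prems
  obtain t1 where "exec c (R, S) t1 \<sigma>''" "u = bit_size (R x) + t1"
    by (cases rule: exec_IfNZ_cases) (use IfNZ_True.hyps(1) in auto)
  with IfNZ_True.IH show ?case by blast
next
  case (IfNZ_False R x d S t \<sigma>' c)
  from IfNZ_False.prems
  obtain t1 where "exec d (R, S) t1 \<sigma>''" "u = bit_size (R x) + t1"
    by (cases rule: exec_IfNZ_cases) (use IfNZ_False.hyps(1) in auto)
  with IfNZ_False.IH show ?case by blast
next
  case (WhileNZ_True R x c S t \<sigma>' v \<tau>)
  from WhileNZ_True.prems
  obtain t1 \<rho> t2 where "exec c (R, S) t1 \<rho>" "exec (WhileNZ x c) \<rho> t2 \<sigma>''"
    "u = bit_size (R x) + t1 + t2"
    by (cases rule: exec_WhileNZ_cases) (use WhileNZ_True.hyps(1) in auto)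
  with WhileNZ_True.IH show ?case by blast
next
  case (WhileNZ_False R x c S)
  from WhileNZ_False.prems show ?case
    by (cases rule: exec_WhileNZ_cases) (use WhileNZ_False.hyps in auto)
qed (elim exec_cases; simp)+

text \<open>The input is on stack 0, everything else is cleared; the output is read off stack 1.\<close>

definition computes :: "program \<Rightarrow> nat list \<Rightarrow> nat list \<Rightarrow> nat \<Rightarrow> bool" where
  "computes A xs ys t \<longleftrightarrow>
     (\<exists>R S. exec A (\<lambda>_. 0, (\<lambda>_. [])(0 := xs)) t (R, S) \<and> S 1 = ys)"


section \<open>Finite fields and polynomials as inputs\<close>

text \<open>
  A finite field with \<open>q = p ^ n\<close> elements is presented as \<open>(\<int>/p)[X]/(g)\<close> for a prime \<open>p\<close> and a
  monic irreducible polynomial \<open>g\<close> of degree \<open>n\<close>.  All coefficient lists start with the leading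
  coefficient, as in \<^theory>\<open>HOL-Algebra.Polynomials\<close>.
\<close>

type_synonym presentation = "nat \<times> nat list"

definition presentations :: "nat \<Rightarrow> presentation set" where
  "presentations q = {(p, g). prime p \<and>
     map int g \<in> carrier (poly_ring (residue_ring (int p))) \<and> hd g = 1 \<and>
     pirreducible\<^bsub>residue_ring (int p)\<^esub> (carrier (residue_ring (int p))) (map int g) \<and>
     q = p ^ (length g - 1)}"

definition Fq :: "presentation \<Rightarrow> int list set ring" where
  "Fq K = (case K of (p, g) \<Rightarrow>
     Rupt\<^bsub>residue_ring (int p)\<^esub> (carrier (residue_ring (int p))) (map int g))"

text \<open>
  Elements of the field are written as lists of exactly \<open>n\<close> residues modulo \<open>p\<close>; since leading
  zeros are allowed here, \<open>ring.normalize\<close> is needed to get a polynomial of the library.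
\<close>

definition codes :: "presentation \<Rightarrow> nat list set" where
  "codes K = (case K of (p, g) \<Rightarrow> {v. length v = length g - 1 \<and> set v \<subseteq> {..<p}})"

definition field_elem :: "presentation \<Rightarrow> nat list \<Rightarrow> int list set" where
  "field_elem K v = (case K of (p, g) \<Rightarrow>
     PIdl\<^bsub>poly_ring (residue_ring (int p))\<^esub> (map int g)
       +>\<^bsub>poly_ring (residue_ring (int p))\<^esub> ring.normalize (residue_ring (int p)) (map int v))"

text \<open>Nonzero polynomials over the field, by the codes of their coefficients.\<close>

definition poly_codes :: "presentation \<Rightarrow> nat list list set" where
  "poly_codes K = {cs. cs \<noteq> [] \<and> set cs \<subseteq> codes K \<and> map (field_elem K) cs \<in> carrier (poly_ring (Fq K))}"

definition input_field :: "presentation \<Rightarrow> nat list" where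
  "input_field K = (case K of (p, g) \<Rightarrow> p # (length g - 1) # g)"

definition input_poly :: "nat list list \<Rightarrow> nat list" where
  "input_poly cs = (length cs - 1) # concat cs"

definition primitive_root_of_unity :: "('a, 'b) ring_scheme \<Rightarrow> nat \<Rightarrow> 'a \<Rightarrow> bool" where
  "primitive_root_of_unity F z x \<longleftrightarrow> x \<in> carrier F \<and> 0 < z \<and> x [^]\<^bsub>F\<^esub> z = \<one>\<^bsub>F\<^esub> \<and>
     (\<forall>k. 0 < k \<and> k < z \<longrightarrow> x [^]\<^bsub>F\<^esub> k \<noteq> \<one>\<^bsub>F\<^esub>)"

text \<open>
  Soft-O of \<open>P(x)\<close> as an explicit bound: a constant factor can be absorbed into \<open>P\<close>, and the
  summand \<open>2\<close> only serves to keep the ignored logarithmic factor at least \<open>1\<close>.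
\<close>

definition soft_poly_bound :: "real poly \<Rightarrow> nat \<Rightarrow> real \<Rightarrow> real" where
  "soft_poly_bound P k x = poly P x * (log 2 (2 + x)) ^ k"

end

theory Submission imports Defs begin

text \<open>
  The roots of \<open>f\<close> are found by descending along a chain \<open>q - 1 = M\<^sub>0, M\<^sub>1, \<dots>, 1\<close> in which consecutive
  terms differ by a prime factor of \<open>q - 1\<close>.  The Graeffe transform of a polynomial with respect to
  a prime \<open>r\<close> is computed with the help of a primitive \<open>r\<close>-th root of unity and vanishes at the \<open>r\<close>-th powers of
  its roots; after all steps every nonzero root has become \<open>1\<close>.  Going back, the candidates for the
  roots are the \<open>r\<close>-th roots of the roots found one level up, so that the only real task is to extract an
  \<open>r\<close>-th root of a given \<open>r\<close>-th power \<open>c\<close>, in time polynomial in \<open>r\<close> and \<open>log q\<close> and without a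
  nonresidue at hand.  This is done by calculating in the algebra \<open>F[T]/(T\<^sup>r - c)\<close>, whose points are
  the \<open>r\<close>-th roots of \<open>c\<close>.  The elements that vanish
  at some but not all of them split the algebra; a function of norm \<open>1\<close> that is not constant
  on the points supplies them, since its values at two points first become equal at some term of the chain.

  Running times are controlled by closure properties: the functions computable on this machine in
  time polynomial in the size of the argument are closed under composition, case distinctions and
  folds over lists whose intermediate results stay polynomially bounded.  The prime factors of \<open>q - 1\<close>
  are found by trial division up to a polynomial bound, and the given program for the roots of
  unity is run as a subroutine on shifted registers.
\<close>

section \<open>Running programs within a time bound\<close>

text \<open>Extracting one \<open>r\<close>-th root yields polynomially many candidates, and the
  chain may have \<open>log q\<close> terms, so their number would explode if it were multiplied at
  each term. This is the purpose of the Graeffe transforms: every level has a polynomial of the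
  degree of \<open>f\<close>, and candidates that are no roots of it are discarded. Wrong candidates
  are therefore harmless; completeness is what has to be proved.

  The function of norm \<open>1\<close> is \<open>s(y) = (1 + y) / (1 + \<zeta> y)\<close>. Where
  \<open>s ^ M\<close> is not constant on the \<open>r\<close>-th roots of \<open>c\<close> but its
  \<open>\<rho>\<close>-th power is, the norm forces that constant \<open>C\<close> to satisfy
  \<open>C ^ r = 1\<close>. So some value of \<open>s ^ M\<close> is a product of known roots of
  unity, or two of its values agree; either case yields a splitting element. For
  \<open>r = \<rho> = 2\<close> a value can be a fourth root of unity, whence the special role of
  \<open>4\<close>.

  On the machine side, closure properties are proved on whole types, so size bounds must hold for
  malformed data as well. Hence the definitions cut lists to prescribed lengths and reduce modulo
  nonzero numbers; on proper data the cuts change nothing.\<close>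

definition run :: "program \<Rightarrow> state \<Rightarrow> nat \<Rightarrow> (state \<Rightarrow> bool) \<Rightarrow> bool" where
  "run c \<sigma> T Q \<longleftrightarrow> (\<exists>t \<sigma>'. exec c \<sigma> t \<sigma>' \<and> t \<le> T \<and> Q \<sigma>')"

lemma run_mono: "run c \<sigma> T P \<Longrightarrow> T \<le> T' \<Longrightarrow> (\<And>\<sigma>'. P \<sigma>' \<Longrightarrow> Q \<sigma>') \<Longrightarrow> run c \<sigma> T' Q"
  unfolding run_def by (meson order_trans)

lemma run_Seq:
  assumes "run c \<sigma> T P" "\<And>\<sigma>'. P \<sigma>' \<Longrightarrow> run d \<sigma>' T' Q"
  shows "run (Seq c d) \<sigma> (T + T') Q"
  using assms unfolding run_def by (meson exec.Seq add_mono)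

lemma run_IfNZ:
  assumes "R x \<noteq> 0 \<Longrightarrow> run c (R, S) T Q" "R x = 0 \<Longrightarrow> run d (R, S) T Q"
  shows "run (IfNZ x c d) (R, S) (bit_size (R x) + T) Q"
  using assms unfolding run_def by (metis exec.IfNZ_True exec.IfNZ_False nat_add_left_cancel_le)

text \<open>The invariant is indexed by the number of rounds still to come and so carries
  termination along with correctness: \<open>I (Suc n)\<close> forces the test to succeed,
  \<open>I 0\<close> forces it to fail. The summand \<open>1\<close> pays for the last test, since
  zero is written with one digit.\<close>

lemma run_WhileNZ:
  assumes step: "\<And>n R S. I (Suc n) (R, S) \<Longrightarrow> R x \<noteq> 0 \<and> bit_size (R x) \<le> B \<and> run c (R, S) T (I n)"
    and stop: "\<And>R S. I 0 (R, S) \<Longrightarrow> R x = 0"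
  shows "I n \<sigma> \<Longrightarrow> run (WhileNZ x c) \<sigma> (n * (B + T) + 1) (I 0)"
proof (induction n arbitrary: \<sigma>)
  case 0
  obtain R S where \<sigma>: "\<sigma> = (R, S)" by fastforce
  have x: "R x = 0" using stop 0 \<sigma> by blast
  have "exec (WhileNZ x c) (R, S) (bit_size (R x)) (R, S)"
    by (rule exec.WhileNZ_False) (rule x)
  moreover have "bit_size (R x) = 1" using x by (simp add: bit_size_def floorlog_def)
  ultimately show ?case unfolding run_def using 0 \<sigma> by (intro exI) auto
next
  case (Suc n)
  obtain R S where \<sigma>: "\<sigma> = (R, S)" by fastforce
  from step Suc.prems \<sigma> have x: "R x \<noteq> 0" "bit_size (R x) \<le> B" and "run c (R, S) T (I n)" by auto
  then obtain t \<sigma>' where t: "exec c (R, S) t \<sigma>'" "t \<le> T" "I n \<sigma>'" unfolding run_def by blast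
  from Suc.IH[OF t(3)] obtain u \<sigma>'' where
    u: "exec (WhileNZ x c) \<sigma>' u \<sigma>''" "u \<le> n * (B + T) + 1" "I 0 \<sigma>''" unfolding run_def by blast
  have "exec (WhileNZ x c) (R, S) (bit_size (R x) + t + u) \<sigma>''"
    using x t u by (intro exec.WhileNZ_True)
  moreover have "bit_size (R x) + t + u \<le> Suc n * (B + T) + 1" using x t u by simp
  ultimately show ?case unfolding run_def using u \<sigma> by blast
qed

text \<open>Straight-line code is executed symbolically by \<open>effect\<close> and
  \<open>cost\<close>, so that the simplifier can evaluate whole blocks. Stack operations and
  control structures get dummy values there and are excluded by \<open>simple\<close>.\<close>

fun simple :: "program \<Rightarrow> bool" where
  "simple (Load x a) = True"
| "simple (Op bop x y z) = True"
| "simple _ = False"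

fun effect :: "program \<Rightarrow> (nat \<Rightarrow> nat) \<Rightarrow> nat \<Rightarrow> nat" where
  "effect (Load x a) R = R(x := a)"
| "effect (Op bop x y z) R = R(x := binop_val bop (R y) (R z))"
| "effect _ R = R"

fun cost :: "program \<Rightarrow> (nat \<Rightarrow> nat) \<Rightarrow> nat" where
  "cost (Load x a) R = bit_size a"
| "cost (Op bop x y z) R = binop_cost bop (R y) (R z)"
| "cost _ R = 0"

fun block :: "program list \<Rightarrow> program" where
  "block [] = Skip"
| "block (c # cs) = Seq c (block cs)"

fun block_cost :: "program list \<Rightarrow> (nat \<Rightarrow> nat) \<Rightarrow> nat" where
  "block_cost [] R = 1"
| "block_cost (c # cs) R = cost c R + block_cost cs (effect c R)"

lemma exec_block:
  "\<forall>c\<in>set cs. simple c \<Longrightarrow> exec (block cs) (R, S) (block_cost cs R) (fold effect cs R, S)"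
proof (induction cs arbitrary: R)
  case Nil
  show ?case using exec.Skip by simp
next
  case (Cons c cs)
  have "exec c (R, S) (cost c R) (effect c R, S)"
    using Cons.prems by (cases c) (auto intro: exec.intros)
  then show ?case using Cons by (auto intro: exec.Seq)
qed

lemma run_block:
  assumes "\<forall>c\<in>set cs. simple c" "block_cost cs R \<le> T" "Q (fold effect cs R, S)"
  shows "run (block cs) (R, S) T Q"
  using assms exec_block unfolding run_def by blast


section \<open>Encoding of data in a single register\<close>

text \<open>Unlike \<open>bit_size\<close>, this length is zero for the number zero, which makes the
  size of an encoded pair or list an exact sum.\<close>

abbreviation bl :: "nat \<Rightarrow> nat" where "bl \<equiv> floorlog 2"

lemma bl_0 [simp]: "bl 0 = 0" by (simp add: floorlog_def)
lemma bl_1 [simp]: "bl 1 = 1" "bl (Suc 0) = 1" by (simp_all add: floorlog_def)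
lemma bl_2 [simp]: "bl 2 = 2" by (simp add: compute_floorlog)

lemma less_power_bl: "n < 2 ^ bl n"
  by (cases "n = 0") (auto intro: floorlog_bounds[THEN conjunct2])

lemma bl_le_iff: "bl n \<le> k \<longleftrightarrow> n < 2 ^ k"
  by (simp add: floorlog_le_iff)

lemma bl_le_self: "bl n \<le> n"
  by (simp add: bl_le_iff)

lemma bl_mono: "m \<le> n \<Longrightarrow> bl m \<le> bl n" by (rule floorlog_mono)

lemma bl_add: "bl (m + n) \<le> bl m + bl n + 1"
proof -
  have "m * 1 \<le> 2 ^ bl m * 2 ^ bl n" "n * 1 \<le> 2 ^ bl n * 2 ^ bl m"
    by (intro mult_mono; use less_power_bl[of m] less_power_bl[of n] in simp)+
  moreover have "m < 2 ^ bl m * 2 ^ bl n \<or> m = 0 \<or> True" by simp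
  moreover have "m < 2 ^ bl m * 2 ^ bl n"
    using less_power_bl[of m] by (metis less_le_trans mult.right_neutral mult_le_mono2 one_le_numeral one_le_power)
  ultimately have "m + n < 2 * (2 ^ bl m * 2 ^ bl n)" by (simp add: mult.commute)
  then show ?thesis by (simp add: bl_le_iff power_add mult_ac)
qed

lemma bl_mult: "bl (m * n) \<le> bl m + bl n"
  unfolding bl_le_iff power_add by (intro mult_strict_mono less_power_bl) auto

lemma bl_pow2 [simp]: "bl (2 ^ k) = k + 1"
  using floorlog_power[of 1 2 k] by simp

lemma bl_double: "bl (2 * n + 1) = bl n + 1"
  by (subst compute_floorlog) simp

lemma bl_div2: "bl (n div 2) = bl n - 1"
proof (cases "n = 0")
  case False
  then show ?thesis by (subst (2) compute_floorlog) simp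
qed simp

lemma bl_append: "x < 2 ^ k \<Longrightarrow> l > 0 \<Longrightarrow> bl (l * 2 ^ k + x) = bl l + k"
proof (induction k arbitrary: x)
  case (Suc k)
  have "(l * 2 ^ Suc k + x) div 2 = l * 2 ^ k + x div 2"
    using div_mult_self2[of 2 x "l * 2 ^ k"] by (simp add: algebra_simps)
  with Suc show ?case by (subst compute_floorlog) auto
qed simp

text \<open>A self-delimiting code: from the low end, \<open>bl x\<close> zeros and a one announce
  the length of \<open>x\<close>, then come the digits of \<open>x\<close>, then \<open>l\<close>.
  The tail is stored without overhead, so sizes add up along a list, whereas a Cantor pairing could
  double the size with each cell.\<close>

definition consn :: "nat \<Rightarrow> nat \<Rightarrow> nat" where
  "consn x l = ((l * 2 ^ bl x + x) * 2 + 1) * 2 ^ bl x"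

lemma consn_pos [simp]: "consn x l \<noteq> 0" "0 < consn x l" by (auto simp: consn_def)

lemma bl_consn: "bl (consn x l) = bl l + 2 * bl x + 1"
proof (cases "l = 0")
  case True
  have "bl ((2 * x + 1) * 2 ^ bl x) = bl (2 * x + 1) + bl x" by (rule floorlog_power) auto
  then show ?thesis using bl_double[of x] True by (simp add: consn_def mult_ac)
next
  case False
  then have "bl (l * 2 ^ bl x + x) = bl l + bl x" by (intro bl_append less_power_bl) simp
  moreover have "bl ((2 * (l * 2 ^ bl x + x) + 1) * 2 ^ bl x) = bl (2 * (l * 2 ^ bl x + x) + 1) + bl x"
    by (rule floorlog_power) auto
  ultimately show ?thesis using bl_double[of "l * 2 ^ bl x + x"] by (simp add: consn_def mult_ac)
qed

lemma odd_power2_inj: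
  fixes a b :: nat
  shows "(a * 2 + 1) * 2 ^ k = (b * 2 + 1) * 2 ^ m \<Longrightarrow> a = b \<and> k = m"
proof (induction k arbitrary: m)
  case 0
  have "odd ((a * 2 + 1) * 2 ^ (0::nat))" by simp
  then have "odd ((b * 2 + 1) * 2 ^ m)" by (metis 0)
  then show ?case using 0 by (cases m) simp_all
next
  case (Suc k)
  have "even ((a * 2 + 1) * 2 ^ Suc k)" by simp
  then have "even ((b * 2 + 1) * 2 ^ m)" by (metis Suc.prems)
  then obtain m' where m: "m = Suc m'" by (cases m) simp_all
  then have "(a * 2 + 1) * 2 ^ k = (b * 2 + 1) * 2 ^ m'" using Suc.prems by simp
  then show ?case using Suc.IH m by blast
qed

lemma consn_inject [simp]: "consn x l = consn y m \<longleftrightarrow> x = y \<and> l = m"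
proof
  assume "consn x l = consn y m"
  then have *: "l * 2 ^ bl x + x = m * 2 ^ bl y + y" "bl x = bl y"
    using odd_power2_inj unfolding consn_def by blast+
  then have "(l * 2 ^ bl x + x) div 2 ^ bl x = (m * 2 ^ bl x + y) div 2 ^ bl x" by simp
  then have "l = m" using less_power_bl[of x] less_power_bl[of y] *(2) by simp
  then show "x = y \<and> l = m" using * by simp
qed auto

text \<open>Injectivity is required within a type only. A nonempty list shares its code with the
  pair of its head and tail, which later lets programs for pairs serve for lists.\<close>

class enc =
  fixes enc :: "'a \<Rightarrow> nat"
  assumes enc_inject: "enc x = enc y \<Longrightarrow> x = y"

lemma enc_eq_iff [simp]: "enc x = enc y \<longleftrightarrow> x = y"
  using enc_inject by blast

instantiation nat :: enc begin
definition "enc_nat (n :: nat) = n"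
instance by standard (simp add: enc_nat_def)
end

instantiation bool :: enc begin
definition "enc_bool b = (if b then 1 else 0 :: nat)"
instance by standard (simp add: enc_bool_def split: if_splits)
end

instantiation prod :: (enc, enc) enc begin
definition "enc_prod z = consn (enc (fst z)) (enc (snd z))"
instance by standard (simp add: enc_prod_def prod_eq_iff)
end

instantiation list :: (enc) enc begin
definition "enc_list xs = foldr (\<lambda>x. consn (enc x)) xs 0"
instance
proof
  fix xs ys :: "'a list"
  assume "enc xs = enc ys"
  then show "xs = ys"
  proof (induction xs arbitrary: ys)
    case Nil
    then show ?case by (cases ys) (auto simp: enc_list_def)
  next
    case (Cons x xs)
    then show ?case by (cases ys) (auto simp: enc_list_def)
  qed
qed
end

lemma enc_simps [simp]:
  "enc (n :: nat) = n" "enc True = 1" "enc False = 0"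
  "enc (a, b) = consn (enc a) (enc b)"
  "enc [] = 0" "enc (x # xs) = consn (enc x) (enc xs)"
  by (simp_all add: enc_nat_def enc_bool_def enc_prod_def enc_list_def)

lemma enc_eq_0_iff [simp]: "enc (xs :: 'a::enc list) = 0 \<longleftrightarrow> xs = []"
  by (cases xs) auto

lemma enc_bool_eq_0_iff [simp]: "enc b = 0 \<longleftrightarrow> \<not> b"
  by (cases b) auto

definition sz :: "'a::enc \<Rightarrow> nat" where "sz x = bl (enc x)"

lemma sz_simps [simp]:
  "sz (n :: nat) = bl n" "sz True = 1" "sz False = 0" "sz (a, b) = 2 * sz a + sz b + 1"
  "sz [] = 0" "sz (x # xs) = 2 * sz x + sz xs + 1"
  by (simp_all add: sz_def bl_consn)

lemma sz_bool: "sz (b :: bool) \<le> 1" by (cases b) auto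
lemma sz_fst: "sz (fst z) \<le> sz z" and sz_snd: "sz (snd z) \<le> sz z" by (cases z; simp)+

lemma sz_list: "sz xs = (\<Sum>x\<leftarrow>xs. 2 * sz x + 1)"
  by (induction xs) auto

lemma length_le_sz: "length xs \<le> sz xs"
  by (induction xs) auto

lemma sz_elem: "x \<in> set xs \<Longrightarrow> 2 * sz x + 1 \<le> sz xs"
  by (induction xs) auto

lemma sz_append [simp]: "sz (xs @ ys) = sz xs + sz ys" by (simp add: sz_list)
lemma sz_rev [simp]: "sz (rev xs) = sz xs" by (simp add: sz_list rev_map[symmetric] sum_list_rev)

lemma sz_list_le:
  assumes "\<And>x. x \<in> set xs \<Longrightarrow> sz x \<le> B" "length xs \<le> N"
  shows "sz xs \<le> N * (2 * B + 1)"
proof -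
  have "sz xs \<le> length xs * (2 * B + 1)" using assms(1)
  proof (induction xs)
    case (Cons x xs)
    have "sz x \<le> B" "sz xs \<le> length xs * (2 * B + 1)" using Cons by simp_all
    then show ?case by simp
  qed simp
  also have "\<dots> \<le> N * (2 * B + 1)" using assms(2) by (rule mult_le_mono1)
  finally show ?thesis .
qed

lemma sz_concat_elem: "x \<in> set xs \<Longrightarrow> sz x \<le> sz xs"
  using sz_elem[of x xs] by simp


section \<open>Programs for list cells\<close>

lemma bit_size_le: "bit_size a \<le> bl a + 1" by (simp add: bit_size_def)

text \<open>One quadratic bound for all five operations; the margin absorbs the additive costs and
  the digit that \<open>bit_size\<close> charges for zero.\<close>

lemma binop_cost_le: "bl a \<le> B \<Longrightarrow> bl b \<le> B \<Longrightarrow> binop_cost bop a b \<le> (B + 2) ^ 2"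
proof -
  assume "bl a \<le> B" "bl b \<le> B"
  then have s: "bit_size a \<le> B + 1" "bit_size b \<le> B + 1"
    using bit_size_le[of a] bit_size_le[of b] by linarith+
  have "bit_size a * bit_size b \<le> (B + 1) * (B + 1)" using s by (intro mult_le_mono)
  moreover have "(B + 2) ^ 2 = (B + 1) * (B + 1) + 2 * B + 3" by (simp add: power2_eq_square)
  ultimately show ?thesis using s by (cases bop) auto
qed

lemma load_cost_le: "bl a \<le> B \<Longrightarrow> bit_size a \<le> (B + 2) ^ 2"
  using bit_size_le[of a] by (simp add: power2_eq_square)

text \<open>Halving a copy of \<open>x\<close> until it vanishes while doubling register
  \<open>b + 1\<close> yields \<open>2 ^ bl x\<close>; the code of the cell is then plain
  arithmetic. Registers are copied by adding zero.\<close>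

definition cons_prog :: "nat \<Rightarrow> nat \<Rightarrow> nat \<Rightarrow> nat \<Rightarrow> program" where
  "cons_prog x l z b = Seq (block [Load b 2, Load (b+1) 1, Load (b+3) 0, Op OpAdd (b+2) x (b+3)])
    (Seq (WhileNZ (b+2) (block [Op OpDiv (b+2) (b+2) b, Op OpMul (b+1) (b+1) b]))
      (block [Op OpMul (b+2) l (b+1), Op OpAdd (b+2) (b+2) x, Op OpMul (b+2) (b+2) b, Load (b+3) 1,
        Op OpAdd (b+2) (b+2) (b+3), Op OpMul z (b+2) (b+1)]))"

text \<open>At most \<open>B\<close> rounds of quadratic cost. \<open>4 * B + 10\<close> is the
  \<open>B + 2\<close> of \<open>binop_cost_le\<close> for the bound \<open>4 * B + 8\<close>, which
  covers the length of every intermediate number in both cell programs; the factor \<open>50\<close>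
  is generous.\<close>

definition cell_time :: "nat \<Rightarrow> nat" where
  "cell_time B = 50 * (4 * B + 10) * (4 * B + 10) ^ 2"

lemma run_cons:
  assumes b: "x < b" "l < b" "z < b" and B: "bl (R x) \<le> B" "bl (R l) \<le> B"
  shows "run (cons_prog x l z b) (R, S) (cell_time B)
    (\<lambda>(R', S'). S' = S \<and> R' z = consn (R x) (R l) \<and> (\<forall>i<b. i \<noteq> z \<longrightarrow> R' i = R i))"
proof -
  define C where "C = (4 * B + 8 + 2) ^ 2"
  define I :: "nat \<Rightarrow> state \<Rightarrow> bool" where "I = (\<lambda>n (R', S'). S' = S \<and> R' b = 2 \<and> bl (R' (b+2)) = n \<and>
    (\<exists>i. i + n = bl (R x) \<and> R' (b+1) = 2 ^ i) \<and> (\<forall>i<b. R' i = R i))"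
  have C: "binop_cost bop u v \<le> C" if "bl u \<le> 4 * B + 8" "bl v \<le> 4 * B + 8" for bop u v
    using binop_cost_le[OF that] unfolding C_def .
  have L: "bit_size v \<le> C" if "bl v \<le> 4 * B + 8" for v
    using load_cost_le[OF that] unfolding C_def .
  let ?l = "l"
  have 1: "run (block [Load b 2, Load (b+1) 1, Load (b+3) 0, Op OpAdd (b+2) x (b+3)]) (R, S)
      (C + (C + (C + (C + 1)))) (I (bl (R x)))"
    using b B by (intro run_block) (auto simp: I_def intro!: add_mono C L simp del: binop_cost.simps)
  have 2: "run (WhileNZ (b+2) (block [Op OpDiv (b+2) (b+2) b, Op OpMul (b+1) (b+1) b])) \<sigma>'
      (bl (R x) * (C + (C + (C + 1))) + 1) (I 0)" if "I (bl (R x)) \<sigma>'" for \<sigma>'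
  using that
  proof (rule run_WhileNZ[where I = I, rotated 2])
    fix n R' S' assume I: "I (Suc n) (R', S')"
    then obtain i where i: "i + Suc n = bl (R x)" "R' (b+1) = 2 ^ i" by (auto simp: I_def)
    then have "R' (b+2) \<noteq> 0" using I by (intro notI) (simp add: I_def)
    moreover have "bit_size (R' (b+2)) \<le> C" using I i B by (intro L) (simp add: I_def)
    moreover have "run (block [Op OpDiv (b+2) (b+2) b, Op OpMul (b+1) (b+1) b]) (R', S')
        (C + (C + 1)) (I n)"
    proof (intro run_block)
      show "block_cost [Op OpDiv (b+2) (b+2) b, Op OpMul (b+1) (b+1) b] R' \<le> C + (C + 1)"
        using I i B by (auto simp: I_def simp del: binop_cost.simps intro!: add_mono C)
      show "I n (fold effect [Op OpDiv (b + 2) (b + 2) b, Op OpMul (b + 1) (b + 1) b] R', S')"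
        using I i by (auto simp: I_def bl_div2 intro!: exI[of _ "Suc i"])
    qed simp
    ultimately show "R' (b+2) \<noteq> 0 \<and> bit_size (R' (b+2)) \<le> C \<and>
       run (block [Op OpDiv (b+2) (b+2) b, Op OpMul (b+1) (b+1) b]) (R', S') (C + (C + 1)) (I n)"
      by blast
  qed (auto simp: I_def floorlog_eq_zero_iff)
  have 3: "run (block [Op OpMul (b+2) l (b+1), Op OpAdd (b+2) (b+2) x, Op OpMul (b+2) (b+2) b, Load (b+3) 1,
        Op OpAdd (b+2) (b+2) (b+3), Op OpMul z (b+2) (b+1)]) \<sigma>' (C+(C+(C+(C+(C+(C+1))))))
    (\<lambda>(R', S'). S' = S \<and> R' z = consn (R x) (R l) \<and> (\<forall>i<b. i \<noteq> z \<longrightarrow> R' i = R i))"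
    if "I 0 \<sigma>'" for \<sigma>'
  proof -
    obtain R' where \<sigma>': "\<sigma>' = (R', S)" using \<open>I 0 \<sigma>'\<close> by (cases \<sigma>') (auto simp: I_def)
    have I: "R' b = 2" "R' (b+1) = 2 ^ bl (R x)" "\<And>i. i < b \<Longrightarrow> R' i = R i" using \<open>I 0 \<sigma>'\<close>
      by (auto simp: I_def \<sigma>')
    have p: "bl (2 ^ bl (R x)) \<le> B + 1" using B by simp
    have 1: "bl (R l * 2 ^ bl (R x)) \<le> 2 * B + 1" using bl_mult[of "R l" "2 ^ bl (R x)"] B p by linarith
    have 2: "bl (R l * 2 ^ bl (R x) + R x) \<le> 3 * B + 2"
      using bl_add[of "R l * 2 ^ bl (R x)" "R x"] B 1 by linarith
    have 3: "bl ((R l * 2 ^ bl (R x) + R x) * 2) \<le> 3 * B + 4"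
      using bl_mult[of "R l * 2 ^ bl (R x) + R x" 2] 2 by simp
    have 4: "bl ((R l * 2 ^ bl (R x) + R x) * 2 + 1) \<le> 3 * B + 6"
      using bl_add[of "(R l * 2 ^ bl (R x) + R x) * 2" 1] 3 by simp
    show ?thesis unfolding \<sigma>'
    proof (intro run_block)
      show "block_cost [Op OpMul (b+2) l (b+1), Op OpAdd (b+2) (b+2) x, Op OpMul (b+2) (b+2) b, Load (b+3) 1,
        Op OpAdd (b+2) (b+2) (b+3), Op OpMul z (b+2) (b+1)] R' \<le> (C+(C+(C+(C+(C+(C+1))))))"
        unfolding block_cost.simps using b B I 1 2 3 4
        by (intro add_mono order_refl) (auto simp del: binop_cost.simps intro!: C L)
    qed (use b I in \<open>auto simp: consn_def\<close>)
  qed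
  have t: "C + (C + (C + (C + 1))) + (bl (R x) * (C + (C + (C + 1))) + 1 + (C+(C+(C+(C+(C+(C+1)))))))
     \<le> cell_time B"
  proof -
    have "bl (R x) * (C + (C + (C + 1))) \<le> B * (4 * C)"
      using B by (intro mult_le_mono) (auto simp: C_def)
    moreover have "cell_time B = 50 * (4 * B + 10) * C" by (simp add: cell_time_def C_def add.assoc)
    moreover have "1 \<le> C" by (simp add: C_def)
    moreover have "50 * (4 * B + 10) * C = 196 * (B * C) + 4 * (B * C) + 500 * C" by (simp add: algebra_simps)
    ultimately show ?thesis by linarith
  qed
  show ?thesis unfolding cons_prog_def
    by (rule run_mono[OF run_Seq[OF 1 run_Seq[OF 2 3]] t])
qed

text \<open>Register \<open>b + 3\<close> holds one minus the parity of the remaining number and so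
  controls a loop that strips the trailing zeros. Their count \<open>k\<close> is kept as the power
  \<open>2 ^ k\<close>, by which the rest is split with \<open>mod\<close> and
  \<open>div\<close>.\<close>

definition uncons_prog :: "nat \<Rightarrow> nat \<Rightarrow> nat \<Rightarrow> nat \<Rightarrow> program" where
  "uncons_prog w x l b = Seq (block [Load b 2, Load (b+1) 1, Load (b+4) 0, Op OpAdd (b+2) w (b+4),
      Load (b+5) 1, Op OpMod (b+3) (b+2) b, Op OpSub (b+3) (b+5) (b+3)])
    (Seq (WhileNZ (b+3) (block [Op OpDiv (b+2) (b+2) b, Op OpMul (b+1) (b+1) b,
        Op OpMod (b+3) (b+2) b, Op OpSub (b+3) (b+5) (b+3)]))
      (block [Op OpDiv (b+2) (b+2) b, Op OpMod x (b+2) (b+1), Op OpDiv l (b+2) (b+1)]))"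

lemma run_uncons:
  assumes b: "w < b" "x < b" "l < b" "x \<noteq> l" and w: "R w = consn u v" and B: "bl (R w) \<le> B"
  shows "run (uncons_prog w x l b) (R, S) (cell_time B)
    (\<lambda>(R', S'). S' = S \<and> R' x = u \<and> R' l = v \<and> (\<forall>i<b. i \<noteq> x \<longrightarrow> i \<noteq> l \<longrightarrow> R' i = R i))"
proof -
  define C where "C = (4 * B + 8 + 2) ^ 2"
  define k where "k = bl u"
  define m where "m = v * 2 ^ k + u"
  have w': "R w = (m * 2 + 1) * 2 ^ k" using w by (simp add: consn_def m_def k_def)
  have k: "2 * k \<le> B" using B w bl_consn[of u v] by (simp add: k_def)
  define I :: "nat \<Rightarrow> state \<Rightarrow> bool" where "I = (\<lambda>n (R', S'). S' = S \<and> R' b = 2 \<and> R' (b+5) = 1 \<and>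
    R' (b+2) = (m * 2 + 1) * 2 ^ n \<and> R' (b+3) = (if n = 0 then 0 else 1) \<and>
    (\<exists>i. i + n = k \<and> R' (b+1) = 2 ^ i) \<and> (\<forall>i<b. R' i = R i))"
  have C: "binop_cost bop u v \<le> C" if "bl u \<le> 4 * B + 8" "bl v \<le> 4 * B + 8" for bop u v
    using binop_cost_le[OF that] unfolding C_def .
  have L: "bit_size v \<le> C" if "bl v \<le> 4 * B + 8" for v
    using load_cost_le[OF that] unfolding C_def .
  have m': "bl ((m * 2 + 1) * 2 ^ n) \<le> B" if "n \<le> k" for n
  proof -
    have "(m * 2 + 1) * 2 ^ n \<le> (m * 2 + 1) * 2 ^ k"
      using that by (intro mult_le_mono2 power_increasing) auto
    then show ?thesis using B unfolding w' by (meson bl_mono order_trans)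
  qed
  have "m \<le> (m * 2 + 1) * 2 ^ 0" by simp
  then have mB: "bl m \<le> B" using m'[of 0] bl_mono by (meson le0 order_trans)
  have par: "(m * 2 + 1) * 2 ^ n mod 2 = (if n = 0 then 1 else 0)" for n
      proof (cases n)
    case 0
    have "(m * 2 + 1) mod 2 = 1" by presburger
    then show ?thesis using 0 by simp
  qed (simp add: mult.left_commute)
  have bm: "bl (y mod 2) \<le> 1" "bl (Suc 0 - y) \<le> 1" for y
    using bl_mono[of "y mod 2" 1] bl_mono[of "Suc 0 - y" 1] by auto
  have 1: "run (block [Load b 2, Load (b+1) 1, Load (b+4) 0, Op OpAdd (b+2) w (b+4),
      Load (b+5) 1, Op OpMod (b+3) (b+2) b, Op OpSub (b+3) (b+5) (b+3)]) (R, S)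
      (C + (C + (C + (C + (C + (C + (C + 1))))))) (I k)"
  proof (intro run_block)
    show "block_cost [Load b 2, Load (b+1) 1, Load (b+4) 0, Op OpAdd (b+2) w (b+4),
      Load (b+5) 1, Op OpMod (b+3) (b+2) b, Op OpSub (b+3) (b+5) (b+3)] R \<le>
      (C + (C + (C + (C + (C + (C + (C + 1)))))))"
      unfolding block_cost.simps using b B bm[of "R w"]
      by (intro add_mono order_refl) (auto simp del: binop_cost.simps intro!: C L)
    show "I k (fold effect [Load b 2, Load (b+1) 1, Load (b+4) 0, Op OpAdd (b+2) w (b+4),
      Load (b+5) 1, Op OpMod (b+3) (b+2) b, Op OpSub (b+3) (b+5) (b+3)] R, S)"
      using b par[of k] by (auto simp: I_def w')
  qed simp
  let ?body = "[Op OpDiv (b+2) (b+2) b, Op OpMul (b+1) (b+1) b,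
        Op OpMod (b+3) (b+2) b, Op OpSub (b+3) (b+5) (b+3)]"
  have 2: "run (WhileNZ (b+3) (block ?body)) \<sigma>'
      (k * (C + (C + (C + (C + (C + 1))))) + 1) (I 0)" if "I k \<sigma>'" for \<sigma>'
  using that
  proof (rule run_WhileNZ[where I = I, rotated 2])
    fix n R' S' assume I: "I (Suc n) (R', S')"
    then obtain i where i: "i + Suc n = k" "R' (b+1) = 2 ^ i" by (auto simp: I_def)
    have r: "R' b = 2" "R' (b+5) = 1" "R' (b+2) = (m * 2 + 1) * 2 ^ Suc n" "R' (b+3) = 1" "S' = S"
      "\<And>i. i < b \<Longrightarrow> R' i = R i" using I by (auto simp: I_def)
    have h: "(m * 2 + 1) * 2 ^ Suc n div 2 = (m * 2 + 1) * 2 ^ n" by simp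
    have "run (block ?body) (R', S') (C + (C + (C + (C + 1)))) (I n)"
    proof (intro run_block)
      show "block_cost ?body R' \<le> C + (C + (C + (C + 1)))"
        unfolding block_cost.simps using r h i k m'[of "Suc n"] m'[of n] bm
        by (intro add_mono order_refl) (auto simp del: binop_cost.simps power_Suc intro!: C L le_trans[OF bm(1)])
      show "I n (fold effect ?body R', S')"
        using r h i par[of n] by (auto simp: I_def simp del: power_Suc intro!: exI[of _ "Suc i"])
         (simp_all)
    qed simp
    then show "R' (b+3) \<noteq> 0 \<and> bit_size (R' (b+3)) \<le> C \<and> run (block ?body) (R', S') (C + (C + (C + (C + 1)))) (I n)"
      using r L[of 1] by simp
  qed (auto simp: I_def)
  have 3: "run (block [Op OpDiv (b+2) (b+2) b, Op OpMod x (b+2) (b+1), Op OpDiv l (b+2) (b+1)]) \<sigma>'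
      (C+(C+(C+1)))
    (\<lambda>(R', S'). S' = S \<and> R' x = u \<and> R' l = v \<and> (\<forall>i<b. i \<noteq> x \<longrightarrow> i \<noteq> l \<longrightarrow> R' i = R i))"
    if "I 0 \<sigma>'" for \<sigma>'
  proof -
    obtain R' where \<sigma>': "\<sigma>' = (R', S)" using \<open>I 0 \<sigma>'\<close> by (cases \<sigma>') (auto simp: I_def)
    have I: "R' b = 2" "R' (b+1) = 2 ^ k" "R' (b+2) = m * 2 + 1" "\<And>i. i < b \<Longrightarrow> R' i = R i"
      using \<open>I 0 \<sigma>'\<close> by (auto simp: I_def \<sigma>')
    have uv: "m mod 2 ^ k = u" "m div 2 ^ k = v" using less_power_bl[of u] by (auto simp: m_def k_def)
    have m2: "Suc (m * 2) div 2 = m" by simp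
    show ?thesis unfolding \<sigma>'
    proof (intro run_block)
      show "block_cost [Op OpDiv (b+2) (b+2) b, Op OpMod x (b+2) (b+1), Op OpDiv l (b+2) (b+1)] R'
         \<le> C+(C+(C+1))"
        unfolding block_cost.simps using b I k m'[of 0] mB
        by (intro add_mono order_refl) (auto simp del: binop_cost.simps simp: m2 intro!: C L)
    qed (use b I uv m2 in auto)
  qed
  have t: "(C + (C + (C + (C + (C + (C + (C + 1))))))) + (k * (C + (C + (C + (C + (C + 1))))) + 1 + (C+(C+(C+1))))
     \<le> cell_time B"
  proof -
    have "k * (C + (C + (C + (C + (C + 1))))) \<le> B * (6 * C)"
      using k by (intro mult_le_mono) (auto simp: C_def)
    moreover have "cell_time B = 50 * (4 * B + 10) * C" by (simp add: cell_time_def C_def add.assoc)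
    moreover have "1 \<le> C" by (simp add: C_def)
    moreover have "50 * (4 * B + 10) * C = 194 * (B * C) + 6 * (B * C) + 500 * C" by (simp add: algebra_simps)
    ultimately show ?thesis by linarith
  qed
  show ?thesis unfolding uncons_prog_def
    by (rule run_mono[OF run_Seq[OF 1 run_Seq[OF 2 3]] t])
qed

section \<open>Functions computable in polynomial time\<close>

text \<open>Powers of \<open>sz x + 2\<close> suffice as bounds: the base is at least two, so
  constants and sums are absorbed by a larger exponent.\<close>

definition pbd :: "'a::enc set \<Rightarrow> ('a \<Rightarrow> nat) \<Rightarrow> bool" where
  "pbd D F \<longleftrightarrow> (\<exists>k. \<forall>x\<in>D. F x \<le> (sz x + 2) ^ k)"

lemma pbdI: "(\<And>x. x \<in> D \<Longrightarrow> F x \<le> (sz x + 2) ^ k) \<Longrightarrow> pbd D F"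
  unfolding pbd_def by blast

lemma pbd_mono: "pbd D F \<Longrightarrow> (\<And>x. x \<in> D \<Longrightarrow> G x \<le> F x) \<Longrightarrow> pbd D G"
  unfolding pbd_def by (meson order_trans)

lemma pbd_subset: "pbd D F \<Longrightarrow> D' \<subseteq> D \<Longrightarrow> pbd D' F"
  unfolding pbd_def by blast

lemma pbd_sz: "pbd D sz"
  by (rule pbdI[of _ _ 1]) simp

lemma pbd_const: "pbd D (\<lambda>_. c)"
proof (rule pbdI)
  fix x :: 'a
  have "c \<le> 2 ^ c" by simp
  also have "\<dots> \<le> (sz x + 2) ^ c" by (intro power_mono) auto
  finally show "c \<le> (sz x + 2) ^ c" .
qed

lemma pbd_mult: "pbd D F \<Longrightarrow> pbd D G \<Longrightarrow> pbd D (\<lambda>x. F x * G x)"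
proof -
  assume "pbd D F" "pbd D G"
  then obtain k l where "\<And>x. x \<in> D \<Longrightarrow> F x \<le> (sz x + 2) ^ k" "\<And>x. x \<in> D \<Longrightarrow> G x \<le> (sz x + 2) ^ l"
    unfolding pbd_def by blast
  then have "F x * G x \<le> (sz x + 2) ^ (k + l)" if "x \<in> D" for x
    unfolding power_add using that by (intro mult_le_mono)
  then show ?thesis by (rule pbdI)
qed

lemma pbd_add: "pbd D F \<Longrightarrow> pbd D G \<Longrightarrow> pbd D (\<lambda>x. F x + G x)"
proof -
  assume "pbd D F" "pbd D G"
  then obtain k l where *: "\<And>x. x \<in> D \<Longrightarrow> F x \<le> (sz x + 2) ^ k" "\<And>x. x \<in> D \<Longrightarrow> G x \<le> (sz x + 2) ^ l"
    unfolding pbd_def by blast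
  have "F x + G x \<le> (sz x + 2) ^ (1 + (k + l))" if "x \<in> D" for x
  proof -
    have "(sz x + 2) ^ k \<le> (sz x + 2) ^ (k + l)" "(sz x + 2) ^ l \<le> (sz x + 2) ^ (k + l)"
      by (intro power_increasing; simp)+
    then have "F x + G x \<le> 2 * (sz x + 2) ^ (k + l)" using *[OF that] by linarith
    also have "\<dots> \<le> (sz x + 2) ^ (1 + (k + l))" unfolding power_add[of _ 1] by (intro mult_le_mono1) simp
    finally show ?thesis .
  qed
  then show ?thesis by (rule pbdI)
qed

lemma pbd_power: "pbd D F \<Longrightarrow> pbd D (\<lambda>x. F x ^ n)"
  by (induction n) (simp_all add: pbd_const pbd_mult)

lemma pbd_comp:
  assumes F: "pbd D' F" and f: "\<And>x. x \<in> D \<Longrightarrow> f x \<in> D'" and s: "pbd D (\<lambda>x. sz (f x))"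
  shows "pbd D (\<lambda>x. F (f x))"
proof -
  obtain k where "\<And>y. y \<in> D' \<Longrightarrow> F y \<le> (sz y + 2) ^ k" using F unfolding pbd_def by blast
  moreover have "pbd D (\<lambda>x. (sz (f x) + 2) ^ k)" by (intro pbd_power pbd_add s pbd_const)
  ultimately show ?thesis by (rule_tac pbd_mono) (use f in auto)
qed

lemmas pbd_intros = pbd_const pbd_mult pbd_add pbd_power pbd_sz

lemma pbd_cell_time: "pbd D F \<Longrightarrow> pbd D (\<lambda>x. cell_time (F x))"
  unfolding cell_time_def by (intro pbd_intros)

definition post :: "nat \<Rightarrow> nat \<Rightarrow> (nat \<Rightarrow> nat) \<Rightarrow> (nat \<Rightarrow> nat list) \<Rightarrow> nat \<Rightarrow> state \<Rightarrow> bool" where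
  "post z b R S w = (\<lambda>(R', S'). S' = S \<and> R' z = w \<and> (\<forall>i<b. i \<noteq> z \<longrightarrow> R' i = R i))"

lemma postE:
  assumes "post z b R S w \<sigma>"
  obtains R' where "\<sigma> = (R', S)" "R' z = w" "\<And>i. i < b \<Longrightarrow> i \<noteq> z \<Longrightarrow> R' i = R i"
  using assms by (cases \<sigma>) (auto simp: post_def)

text \<open>Calling convention: the argument is in register \<open>a\<close>, the result goes to register \<open>z\<close>, and
  the registers from \<open>b\<close> on are scratch.\<close>

definition implements :: "('a::enc set) \<Rightarrow> ('a \<Rightarrow> 'b::enc) \<Rightarrow> ('a \<Rightarrow> nat) \<Rightarrow> bool" where
  "implements D f T \<longleftrightarrow> (\<forall>a z b. a < b \<longrightarrow> z < b \<longrightarrow> (\<exists>c. \<forall>v\<in>D. \<forall>R. R a = enc v \<longrightarrow>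
     run c (R, \<lambda>_. []) (T v) (post z b R (\<lambda>_. []) (enc (f v)))))"

text \<open>In \<open>implements\<close> the program is chosen after the addresses but before the
  argument, so every function has a relocatable and uniform program; all stacks are empty before and
  after, data live in registers. The size bound is carried along because composition needs it to
  bound the time of the second program.\<close>

definition pt :: "'a::enc set \<Rightarrow> ('a \<Rightarrow> 'b::enc) \<Rightarrow> bool" where
  "pt D f \<longleftrightarrow> (\<exists>T. pbd D T \<and> pbd D (\<lambda>v. sz (f v)) \<and> implements D f T)"

lemma ptI:
  assumes "pbd D T" "pbd D (\<lambda>v. sz (f v))"
    "\<And>a z b. a < b \<Longrightarrow> z < b \<Longrightarrow> \<exists>c. \<forall>v\<in>D. \<forall>R. R a = enc v \<longrightarrow>
     run c (R, \<lambda>_. []) (T v) (post z b R (\<lambda>_. []) (enc (f v)))"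
  shows "pt D f"
  using assms unfolding pt_def implements_def by blast

lemma ptE:
  assumes "pt D f"
  obtains T where "pbd D T" "pbd D (\<lambda>v. sz (f v))"
    "\<And>a z b. a < b \<Longrightarrow> z < b \<Longrightarrow> \<exists>c. \<forall>v\<in>D. \<forall>R. R a = enc v \<longrightarrow>
     run c (R, \<lambda>_. []) (T v) (post z b R (\<lambda>_. []) (enc (f v)))"
  using assms unfolding pt_def implements_def by blast

lemma pt_pbd: "pt D f \<Longrightarrow> pbd D (\<lambda>v. sz (f v))"
  unfolding pt_def by blast

text \<open>Programs see only codes. A program for one type therefore serves for another as soon as
  arguments and results have the same codes.\<close>

lemma pt_recode:
  fixes f :: "'a::enc \<Rightarrow> 'b::enc" and g :: "'c::enc \<Rightarrow> 'd::enc"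
  assumes f: "pt D f" and *: "\<And>x. x \<in> D' \<Longrightarrow> \<exists>y\<in>D. enc y = enc x \<and> enc (f y) = enc (g x)"
  shows "pt D' g"
proof -
  obtain T where T: "pbd D T" "pbd D (\<lambda>v. sz (f v))"
    "\<And>a z b. a < b \<Longrightarrow> z < b \<Longrightarrow> \<exists>c. \<forall>v\<in>D. \<forall>R. R a = enc v \<longrightarrow>
     run c (R, \<lambda>_. []) (T v) (post z b R (\<lambda>_. []) (enc (f v)))" using f by (rule ptE) blast
  define y where "y x = (SOME y. y \<in> D \<and> enc y = enc x \<and> enc (f y) = enc (g x))" for x
  have y: "y x \<in> D" "enc (y x) = enc x" "enc (f (y x)) = enc (g x)" if "x \<in> D'" for x
    using someI_ex[of "\<lambda>y. y \<in> D \<and> enc y = enc x \<and> enc (f y) = enc (g x)"] *[OF that]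
    unfolding y_def by blast+
  have "pbd D' (\<lambda>x. sz (y x))" by (rule pbd_mono[OF pbd_sz]) (simp add: sz_def y)
  then have "pbd D' (\<lambda>x. T (y x))" "pbd D' (\<lambda>x. sz (f (y x)))"
    using pbd_comp[OF T(1)] pbd_comp[OF T(2)] y by blast+
  moreover from this(2) have "pbd D' (\<lambda>x. sz (g x))" by (rule pbd_mono) (simp add: sz_def y)
  ultimately show ?thesis
  proof (intro ptI[of D' "\<lambda>x. T (y x)"])
    fix a z b :: nat assume "a < b" "z < b"
    from T(3)[OF this] obtain c where "\<forall>v\<in>D. \<forall>R. R a = enc v \<longrightarrow>
      run c (R, \<lambda>_. []) (T v) (post z b R (\<lambda>_. []) (enc (f v)))" by blast
    then show "\<exists>c. \<forall>v\<in>D'. \<forall>R. R a = enc v \<longrightarrow>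
      run c (R, \<lambda>_. []) (T (y v)) (post z b R (\<lambda>_. []) (enc (g v)))" using y by metis
  qed
qed

lemma pt_subset: "pt D f \<Longrightarrow> D' \<subseteq> D \<Longrightarrow> pt D' f"
  by (rule pt_recode) auto

lemma pt_cong: "pt D f \<Longrightarrow> (\<And>x. x \<in> D \<Longrightarrow> f x = g x) \<Longrightarrow> pt D g"
  by (rule pt_recode) auto

lemma pt_comp:
  assumes g: "pt D' g" and f: "pt D f" and D: "\<And>x. x \<in> D \<Longrightarrow> f x \<in> D'"
  shows "pt D (\<lambda>x. g (f x))"
proof -
  obtain T where T: "pbd D T" "pbd D (\<lambda>v. sz (f v))"
    "\<And>a z b. a < b \<Longrightarrow> z < b \<Longrightarrow> \<exists>c. \<forall>v\<in>D. \<forall>R. R a = enc v \<longrightarrow>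
     run c (R, \<lambda>_. []) (T v) (post z b R (\<lambda>_. []) (enc (f v)))" using f by (rule ptE) blast
  obtain U where U: "pbd D' U" "pbd D' (\<lambda>v. sz (g v))"
    "\<And>a z b. a < b \<Longrightarrow> z < b \<Longrightarrow> \<exists>c. \<forall>v\<in>D'. \<forall>R. R a = enc v \<longrightarrow>
     run c (R, \<lambda>_. []) (U v) (post z b R (\<lambda>_. []) (enc (g v)))" using g by (rule ptE) blast
  show ?thesis
  proof (rule ptI)
    show "pbd D (\<lambda>x. T x + U (f x))" "pbd D (\<lambda>x. sz (g (f x)))"
      using T U D by (auto intro!: pbd_add pbd_comp[of D'])
    fix a z b :: nat assume ab: "a < b" "z < b"
    obtain c where c: "\<forall>v\<in>D. \<forall>R. R a = enc v \<longrightarrow>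
      run c (R, \<lambda>_. []) (T v) (post b (b + 1) R (\<lambda>_. []) (enc (f v)))"
      using T(3)[of a "b + 1" b] ab by auto
    obtain d where d: "\<forall>v\<in>D'. \<forall>R. R b = enc v \<longrightarrow>
      run d (R, \<lambda>_. []) (U v) (post z (b + 1) R (\<lambda>_. []) (enc (g v)))"
      using U(3)[of b "b + 1" z] ab by auto
    have "run (Seq c d) (R, \<lambda>_. []) (T v + U (f v)) (post z b R (\<lambda>_. []) (enc (g (f v))))"
      if "v \<in> D" "R a = enc v" for v R
    proof (rule run_Seq)
      show "run c (R, \<lambda>_. []) (T v) (post b (b + 1) R (\<lambda>_. []) (enc (f v)))"
        using c that by blast
      fix \<sigma> assume "post b (b + 1) R (\<lambda>_. []) (enc (f v)) \<sigma>"
      then obtain R' where R': "\<sigma> = (R', \<lambda>_. [])" "R' b = enc (f v)" "\<And>i. i < b + 1 \<Longrightarrow> i \<noteq> b \<Longrightarrow> R' i = R i"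
        by (rule postE) blast
      have "run d (R', \<lambda>_. []) (U (f v)) (post z (b + 1) R' (\<lambda>_. []) (enc (g (f v))))"
        using d D that R' by blast
      then show "run d \<sigma> (U (f v)) (post z b R (\<lambda>_. []) (enc (g (f v))))"
        unfolding R'(1) by (rule run_mono) (use ab R'(3) in \<open>auto simp: post_def\<close>)
    qed
    then show "\<exists>c. \<forall>v\<in>D. \<forall>R. R a = enc v \<longrightarrow>
      run c (R, \<lambda>_. []) (T v + U (f v)) (post z b R (\<lambda>_. []) (enc (g (f v))))" by blast
  qed
qed

lemma pt_ident: "pt D (\<lambda>x. x)"
proof (rule ptI)
  show "pbd D (\<lambda>x. 1 + ((sz x + 1 + 1) + 1))" "pbd D (\<lambda>x. sz x)" by (intro pbd_intros)+
  fix a z b :: nat assume ab: "a < b" "z < b"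
  have "run (block [Load b 0, Op OpAdd z a b]) (R, \<lambda>_. []) (1 + ((sz v + 1 + 1) + 1))
    (post z b R (\<lambda>_. []) (enc v))" if "R a = enc v" for v :: 'a and R
    using ab that by (intro run_block) (auto simp: post_def sz_def bit_size_def)
  then show "\<exists>c. \<forall>v\<in>D. \<forall>R. R a = enc v \<longrightarrow>
      run c (R, \<lambda>_. []) (1 + ((sz v + 1 + 1) + 1)) (post z b R (\<lambda>_. []) (enc v))" by blast
qed

lemma pt_const: "pt D (\<lambda>_. c)"
proof (rule ptI)
  show "pbd D (\<lambda>_. bit_size (enc c) + 1)" "pbd D (\<lambda>_. sz c)" by (intro pbd_intros)+
  fix a z b :: nat assume ab: "a < b" "z < b"
  have "run (block [Load z (enc c)]) (R, \<lambda>_. []) (bit_size (enc c) + 1)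
    (post z b R (\<lambda>_. []) (enc c))" for R
    using ab by (intro run_block) (auto simp: post_def)
  then show "\<exists>p. \<forall>v\<in>D. \<forall>R. R a = enc v \<longrightarrow>
      run p (R, \<lambda>_. []) (bit_size (enc c) + 1) (post z b R (\<lambda>_. []) (enc c))" by blast
qed

text \<open>Template for binary operations: both operands are computed into the first two scratch
  registers, where \<open>c\<close> picks them up. \<open>c\<close> may overwrite everything from
  \<open>b\<close> on, the operands included.\<close>

lemma pt_combine:
  assumes f: "pt D f" and g: "pt D g"
    and W: "pbd D W" and h: "pbd D (\<lambda>v. sz (h v))"
    and c: "\<And>z b. z < b \<Longrightarrow> \<exists>c. \<forall>v\<in>D. \<forall>R. R b = enc (f v) \<longrightarrow> R (b + 1) = enc (g v) \<longrightarrow>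
      run c (R, \<lambda>_. []) (W v) (post z b R (\<lambda>_. []) (enc (h v)))"
  shows "pt D h"
proof -
  obtain T where T: "pbd D T"
    "\<And>a z b. a < b \<Longrightarrow> z < b \<Longrightarrow> \<exists>c. \<forall>v\<in>D. \<forall>R. R a = enc v \<longrightarrow>
     run c (R, \<lambda>_. []) (T v) (post z b R (\<lambda>_. []) (enc (f v)))" using f by (rule ptE) blast
  obtain U where U: "pbd D U"
    "\<And>a z b. a < b \<Longrightarrow> z < b \<Longrightarrow> \<exists>c. \<forall>v\<in>D. \<forall>R. R a = enc v \<longrightarrow>
     run c (R, \<lambda>_. []) (U v) (post z b R (\<lambda>_. []) (enc (g v)))" using g by (rule ptE) blast
  show ?thesis
  proof (rule ptI)
    show "pbd D (\<lambda>x. T x + (U x + W x))" using T U W by (intro pbd_add)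
    show "pbd D (\<lambda>v. sz (h v))" by fact
    fix a z b :: nat assume ab: "a < b" "z < b"
    obtain c1 where c1: "\<forall>v\<in>D. \<forall>R. R a = enc v \<longrightarrow>
      run c1 (R, \<lambda>_. []) (T v) (post b (b + 1) R (\<lambda>_. []) (enc (f v)))"
      using T(2)[of a "b + 1" b] ab by auto
    obtain c2 where c2: "\<forall>v\<in>D. \<forall>R. R a = enc v \<longrightarrow>
      run c2 (R, \<lambda>_. []) (U v) (post (b + 1) (b + 2) R (\<lambda>_. []) (enc (g v)))"
      using U(2)[of a "b + 2" "b + 1"] ab by auto
    obtain c3 where c3: "\<forall>v\<in>D. \<forall>R. R b = enc (f v) \<longrightarrow> R (b + 1) = enc (g v) \<longrightarrow>
      run c3 (R, \<lambda>_. []) (W v) (post z b R (\<lambda>_. []) (enc (h v)))" using c[OF ab(2)] by blast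
    have "run (Seq c1 (Seq c2 c3)) (R, \<lambda>_. []) (T v + (U v + W v)) (post z b R (\<lambda>_. []) (enc (h v)))"
      if v: "v \<in> D" "R a = enc v" for v R
    proof (rule run_Seq)
      show "run c1 (R, \<lambda>_. []) (T v) (post b (b + 1) R (\<lambda>_. []) (enc (f v)))"
        using c1 v by blast
      fix \<sigma> assume "post b (b + 1) R (\<lambda>_. []) (enc (f v)) \<sigma>"
      then obtain R1 where R1: "\<sigma> = (R1, \<lambda>_. [])" "R1 b = enc (f v)" "\<And>i. i < b + 1 \<Longrightarrow> i \<noteq> b \<Longrightarrow> R1 i = R i"
        by (rule postE) blast
      show "run (Seq c2 c3) \<sigma> (U v + W v) (post z b R (\<lambda>_. []) (enc (h v)))"
      proof (rule run_Seq)
        show "run c2 \<sigma> (U v) (post (b + 1) (b + 2) R1 (\<lambda>_. []) (enc (g v)))"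
          unfolding R1(1) using c2 v R1(3)[of a] ab by auto
        fix \<tau> assume "post (b + 1) (b + 2) R1 (\<lambda>_. []) (enc (g v)) \<tau>"
        then obtain R2 where R2: "\<tau> = (R2, \<lambda>_. [])" "R2 (b + 1) = enc (g v)"
          "\<And>i. i < b + 2 \<Longrightarrow> i \<noteq> b + 1 \<Longrightarrow> R2 i = R1 i" by (rule postE) blast
        have "run c3 (R2, \<lambda>_. []) (W v) (post z b R2 (\<lambda>_. []) (enc (h v)))"
          using c3 v R1 R2 by simp
        then show "run c3 \<tau> (W v) (post z b R (\<lambda>_. []) (enc (h v)))"
          unfolding R2(1) by (rule run_mono) (use ab R1(3) R2(3) in \<open>auto simp: post_def\<close>)
      qed
    qed
    then show "\<exists>c. \<forall>v\<in>D. \<forall>R. R a = enc v \<longrightarrow>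
      run c (R, \<lambda>_. []) (T v + (U v + W v)) (post z b R (\<lambda>_. []) (enc (h v)))" by blast
  qed
qed

lemma pt_Pair:
  assumes f: "pt D f" and g: "pt D g"
  shows "pt D (\<lambda>x. (f x, g x))"
proof (rule pt_combine[OF f g])
  show "pbd D (\<lambda>x. cell_time (sz (f x) + sz (g x)))" "pbd D (\<lambda>x. sz (f x, g x))"
    unfolding sz_simps by (intro pbd_intros pbd_cell_time pt_pbd f g)+
  fix z b :: nat assume "z < b"
  have "run (cons_prog b (b + 1) z (b + 2)) (R, \<lambda>_. []) (cell_time (sz (f v) + sz (g v)))
     (post z b R (\<lambda>_. []) (enc (f v, g v)))"
    if "R b = enc (f v)" "R (b + 1) = enc (g v)" for v R
    using that \<open>z < b\<close>
    by (intro run_mono[OF run_cons[of b "b + 2" "b + 1" z R "sz (f v) + sz (g v)"]])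
      (auto simp: post_def sz_def)
  then show "\<exists>c. \<forall>v\<in>D. \<forall>R. R b = enc (f v) \<longrightarrow> R (b + 1) = enc (g v) \<longrightarrow>
      run c (R, \<lambda>_. []) (cell_time (sz (f v) + sz (g v))) (post z b R (\<lambda>_. []) (enc (f v, g v)))" by blast
qed

lemma pt_binop:
  assumes f: "pt D f" and g: "pt D g"
  shows "pt D (\<lambda>x. binop_val bop (f x) (g x))"
proof (rule pt_combine[OF f g])
  show "pbd D (\<lambda>x. (sz (f x) + sz (g x) + 2) ^ 2 + 1)" by (intro pbd_intros pt_pbd f g)
  show "pbd D (\<lambda>x. sz (binop_val bop (f x) (g x)))"
  proof (rule pbd_mono)
    show "pbd D (\<lambda>x. sz (f x) + sz (g x) + 1)" by (intro pbd_intros pt_pbd f g)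
    fix x
    have "bl (m - n) \<le> bl m + bl n + 1" "bl (m div n) \<le> bl m + bl n + 1" "bl (m mod n) \<le> bl m + bl n + 1"
      "bl (m * n) \<le> bl m + bl n + 1" "bl (m + n) \<le> bl m + bl n + 1" for m n
      using bl_mono[of "m - n" m] bl_mono[of "m div n" m] bl_mono[of "m mod n" m] bl_mult[of m n] bl_add[of m n]
      by auto
    then show "sz (binop_val bop (f x) (g x)) \<le> sz (f x) + sz (g x) + 1"
      by (cases bop) simp_all
  qed
  fix z b :: nat assume "z < b"
  have "run (block [Op bop z b (b + 1)]) (R, \<lambda>_. []) ((sz (f v) + sz (g v) + 2) ^ 2 + 1)
     (post z b R (\<lambda>_. []) (enc (binop_val bop (f v) (g v))))"
    if "R b = enc (f v)" "R (b + 1) = enc (g v)" for v R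
    using that \<open>z < b\<close> binop_cost_le[of "f v" "sz (f v) + sz (g v)" "g v" bop]
    by (intro run_block) (auto simp: post_def)
  then show "\<exists>c. \<forall>v\<in>D. \<forall>R. R b = enc (f v) \<longrightarrow> R (b + 1) = enc (g v) \<longrightarrow>
      run c (R, \<lambda>_. []) ((sz (f v) + sz (g v) + 2) ^ 2 + 1)
        (post z b R (\<lambda>_. []) (enc (binop_val bop (f v) (g v))))" by blast
qed

lemma pt_nat_ops:
  fixes f g :: "'a::enc \<Rightarrow> nat"
  assumes "pt D f" "pt D g"
  shows "pt D (\<lambda>x. f x + g x)" "pt D (\<lambda>x. f x - g x)" "pt D (\<lambda>x. f x * g x)"
    "pt D (\<lambda>x. f x div g x)" "pt D (\<lambda>x. f x mod g x)"
  using pt_binop[OF assms, of OpAdd] pt_binop[OF assms, of OpSub] pt_binop[OF assms, of OpMul]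
    pt_binop[OF assms, of OpDiv] pt_binop[OF assms, of OpMod] by simp_all

lemma pt_eq:
  assumes f: "pt D f" and g: "pt D g"
  shows "pt D (\<lambda>x. f x = g x)"
proof (rule pt_combine[OF f g])
  let ?T = "\<lambda>x. 4 * (sz (f x) + sz (g x) + 1 + 2) ^ 2 + 2"
  show "pbd D ?T" by (intro pbd_intros pt_pbd f g)
  show "pbd D (\<lambda>x. sz (f x = g x))"
    by (rule pbd_mono[OF pbd_const[of _ 1]]) (rule sz_bool)
  fix z b :: nat assume zb: "z < b"
  \<comment> \<open>Truncated subtraction both ways gives the distance of the codes, which is zero
    exactly when they agree; subtracting it from one leaves the code of the truth value.\<close>
  let ?p = "[Op OpSub (b + 2) b (b + 1), Op OpSub (b + 3) (b + 1) b, Op OpAdd (b + 2) (b + 2) (b + 3),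
     Load (b + 4) 1, Op OpSub z (b + 4) (b + 2)]"
  have "run (block ?p) (R, \<lambda>_. []) (?T v) (post z b R (\<lambda>_. []) (enc (f v = g v)))"
    if R: "R b = enc (f v)" "R (b + 1) = enc (g v)" for v R
  proof (rule run_block)
    define B where "B = sz (f v) + sz (g v) + 1"
    have "(enc (f v) - enc (g v)) + (enc (g v) - enc (f v)) \<le> enc (f v) + enc (g v)" by simp
    note le = bl_mono[OF this]
    have B: "bl (enc (f v)) \<le> B" "bl (enc (g v)) \<le> B" "bl (enc (f v) - enc (g v)) \<le> B"
        "bl (enc (g v) - enc (f v)) \<le> B" "bl ((enc (f v) - enc (g v)) + (enc (g v) - enc (f v))) \<le> B"
        "bl (Suc 0) \<le> B"
      using bl_mono[of "enc (f v) - enc (g v)" "enc (f v)"] bl_mono[of "enc (g v) - enc (f v)" "enc (g v)"]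
       le
       bl_add[of "enc (f v)" "enc (g v)"]
      by (auto simp: sz_def B_def)
    define C where "C = (B + 2) ^ 2"
    have C: "binop_cost bop m n \<le> C" if "bl m \<le> B" "bl n \<le> B" for bop m n
      unfolding C_def using that by (rule binop_cost_le)
    have "block_cost ?p R \<le> C + (C + (C + (1 + (C + 1))))"
      unfolding block_cost.simps
      by (intro add_mono order_refl) (use B R in \<open>auto simp del: binop_cost.simps intro!: C simp: bit_size_def\<close>)
    then show "block_cost ?p R \<le> ?T v" by (simp add: C_def B_def)
    show "post z b R (\<lambda>_. []) (enc (f v = g v)) (fold effect ?p R, \<lambda>_. [])"
    proof (cases "f v = g v")
      case False
      then have "enc (f v) \<noteq> enc (g v)" by simp
      then have "Suc 0 \<le> (enc (f v) - enc (g v)) + (enc (g v) - enc (f v))" by linarith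
      then show ?thesis using R zb False by (auto simp: post_def)
    qed (use R zb in \<open>auto simp: post_def\<close>)
  qed auto
  then show "\<exists>c. \<forall>v\<in>D. \<forall>R. R b = enc (f v) \<longrightarrow> R (b + 1) = enc (g v) \<longrightarrow>
      run c (R, \<lambda>_. []) (?T v) (post z b R (\<lambda>_. []) (enc (f v = g v)))" by blast
qed

text \<open>Each branch has to be polynomial only where it is taken; this makes partial functions
  such as \<open>hd\<close> usable behind a test.\<close>

lemma pt_If:
  assumes c: "pt D c" and f: "pt {x\<in>D. c x} f" and g: "pt {x\<in>D. \<not> c x} g"
  shows "pt D (\<lambda>x. if c x then f x else g x)"
proof -
  obtain T where T: "pbd {x\<in>D. c x} T"  "pbd {x\<in>D. c x} (\<lambda>v. sz (f v))"
    "\<And>a z b. a < b \<Longrightarrow> z < b \<Longrightarrow> \<exists>p. \<forall>v\<in>{x\<in>D. c x}. \<forall>R. R a = enc v \<longrightarrow>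
     run p (R, \<lambda>_. []) (T v) (post z b R (\<lambda>_. []) (enc (f v)))" using f by (rule ptE) blast
  obtain U where U: "pbd {x\<in>D. \<not> c x} U" "pbd {x\<in>D. \<not> c x} (\<lambda>v. sz (g v))"
    "\<And>a z b. a < b \<Longrightarrow> z < b \<Longrightarrow> \<exists>p. \<forall>v\<in>{x\<in>D. \<not> c x}. \<forall>R. R a = enc v \<longrightarrow>
     run p (R, \<lambda>_. []) (U v) (post z b R (\<lambda>_. []) (enc (g v)))" using g by (rule ptE) blast
  obtain V where V: "pbd D V"
    "\<And>a z b. a < b \<Longrightarrow> z < b \<Longrightarrow> \<exists>p. \<forall>v\<in>D. \<forall>R. R a = enc v \<longrightarrow>
     run p (R, \<lambda>_. []) (V v) (post z b R (\<lambda>_. []) (enc (c v)))" using c by (rule ptE) blast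
  have merge: "pbd D (\<lambda>x. if c x then F x else G x)" if F: "pbd {x\<in>D. c x} F" and G: "pbd {x\<in>D. \<not> c x} G" for F G :: "'a \<Rightarrow> nat"
  proof -
    obtain k l where *: "\<And>x. x \<in> D \<Longrightarrow> c x \<Longrightarrow> F x \<le> (sz x + 2) ^ k" "\<And>x. x \<in> D \<Longrightarrow> \<not> c x \<Longrightarrow> G x \<le> (sz x + 2) ^ l"
      using F G unfolding pbd_def by auto
    have "pbd D (\<lambda>x. (sz x + 2) ^ k + (sz x + 2) ^ l)" by (intro pbd_intros)
    then show ?thesis by (rule pbd_mono) (use * in \<open>auto simp: trans_le_add1 trans_le_add2\<close>)
  qed
  let ?W = "\<lambda>x. V x + (1 + (if c x then T x else U x))"
  show ?thesis
  proof (rule ptI)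
    show "pbd D ?W" by (intro pbd_add pbd_const V merge T U)
    show "pbd D (\<lambda>x. sz (if c x then f x else g x))"
      using merge[OF T(2) U(2)] by (rule pbd_mono) simp
    fix a z b :: nat assume ab: "a < b" "z < b"
    obtain p where p: "\<forall>v\<in>D. \<forall>R. R a = enc v \<longrightarrow>
      run p (R, \<lambda>_. []) (V v) (post b (b + 1) R (\<lambda>_. []) (enc (c v)))"
      using V(2)[of a "b + 1" b] ab by auto
    obtain p1 where p1: "\<forall>v\<in>{x\<in>D. c x}. \<forall>R. R a = enc v \<longrightarrow>
      run p1 (R, \<lambda>_. []) (T v) (post z b R (\<lambda>_. []) (enc (f v)))" using T(3)[OF ab] by auto
    obtain p2 where p2: "\<forall>v\<in>{x\<in>D. \<not> c x}. \<forall>R. R a = enc v \<longrightarrow>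
      run p2 (R, \<lambda>_. []) (U v) (post z b R (\<lambda>_. []) (enc (g v)))" using U(3)[OF ab] by auto
    have "run (Seq p (IfNZ b p1 p2)) (R, \<lambda>_. []) (?W v) (post z b R (\<lambda>_. []) (enc (if c v then f v else g v)))"
      if v: "v \<in> D" "R a = enc v" for v R
    proof (rule run_Seq)
      show "run p (R, \<lambda>_. []) (V v) (post b (b + 1) R (\<lambda>_. []) (enc (c v)))"
        using p v by blast
      fix \<sigma> assume "post b (b + 1) R (\<lambda>_. []) (enc (c v)) \<sigma>"
      then obtain R1 where R1: "\<sigma> = (R1, \<lambda>_. [])" "R1 b = enc (c v)" "\<And>i. i < b + 1 \<Longrightarrow> i \<noteq> b \<Longrightarrow> R1 i = R i"
        by (rule postE) blast
      have a1: "R1 a = enc v" using R1(3)[of a] ab v by simp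
      have s1: "bit_size (R1 b) = 1" unfolding R1(2) by (cases "c v") (simp_all add: bit_size_def)
      have fr: "post z b R1 (\<lambda>_. []) w \<tau> \<Longrightarrow> post z b R (\<lambda>_. []) w \<tau>" for w \<tau>
        using R1(3) by (auto simp: post_def)
      have "run (IfNZ b p1 p2) (R1, \<lambda>_. []) (bit_size (R1 b) + (if c v then T v else U v))
          (post z b R (\<lambda>_. []) (enc (if c v then f v else g v)))"
      proof (rule run_IfNZ)
        assume "R1 b \<noteq> 0"
        then have cv: "c v" using R1(2) by simp
        then have r: "run p1 (R1, \<lambda>_. []) (T v) (post z b R1 (\<lambda>_. []) (enc (f v)))" using p1 v a1 by blast
        then show "run p1 (R1, \<lambda>_. []) (if c v then T v else U v)
            (post z b R (\<lambda>_. []) (enc (if c v then f v else g v)))"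
          using cv by (intro run_mono[OF r]) (auto intro: fr)
      next
        assume "R1 b = 0"
        then have cv: "\<not> c v" using R1(2) by simp
        then have r: "run p2 (R1, \<lambda>_. []) (U v) (post z b R1 (\<lambda>_. []) (enc (g v)))" using p2 v a1 by blast
        then show "run p2 (R1, \<lambda>_. []) (if c v then T v else U v)
            (post z b R (\<lambda>_. []) (enc (if c v then f v else g v)))"
          using cv by (intro run_mono[OF r]) (auto intro: fr)
      qed
      then show "run (IfNZ b p1 p2) \<sigma> (1 + (if c v then T v else U v))
          (post z b R (\<lambda>_. []) (enc (if c v then f v else g v)))" unfolding R1(1) s1 .
    qed
    then show "\<exists>p. \<forall>v\<in>D. \<forall>R. R a = enc v \<longrightarrow>
      run p (R, \<lambda>_. []) (?W v) (post z b R (\<lambda>_. []) (enc (if c v then f v else g v)))" by blast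
  qed
qed

lemma pt_fst0: "pt D (fst :: 'a::enc \<times> 'b::enc \<Rightarrow> 'a)" and pt_snd0: "pt D (snd :: 'a::enc \<times> 'b::enc \<Rightarrow> 'b)"
proof -
  have s: "pbd D (\<lambda>x. sz (fst x :: 'a))" "pbd D (\<lambda>x. sz (snd x :: 'b))"
    by (rule pbd_mono[OF pbd_sz], simp add: sz_fst sz_snd)+
  have t: "pbd D (\<lambda>x :: 'a \<times> 'b. cell_time (sz x))" by (intro pbd_cell_time pbd_sz)
  show "pt D (fst :: 'a::enc \<times> 'b::enc \<Rightarrow> 'a)"
  proof (rule ptI[OF t s(1)])
    fix a z b :: nat assume ab: "a < b" "z < b"
    have "run (uncons_prog a z b (b + 1)) (R, \<lambda>_. []) (cell_time (sz v)) (post z b R (\<lambda>_. []) (enc (fst v)))"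
      if "R a = enc v" for R and v :: "'a \<times> 'b"
      using ab that
      by (intro run_mono[OF run_uncons[of a "b + 1" z b R "enc (fst v)" "enc (snd v)" "sz v"]])
        (auto simp: post_def sz_def enc_prod_def)
    then show "\<exists>c. \<forall>v::'a \<times> 'b\<in>D. \<forall>R. R a = enc v \<longrightarrow>
      run c (R, \<lambda>_. []) (cell_time (sz v)) (post z b R (\<lambda>_. []) (enc (fst v)))" by blast
  qed
  show "pt D (snd :: 'a::enc \<times> 'b::enc \<Rightarrow> 'b)"
  proof (rule ptI[OF t s(2)])
    fix a z b :: nat assume ab: "a < b" "z < b"
    have "run (uncons_prog a b z (b + 1)) (R, \<lambda>_. []) (cell_time (sz v)) (post z b R (\<lambda>_. []) (enc (snd v)))"
      if "R a = enc v" for R and v :: "'a \<times> 'b"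
      using ab that
      by (intro run_mono[OF run_uncons[of a "b + 1" b z R "enc (fst v)" "enc (snd v)" "sz v"]])
        (auto simp: post_def sz_def enc_prod_def)
    then show "\<exists>c. \<forall>v::'a \<times> 'b\<in>D. \<forall>R. R a = enc v \<longrightarrow>
      run c (R, \<lambda>_. []) (cell_time (sz v)) (post z b R (\<lambda>_. []) (enc (snd v)))" by blast
  qed
qed

lemma pt_fst: "pt D f \<Longrightarrow> pt D (\<lambda>x. fst (f x))" and pt_snd: "pt D f \<Longrightarrow> pt D (\<lambda>x. snd (f x))"
  using pt_comp[OF pt_fst0, of D f UNIV] pt_comp[OF pt_snd0, of D f UNIV] by auto

lemma pt_Cons: "pt D f \<Longrightarrow> pt D g \<Longrightarrow> pt D (\<lambda>x. f x # g x)"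
  by (rule pt_recode[OF pt_Pair[of D f g]]) auto

lemma pt_hd0: "pt {xs. xs \<noteq> []} hd"
  by (rule pt_recode[OF pt_fst0[of UNIV]], rule_tac x = "(hd x, tl x)" in bexI) (auto simp: neq_Nil_conv)

lemma pt_tl0: "pt {xs. xs \<noteq> []} tl"
  by (rule pt_recode[OF pt_snd0[of UNIV]], rule_tac x = "(hd x, tl x)" in bexI) (auto simp: neq_Nil_conv)

lemma pt_case_list:
  fixes a :: "'e::enc \<Rightarrow> 'r::enc" and xs :: "'e \<Rightarrow> 'x::enc list"
  assumes xs: "pt D xs" and a: "pt D a"
    and b: "pt {z. \<exists>e\<in>D. xs e = fst (snd z) # snd (snd z) \<and> fst z = e} (\<lambda>z. b (fst z) (fst (snd z)) (snd (snd z)))"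
  shows "pt D (\<lambda>e. case xs e of [] \<Rightarrow> a e | y # ys \<Rightarrow> b e y ys)"
proof -
  let ?D = "{e \<in> D. xs e \<noteq> []}"
  have xs': "pt ?D xs" using xs by (rule pt_subset) auto
  have "pt ?D (\<lambda>e. hd (xs e))" "pt ?D (\<lambda>e. tl (xs e))"
    using pt_comp[OF pt_hd0 xs'] pt_comp[OF pt_tl0 xs'] by auto
  then have "pt ?D (\<lambda>e. (e, hd (xs e), tl (xs e)))" by (intro pt_Pair pt_ident)
  from pt_comp[OF b this] have "pt ?D (\<lambda>e. b e (hd (xs e)) (tl (xs e)))" by simp
  moreover have "pt {e \<in> D. xs e = []} a" using a by (rule pt_subset) auto
  ultimately have "pt D (\<lambda>e. if xs e = [] then a e else b e (hd (xs e)) (tl (xs e)))"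
    by (intro pt_If pt_eq xs pt_const)
  then show ?thesis by (rule pt_cong) (auto split: list.split)
qed

section \<open>Loops over lists\<close>

text \<open>The bound \<open>F\<close> on all intermediate states is essential: a cheap body that
  squares its state would produce exponentially long numbers. Register \<open>b\<close> holds the
  remaining list, \<open>b + 1\<close> the state, and \<open>b + 3\<close> the argument triple of
  the body.\<close>

lemma pt_fold:
  fixes xs :: "'e::enc \<Rightarrow> 'x::enc list" and s :: "'e \<Rightarrow> 's::enc"
  assumes xs: "pt D xs" and s: "pt D s"
    and h: "pt {z. fst z \<in> D \<and> fst (snd z) \<in> set (xs (fst z))} (\<lambda>z. h (fst z) (fst (snd z)) (snd (snd z)))"
    and F: "pbd D F" and bnd: "\<And>e ys zs. e \<in> D \<Longrightarrow> xs e = ys @ zs \<Longrightarrow> sz (fold (h e) ys (s e)) \<le> F e"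
  shows "pt D (\<lambda>e. fold (h e) (xs e) (s e))"
proof -
  let ?S = "\<lambda>_. []" and ?D = "{z. fst z \<in> D \<and> fst (snd z) \<in> set (xs (fst z))}"
  obtain T1 where T1: "pbd D T1"
    "\<And>a z b. a < b \<Longrightarrow> z < b \<Longrightarrow> \<exists>c. \<forall>v\<in>D. \<forall>R. R a = enc v \<longrightarrow>
     run c (R, ?S) (T1 v) (post z b R ?S (enc (xs v)))" using xs by (rule ptE) blast
  obtain T2 where T2: "pbd D T2"
    "\<And>a z b. a < b \<Longrightarrow> z < b \<Longrightarrow> \<exists>c. \<forall>v\<in>D. \<forall>R. R a = enc v \<longrightarrow>
     run c (R, ?S) (T2 v) (post z b R ?S (enc (s v)))" using s by (rule ptE) blast
  obtain T3 where T3: "pbd ?D T3"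
    "\<And>a z b. a < b \<Longrightarrow> z < b \<Longrightarrow> \<exists>c. \<forall>v\<in>?D. \<forall>R. R a = enc v \<longrightarrow>
     run c (R, ?S) (T3 v) (post z b R ?S (enc (h (fst v) (fst (snd v)) (snd (snd v)))))"
    using h by (rule ptE) blast
  from T3(1) obtain k where k: "\<And>z. z \<in> ?D \<Longrightarrow> T3 z \<le> (sz z + 2) ^ k" unfolding pbd_def by blast
  \<comment> \<open>Covers all cells built in a round, above all the triple
    \<open>(e, x, st)\<close>: an element counts twice there, but \<open>2 * sz x\<close> is at most
    the size of the list containing it.\<close>
  define B where "B e = 2 * sz e + 2 * sz (xs e) + F e + 2" for e
  have B: "pbd D B" unfolding B_def by (intro pbd_intros F pt_pbd[OF xs])
  let ?W = "\<lambda>e. cell_time (B e) + (cell_time (B e) + (cell_time (B e) + (B e + 2) ^ k))"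
  let ?T = "\<lambda>e. T1 e + (T2 e + (sz (xs e) * (B e + 1 + ?W e) + 1 + (B e + 1 + 1 + 1 + 1)))"
  show ?thesis
  proof (rule ptI)
    show "pbd D ?T" by (intro pbd_intros pbd_cell_time B T1 T2 pt_pbd[OF xs])
    show "pbd D (\<lambda>e. sz (fold (h e) (xs e) (s e)))"
      using F by (rule pbd_mono) (rule bnd[where zs = "[]"], auto)
    fix a z b :: nat assume ab: "a < b" "z < b"
    obtain c1 where c1: "\<forall>v\<in>D. \<forall>R. R a = enc v \<longrightarrow>
      run c1 (R, ?S) (T1 v) (post b (b + 1) R ?S (enc (xs v)))" using T1(2)[of a "b + 1" b] ab by auto
    obtain c2 where c2: "\<forall>v\<in>D. \<forall>R. R a = enc v \<longrightarrow>
      run c2 (R, ?S) (T2 v) (post (b + 1) (b + 2) R ?S (enc (s v)))" using T2(2)[of a "b + 2" "b + 1"] ab by auto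
    obtain c3 where c3: "\<forall>v\<in>?D. \<forall>R. R (b + 3) = enc v \<longrightarrow>
      run c3 (R, ?S) (T3 v) (post (b + 1) (b + 4) R ?S (enc (h (fst v) (fst (snd v)) (snd (snd v)))))"
      using T3(2)[of "b + 3" "b + 4" "b + 1"] by auto
    define body where "body = Seq (uncons_prog b (b + 2) b (b + 4)) (Seq (cons_prog (b + 2) (b + 1) (b + 3) (b + 4))
      (Seq (cons_prog a (b + 3) (b + 3) (b + 4)) c3))"
    define c where "c = Seq c1 (Seq c2 (Seq (WhileNZ b body) (block [Load (b + 2) 0, Op OpAdd z (b + 1) (b + 2)])))"
    have "run c (R, ?S) (?T e) (post z b R ?S (enc (fold (h e) (xs e) (s e))))"
      if e: "e \<in> D" "R a = enc e" for e R
      unfolding c_def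
    proof (rule run_Seq)
      show "run c1 (R, ?S) (T1 e) (post b (b + 1) R ?S (enc (xs e)))" using c1 e by blast
      fix \<sigma> assume "post b (b + 1) R ?S (enc (xs e)) \<sigma>"
      then obtain R1 where R1: "\<sigma> = (R1, ?S)" "R1 b = enc (xs e)" "\<And>i. i < b + 1 \<Longrightarrow> i \<noteq> b \<Longrightarrow> R1 i = R i"
        by (rule postE) blast
      define I :: "nat \<Rightarrow> state \<Rightarrow> bool" where "I = (\<lambda>n (R', S'). S' = ?S \<and> (\<forall>i<b. R' i = R i) \<and>
        (\<exists>ys zs. xs e = ys @ zs \<and> length zs = n \<and> R' b = enc zs \<and> R' (b + 1) = enc (fold (h e) ys (s e))))"
      show "run (Seq c2 (Seq (WhileNZ b body) (block [Load (b + 2) 0, Op OpAdd z (b + 1) (b + 2)]))) \<sigma>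
        (T2 e + (sz (xs e) * (B e + 1 + ?W e) + 1 + (B e + 1 + 1 + 1 + 1)))
        (post z b R ?S (enc (fold (h e) (xs e) (s e))))"
      proof (rule run_Seq)
        show "run c2 \<sigma> (T2 e) (post (b + 1) (b + 2) R1 ?S (enc (s e)))"
          unfolding R1(1) using c2 e R1(3)[of a] ab by auto
        fix \<tau> assume "post (b + 1) (b + 2) R1 ?S (enc (s e)) \<tau>"
        then obtain R2 where R2: "\<tau> = (R2, ?S)" "R2 (b + 1) = enc (s e)"
          "\<And>i. i < b + 2 \<Longrightarrow> i \<noteq> b + 1 \<Longrightarrow> R2 i = R1 i" by (rule postE) blast
        have I0: "I (length (xs e)) \<tau>" using R1 R2 unfolding I_def
          by (auto intro!: exI[of _ "[]"])
        have "run (WhileNZ b body) \<tau> (length (xs e) * (B e + 1 + ?W e) + 1) (I 0)"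
          using I0
        proof (rule run_WhileNZ[where I = I, rotated 2])
          fix n R' S' assume I: "I (Suc n) (R', S')"
          then obtain ys zs where yz: "xs e = ys @ zs" "length zs = Suc n" "R' b = enc zs"
            "R' (b + 1) = enc (fold (h e) ys (s e))" and fr: "\<And>i. i < b \<Longrightarrow> R' i = R i" and S': "S' = ?S"
            by (auto simp: I_def)
          then obtain x zs' where zs: "zs = x # zs'" by (cases zs) auto
          define st where "st = fold (h e) ys (s e)"
          have st: "sz st \<le> F e" using bnd[OF e(1) yz(1)] by (simp add: st_def)
          have x: "x \<in> set (xs e)" using yz zs by simp
          have szs: "sz zs \<le> sz (xs e)" "2 * sz x \<le> sz (xs e)" using sz_elem[OF x] by (simp_all add: yz(1))
          have z_D: "(e, x, st) \<in> ?D" using x e by simp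
          have b1: "R' b = consn (enc x) (enc zs')" using yz(3) zs by simp
          have b2: "bl (R' b) \<le> B e" using szs unfolding yz(3) sz_def[symmetric] B_def by simp
          have w: "run body (R', S') (?W e) (I n)" unfolding body_def
          proof (rule run_Seq)
            show "run (uncons_prog b (b + 2) b (b + 4)) (R', S') (cell_time (B e))
              (\<lambda>(Ra, Sa). Sa = S' \<and> Ra (b + 2) = enc x \<and> Ra b = enc zs' \<and> (\<forall>i<b+4. i \<noteq> b+2 \<longrightarrow> i \<noteq> b \<longrightarrow> Ra i = R' i))"
              using b1 b2 by (intro run_uncons) auto
            fix \<sigma>1 :: state assume 1: "case \<sigma>1 of (Ra, Sa) \<Rightarrow> Sa = S' \<and> Ra (b + 2) = enc x \<and> Ra b = enc zs' \<and> (\<forall>i<b+4. i \<noteq> b+2 \<longrightarrow> i \<noteq> b \<longrightarrow> Ra i = R' i)"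
            then obtain Ra where a: "\<sigma>1 = (Ra, S')" "Ra (b + 2) = enc x" "Ra b = enc zs'"
              "\<And>i. i < b+4 \<Longrightarrow> i \<noteq> b+2 \<Longrightarrow> i \<noteq> b \<Longrightarrow> Ra i = R' i" by (cases \<sigma>1) auto
            have a1: "Ra (b + 1) = enc st" using a(4)[of "b + 1"] yz by (simp add: st_def)
            show "run (Seq (cons_prog (b + 2) (b + 1) (b + 3) (b + 4)) (Seq (cons_prog a (b + 3) (b + 3) (b + 4)) c3)) \<sigma>1
              (cell_time (B e) + (cell_time (B e) + (B e + 2) ^ k)) (I n)" unfolding a(1)
            proof (rule run_Seq)
              show "run (cons_prog (b + 2) (b + 1) (b + 3) (b + 4)) (Ra, S') (cell_time (B e))
                (\<lambda>(Rb, Sb). Sb = S' \<and> Rb (b+3) = consn (Ra (b + 2)) (Ra (b + 1)) \<and> (\<forall>i<b+4. i \<noteq> b+3 \<longrightarrow> Rb i = Ra i))"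
                using a a1 szs st by (intro run_cons) (auto simp: sz_def[symmetric] B_def)
              fix \<sigma>2 :: state assume "case \<sigma>2 of (Rb, Sb) \<Rightarrow> Sb = S' \<and> Rb (b+3) = consn (Ra (b + 2)) (Ra (b + 1)) \<and> (\<forall>i<b+4. i \<noteq> b+3 \<longrightarrow> Rb i = Ra i)"
              then obtain Rb where b: "\<sigma>2 = (Rb, S')" "Rb (b+3) = enc (x, st)" "\<And>i. i < b+4 \<Longrightarrow> i \<noteq> b+3 \<Longrightarrow> Rb i = Ra i"
                using a a1 by (cases \<sigma>2) auto
              have ba: "Rb a = enc e" using b(3)[of a] a(4)[of a] fr[of a] e ab by simp
              show "run (Seq (cons_prog a (b + 3) (b + 3) (b + 4)) c3) \<sigma>2 (cell_time (B e) + (B e + 2) ^ k) (I n)"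
                unfolding b(1)
              proof (rule run_Seq)
                show "run (cons_prog a (b + 3) (b + 3) (b + 4)) (Rb, S') (cell_time (B e))
                  (\<lambda>(Rb', Sb). Sb = S' \<and> Rb' (b+3) = consn (Rb a) (Rb (b+3)) \<and> (\<forall>i<b+4. i \<noteq> b+3 \<longrightarrow> Rb' i = Rb i))"
                  using b ba ab szs st by (intro run_cons) (auto simp: sz_def[symmetric] B_def bl_consn)
                fix \<sigma>3 :: state assume "case \<sigma>3 of (Rb', Sb) \<Rightarrow> Sb = S' \<and> Rb' (b+3) = consn (Rb a) (Rb (b+3)) \<and> (\<forall>i<b+4. i \<noteq> b+3 \<longrightarrow> Rb' i = Rb i)"
                then obtain Rc where cc: "\<sigma>3 = (Rc, ?S)" "Rc (b+3) = enc (e, x, st)" "\<And>i. i < b+4 \<Longrightarrow> i \<noteq> b+3 \<Longrightarrow> Rc i = Rb i"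
                  using b ba S' by (cases \<sigma>3) auto
                have "run c3 (Rc, ?S) (T3 (e, x, st)) (post (b + 1) (b + 4) Rc ?S (enc (h e x st)))"
                  using c3 z_D cc(2) by fastforce
                moreover have "T3 (e, x, st) \<le> (B e + 2) ^ k"
                proof -
                  have "sz (e, x, st) \<le> B e" using szs st by (simp add: B_def)
                  then show ?thesis using k[OF z_D] by (meson add_le_mono1 order_trans power_mono zero_le)
                qed
                moreover have "I n \<sigma>'" if p: "post (b + 1) (b + 4) Rc ?S (enc (h e x st)) \<sigma>'" for \<sigma>'
                proof -
                  obtain R4 where R4: "\<sigma>' = (R4, ?S)" "R4 (b + 1) = enc (h e x st)" "\<And>i. i < b + 4 \<Longrightarrow> i \<noteq> b + 1 \<Longrightarrow> R4 i = Rc i"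
                    using p by (rule postE) blast
                  have "R4 i = R i" if "i < b" for i using that R4(3)[of i] cc(3)[of i] b(3)[of i] a(4)[of i] fr[of i] by simp
                  moreover have "R4 b = enc zs'" using R4(3)[of b] cc(3)[of b] b(3)[of b] a(3) by simp
                  ultimately show ?thesis unfolding I_def using R4 yz zs
                    by (auto simp: st_def intro!: exI[of _ "ys @ [x]"] exI[of _ zs'])
                qed
                ultimately show "run c3 \<sigma>3 ((B e + 2) ^ k) (I n)" unfolding cc(1) by (rule run_mono)
              qed
            qed
          qed
          have "bit_size (R' b) \<le> B e + 1"
            using b2 bit_size_le[of "R' b"] by linarith
          with w show "R' b \<noteq> 0 \<and> bit_size (R' b) \<le> B e + 1 \<and> run body (R', S') (?W e) (I n)"
            using yz zs by simp
        qed (auto simp: I_def)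
        moreover have "length (xs e) * (B e + 1 + ?W e) + 1 \<le> sz (xs e) * (B e + 1 + ?W e) + 1"
          by (intro add_mono mult_le_mono1 order_refl length_le_sz)
        ultimately have w: "run (WhileNZ b body) \<tau> (sz (xs e) * (B e + 1 + ?W e) + 1) (I 0)"
          by (rule run_mono)
        show "run (Seq (WhileNZ b body) (block [Load (b + 2) 0, Op OpAdd z (b + 1) (b + 2)])) \<tau>
          (sz (xs e) * (B e + 1 + ?W e) + 1 + (B e + 1 + 1 + 1 + 1)) (post z b R ?S (enc (fold (h e) (xs e) (s e))))"
        proof (rule run_Seq[OF w])
          fix \<sigma>' assume "I 0 \<sigma>'"
          then obtain R' where R': "\<sigma>' = (R', ?S)" "R' (b + 1) = enc (fold (h e) (xs e) (s e))" "\<And>i. i < b \<Longrightarrow> R' i = R i"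
            by (cases \<sigma>') (auto simp: I_def)
          have "sz (fold (h e) (xs e) (s e)) \<le> B e" using bnd[OF e(1), of "xs e" "[]"] by (simp add: B_def)
          then show "run (block [Load (b + 2) 0, Op OpAdd z (b + 1) (b + 2)]) \<sigma>' (B e + 1 + 1 + 1 + 1)
             (post z b R ?S (enc (fold (h e) (xs e) (s e))))"
            unfolding R'(1) using R' ab
            by (intro run_block) (auto simp: post_def bit_size_def sz_def)
        qed
      qed
    qed
    then show "\<exists>c. \<forall>e\<in>D. \<forall>R. R a = enc e \<longrightarrow>
      run c (R, ?S) (?T e) (post z b R ?S (enc (fold (h e) (xs e) (s e))))" by blast
  qed
qed

fun bits_acc :: "nat \<Rightarrow> nat list \<Rightarrow> nat list" where
  "bits_acc n acc = (if n = 0 then acc else bits_acc (n div 2) (n mod 2 # acc))"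

declare bits_acc.simps [simp del]

definition bits :: "nat \<Rightarrow> nat list" where "bits n = bits_acc n []"

lemma bits_acc_append: "bits_acc n acc = bits n @ acc"
proof (induction n arbitrary: acc rule: less_induct)
  case (less n)
  show ?case
  proof (cases "n = 0")
    case False
    then have "bits_acc n ac = bits (n div 2) @ n mod 2 # ac" for ac
      using less[of "n div 2"] by (subst bits_acc.simps) simp
    then show ?thesis unfolding bits_def by simp
  qed (simp add: bits_def bits_acc.simps)
qed

lemma bits_0 [simp]: "bits 0 = []" by (simp add: bits_def bits_acc.simps)

lemma bits_rec: "n \<noteq> 0 \<Longrightarrow> bits n = bits (n div 2) @ [n mod 2]"
  by (subst bits_def, subst bits_acc.simps) (simp add: bits_acc_append)

lemma length_bits [simp]: "length (bits n) = bl n"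
proof (induction n rule: less_induct)
  case (less n)
  show ?case
  proof (cases "n = 0")
    case False
    then have "bl n = bl (n div 2) + 1" by (subst compute_floorlog) simp
    then show ?thesis using False less[of "n div 2"] by (simp add: bits_rec[OF False])
  qed simp
qed

lemma set_bits: "set (bits n) \<subseteq> {0, 1}"
proof (induction n rule: less_induct)
  case (less n)
  show ?case
  proof (cases "n = 0")
    case False
    then show ?thesis using less[of "n div 2"] by (auto simp: bits_rec[OF False])
  qed simp
qed

text \<open>Turns a number into a list of logarithmic length, through which numbers can drive later
  loops; counting down from the number itself would take exponentially many rounds. The digits are
  split off from the low end and consed, so the most significant one comes first.\<close>

lemma pt_bits0: "pt D bits"
proof (rule ptI)
  let ?S = "\<lambda>_ :: nat. [] :: nat list"
  define B where "B n = 3 * bl n + 2" for n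
  define C where "C n = (B n + 2) ^ 2" for n
  let ?W = "\<lambda>n. C n + 1 + (cell_time (B n) + (C n + 1))"
  let ?T = "\<lambda>n. (C n + (C n + (C n + (C n + 1)))) + ((bl n * (B n + 1 + ?W n) + 1) + (C n + (C n + 1)))"
  have sB: "pbd D bl"
    by (rule pbd_mono[OF pbd_sz], unfold sz_simps, rule order_refl)
  have pB: "pbd D (\<lambda>n. B n)" unfolding B_def by (rule pbd_add[OF pbd_mult[OF pbd_const sB] pbd_const])
  have pC: "pbd D (\<lambda>n. C n)" unfolding C_def by (rule pbd_power[OF pbd_add[OF pB pbd_const]])
  show "pbd D ?T" by (intro pbd_add pbd_mult pbd_const pbd_cell_time pB pC sB)
  have szb: "sz xs \<le> 3 * length xs" if "set xs \<subseteq> {0, 1::nat}" for xs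
    using sz_list_le[of xs 1 "length xs"] that by fastforce
  show "pbd D (\<lambda>n. sz (bits n))"
  proof (rule pbd_mono)
    show "pbd D (\<lambda>n. 3 * bl n)" by (rule pbd_mult[OF pbd_const sB])
    fix n show "sz (bits n) \<le> 3 * bl n" using szb[OF set_bits[of n]] unfolding length_bits .
  qed
  fix a z b :: nat assume ab: "a < b" "z < b"
  define body where "body = Seq (block [Op OpMod (b+3) (b+1) b]) (Seq (cons_prog (b+3) (b+2) (b+2) (b+4)) (block [Op OpDiv (b+1) (b+1) b]))"
  define c where "c = Seq (block [Load b 2, Load (b+2) 0, Load (b+3) 0, Op OpAdd (b+1) a (b+3)])
    (Seq (WhileNZ (b+1) body) (block [Load (b+3) 0, Op OpAdd z (b+2) (b+3)]))"
  have "run c (R, ?S) (?T n) (post z b R ?S (enc (bits n)))" if "R a = enc n" for n R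
  proof -
    have Rn: "R a = n" using that by simp
    have C: "binop_cost bop u v \<le> C n" if "bl u \<le> B n" "bl v \<le> B n" for bop u v
      using binop_cost_le[OF that] unfolding C_def .
    have L: "bit_size v \<le> C n" if "bl v \<le> B n" for v
      using load_cost_le[OF that] unfolding C_def .
    have Bn: "bl n \<le> B n" "2 \<le> B n" by (simp_all add: B_def)
    define I :: "nat \<Rightarrow> state \<Rightarrow> bool" where "I = (\<lambda>i (R', S'). S' = ?S \<and> R' b = 2 \<and> (\<forall>i<b. R' i = R i) \<and>
       bl (R' (b+1)) = i \<and> R' (b+1) \<le> n \<and> (\<exists>acc. R' (b+2) = enc acc \<and> length acc \<le> bl n \<and> bits (R' (b+1)) @ acc = bits n))"
    have 1: "run (block [Load b 2, Load (b+2) 0, Load (b+3) 0, Op OpAdd (b+1) a (b+3)]) (R, ?S)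
       (C n + (C n + (C n + (C n + 1)))) (I (bl n))"
    proof (rule run_block)
      show "block_cost [Load b 2, Load (b+2) 0, Load (b+3) 0, Op OpAdd (b+1) a (b+3)] R \<le> C n + (C n + (C n + (C n + 1)))"
        unfolding block_cost.simps by (intro add_mono order_refl)
          (use Bn ab in \<open>auto simp del: binop_cost.simps simp: Rn intro!: C L\<close>)
      have "\<exists>acc. (0::nat) = enc acc \<and> length acc \<le> bl n \<and> bits n @ acc = bits n" by (rule exI[of _ "[]"]) simp
      then show "I (bl n) (fold effect [Load b 2, Load (b+2) 0, Load (b+3) 0, Op OpAdd (b+1) a (b+3)] R, ?S)"
        using ab by (simp add: I_def Rn)
    qed simp
    have 2: "run (WhileNZ (b+1) body) \<sigma> (bl n * (B n + 1 + ?W n) + 1) (I 0)" if "I (bl n) \<sigma>" for \<sigma>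
      using that
    proof (rule run_WhileNZ[where I = I, rotated 2])
      fix i R' S' assume "I (Suc i) (R', S')"
      then obtain acc where I: "S' = ?S" "R' b = 2" "\<And>i. i < b \<Longrightarrow> R' i = R i" "bl (R' (b+1)) = Suc i" "R' (b+1) \<le> n"
        "R' (b+2) = enc acc" "length acc \<le> bl n" "bits (R' (b+1)) @ acc = bits n" by (auto simp: I_def)
      define m where "m = R' (b+1)"
      have m1: "R' (b+1) = m" by (simp add: m_def)
      have "m \<noteq> 0" using I(4) by (cases "m = 0") (simp_all add: m_def)
      moreover have "bl m \<le> bl n" using bl_mono[OF I(5)] by (simp only: m_def)
      ultimately have m: "m \<noteq> 0" "bl m \<le> bl n" by simp_all
      have acc: "sz acc \<le> 3 * bl n" using szb[of acc] I(7) set_bits[of n] unfolding I(8)[symmetric] by simp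
      have m2: "bl (m mod 2) \<le> 1" using bl_mono[of "m mod 2" 1] by simp
      have "run body (R', S') (?W n) (I i)" unfolding body_def
      proof (rule run_Seq)
        show "run (block [Op OpMod (b+3) (b+1) b]) (R', S') (C n + 1)
          (\<lambda>\<sigma>'. \<sigma>' = (R'(b+3 := m mod 2), S'))"
          using I(2) m1 m Bn by (intro run_block) (auto simp del: binop_cost.simps intro!: C)
        fix \<sigma>1 assume s1: "\<sigma>1 = (R'(b+3 := m mod 2), S')"
        show "run (Seq (cons_prog (b+3) (b+2) (b+2) (b+4)) (block [Op OpDiv (b+1) (b+1) b])) \<sigma>1
           (cell_time (B n) + (C n + 1)) (I i)" unfolding s1
        proof (rule run_Seq)
          let ?R = "R'(b+3 := m mod 2)"
          show "run (cons_prog (b+3) (b+2) (b+2) (b+4)) (?R, S') (cell_time (B n))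
             (\<lambda>(Ra, Sa). Sa = S' \<and> Ra (b+2) = consn (?R (b+3)) (?R (b+2)) \<and> (\<forall>i<b+4. i \<noteq> b+2 \<longrightarrow> Ra i = ?R i))"
            using I(6) acc m2 Bn by (intro run_cons) (auto simp: sz_def[symmetric] B_def)
          fix \<sigma>2 :: state
          assume "case \<sigma>2 of (Ra, Sa) \<Rightarrow> Sa = S' \<and> Ra (b+2) = consn (?R (b+3)) (?R (b+2)) \<and> (\<forall>i<b+4. i \<noteq> b+2 \<longrightarrow> Ra i = ?R i)"
          then obtain Ra where Ra: "\<sigma>2 = (Ra, ?S)" "Ra (b+2) = enc (m mod 2 # acc)" "\<And>i. i < b+4 \<Longrightarrow> i \<noteq> b+2 \<Longrightarrow> Ra i = ?R i"
            using I(1,6) by (cases \<sigma>2) auto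
          have Ra': "Ra b = 2" "Ra (b+1) = m" "\<And>i. i < b \<Longrightarrow> Ra i = R i" using Ra(3) I(2,3) m1 by simp_all
          have bits: "bits (m div 2) @ m mod 2 # acc = bits n" using I(8) bits_rec[OF m(1)] unfolding m1 by simp
          have len: "Suc (length acc) \<le> bl n" using arg_cong[OF bits, of length] by simp
          have "m div 2 \<le> n" using I(5) unfolding m1 by (meson div_le_dividend order_trans)
          moreover have "bl (m div 2) = i" using I(4) unfolding m1 by (simp add: bl_div2)
          ultimately show "run (block [Op OpDiv (b+1) (b+1) b]) \<sigma>2 (C n + 1) (I i)"
            unfolding Ra(1) using Ra(2) Ra' bits len m Bn
            by (intro run_block) (auto simp del: binop_cost.simps simp: I_def intro!: C exI[of _ "m mod 2 # acc"])
        qed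
      qed
      moreover have "bit_size (R' (b+1)) \<le> B n + 1" using bit_size_le[of m] m Bn unfolding m1 by simp
      ultimately show "R' (b+1) \<noteq> 0 \<and> bit_size (R' (b+1)) \<le> B n + 1 \<and> run body (R', S') (?W n) (I i)"
        using m unfolding m1 by blast
    qed (simp add: I_def floorlog_eq_zero_iff)
    show ?thesis unfolding c_def
    proof (rule run_Seq[OF 1], rule run_Seq[OF 2], assumption)
      fix \<sigma> assume "I 0 \<sigma>"
      then obtain R' where R': "\<sigma> = (R', ?S)" "R' (b+2) = enc (bits n)" "\<And>i. i < b \<Longrightarrow> R' i = R i"
        by (cases \<sigma>) (simp add: I_def floorlog_eq_zero_iff, metis append_Nil bits_0)
      have "bl (enc (bits n)) \<le> B n" using szb[OF set_bits[of n]] by (simp add: sz_def B_def)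
      then show "run (block [Load (b+3) 0, Op OpAdd z (b+2) (b+3)]) \<sigma> (C n + (C n + 1)) (post z b R ?S (enc (bits n)))"
        unfolding R'(1) using R' ab Bn
        by (intro run_block) (auto simp del: binop_cost.simps simp: post_def intro!: add_mono C L)
    qed
  qed
  then show "\<exists>c. \<forall>n\<in>D. \<forall>R. R a = enc n \<longrightarrow> run c (R, ?S) (?T n) (post z b R ?S (enc (bits n)))"
    by (intro exI[of _ c] ballI allI impI)
qed

section \<open>The root finding algorithm\<close>

text \<open>All polynomials and all field elements are lists of coefficients starting with the constant
  one.  The algorithm only uses the operations of the ring record, never its carrier.\<close>

definition ev :: "('c, 'x) ring_scheme \<Rightarrow> 'c list \<Rightarrow> 'c \<Rightarrow> 'c" where
  "ev G u x = foldr (\<lambda>a acc. a \<oplus>\<^bsub>G\<^esub> (x \<otimes>\<^bsub>G\<^esub> acc)) u \<zero>\<^bsub>G\<^esub>"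

definition smul :: "('c, 'x) ring_scheme \<Rightarrow> 'c \<Rightarrow> 'c list \<Rightarrow> 'c list" where
  "smul G c u = map (\<lambda>a. c \<otimes>\<^bsub>G\<^esub> a) u"

definition zeros :: "('c, 'x) ring_scheme \<Rightarrow> 'a list \<Rightarrow> 'c list" where
  "zeros G h = map (\<lambda>_. \<zero>\<^bsub>G\<^esub>) h"

text \<open>The substitution \<open>T \<mapsto> k T\<close>.\<close>

definition sc :: "('c, 'x) ring_scheme \<Rightarrow> 'c \<Rightarrow> 'c list \<Rightarrow> 'c list" where
  "sc G k u = foldr (\<lambda>a acc. a # smul G k acc) u []"

definition addl :: "('c, 'x) ring_scheme \<Rightarrow> 'c list \<Rightarrow> 'c list \<Rightarrow> 'c list" where
  "addl G u v = map (\<lambda>z. fst z \<oplus>\<^bsub>G\<^esub> snd z) (zip u v)"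

text \<open>Multiplication by \<open>T\<close> and multiplication modulo \<open>T ^ n - (h ! 0 + \<dots> + h ! (n - 1) T ^ (n - 1))\<close>
  for \<open>n = length h\<close>.\<close>

definition xmul :: "('c, 'x) ring_scheme \<Rightarrow> 'c list \<Rightarrow> 'c list \<Rightarrow> 'c list" where
  "xmul G h acc = (case rev acc of [] \<Rightarrow> [] | l # ls \<Rightarrow> addl G (\<zero>\<^bsub>G\<^esub> # rev ls) (smul G l h))"

definition mulm :: "('c, 'x) ring_scheme \<Rightarrow> 'c list \<Rightarrow> 'c list \<Rightarrow> 'c list \<Rightarrow> 'c list" where
  "mulm G h u v = foldr (\<lambda>c acc. addl G (smul G c v) (xmul G h acc)) u (zeros G h)"

definition onel :: "('c, 'x) ring_scheme \<Rightarrow> 'a list \<Rightarrow> 'c list" where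
  "onel G h = (case h of [] \<Rightarrow> [] | _ # t \<Rightarrow> \<one>\<^bsub>G\<^esub> # zeros G t)"

text \<open>The sum is cut to the length of \<open>h\<close>. On elements of the carrier this
  changes nothing, but every result, even for malformed arguments, is thereby bounded in terms of
  \<open>G\<close> and \<open>h\<close> alone, as \<open>ptr\<close> demands.\<close>

definition ext :: "('c, 'x) ring_scheme \<Rightarrow> 'c list \<Rightarrow> 'c list ring" where
  "ext G h = \<lparr>carrier = {u. length u = length h \<and> set u \<subseteq> carrier G}, mult = mulm G h, one = onel G h,
     zero = zeros G h, add = (\<lambda>u v. map snd (zip h (addl G u v)))\<rparr>"

definition pw :: "('c, 'x) ring_scheme \<Rightarrow> 'c \<Rightarrow> nat \<Rightarrow> 'c" where
  "pw R a n = fold (\<lambda>b s. if b = 1 then (s \<otimes>\<^bsub>R\<^esub> s) \<otimes>\<^bsub>R\<^esub> a else s \<otimes>\<^bsub>R\<^esub> s) (bits n) \<one>\<^bsub>R\<^esub>"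

definition mulL :: "('c, 'x) ring_scheme \<Rightarrow> 'c list \<Rightarrow> 'c list \<Rightarrow> 'c list" where
  "mulL G u v = foldr (\<lambda>c acc. addl G (smul G c v @ zeros G acc) (\<zero>\<^bsub>G\<^esub> # acc)) u (zeros G (tl v))"

text \<open>The first state component counts the coefficients still to be skipped.\<close>

definition every :: "nat \<Rightarrow> 'c list \<Rightarrow> 'c list" where
  "every r u = rev (snd (fold (\<lambda>a s. if fst s = 0 then (r - 1, a # snd s) else (fst s - 1, snd s)) u (0, [])))"

text \<open>The Graeffe transform of \<open>f\<close> vanishes at the \<open>r\<close>-th powers of the roots of \<open>f\<close>.  The prime \<open>r\<close> is
  given in unary, as the list of the numbers below \<open>r\<close>.\<close>

definition graeffe_prod :: "('c, 'x) ring_scheme \<Rightarrow> nat list \<Rightarrow> 'c \<Rightarrow> 'c list \<Rightarrow> 'c list" where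
  "graeffe_prod G rs \<zeta> f = foldr (\<lambda>k acc. mulL G (sc G (pw G \<zeta> k) f) acc) rs [\<one>\<^bsub>G\<^esub>]"

text \<open>The zip cuts the result to the length of \<open>f\<close>. For a primitive root of unity
  the length is right anyway, but the size bound has to hold for all arguments.\<close>

definition graeffe :: "('c, 'x) ring_scheme \<Rightarrow> nat list \<Rightarrow> 'c \<Rightarrow> 'c list \<Rightarrow> 'c list" where
  "graeffe G rs \<zeta> f = map snd (zip f (every (length rs) (graeffe_prod G rs \<zeta> f)))"

definition modl :: "('c, 'x) ring_scheme \<Rightarrow> 'c \<Rightarrow> nat list \<Rightarrow> 'c list" where
  "modl G c rs = c # zeros G (tl rs)"

definition linl :: "('c, 'x) ring_scheme \<Rightarrow> 'c \<Rightarrow> nat list \<Rightarrow> 'c list" where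
  "linl G a rs = a # \<one>\<^bsub>G\<^esub> # zeros G (tl (tl rs))"

text \<open>Here \<open>m\<close> stands for \<open>-1\<close>, \<open>\<zeta>\<close> is a primitive \<open>r\<close>-th root of unity, and \<open>h\<close> encodes \<open>T ^ r = c\<close>.
  For \<open>v = (1 + T) ^ M\<close> and \<open>s(y) = (1 + y) / (1 + \<zeta> y)\<close>, the elements of \<open>rels1\<close> and \<open>rels2\<close> express that
  \<open>s(y) ^ M\<close> equals \<open>\<kappa>\<close>, respectively \<open>s(\<zeta> ^ b y) ^ M\<close>.\<close>

definition rels1 :: "('c, 'x) ring_scheme \<Rightarrow> 'c \<Rightarrow> 'c list \<Rightarrow> 'c \<Rightarrow> 'c list \<Rightarrow> 'c list list" where
  "rels1 G m U \<zeta> v = map (\<lambda>\<kappa>. addl G v (smul G (m \<otimes>\<^bsub>G\<^esub> \<kappa>) (sc G \<zeta> v))) U"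

definition rels2 :: "('c, 'x) ring_scheme \<Rightarrow> 'c \<Rightarrow> nat list \<Rightarrow> 'c \<Rightarrow> 'c list \<Rightarrow> 'c list \<Rightarrow> 'c list list" where
  "rels2 G m rs \<zeta> h v = map (\<lambda>b. addl G (mulm G h v (sc G (pw G \<zeta> b \<otimes>\<^bsub>G\<^esub> \<zeta>) v))
     (smul G m (mulm G h (sc G \<zeta> v) (sc G (pw G \<zeta> b) v)))) rs"

text \<open>With \<open>J = E ^ (q - 1)\<close>, the polynomial \<open>J + T (1 - J)\<close> takes the value \<open>y\<close> at the roots \<open>y\<close> of \<open>E\<close>
  and the value \<open>1\<close> elsewhere, so the product of its conjugates is the product of the roots of \<open>E\<close>.\<close>

definition sel :: "('c, 'x) ring_scheme \<Rightarrow> 'c \<Rightarrow> nat \<Rightarrow> nat list \<Rightarrow> 'c list \<Rightarrow> 'c list \<Rightarrow> 'c list" where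
  "sel G m q rs h E = (let J = pw (ext G h) E (q - 1)
     in addl G J (mulm G h (linl G \<zero>\<^bsub>G\<^esub> rs) (addl G (onel G h) (smul G m J))))"

definition normp :: "('c, 'x) ring_scheme \<Rightarrow> nat list \<Rightarrow> 'c \<Rightarrow> 'c list \<Rightarrow> 'c list \<Rightarrow> 'c" where
  "normp G rs \<zeta> h \<theta> = (case foldr (\<lambda>k acc. mulm G h (sc G (pw G \<zeta> k) \<theta>) acc) rs (onel G h) of
     [] \<Rightarrow> \<zero>\<^bsub>G\<^esub> | a # _ \<Rightarrow> a)"

text \<open>A product \<open>w\<close> of \<open>t\<close> roots of \<open>y ^ r = c\<close> is \<open>y ^ t\<close> up to a power of \<open>\<zeta>\<close>; if \<open>0 < t < r\<close>, then
  \<open>a t = 1 + b r\<close> for suitable \<open>a\<close> and \<open>b\<close>, and \<open>y\<close> is \<open>w ^ a / c ^ b\<close> up to a power of \<open>\<zeta>\<close>.\<close>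

definition cands :: "('c, 'x) ring_scheme \<Rightarrow> nat list \<Rightarrow> 'c \<Rightarrow> 'c \<Rightarrow> 'c \<Rightarrow> 'c list" where
  "cands G rs \<zeta> ci w = concat (map (\<lambda>a. concat (map (\<lambda>b. map (\<lambda>j.
     (pw G w a \<otimes>\<^bsub>G\<^esub> pw G ci b) \<otimes>\<^bsub>G\<^esub> pw G \<zeta> j) rs) rs)) rs)"

definition rootc :: "('c, 'x) ring_scheme \<Rightarrow> 'c \<Rightarrow> nat \<Rightarrow> 'c list \<Rightarrow> nat list \<Rightarrow> nat list \<Rightarrow> 'c \<Rightarrow> 'c \<Rightarrow> 'c list" where
  "rootc G m q U Ms rs \<zeta> c = map (\<lambda>j. m \<otimes>\<^bsub>G\<^esub> pw G \<zeta> j) rs @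
     concat (map (\<lambda>M. let h = modl G c rs; v = pw (ext G h) (linl G \<one>\<^bsub>G\<^esub> rs) M
       in concat (map (\<lambda>E. cands G rs \<zeta> (pw G c (q - 2)) (normp G rs \<zeta> h (sel G m q rs h E)))
         (rels1 G m U \<zeta> v @ rels2 G m rs \<zeta> h v))) Ms)"

text \<open>An entry \<open>(M, rs, z)\<close> of the chain consists of a divisor \<open>M\<close> of \<open>q - 1\<close>, a prime \<open>r\<close> in unary such
  that \<open>M r\<close> is the preceding divisor, and a primitive \<open>r\<close>-th (or fourth, if \<open>r = 2\<close>) root of unity.\<close>

type_synonym 'c link = "nat \<times> nat list \<times> 'c"

definition zet :: "('c, 'x) ring_scheme \<Rightarrow> 'c link \<Rightarrow> 'c" where
  "zet G l = (if length (fst (snd l)) = 2 then snd (snd l) \<otimes>\<^bsub>G\<^esub> snd (snd l) else snd (snd l))"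

text \<open>The exponents run below \<open>2 * r\<close>: for \<open>r = 2\<close> this exhausts the
  four powers of the fourth root of unity, for other \<open>r\<close> the powers are merely listed
  twice.\<close>

definition unity1 :: "('c, 'x) ring_scheme \<Rightarrow> 'c link list \<Rightarrow> 'c list" where
  "unity1 G ls = concat (map (\<lambda>l. map (\<lambda>j. pw G (snd (snd l)) j)
     (fst (snd l) @ map (\<lambda>j. j + length (fst (snd l))) (fst (snd l)))) ls)"

text \<open>The candidates for the constant \<open>\<kappa>\<close> of \<open>rels1\<close>: the
  values found in \<open>link_lemma\<close> are products of powers of two roots of unity that may
  belong to different entries of the chain.\<close>

definition unity2 :: "('c, 'x) ring_scheme \<Rightarrow> 'c link list \<Rightarrow> 'c list" where
  "unity2 G ls = concat (map (\<lambda>a. map (\<lambda>b. a \<otimes>\<^bsub>G\<^esub> b) (unity1 G ls)) (unity1 G ls))"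

text \<open>Each step records the polynomial before its transform, the last step on top, which is
  the order in which the way back needs them.\<close>

definition forward :: "('c, 'x) ring_scheme \<Rightarrow> 'c link list \<Rightarrow> 'c list \<Rightarrow> 'c list \<times> ('c link \<times> 'c list) list" where
  "forward G ls f = fold (\<lambda>l s. (graeffe G (fst (snd l)) (zet G l) (fst s), (l, fst s) # snd s)) ls (f, [])"

text \<open>Evaluation of the recorded polynomial removes wrong candidates. The remaining ones are
  distinct roots of it, so cutting their list to its length loses none; the cut makes the size bound
  evident without any algebra.\<close>

definition backstep :: "('c, 'x) ring_scheme \<Rightarrow> 'c \<Rightarrow> nat \<Rightarrow> 'c list \<Rightarrow> nat list \<Rightarrow> 'c link \<times> 'c list \<Rightarrow> 'c list \<Rightarrow> 'c list" where
  "backstep G m q U Ms lg C = map snd (zip (snd lg) (remdups (filter (\<lambda>y. ev G (snd lg) y = \<zero>\<^bsub>G\<^esub>)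
     (concat (map (\<lambda>c. rootc G m q U Ms (fst (snd (fst lg))) (zet G (fst lg)) c) C)))))"

text \<open>The chain accounts for nonzero roots only, so zero is tried separately. At the end of
  the chain the exponent is \<open>1\<close>, whence the single initial candidate
  \<open>\<one>\<close>.\<close>

definition solve :: "('c, 'x) ring_scheme \<Rightarrow> 'c \<Rightarrow> nat \<Rightarrow> 'c link list \<Rightarrow> 'c list \<Rightarrow> 'c list" where
  "solve G m q ls f = remdups (filter (\<lambda>y. ev G f y = \<zero>\<^bsub>G\<^esub>) (\<zero>\<^bsub>G\<^esub> #
     fold (backstep G m q (unity2 G ls) (map fst ls)) (snd (forward G ls f)) [\<one>\<^bsub>G\<^esub>]))"

section \<open>Closure of polynomial-time functions under list operations\<close>

lemma pt_comp2:
  assumes "pt UNIV (\<lambda>z. F (fst z) (snd z))" "pt D a" "pt D b"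
  shows "pt D (\<lambda>x. F (a x) (b x))"
  using pt_comp[OF assms(1) pt_Pair[OF assms(2,3)]] by simp

lemma pt_comp3:
  assumes "pt UNIV (\<lambda>z. F (fst z) (fst (snd z)) (snd (snd z)))" "pt D a" "pt D b" "pt D c"
  shows "pt D (\<lambda>x. F (a x) (b x) (c x))"
  using pt_comp[OF assms(1) pt_Pair[OF assms(2) pt_Pair[OF assms(3,4)]]] by simp

lemma pbd_pt: "pbd UNIV F \<Longrightarrow> pt D f \<Longrightarrow> pbd D (\<lambda>x. F (f x))"
  by (rule pbd_comp[of UNIV]) (auto intro: pt_pbd)

lemma pbd_length: "pt D f \<Longrightarrow> pbd D (\<lambda>x. length (f x))"
  by (rule pbd_mono[OF pt_pbd]) (auto intro: length_le_sz)

lemma sz_list_bound: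
  assumes "\<forall>x\<in>set xs. sz x \<le> B" "length xs \<le> N"
  shows "sz xs \<le> N * (2 * B + 1)"
  by (rule sz_list_le) (use assms in auto)

lemmas pt_basic = pt_fst pt_snd pt_Pair pt_Cons pt_ident pt_const

lemma pt_rev:
  fixes f :: "'e::enc \<Rightarrow> 'b::enc list"
  assumes f: "pt D f"
  shows "pt D (\<lambda>e. rev (f e))"
proof -
  have "pt D (\<lambda>e. fold (\<lambda>x s. x # s) (f e) [])"
    by (rule pt_fold[OF f pt_const _ pt_pbd[OF f]]) (intro pt_basic, simp add: fold_Cons_rev)
  then show ?thesis by (simp add: fold_Cons_rev)
qed

lemma pt_foldr:
  fixes xs :: "'e::enc \<Rightarrow> 'x::enc list" and s :: "'e \<Rightarrow> 's::enc"
  assumes xs: "pt D xs" and s: "pt D s"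
    and h: "pt {z. fst z \<in> D \<and> fst (snd z) \<in> set (xs (fst z))} (\<lambda>z. h (fst z) (fst (snd z)) (snd (snd z)))"
    and F: "pbd D F" and bnd: "\<And>e ys zs. e \<in> D \<Longrightarrow> xs e = zs @ ys \<Longrightarrow> sz (foldr (h e) ys (s e)) \<le> F e"
  shows "pt D (\<lambda>e. foldr (h e) (xs e) (s e))"
  unfolding foldr_conv_fold
proof (rule pt_fold[OF pt_rev[OF xs] s _ F])
  show "pt {z. fst z \<in> D \<and> fst (snd z) \<in> set (rev (xs (fst z)))} (\<lambda>z. h (fst z) (fst (snd z)) (snd (snd z)))"
    using h by simp
  fix e ys zs assume "e \<in> D" "rev (xs e) = ys @ zs"
  then show "sz (fold (h e) ys (s e)) \<le> F e"
    using bnd[of e "rev zs" "rev ys"] by (simp add: foldr_conv_fold rev_swap)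
qed

lemma pt_append:
  fixes f g :: "'e::enc \<Rightarrow> 'b::enc list"
  assumes f: "pt D f" and g: "pt D g"
  shows "pt D (\<lambda>e. f e @ g e)"
proof -
  have *: "foldr (#) xs ys = xs @ ys" for xs ys :: "'b list" by (induction xs) auto
  have "pt D (\<lambda>e. foldr (\<lambda>x s. x # s) (f e) (g e))"
  proof (rule pt_foldr[OF f g])
    show "pbd D (\<lambda>e. sz (f e) + sz (g e))" by (intro pbd_add pt_pbd f g)
  qed (intro pt_basic, simp add: *)
  then show ?thesis by (simp add: *)
qed

text \<open>A bound depending on a list element becomes a bound in the environment alone, because an
  element is no larger than the list that contains it.\<close>

lemma pbd_body:
  assumes xs: "pt D xs" and G: "pbd {z. fst z \<in> D \<and> snd z \<in> set (xs (fst z))} G"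
  obtains B where "pbd D B" "\<And>e x. e \<in> D \<Longrightarrow> x \<in> set (xs e) \<Longrightarrow> G (e, x) \<le> B e"
proof -
  obtain k where k: "\<And>e x. e \<in> D \<Longrightarrow> x \<in> set (xs e) \<Longrightarrow> G (e, x) \<le> (sz (e, x) + 2) ^ k"
    using G unfolding pbd_def by auto
  let ?B = "\<lambda>e. (2 * sz e + sz (xs e) + 1 + 2) ^ k"
  have "G (e, x) \<le> ?B e" if "e \<in> D" "x \<in> set (xs e)" for e x
  proof -
    have "sz (e, x) + 2 \<le> 2 * sz e + sz (xs e) + 1 + 2" using sz_elem[OF that(2)] by simp
    then show ?thesis using k[OF that] power_mono[of "sz (e, x) + 2" _ k] by (meson order_trans zero_le)
  qed
  moreover have "pbd D ?B" by (intro pbd_intros pt_pbd xs)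
  ultimately show ?thesis using that by blast
qed

lemma pt_body:
  assumes "pt {z. fst z \<in> D \<and> snd z \<in> set (xs (fst z))} (\<lambda>z. f (fst z) (snd z))"
  shows "pt {z. fst z \<in> D \<and> fst (snd z) \<in> set (xs (fst z))} (\<lambda>z. f (fst z) (fst (snd z)))"
proof -
  have "pt {z. fst z \<in> D \<and> fst (snd z) \<in> set (xs (fst z))} (\<lambda>z. (fst z, fst (snd z)))" by (intro pt_basic)
  from pt_comp[OF assms this] show ?thesis by simp
qed

lemma pt_map:
  assumes xs: "pt D xs" and f: "pt {z. fst z \<in> D \<and> snd z \<in> set (xs (fst z))} (\<lambda>z. f (fst z) (snd z))"
  shows "pt D (\<lambda>e. map (f e) (xs e))"
proof -
  obtain B where B: "pbd D B" "\<And>e x. e \<in> D \<Longrightarrow> x \<in> set (xs e) \<Longrightarrow> sz (f e x) \<le> B e"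
    using pbd_body[OF xs pt_pbd[OF f]] by auto
  have *: "foldr (\<lambda>x s. f e x # s) ys [] = map (f e) ys" for e ys by (induction ys) auto
  have "pt D (\<lambda>e. foldr (\<lambda>x s. f e x # s) (xs e) [])"
  proof (rule pt_foldr[OF xs pt_const])
    show "pbd D (\<lambda>e. length (xs e) * (2 * B e + 1))" by (intro pbd_intros pbd_length xs B)
    show "sz (foldr (\<lambda>x s. f e x # s) ys []) \<le> length (xs e) * (2 * B e + 1)"
      if "e \<in> D" "xs e = zs @ ys" for e ys zs
      unfolding * by (rule sz_list_bound) (use that B(2)[of e] in auto)
    show "pt {z. fst z \<in> D \<and> fst (snd z) \<in> set (xs (fst z))} (\<lambda>z. f (fst z) (fst (snd z)) # snd (snd z))"
      by (intro pt_Cons pt_body f pt_basic)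
  qed
  then show ?thesis by (simp add: *)
qed

lemma pt_filter:
  fixes xs :: "'e::enc \<Rightarrow> 'c::enc list"
  assumes xs: "pt D xs" and f: "pt {z. fst z \<in> D \<and> snd z \<in> set (xs (fst z))} (\<lambda>z. f (fst z) (snd z))"
  shows "pt D (\<lambda>e. filter (f e) (xs e))"
proof -
  have *: "foldr (\<lambda>x s. if f e x then x # s else s) ys [] = filter (f e) ys" for e ys by (induction ys) auto
  have s: "sz (filter P ys) \<le> sz ys" for P and ys :: "'c list" by (induction ys) auto
  have "pt D (\<lambda>e. foldr (\<lambda>x s. if f e x then x # s else s) (xs e) [])"
  proof (rule pt_foldr[OF xs pt_const _ pt_pbd[OF xs]])
    show "sz (foldr (\<lambda>x s. if f e x then x # s else s) ys []) \<le> sz (xs e)"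
      if "e \<in> D" "xs e = zs @ ys" for e ys zs
      unfolding * using s[of "f e" ys] that by simp
    show "pt {z. fst z \<in> D \<and> fst (snd z) \<in> set (xs (fst z))}
        (\<lambda>z. if f (fst z) (fst (snd z)) then fst (snd z) # snd (snd z) else snd (snd z))"
      by (intro pt_If pt_body f pt_basic)
  qed
  then show ?thesis by (simp add: *)
qed

lemma pt_concat:
  fixes xs :: "'e::enc \<Rightarrow> 'b::enc list list"
  assumes xs: "pt D xs"
  shows "pt D (\<lambda>e. concat (xs e))"
proof -
  have s: "sz (concat ys) \<le> sz ys" for ys :: "'b list list" by (induction ys) auto
  have "pt D (\<lambda>e. foldr (\<lambda>x s. x @ s) (xs e) [])"
  proof (rule pt_foldr[OF xs pt_const _ pt_pbd[OF xs]])
    show "sz (foldr (\<lambda>x s. x @ s) ys []) \<le> sz (xs e)" if "e \<in> D" "xs e = zs @ ys" for e ys zs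
      using s[of ys] that by (simp add: concat_conv_foldr)
  qed (intro pt_append pt_basic)
  then show ?thesis by (simp add: concat_conv_foldr)
qed

lemma pt_length:
  fixes xs :: "'e::enc \<Rightarrow> 'b::enc list"
  assumes xs: "pt D xs"
  shows "pt D (\<lambda>e. length (xs e))"
proof -
  have *: "fold (\<lambda>x n. n + 1) ys k = length ys + k" for ys :: "'b list" and k by (induction ys arbitrary: k) auto
  have "pt D (\<lambda>e. fold (\<lambda>x n. n + 1) (xs e) (0::nat))"
  proof (rule pt_fold[OF xs pt_const _ pt_pbd[OF xs]])
    show "sz (fold (\<lambda>x n. n + 1) ys (0::nat)) \<le> sz (xs e)" if "e \<in> D" "xs e = ys @ zs" for e ys zs
      unfolding * using that length_le_sz[of ys] bl_le_self[of "length ys"] by simp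
  qed (intro pt_nat_ops pt_basic)
  then show ?thesis unfolding * by simp
qed

lemma pt_tl:
  assumes "pt D xs"
  shows "pt D (\<lambda>e. tl (xs e))"
proof -
  have "pt D (\<lambda>e. case xs e of [] \<Rightarrow> [] | y # ys \<Rightarrow> ys)"
    by (rule pt_case_list[OF assms]) (intro pt_basic)+
  then show ?thesis by (rule pt_cong) (auto split: list.split)
qed

lemma pt_zip:
  fixes xs :: "'e::enc \<Rightarrow> 'b::enc list" and ys :: "'e \<Rightarrow> 'c::enc list"
  assumes xs: "pt D xs" and ys: "pt D ys"
  shows "pt D (\<lambda>e. zip (xs e) (ys e))"
proof -
  define h :: "'b \<Rightarrow> 'c list \<times> ('b \<times> 'c) list \<Rightarrow> 'c list \<times> ('b \<times> 'c) list"
    where "h x s = (case fst s of [] \<Rightarrow> s | y # w \<Rightarrow> (w, (x, y) # snd s))" for x s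
  have *: "fold h us (vs, acc) = (drop (length us) vs, rev (zip us vs) @ acc)" for us vs acc
    by (induction us arbitrary: vs acc) (auto simp: h_def split: list.split)
  have sd: "sz (drop n vs) \<le> sz vs" for n and vs :: "'c list"
    using sz_append[of "take n vs" "drop n vs"] by simp
  have szz: "sz (zip us vs) \<le> 3 * (sz us + sz vs)" for us :: "'b list" and vs :: "'c list"
  proof (induction us arbitrary: vs)
    case (Cons u us)
    show ?case
    proof (cases vs)
      case (Cons v vs')
      then show ?thesis using Cons.IH[of vs'] by simp
    qed simp
  qed simp
  have "pt D (\<lambda>e. fold h (xs e) (ys e, []))"
  proof (rule pt_fold[OF xs])
    show "pt D (\<lambda>e. (ys e, [] :: ('b \<times> 'c) list))" by (intro pt_basic ys)
    show "pbd D (\<lambda>e. 2 * sz (ys e) + 3 * (sz (xs e) + sz (ys e)) + 1)" by (intro pbd_intros pt_pbd xs ys)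
    show "sz (fold h us (ys e, [])) \<le> 2 * sz (ys e) + 3 * (sz (xs e) + sz (ys e)) + 1" if "e \<in> D" "xs e = us @ vs" for e us vs
      unfolding * using sd[of "length us" "ys e"] szz[of us "ys e"] that by simp
    show "pt {z. fst z \<in> D \<and> fst (snd z) \<in> set (xs (fst z))} (\<lambda>z. h (fst (snd z)) (snd (snd z)))"
      unfolding h_def by (rule pt_case_list) (intro pt_basic)+
  qed
  then have "pt D (\<lambda>e. rev (snd (fold h (xs e) (ys e, []))))" by (intro pt_rev pt_snd)
  then show ?thesis unfolding * by simp
qed

lemma pt_member:
  fixes x :: "'e::enc \<Rightarrow> 'b::enc"
  assumes x: "pt D x" and xs: "pt D xs"
  shows "pt D (\<lambda>e. x e \<in> set (xs e))"
proof -
  have *: "fold (\<lambda>y b. if y = u then True else b) ys k \<longleftrightarrow> k \<or> u \<in> set ys" for u :: 'b and ys k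
    by (induction ys arbitrary: k) auto
  have "pt D (\<lambda>e. fold (\<lambda>y b. if y = x e then True else b) (xs e) False)"
  proof (rule pt_fold[OF xs pt_const _ pbd_const[of _ 1]])
    have "pt UNIV (\<lambda>z. z)" by (rule pt_ident)
    have "pt {z. fst z \<in> D \<and> fst (snd z) \<in> set (xs (fst z))} (\<lambda>z. x (fst z))"
      by (rule pt_comp[OF x]) (intro pt_basic, auto)
    then show "pt {z. fst z \<in> D \<and> fst (snd z) \<in> set (xs (fst z))}
       (\<lambda>z. if fst (snd z) = x (fst z) then True else snd (snd z))"
      by (intro pt_If pt_eq pt_basic)
  qed (rule sz_bool)
  then show ?thesis unfolding * by simp
qed

lemma pt_remdups:
  fixes xs :: "'e::enc \<Rightarrow> 'b::enc list"
  assumes xs: "pt D xs"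
  shows "pt D (\<lambda>e. remdups (xs e))"
proof -
  have *: "foldr (\<lambda>x s. if x \<in> set s then s else x # s) ys [] = remdups ys" for ys :: "'b list"
    by (induction ys) auto
  have s: "sz (remdups ys) \<le> sz ys" for ys :: "'b list" by (induction ys) auto
  have "pt D (\<lambda>e. foldr (\<lambda>x s. if x \<in> set s then s else x # s) (xs e) [])"
  proof (rule pt_foldr[OF xs pt_const _ pt_pbd[OF xs]])
    show "sz (foldr (\<lambda>x s. if x \<in> set s then s else x # s) ys []) \<le> sz (xs e)" if "e \<in> D" "xs e = zs @ ys" for e ys zs
      unfolding * using s[of ys] that by simp
  qed (intro pt_If pt_member pt_basic)
  then show ?thesis unfolding * by simp
qed

lemma pt_bits: "pt D f \<Longrightarrow> pt D (\<lambda>e. bits (f e))"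
  using pt_comp[OF pt_bits0[of UNIV]] by blast

lemma pt_lift: "pt D f \<Longrightarrow> pt {z. fst z \<in> D \<and> P z} (\<lambda>z. f (fst z))"
  by (rule pt_comp[of D f]) (auto intro: pt_basic)

lemmas pt_list = pt_rev pt_append pt_concat pt_length pt_tl pt_zip pt_member pt_remdups pt_bits

section \<open>The algorithm runs in polynomial time\<close>

text \<open>A family of ring records whose operations are computable in polynomial time, with results whose
  size is bounded in terms of the parameter alone; hence intermediate results in loops cannot grow.\<close>

definition ptr :: "('w::enc \<Rightarrow> ('c::enc, 'x) ring_scheme) \<Rightarrow> bool" where
  "ptr G \<longleftrightarrow>
     pt UNIV (\<lambda>z. fst (snd z) \<oplus>\<^bsub>G (fst z)\<^esub> snd (snd z)) \<and>
     pt UNIV (\<lambda>z. fst (snd z) \<otimes>\<^bsub>G (fst z)\<^esub> snd (snd z)) \<and>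
     pt UNIV (\<lambda>w. \<zero>\<^bsub>G w\<^esub>) \<and> pt UNIV (\<lambda>w. \<one>\<^bsub>G w\<^esub>) \<and>
     (\<exists>B. pbd UNIV B \<and> (\<forall>w a b. sz (a \<oplus>\<^bsub>G w\<^esub> b) \<le> B w \<and> sz (a \<otimes>\<^bsub>G w\<^esub> b) \<le> B w))"

context
  fixes G :: "'w::enc \<Rightarrow> ('c::enc, 'x) ring_scheme"
  assumes ptr: "ptr G"
begin

text \<open>Extended to zero and one, since these are the initial values of most loops.\<close>

definition bnd :: "'w \<Rightarrow> nat" where
  "bnd = (SOME B. pbd UNIV B \<and> (\<forall>w a b. sz (a \<oplus>\<^bsub>G w\<^esub> b) \<le> B w \<and> sz (a \<otimes>\<^bsub>G w\<^esub> b) \<le> B w \<and>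
     sz \<zero>\<^bsub>G w\<^esub> \<le> B w \<and> sz \<one>\<^bsub>G w\<^esub> \<le> B w))"

lemma bnd: "pbd UNIV bnd" "sz (a \<oplus>\<^bsub>G w\<^esub> b) \<le> bnd w" "sz (a \<otimes>\<^bsub>G w\<^esub> b) \<le> bnd w"
  "sz \<zero>\<^bsub>G w\<^esub> \<le> bnd w" "sz \<one>\<^bsub>G w\<^esub> \<le> bnd w"
proof -
  obtain B where B: "pbd UNIV B" "\<And>w a b. sz (a \<oplus>\<^bsub>G w\<^esub> b) \<le> B w \<and> sz (a \<otimes>\<^bsub>G w\<^esub> b) \<le> B w"
    using ptr unfolding ptr_def by blast
  have "pt UNIV (\<lambda>w. \<zero>\<^bsub>G w\<^esub>)" "pt UNIV (\<lambda>w. \<one>\<^bsub>G w\<^esub>)" using ptr unfolding ptr_def by blast+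
  then have "pbd UNIV (\<lambda>w. B w + sz \<zero>\<^bsub>G w\<^esub> + sz \<one>\<^bsub>G w\<^esub>)" using B by (intro pbd_add pt_pbd)
  moreover have "\<forall>w a b. sz (a \<oplus>\<^bsub>G w\<^esub> b) \<le> B w + sz \<zero>\<^bsub>G w\<^esub> + sz \<one>\<^bsub>G w\<^esub> \<and>
     sz (a \<otimes>\<^bsub>G w\<^esub> b) \<le> B w + sz \<zero>\<^bsub>G w\<^esub> + sz \<one>\<^bsub>G w\<^esub> \<and>
     sz \<zero>\<^bsub>G w\<^esub> \<le> B w + sz \<zero>\<^bsub>G w\<^esub> + sz \<one>\<^bsub>G w\<^esub> \<and> sz \<one>\<^bsub>G w\<^esub> \<le> B w + sz \<zero>\<^bsub>G w\<^esub> + sz \<one>\<^bsub>G w\<^esub>"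
    using B(2) by (simp add: trans_le_add1)
  ultimately have "\<exists>B. pbd UNIV B \<and> (\<forall>w a b. sz (a \<oplus>\<^bsub>G w\<^esub> b) \<le> B w \<and> sz (a \<otimes>\<^bsub>G w\<^esub> b) \<le> B w \<and>
     sz \<zero>\<^bsub>G w\<^esub> \<le> B w \<and> sz \<one>\<^bsub>G w\<^esub> \<le> B w)" by blast
  from someI_ex[OF this] show "pbd UNIV bnd" "sz (a \<oplus>\<^bsub>G w\<^esub> b) \<le> bnd w" "sz (a \<otimes>\<^bsub>G w\<^esub> b) \<le> bnd w"
    "sz \<zero>\<^bsub>G w\<^esub> \<le> bnd w" "sz \<one>\<^bsub>G w\<^esub> \<le> bnd w" unfolding bnd_def by blast+
qed

lemma pbd_bnd: "pt D w \<Longrightarrow> pbd D (\<lambda>e. bnd (w e))"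
  using pbd_pt[OF bnd(1)] by blast

lemma pt_radd: "pt D w \<Longrightarrow> pt D a \<Longrightarrow> pt D b \<Longrightarrow> pt D (\<lambda>e. a e \<oplus>\<^bsub>G (w e)\<^esub> b e)"
  and pt_rmult: "pt D w \<Longrightarrow> pt D a \<Longrightarrow> pt D b \<Longrightarrow> pt D (\<lambda>e. a e \<otimes>\<^bsub>G (w e)\<^esub> b e)"
  using pt_comp3[of "\<lambda>w a b. a \<oplus>\<^bsub>G w\<^esub> b"] pt_comp3[of "\<lambda>w a b. a \<otimes>\<^bsub>G w\<^esub> b"] ptr unfolding ptr_def by blast+

lemma pt_rzero: "pt D w \<Longrightarrow> pt D (\<lambda>e. \<zero>\<^bsub>G (w e)\<^esub>)" and pt_rone: "pt D w \<Longrightarrow> pt D (\<lambda>e. \<one>\<^bsub>G (w e)\<^esub>)"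
  using pt_comp[of UNIV "\<lambda>w. \<zero>\<^bsub>G w\<^esub>" D w] pt_comp[of UNIV "\<lambda>w. \<one>\<^bsub>G w\<^esub>" D w] ptr unfolding ptr_def by blast+

lemmas pt_r = pt_radd pt_rmult pt_rzero pt_rone

text \<open>Typical of the loops that follow: every intermediate state is zero or the result of a
  ring operation, and so bounded by \<open>bnd\<close> whatever happened before.\<close>

lemma pt_ev: "pt D w \<Longrightarrow> pt D u \<Longrightarrow> pt D x \<Longrightarrow> pt D (\<lambda>e. ev (G (w e)) (u e) (x e))"
proof (rule pt_comp3[where F = "\<lambda>w u x. ev (G w) u x"])
  have b: "sz (ev (G w) u x) \<le> bnd w" for w u x by (cases u) (auto simp: ev_def bnd)
  show "pt UNIV (\<lambda>z. ev (G (fst z)) (fst (snd z)) (snd (snd z)))"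
    unfolding ev_def
  proof (rule pt_foldr)
    show "pbd UNIV (\<lambda>z. bnd (fst z))" by (intro pbd_bnd pt_basic)
  qed (intro pt_basic pt_r, intro pt_basic pt_r, intro pt_basic pt_r, use b in \<open>simp add: ev_def\<close>)
qed

lemma pt_smul: "pt D w \<Longrightarrow> pt D c \<Longrightarrow> pt D u \<Longrightarrow> pt D (\<lambda>e. smul (G (w e)) (c e) (u e))"
proof (rule pt_comp3[where F = "\<lambda>w c u. smul (G w) c u"])
  show "pt UNIV (\<lambda>z. smul (G (fst z)) (fst (snd z)) (snd (snd z)))"
    unfolding smul_def by (intro pt_map pt_basic pt_r)
qed

lemma pt_zeros: "pt D w \<Longrightarrow> pt D u \<Longrightarrow> pt D (\<lambda>e. zeros (G (w e)) (u e))"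
proof (rule pt_comp2[where F = "\<lambda>w u. zeros (G w) u"])
  show "pt UNIV (\<lambda>z. zeros (G (fst z)) (snd z))"
    unfolding zeros_def by (intro pt_map pt_basic pt_r)
qed

lemma pt_addl: "pt D w \<Longrightarrow> pt D u \<Longrightarrow> pt D v \<Longrightarrow> pt D (\<lambda>e. addl (G (w e)) (u e) (v e))"
proof (rule pt_comp3[where F = "\<lambda>w c u. addl (G w) c u"])
  show "pt UNIV (\<lambda>z. addl (G (fst z)) (fst (snd z)) (snd (snd z)))"
    unfolding addl_def by (intro pt_map pt_zip pt_basic pt_r)
qed

lemma addl_elem: "x \<in> set (addl (G w) u v) \<Longrightarrow> sz x \<le> bnd w"
  by (auto simp: addl_def bnd)

lemma length_addl: "length (addl R u v) = min (length u) (length v)"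
  by (simp add: addl_def)

text \<open>A coefficient of the result either stems from a multiplication or is an untouched
  coefficient of \<open>u\<close>; hence the size of \<open>u\<close> enters the bound.\<close>

lemma pt_sc: "pt D w \<Longrightarrow> pt D k \<Longrightarrow> pt D u \<Longrightarrow> pt D (\<lambda>e. sc (G (w e)) (k e) (u e))"
proof (rule pt_comp3[where F = "\<lambda>w k u. sc (G w) k u"])
  have l: "length (sc (G w) k u) = length u" for w k u by (induction u) (auto simp: sc_def smul_def)
  have b: "x \<in> set (sc (G w) k u) \<Longrightarrow> sz x \<le> bnd w \<or> x \<in> set u" for w k u x
    by (induction u) (auto simp: sc_def smul_def bnd)
  show "pt UNIV (\<lambda>z. sc (G (fst z)) (fst (snd z)) (snd (snd z)))"
    unfolding sc_def
  proof (rule pt_foldr)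
    show "pbd UNIV (\<lambda>z. length (snd (snd z)) * (2 * (bnd (fst z) + sz (snd (snd z))) + 1))"
      by (intro pbd_intros pbd_bnd pbd_length pt_pbd pt_basic)
    fix e :: "'w \<times> 'c \<times> 'c list" and ys zs
    assume e: "snd (snd e) = zs @ ys"
    have "sz (sc (G (fst e)) (fst (snd e)) ys) \<le> length (snd (snd e)) * (2 * (bnd (fst e) + sz (snd (snd e))) + 1)"
    proof (rule sz_list_bound)
      show "\<forall>x\<in>set (sc (G (fst e)) (fst (snd e)) ys). sz x \<le> bnd (fst e) + sz (snd (snd e))"
        using b[of _ "fst e" "fst (snd e)" ys] sz_elem[of _ ys] by (fastforce simp: e)
    qed (simp add: l e)
    then show "sz (foldr (\<lambda>a acc. a # smul (G (fst e)) (fst (snd e)) acc) ys []) \<le>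
      length (snd (snd e)) * (2 * (bnd (fst e) + sz (snd (snd e))) + 1)" by (simp add: sc_def)
  qed (intro pt_basic pt_smul)+
qed

lemma pt_xmul: "pt D w \<Longrightarrow> pt D h \<Longrightarrow> pt D u \<Longrightarrow> pt D (\<lambda>e. xmul (G (w e)) (h e) (u e))"
proof (rule pt_comp3[where F = "\<lambda>w k u. xmul (G w) k u"])
  show "pt UNIV (\<lambda>z. xmul (G (fst z)) (fst (snd z)) (snd (snd z)))"
    unfolding xmul_def by (rule pt_case_list) (intro pt_list pt_basic pt_smul pt_addl pt_r)+
qed

lemma length_mulm: "length (mulm R h u v) \<le> length h"
proof (induction u)
  case (Cons c u)
  have "length (xmul R h acc) \<le> length h" for acc
    by (auto simp: xmul_def length_addl smul_def split: list.split)
  then show ?case by (simp add: mulm_def length_addl min.coboundedI2)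
qed (simp add: mulm_def zeros_def)

lemma mulm_elem: "x \<in> set (mulm (G w) h u v) \<Longrightarrow> sz x \<le> bnd w"
  by (cases u) (auto simp: mulm_def zeros_def bnd dest: addl_elem)

lemma sz_mulm: "sz (mulm (G w) h u v) \<le> length h * (2 * bnd w + 1)"
  by (rule sz_list_bound) (auto intro: mulm_elem length_mulm)

lemma pt_mulm:
  assumes "pt D w" "pt D h" "pt D u" "pt D v"
  shows "pt D (\<lambda>e. mulm (G (w e)) (h e) (u e) (v e))"
proof -
  have "pt UNIV (\<lambda>z. mulm (G (fst z)) (fst (snd z)) (fst (snd (snd z))) (snd (snd (snd z))))"
    unfolding mulm_def
  proof (rule pt_foldr)
    show "pbd UNIV (\<lambda>z. length (fst (snd z)) * (2 * bnd (fst z) + 1))"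
      by (intro pbd_intros pbd_bnd pbd_length pt_pbd pt_basic)
    fix e :: "'w \<times> 'c list \<times> 'c list \<times> 'c list" and ys
    show "sz (foldr (\<lambda>c acc. addl (G (fst e)) (smul (G (fst e)) c (snd (snd (snd e)))) (xmul (G (fst e)) (fst (snd e)) acc)) ys
          (zeros (G (fst e)) (fst (snd e)))) \<le> length (fst (snd e)) * (2 * bnd (fst e) + 1)"
      using sz_mulm unfolding mulm_def .
  qed (intro pt_basic pt_smul pt_addl pt_zeros pt_xmul)+
  from pt_comp[OF this, of D "\<lambda>e. (w e, h e, u e, v e)"] show ?thesis using assms by (simp add: pt_Pair)
qed

lemma pt_onel: "pt D w \<Longrightarrow> pt D h \<Longrightarrow> pt D (\<lambda>e. onel (G (w e)) (h e))"
proof (rule pt_comp2[where F = "\<lambda>w u. onel (G w) u"])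
  show "pt UNIV (\<lambda>z. onel (G (fst z)) (snd z))"
    unfolding onel_def by (rule pt_case_list) (intro pt_basic pt_zeros pt_r)+
qed

text \<open>Makes towers possible: applied to \<open>resring\<close> it yields the field with
  \<open>q\<close> elements, and applied once more the algebra in which roots are extracted.\<close>

lemma ptr_ext: "ptr (\<lambda>w. ext (G (fst w)) (snd w))"
proof -
  have "pbd UNIV (\<lambda>w::'w \<times> 'c list. length (snd w) * (2 * bnd (fst w) + 1))"
    by (intro pbd_intros pbd_bnd pbd_length pt_basic)
  moreover have "sz (map snd (zip h (addl (G w) u v))) \<le> length h * (2 * bnd w + 1)" for w u v and h :: "'c list"
    by (rule sz_list_bound) (auto dest!: set_zip_rightD intro: addl_elem)
  ultimately have "\<exists>B. pbd UNIV B \<and> (\<forall>w a b. sz (a \<oplus>\<^bsub>ext (G (fst w)) (snd w)\<^esub> b) \<le> B w \<and>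
      sz (a \<otimes>\<^bsub>ext (G (fst w)) (snd w)\<^esub> b) \<le> B w)"
    using sz_mulm by (auto simp: ext_def intro!: exI[of _ "\<lambda>w. length (snd w) * (2 * bnd (fst w) + 1)"])
  moreover have "pt UNIV (\<lambda>z. map snd (zip (snd (fst z)) (addl (G (fst (fst z))) (fst (snd z)) (snd (snd z)))))"
    by (intro pt_map pt_zip pt_basic pt_addl)
  moreover have "pt UNIV (\<lambda>z. mulm (G (fst (fst z))) (snd (fst z)) (fst (snd z)) (snd (snd z)))"
    by (intro pt_basic pt_mulm)
  moreover have "pt UNIV (\<lambda>w. zeros (G (fst w)) (snd w))" "pt UNIV (\<lambda>w. onel (G (fst w)) (snd w))"
    by (intro pt_zeros pt_onel pt_basic)+
  ultimately show ?thesis unfolding ptr_def by (simp add: ext_def)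
qed

lemma pt_pw: "pt D w \<Longrightarrow> pt D a \<Longrightarrow> pt D n \<Longrightarrow> pt D (\<lambda>e. pw (G (w e)) (a e) (n e))"
proof (rule pt_comp3[where F = "\<lambda>w k u. pw (G w) k u"])
  have b: "sz (fold (\<lambda>b s. if b = 1 then (s \<otimes>\<^bsub>G w\<^esub> s) \<otimes>\<^bsub>G w\<^esub> a else s \<otimes>\<^bsub>G w\<^esub> s) bs \<one>\<^bsub>G w\<^esub>) \<le> bnd w"
    for w a and bs :: "nat list" by (cases bs rule: rev_cases) (auto simp: bnd)
  show "pt UNIV (\<lambda>z. pw (G (fst z)) (fst (snd z)) (snd (snd z)))"
    unfolding pw_def
  proof (rule pt_fold)
    show "pbd UNIV (\<lambda>z. bnd (fst z))" by (intro pbd_bnd pt_basic)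
  qed (intro pt_list pt_basic pt_r, intro pt_basic pt_r, intro pt_If pt_eq pt_basic pt_r, rule b)
qed

lemma length_mulL: "length (mulL R u v) \<le> length u + length v"
proof (induction u)
  case (Cons c u)
  then show ?case by (simp add: mulL_def length_addl zeros_def smul_def min.coboundedI2)
qed (simp add: mulL_def zeros_def)

lemma mulL_elem: "x \<in> set (mulL (G w) u v) \<Longrightarrow> sz x \<le> bnd w"
  by (cases u) (auto simp: mulL_def zeros_def bnd dest: addl_elem)

lemma pt_mulL: "pt D w \<Longrightarrow> pt D u \<Longrightarrow> pt D v \<Longrightarrow> pt D (\<lambda>e. mulL (G (w e)) (u e) (v e))"
proof (rule pt_comp3[where F = "\<lambda>w k u. mulL (G w) k u"])
  show "pt UNIV (\<lambda>z. mulL (G (fst z)) (fst (snd z)) (snd (snd z)))"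
    unfolding mulL_def
  proof (rule pt_foldr)
    show "pbd UNIV (\<lambda>z. (length (fst (snd z)) + length (snd (snd z))) * (2 * bnd (fst z) + 1))"
      by (intro pbd_intros pbd_bnd pbd_length pt_pbd pt_basic)
    fix e :: "'w \<times> 'c list \<times> 'c list" and ys zs
    assume e: "fst (snd e) = zs @ ys"
    have "sz (mulL (G (fst e)) ys (snd (snd e))) \<le> (length (fst (snd e)) + length (snd (snd e))) * (2 * bnd (fst e) + 1)"
      by (rule sz_list_bound) (use mulL_elem length_mulL[of "G (fst e)" ys "snd (snd e)"] in \<open>auto simp: e\<close>)
    then show "sz (foldr (\<lambda>c acc. addl (G (fst e)) (smul (G (fst e)) c (snd (snd e)) @ zeros (G (fst e)) acc)
          (\<zero>\<^bsub>G (fst e)\<^esub> # acc)) ys (zeros (G (fst e)) (tl (snd (snd e))))) \<le>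
      (length (fst (snd e)) + length (snd (snd e))) * (2 * bnd (fst e) + 1)" by (simp add: mulL_def)
  qed (intro pt_basic pt_smul pt_addl pt_zeros pt_list pt_r)+
qed

lemma length_sc: "length (sc R k u) = length u"
  by (induction u) (auto simp: sc_def smul_def)

lemma length_graeffe_prod: "length (graeffe_prod R rs \<zeta> f) \<le> 1 + length rs * length f"
proof (induction rs)
  case (Cons k rs)
  then show ?case using length_mulL[of R "sc R (pw R \<zeta> k) f" "graeffe_prod R rs \<zeta> f"]
    by (simp add: graeffe_prod_def length_sc)
qed (simp add: graeffe_prod_def)

lemma graeffe_prod_elem: "x \<in> set (graeffe_prod (G w) rs \<zeta> f) \<Longrightarrow> sz x \<le> bnd w"
  by (cases rs) (auto simp: graeffe_prod_def bnd dest: mulL_elem)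

lemma pt_every:
  assumes "pt D n" "pt D u"
  shows "pt D (\<lambda>e. every (n e) (u e :: 'c list))"
proof (rule pt_comp2[where F = every, OF _ assms])
  define st where "st r = (\<lambda>(a::'c) s. if fst s = 0 then (r - 1, a # snd s) else (fst s - 1, snd s))" for r :: nat
  have st: "fst (fold (st r) ys (0, [])) \<le> r \<and> sz (snd (fold (st r) ys (0, []))) \<le> sz ys" for r ys
    by (induction ys rule: rev_induct) (auto simp: st_def)
  have "pt UNIV (\<lambda>z. fold (st (fst z)) (snd z) (0, []))"
  proof (rule pt_fold)
    show "pbd UNIV (\<lambda>z. 2 * sz (fst z) + sz (snd z) + 1)" by (intro pbd_intros pt_pbd pt_basic)
    show "pt {z. fst z \<in> UNIV \<and> fst (snd z) \<in> set (snd (fst z))} (\<lambda>z. st (fst (fst z)) (fst (snd z)) (snd (snd z)))"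
      unfolding st_def by (intro pt_basic pt_If pt_eq pt_nat_ops)
    show "sz (fold (st (fst e)) ys (0, [])) \<le> 2 * sz (fst e) + sz (snd e) + 1" if "snd e = ys @ zs" for e :: "nat \<times> 'c list" and ys zs
      using st[of "fst e" ys] bl_mono[of "fst (fold (st (fst e)) ys (0, []))" "fst e"] that
      by (cases "fold (st (fst e)) ys (0, [])") auto
  qed (intro pt_basic)+
  then have "pt UNIV (\<lambda>z. rev (snd (fold (st (fst z)) (snd z) (0, []))))" by (intro pt_rev pt_snd)
  then show "pt UNIV (\<lambda>z. every (fst z) (snd z) :: 'c list)" unfolding every_def st_def .
qed

lemma pt_graeffe:
  assumes "pt D w" "pt D rs" "pt D z" "pt D f"
  shows "pt D (\<lambda>e. graeffe (G (w e)) (rs e) (z e) (f e))"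
proof -
  have "pt UNIV (\<lambda>z. graeffe_prod (G (fst z)) (fst (snd z)) (fst (snd (snd z))) (snd (snd (snd z))))"
    unfolding graeffe_prod_def
  proof (rule pt_foldr)
    show "pbd UNIV (\<lambda>z. (1 + length (fst (snd z)) * length (snd (snd (snd z)))) * (2 * bnd (fst z) + 1))"
      by (intro pbd_intros pbd_bnd pbd_length pt_pbd pt_basic)
    fix e :: "'w \<times> nat list \<times> 'c \<times> 'c list" and ys zs
    assume e: "fst (snd e) = zs @ ys"
    have "sz (graeffe_prod (G (fst e)) ys (fst (snd (snd e))) (snd (snd (snd e)))) \<le> (1 + length (fst (snd e)) * length (snd (snd (snd e)))) * (2 * bnd (fst e) + 1)"
    proof (rule sz_list_bound)
      have "length (graeffe_prod (G (fst e)) ys (fst (snd (snd e))) (snd (snd (snd e)))) \<le> 1 + length ys * length (snd (snd (snd e)))"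
        by (rule length_graeffe_prod)
      then show "length (graeffe_prod (G (fst e)) ys (fst (snd (snd e))) (snd (snd (snd e)))) \<le> 1 + length (fst (snd e)) * length (snd (snd (snd e)))"
        unfolding e by (simp add: algebra_simps)
    qed (use graeffe_prod_elem in blast)
    then show "sz (foldr (\<lambda>k acc. mulL (G (fst e)) (sc (G (fst e)) (pw (G (fst e)) (fst (snd (snd e))) k) (snd (snd (snd e)))) acc) ys
          [\<one>\<^bsub>G (fst e)\<^esub>]) \<le> (1 + length (fst (snd e)) * length (snd (snd (snd e)))) * (2 * bnd (fst e) + 1)"
      by (simp add: graeffe_prod_def)
  qed (intro pt_basic pt_mulL pt_sc pt_pw pt_r)+
  from pt_comp[OF this, of D "\<lambda>e. (w e, rs e, z e, f e)"]
  have "pt D (\<lambda>e. graeffe_prod (G (w e)) (rs e) (z e) (f e))" using assms by (simp add: pt_Pair)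
  then have "pt D (\<lambda>e. zip (f e) (every (length (rs e)) (graeffe_prod (G (w e)) (rs e) (z e) (f e))))"
    by (intro pt_zip pt_every pt_length assms)
  then show ?thesis unfolding graeffe_def by (rule pt_map) (intro pt_basic)
qed

lemmas pt_gen = pt_basic pt_list pt_r pt_mulm pt_sc pt_smul pt_addl pt_zeros pt_onel pt_pw pt_ev pt_nat_ops

lemma pt_modl: "pt D w \<Longrightarrow> pt D c \<Longrightarrow> pt D rs \<Longrightarrow> pt D (\<lambda>e. modl (G (w e)) (c e) (rs e))"
  unfolding modl_def by (intro pt_gen)

lemma pt_linl: "pt D w \<Longrightarrow> pt D c \<Longrightarrow> pt D rs \<Longrightarrow> pt D (\<lambda>e. linl (G (w e)) (c e) (rs e))"
  unfolding linl_def by (intro pt_gen)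

lemma pt_rels1: "pt D w \<Longrightarrow> pt D m \<Longrightarrow> pt D U \<Longrightarrow> pt D z \<Longrightarrow> pt D v \<Longrightarrow>
  pt D (\<lambda>e. rels1 (G (w e)) (m e) (U e) (z e) (v e))"
  unfolding rels1_def by (rule pt_map) (assumption | intro pt_gen pt_lift)+

lemma pt_rels2: "pt D w \<Longrightarrow> pt D m \<Longrightarrow> pt D rs \<Longrightarrow> pt D z \<Longrightarrow> pt D h \<Longrightarrow> pt D v \<Longrightarrow>
  pt D (\<lambda>e. rels2 (G (w e)) (m e) (rs e) (z e) (h e) (v e))"
  unfolding rels2_def by (rule pt_map) (assumption | intro pt_gen pt_lift)+

lemma pt_normp:
  assumes "pt D w" "pt D rs" "pt D z" "pt D h" "pt D \<theta>"
  shows "pt D (\<lambda>e. normp (G (w e)) (rs e) (z e) (h e) (\<theta> e))"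
proof -
  have "pt D (\<lambda>e. foldr (\<lambda>k acc. mulm (G (w e)) (h e) (sc (G (w e)) (pw (G (w e)) (z e) k) (\<theta> e)) acc) (rs e) (onel (G (w e)) (h e)))"
  proof (rule pt_foldr)
    show "pbd D (\<lambda>e. length (h e) * (2 * bnd (w e) + 1) + sz (onel (G (w e)) (h e)))"
      by (intro pbd_intros pbd_bnd pbd_length pt_pbd assms pt_gen)
    fix e ys
    show "sz (foldr (\<lambda>k acc. mulm (G (w e)) (h e) (sc (G (w e)) (pw (G (w e)) (z e) k) (\<theta> e)) acc) ys
       (onel (G (w e)) (h e))) \<le> length (h e) * (2 * bnd (w e) + 1) + sz (onel (G (w e)) (h e))"
    proof (cases ys)
      case (Cons y ys')
      show ?thesis unfolding Cons foldr.simps o_apply by (rule trans_le_add1[OF sz_mulm])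
    qed simp
  qed (intro assms, intro pt_gen assms, intro pt_gen pt_lift assms)
  then show ?thesis unfolding normp_def by (rule pt_case_list) (intro pt_gen assms)+
qed

lemma pt_cands: "pt D w \<Longrightarrow> pt D rs \<Longrightarrow> pt D z \<Longrightarrow> pt D ci \<Longrightarrow> pt D x \<Longrightarrow>
  pt D (\<lambda>e. cands (G (w e)) (rs e) (z e) (ci e) (x e))"
proof -
  assume "pt D w" "pt D rs" "pt D z" "pt D ci" "pt D x"
  moreover have "pt UNIV (\<lambda>e. cands (G (fst e)) (fst (snd e)) (fst (snd (snd e))) (fst (snd (snd (snd e)))) (snd (snd (snd (snd e)))))"
    unfolding cands_def by (intro pt_gen pt_map)
  from pt_comp[OF this, of D "\<lambda>e. (w e, rs e, z e, ci e, x e)"] calculation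
  show ?thesis by (simp add: pt_Pair)
qed

lemma cands_elem: "y \<in> set (cands (G w) rs z ci x) \<Longrightarrow> sz y \<le> bnd w"
  by (auto simp: cands_def bnd)

end

context
  fixes G :: "'w::enc \<Rightarrow> ('c::enc, 'x) ring_scheme"
  assumes ptr: "ptr G"
begin

lemmas pt_gen' = pt_basic pt_list pt_nat_ops pt_r[OF ptr] pt_mulm[OF ptr] pt_sc[OF ptr] pt_smul[OF ptr] pt_addl[OF ptr]
  pt_zeros[OF ptr] pt_onel[OF ptr] pt_pw[OF ptr] pt_ev[OF ptr] pt_modl[OF ptr] pt_linl[OF ptr] pt_rels1[OF ptr]
  pt_rels2[OF ptr] pt_normp[OF ptr] pt_cands[OF ptr] pt_graeffe[OF ptr]

lemma pt_pw_ext: "pt D w \<Longrightarrow> pt D h \<Longrightarrow> pt D a \<Longrightarrow> pt D n \<Longrightarrow> pt D (\<lambda>e. pw (ext (G (w e)) (h e)) (a e) (n e))"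
  using pt_pw[OF ptr_ext[OF ptr], of D "\<lambda>e. (w e, h e)" a n] by (simp add: pt_Pair)

lemma pt_sel: "pt D w \<Longrightarrow> pt D m \<Longrightarrow> pt D q \<Longrightarrow> pt D rs \<Longrightarrow> pt D h \<Longrightarrow> pt D x \<Longrightarrow>
  pt D (\<lambda>e. sel (G (w e)) (m e) (q e) (rs e) (h e) (x e))"
  unfolding sel_def Let_def by (intro pt_gen' pt_pw_ext)

lemma pt_rootc:
  assumes "pt D w" "pt D m" "pt D q" "pt D U" "pt D Ms" "pt D rs" "pt D z" "pt D c"
  shows "pt D (\<lambda>e. rootc (G (w e)) (m e) (q e) (U e) (Ms e) (rs e) (z e) (c e))"
proof -
  have "pt UNIV (\<lambda>(w, m, q, U, Ms, rs, z, c). rootc (G w) m q U Ms rs z c)"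
    unfolding rootc_def Let_def case_prod_unfold by (intro pt_gen' pt_map pt_pw_ext pt_sel)
  from pt_comp[OF this, of D "\<lambda>e. (w e, m e, q e, U e, Ms e, rs e, z e, c e)"] assms
  show ?thesis by (simp add: pt_Pair)
qed

lemma rootc_elem: "y \<in> set (rootc (G w) m q U Ms rs z c) \<Longrightarrow> sz y \<le> bnd G w"
  by (auto simp: rootc_def Let_def bnd[OF ptr] dest: cands_elem[OF ptr])

lemma pt_zet: "pt D w \<Longrightarrow> pt D l \<Longrightarrow> pt D (\<lambda>e. zet (G (w e)) (l e))"
proof (rule pt_comp2[where F = "\<lambda>w l. zet (G w) l"])
  show "pt UNIV (\<lambda>z. zet (G (fst z)) (snd z))" unfolding zet_def by (intro pt_gen' pt_If pt_eq)
qed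

lemma pt_unity1: "pt D w \<Longrightarrow> pt D l \<Longrightarrow> pt D (\<lambda>e. unity1 (G (w e)) (l e))"
proof (rule pt_comp2[where F = "\<lambda>w l. unity1 (G w) l"])
  show "pt UNIV (\<lambda>z. unity1 (G (fst z)) (snd z))" unfolding unity1_def by (intro pt_gen' pt_map)
qed

lemma pt_unity2: "pt D w \<Longrightarrow> pt D l \<Longrightarrow> pt D (\<lambda>e. unity2 (G (w e)) (l e))"
proof (rule pt_comp2[where F = "\<lambda>w l. unity2 (G w) l"])
  show "pt UNIV (\<lambda>z. unity2 (G (fst z)) (snd z))" unfolding unity2_def by (intro pt_gen' pt_map pt_unity1)
qed

lemma graeffe_size: "length (graeffe R rs z f) \<le> length f" "x \<in> set (graeffe (G w) rs z f) \<Longrightarrow> sz x \<le> bnd G w"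
proof -
  have "snd (fold (\<lambda>a s. if fst s = 0 then (r - 1, a # snd s) else (fst s - 1, snd s)) u s) = ys \<Longrightarrow>
     set ys \<subseteq> set u \<union> set (snd s)" for r :: nat and u ys :: "'c list" and s
    by (induction u arbitrary: s) (auto split: if_splits, fastforce+)
  then have "set (every r u) \<subseteq> set u" for r and u :: "'c list" unfolding every_def by fastforce
  then show "x \<in> set (graeffe (G w) rs z f) \<Longrightarrow> sz x \<le> bnd G w"
    using graeffe_prod_elem[OF ptr] by (fastforce simp: graeffe_def dest!: set_zip_rightD)
qed (simp add: graeffe_def)

lemma pt_forward: "pt D w \<Longrightarrow> pt D ls \<Longrightarrow> pt D f \<Longrightarrow> pt D (\<lambda>e. forward (G (w e)) (ls e) (f e))"
proof (rule pt_comp3[where F = "\<lambda>w l f. forward (G w) l f"])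
  define N :: "'w \<times> 'c link list \<times> 'c list \<Rightarrow> nat" where
    "N z = length (snd (snd z)) * (2 * (bnd G (fst z) + sz (snd (snd z))) + 1)" for z
  have N: "pbd UNIV N" unfolding N_def by (intro pbd_intros pbd_bnd[OF ptr] pbd_length pt_pbd pt_basic)
  \<comment> \<open>The lengths never exceed that of \<open>f\<close> owing to the cut in
    \<open>graeffe\<close>; the coefficients are results of ring operations, except for those of
    \<open>f\<close> itself.\<close>
  have inv: "length (fst (forward (G w) ys f)) \<le> length f \<and>
     (\<forall>x\<in>set (fst (forward (G w) ys f)). sz x \<le> bnd G w + sz f) \<and> length (snd (forward (G w) ys f)) = length ys \<and>
     (\<forall>(l, g)\<in>set (snd (forward (G w) ys f)). l \<in> set ys \<and> length g \<le> length f \<and> (\<forall>x\<in>set g. sz x \<le> bnd G w + sz f))"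
    for w ys f
  proof (induction ys rule: rev_induct)
    case Nil
    show ?case using sz_concat_elem[of _ f] by (auto simp: forward_def intro: trans_le_add2)
  next
    case (snoc l ys)
    define s where "s = forward (G w) ys f"
    have *: "forward (G w) (ys @ [l]) f = (graeffe (G w) (fst (snd l)) (zet (G w) l) (fst s), (l, fst s) # snd s)"
      by (simp add: forward_def s_def)
    show ?case using snoc graeffe_size(1)[of "G w" "fst (snd l)" "zet (G w) l" "fst s"]
       graeffe_size(2)[of _ w "fst (snd l)" "zet (G w) l" "fst s"]
      unfolding * s_def[symmetric] by (auto intro: trans_le_add1)
  qed
  show "pt UNIV (\<lambda>z. forward (G (fst z)) (fst (snd z)) (snd (snd z)))"
    unfolding forward_def
  proof (rule pt_fold)
    show "pbd UNIV (\<lambda>z. 2 * N z + length (fst (snd z)) * (2 * (2 * sz (fst (snd z)) + N z + 1) + 1) + 1)"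
      by (intro pbd_intros N pbd_length pt_pbd pt_basic)
    fix e :: "'w \<times> 'c link list \<times> 'c list" and ys zs assume e: "fst (snd e) = ys @ zs"
    define s where "s = forward (G (fst e)) ys (snd (snd e))"
    note i = inv[where w = "fst e" and ys = ys and f = "snd (snd e)", folded s_def]
    have "sz (fst s) \<le> N e" unfolding N_def by (rule sz_list_bound) (use i in auto)
    moreover have "sz (snd s) \<le> length (fst (snd e)) * (2 * (2 * sz (fst (snd e)) + N e + 1) + 1)"
    proof (rule sz_list_bound)
      show "\<forall>x\<in>set (snd s). sz x \<le> 2 * sz (fst (snd e)) + N e + 1"
      proof
        fix x assume x: "x \<in> set (snd s)"
        have "sz (snd x) \<le> N e" unfolding N_def by (rule sz_list_bound) (use i x in fastforce)+
        moreover have "sz (fst x) \<le> sz (fst (snd e))" using i x sz_concat_elem[of "fst x" "fst (snd e)"] e by fastforce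
        ultimately show "sz x \<le> 2 * sz (fst (snd e)) + N e + 1" by (cases x) simp
      qed
    qed (use i e in simp)
    ultimately have "sz s \<le> 2 * N e + length (fst (snd e)) * (2 * (2 * sz (fst (snd e)) + N e + 1) + 1) + 1"
      by (cases s) simp
    then show "sz (fold (\<lambda>l s. (graeffe (G (fst e)) (fst (snd l)) (zet (G (fst e)) l) (fst s), (l, fst s) # snd s)) ys
        (snd (snd e), [])) \<le> 2 * N e + length (fst (snd e)) * (2 * (2 * sz (fst (snd e)) + N e + 1) + 1) + 1"
      by (simp add: s_def forward_def)
  qed (intro pt_gen' pt_zet)+
qed

lemma pt_solve:
  assumes "pt D w" "pt D m" "pt D q" "pt D ls" "pt D f"
  shows "pt D (\<lambda>e. solve (G (w e)) (m e) (q e) (ls e) (f e))"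
proof -
  let ?back = "\<lambda>w m q ls. backstep (G w) m q (unity2 (G w) ls) (map fst ls)"
  have "pt UNIV (\<lambda>(w, m, q, ls, f). fold (?back w m q ls) (snd (forward (G w) ls f)) [\<one>\<^bsub>G w\<^esub>])"
    unfolding case_prod_unfold
  proof (rule pt_fold)
    show f: "pt UNIV (\<lambda>e. snd (forward (G (fst e)) (fst (snd (snd (snd e)))) (snd (snd (snd (snd e))))))"
      by (intro pt_basic pt_forward)
    let ?F = "\<lambda>e. (1 + sz (snd (forward (G (fst e)) (fst (snd (snd (snd e)))) (snd (snd (snd (snd e))))))) * (2 * bnd G (fst e) + 1)"
    show "pbd UNIV ?F" by (intro pbd_intros pbd_bnd[OF ptr] pt_pbd f pt_basic)
    fix e :: "'w \<times> 'c \<times> nat \<times> 'c link list \<times> 'c list" and ys zs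
    assume e: "snd (forward (G (fst e)) (fst (snd (snd (snd e)))) (snd (snd (snd (snd e))))) = ys @ zs"
    show "sz (fold (?back (fst e) (fst (snd e)) (fst (snd (snd e))) (fst (snd (snd (snd e))))) ys [\<one>\<^bsub>G (fst e)\<^esub>]) \<le> ?F e"
    proof (cases ys rule: rev_cases)
      case Nil
      then show ?thesis using bnd(5)[OF ptr, of "fst e"] by simp
    next
      \<comment> \<open>Only the last step matters: its cut bounds the number of candidates by the
        length of the polynomial in \<open>lg\<close>, and each candidate is the result of a
        multiplication.\<close>
      case (snoc ys' lg)
      have "2 * sz lg + 1 \<le> sz (ys @ zs)" by (rule sz_elem) (simp add: snoc)
      then have "length (snd lg) \<le> sz (ys @ zs)" using length_le_sz[of "snd lg"] by (cases lg) simp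
      moreover have "y \<in> set (backstep (G w) m q U Ms lg C) \<Longrightarrow> sz y \<le> bnd G w" for y w m q U Ms C
        by (auto simp: backstep_def dest!: set_zip_rightD rootc_elem)
      moreover have "length (backstep (G w) m q U Ms lg C) \<le> length (snd lg)" for w m q U Ms C
        by (simp add: backstep_def)
      ultimately have "sz (backstep (G (fst e)) m q U Ms lg C) \<le> (1 + sz (ys @ zs)) * (2 * bnd G (fst e) + 1)" for m q U Ms C
        by (intro sz_list_bound ballI) (blast, meson order_trans trans_le_add2)
      then show ?thesis unfolding e unfolding snoc by (simp del: sz_append)
    qed
  qed (unfold backstep_def, (intro pt_gen' pt_map pt_filter pt_eq pt_rootc pt_zet pt_unity2)+)
  from pt_comp[OF this, of D "\<lambda>e. (w e, m e, q e, ls e, f e)"] assms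
  have "pt D (\<lambda>e. fold (?back (w e) (m e) (q e) (ls e)) (snd (forward (G (w e)) (ls e) (f e))) [\<one>\<^bsub>G (w e)\<^esub>])"
    by (simp add: pt_Pair)
  then show ?thesis unfolding solve_def
    by (intro pt_gen' pt_filter pt_eq pt_lift assms)
qed

end

section \<open>Stacks, subroutines and complete programs\<close>

text \<open>Loops test registers for being nonzero, so emptiness of the stack is negated into
  \<open>b + 1\<close>. The code of the list is built while popping and therefore comes out
  reversed.\<close>

definition pop_all :: "nat \<Rightarrow> nat \<Rightarrow> nat \<Rightarrow> program" where
  "pop_all s z b = Seq (block [Load z 0, Load (b+2) 1]) (Seq (Empty (b+1) s) (Seq (block [Op OpSub (b+1) (b+2) (b+1)])
     (WhileNZ (b+1) (Seq (Pop b s) (Seq (cons_prog b z z (b+3)) (Seq (Empty (b+1) s) (block [Op OpSub (b+1) (b+2) (b+1)])))))))"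

definition pop_time :: "nat \<Rightarrow> nat" where
  "pop_time V = 3 + (1 + (3 + (V * (1 + (V + 1 + (cell_time V + (1 + 3)))) + 1)))"

lemma cell_time_mono: "m \<le> n \<Longrightarrow> cell_time m \<le> cell_time n"
  unfolding cell_time_def by (intro mult_le_mono power_mono) auto

lemma pop_time_mono: "m \<le> n \<Longrightarrow> pop_time m \<le> pop_time n"
  unfolding pop_time_def by (intro add_mono mult_le_mono cell_time_mono order_refl)

lemma run_Empty: "Q (R(x := (if S s = [] then 1 else 0)), S) \<Longrightarrow> run (Empty x s) (R, S) 1 Q"
  unfolding run_def using exec.Empty by blast

lemma run_Pop: "S s = a # as \<Longrightarrow> Q (R(x := a), S(s := as)) \<Longrightarrow> run (Pop x s) (R, S) (bit_size a) Q"
  unfolding run_def using exec.Pop_Cons by blast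

lemma run_Push: "Q (R, S(s := R x # S s)) \<Longrightarrow> run (Push s x) (R, S) (bit_size (R x)) Q"
  unfolding run_def using exec.Push by blast

lemma run_pop_all:
  assumes "z < b"
  shows "run (pop_all s z b) (R, S) (pop_time (sz (S s))) (post z b R (S(s := [])) (enc (rev (S s))))"
proof -
  define V where "V = sz (S s)"
  define e where "e n = (if n = 0 then 0 else 1 :: nat)" for n :: nat
  define I :: "nat \<Rightarrow> state \<Rightarrow> bool" where "I = (\<lambda>n (R', S'). \<exists>ys zs. S s = ys @ zs \<and> length zs = n \<and> S' = S(s := zs) \<and>
    R' z = enc (rev ys) \<and> R' (b+1) = e n \<and> R' (b+2) = 1 \<and> (\<forall>i<b. i \<noteq> z \<longrightarrow> R' i = R i))"
  let ?sub = "block [Op OpSub (b+1) (b+2) (b+1)]"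
  have sub: "run ?sub (R1, S1) 3 Q"
    if "R1 (b+2) = 1" "R1 (b+1) \<le> 1" "Q (R1(b+1 := 1 - R1 (b+1)), S1)" for R1 S1 Q
  proof (rule run_block)
    have "R1 (b+1) = 0 \<or> R1 (b+1) = 1" using that(2) by auto
    then show "block_cost [Op OpSub (b+1) (b+2) (b+1)] R1 \<le> 3" using that(1) by (auto simp: bit_size_def)
  qed (use that in simp_all)
  let ?body = "Seq (Pop b s) (Seq (cons_prog b z z (b+3)) (Seq (Empty (b+1) s) ?sub))"
  have w: "run (WhileNZ (b+1) ?body) \<sigma> (length (S s) * (1 + (V + 1 + (cell_time V + (1 + 3)))) + 1) (I 0)" if "I (length (S s)) \<sigma>" for \<sigma>
    using that
  proof (rule run_WhileNZ[where I = I, rotated 2])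
    fix n R1 S1 assume "I (Suc n) (R1, S1)"
    then obtain ys zs where I: "S s = ys @ zs" "length zs = Suc n" "S1 = S(s := zs)"
      "R1 z = enc (rev ys)" "R1 (b+1) = 1" "R1 (b+2) = 1" "\<And>i. i < b \<Longrightarrow> i \<noteq> z \<Longrightarrow> R1 i = R i"
      by (auto simp: I_def e_def)
    obtain a zs' where zs: "zs = a # zs'" using I(2) by (cases zs) auto
    have V: "V = sz ys + sz zs" using I(1) by (simp add: V_def)
    have aV: "bl a \<le> V" "sz (rev ys) \<le> V" using V zs by simp_all
    have "run ?body (R1, S1) (bit_size a + (cell_time V + (1 + 3))) (I n)"
    proof (rule run_Seq[OF run_Pop])
      show "S1 s = a # zs'" by (simp add: I zs)
      show "(\<lambda>\<sigma>. \<sigma> = (R1(b := a), S(s := zs'))) (R1(b := a), S1(s := zs'))" using I(3) by simp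
      fix \<sigma>1 assume s1: "\<sigma>1 = (R1(b := a), S(s := zs'))"
      show "run (Seq (cons_prog b z z (b+3)) (Seq (Empty (b+1) s) ?sub)) \<sigma>1 (cell_time V + (1 + 3)) (I n)"
        unfolding s1
      proof (rule run_Seq)
        show "run (cons_prog b z z (b+3)) (R1(b := a), S(s := zs')) (cell_time V)
          (\<lambda>(R', S'). S' = S(s := zs') \<and> R' z = consn ((R1(b := a)) b) ((R1(b := a)) z) \<and> (\<forall>i<b+3. i \<noteq> z \<longrightarrow> R' i = (R1(b := a)) i))"
          by (rule run_cons) (use assms aV I(4) in \<open>auto simp: sz_def\<close>)
        fix \<sigma>2 :: state assume "case \<sigma>2 of (R', S') \<Rightarrow> S' = S(s := zs') \<and> R' z = consn ((R1(b := a)) b) ((R1(b := a)) z) \<and> (\<forall>i<b+3. i \<noteq> z \<longrightarrow> R' i = (R1(b := a)) i)"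
        then obtain R2 where R2: "\<sigma>2 = (R2, S(s := zs'))" "R2 z = consn a (R1 z)"
          "\<And>i. i < b + 3 \<Longrightarrow> i \<noteq> z \<Longrightarrow> R2 i = (R1(b := a)) i"
          using assms by (cases \<sigma>2) auto
        show "run (Seq (Empty (b+1) s) ?sub) \<sigma>2 (1 + 3) (I n)" unfolding R2(1)
        proof (rule run_Seq[OF run_Empty])
          show "(\<lambda>\<sigma>. \<sigma> = (R2(b+1 := (if zs' = [] then 1 else 0)), S(s := zs')))
            (R2(b+1 := (if (S(s := zs')) s = [] then 1 else 0)), S(s := zs'))" by simp
          fix \<sigma>3 assume s3: "\<sigma>3 = (R2(b+1 := (if zs' = [] then 1 else 0)), S(s := zs'))"
          have b2: "R2 (b+2) = 1" using R2(3)[of "b+2"] I(6) assms by simp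
          have z2: "R2 z = enc (rev (ys @ [a]))" using R2(2) I(4) by simp
          have n: "length zs' = n" using I(2) zs by simp
          have fr: "i < b \<Longrightarrow> i \<noteq> z \<Longrightarrow> R2 i = R i" for i using R2(3)[of i] I(7)[of i] by simp
          show "run ?sub \<sigma>3 3 (I n)" unfolding s3
          proof (rule sub)
            have "S s = (ys @ [a]) @ zs'" using I(1) zs by simp
            then show "I n ((R2(b+1 := (if zs' = [] then 1 else 0)))(b+1 := 1 - (R2(b+1 := (if zs' = [] then 1 else 0))) (b+1)), S(s := zs'))"
              unfolding I_def prod.case using b2 z2 n fr assms
              by (intro exI[of _ "ys @ [a]"] exI[of _ zs']) (auto simp: e_def)
          qed (use b2 in auto)
        qed
      qed
    qed
    then have "run ?body (R1, S1) (V + 1 + (cell_time V + (1 + 3))) (I n)"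
      by (rule run_mono) (use bit_size_le[of a] aV in auto)
    then show "R1 (b+1) \<noteq> 0 \<and> bit_size (R1 (b+1)) \<le> 1 \<and> run ?body (R1, S1) (V + 1 + (cell_time V + (1 + 3))) (I n)"
      using I(5) by (simp add: bit_size_def)
  qed (auto simp: I_def e_def)
  have pre: "run (block [Load z 0, Load (b+2) 1]) (R, S) 3 (\<lambda>\<sigma>. \<sigma> = (R(z := 0, b+2 := 1), S))"
    by (rule run_block) (auto simp: bit_size_def)
  let ?R = "R(z := 0, b+2 := 1)"
  have "run (pop_all s z b) (R, S) (3 + (1 + (3 + (length (S s) * (1 + (V + 1 + (cell_time V + (1 + 3)))) + 1)))) (I 0)"
    unfolding pop_all_def
  proof (rule run_Seq[OF pre])
    fix \<sigma> assume s: "\<sigma> = (?R, S)"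
    show "run (Seq (Empty (b+1) s) (Seq ?sub (WhileNZ (b+1) ?body))) \<sigma>
      (1 + (3 + (length (S s) * (1 + (V + 1 + (cell_time V + (1 + 3)))) + 1))) (I 0)" unfolding s
    proof (rule run_Seq)
      show "run (Empty (b+1) s) (?R, S) 1 (\<lambda>\<sigma>. \<sigma> = (?R(b+1 := (if S s = [] then 1 else 0)), S))"
        by (rule run_Empty) simp
      fix \<sigma>1 assume s1: "\<sigma>1 = (?R(b+1 := (if S s = [] then 1 else 0)), S)"
      show "run (Seq ?sub (WhileNZ (b+1) ?body)) \<sigma>1 (3 + (length (S s) * (1 + (V + 1 + (cell_time V + (1 + 3)))) + 1)) (I 0)"
        unfolding s1
      proof (rule run_Seq)
        show "run ?sub (?R(b+1 := (if S s = [] then 1 else 0)), S) 3 (I (length (S s)))"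
        proof (rule sub)
          show "I (length (S s)) ((?R(b+1 := (if S s = [] then 1 else 0)))(b+1 := 1 - (?R(b+1 := (if S s = [] then 1 else 0))) (b+1)), S)"
            unfolding I_def using assms by (auto simp: e_def intro!: exI[of _ "[]"])
        qed auto
      qed (rule w)
    qed
  qed
  moreover have "3 + (1 + (3 + (length (S s) * (1 + (V + 1 + (cell_time V + (1 + 3)))) + 1))) \<le> pop_time (sz (S s))"
    unfolding pop_time_def V_def by (intro add_mono mult_le_mono1 order_refl length_le_sz)
  ultimately show ?thesis by (rule run_mono) (auto simp: I_def post_def)
qed

definition push_all :: "nat \<Rightarrow> nat \<Rightarrow> nat \<Rightarrow> program" where
  "push_all s a b = Seq (block [Load (b+1) 0, Op OpAdd b a (b+1)])
     (WhileNZ b (Seq (uncons_prog b (b+1) b (b+2)) (Push s (b+1))))"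

definition push_time :: "nat \<Rightarrow> nat" where
  "push_time V = (V + 4) + (V * (V + 1 + (cell_time V + (V + 1))) + 1)"

lemma run_push_all:
  assumes "a < b" "R a = enc (xs :: nat list)"
  shows "run (push_all s a b) (R, S) (push_time (sz xs))
    (\<lambda>(R', S'). S' = S(s := rev xs @ S s) \<and> (\<forall>i<b. R' i = R i))"
proof -
  define V where "V = sz xs"
  define I :: "nat \<Rightarrow> state \<Rightarrow> bool" where "I = (\<lambda>n (R', S'). \<exists>ys zs. xs = ys @ zs \<and> length zs = n \<and>
    S' = S(s := rev ys @ S s) \<and> R' b = enc zs \<and> (\<forall>i<b. R' i = R i))"
  let ?body = "Seq (uncons_prog b (b+1) b (b+2)) (Push s (b+1))"
  have 1: "run (block [Load (b+1) 0, Op OpAdd b a (b+1)]) (R, S) (V + 4) (I (length xs))"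
    using assms by (intro run_block) (auto simp: I_def bit_size_def V_def sz_def intro!: exI[of _ "[]"])
  have 2: "run (WhileNZ b ?body) \<sigma> (length xs * (V + 1 + (cell_time V + (V + 1))) + 1) (I 0)" if "I (length xs) \<sigma>" for \<sigma>
    using that
  proof (rule run_WhileNZ[where I = I, rotated 2])
    fix n R1 S1 assume "I (Suc n) (R1, S1)"
    then obtain ys zs where I: "xs = ys @ zs" "length zs = Suc n" "S1 = S(s := rev ys @ S s)" "R1 b = enc zs"
      "\<And>i. i < b \<Longrightarrow> R1 i = R i" by (auto simp: I_def)
    obtain x zs' where zs: "zs = x # zs'" using I(2) by (cases zs) auto
    have V: "V = sz ys + sz zs" using I(1) by (simp add: V_def)
    have b1: "R1 b = consn x (enc zs')" using I(4) zs by simp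
    have b2: "bl (R1 b) \<le> V" unfolding I(4) sz_def[symmetric] using V by simp
    have xV: "bl x \<le> V" using V zs by simp
    have "run ?body (R1, S1) (cell_time V + (V + 1)) (I n)"
    proof (rule run_Seq)
      show "run (uncons_prog b (b+1) b (b+2)) (R1, S1) (cell_time V)
        (\<lambda>(R', S'). S' = S1 \<and> R' (b+1) = x \<and> R' b = enc zs' \<and> (\<forall>i<b+2. i \<noteq> b+1 \<longrightarrow> i \<noteq> b \<longrightarrow> R' i = R1 i))"
        by (rule run_uncons) (use b1 b2 in auto)
      fix \<sigma>1 :: state assume "case \<sigma>1 of (R', S') \<Rightarrow> S' = S1 \<and> R' (b+1) = x \<and> R' b = enc zs' \<and> (\<forall>i<b+2. i \<noteq> b+1 \<longrightarrow> i \<noteq> b \<longrightarrow> R' i = R1 i)"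
      then obtain R2 where R2: "\<sigma>1 = (R2, S1)" "R2 (b+1) = x" "R2 b = enc zs'" "\<And>i. i < b \<Longrightarrow> R2 i = R1 i"
        by (cases \<sigma>1) auto
      have "xs = (ys @ [x]) @ zs'" "length zs' = n" using I zs by auto
      then have "I n (R2, S1(s := R2 (b+1) # S1 s))" unfolding I_def using R2 I(3,5)
        by (auto intro!: exI[of _ "ys @ [x]"] exI[of _ zs'])
      then have "run (Push s (b+1)) (R2, S1) (bit_size (R2 (b+1))) (I n)" by (rule run_Push)
      then show "run (Push s (b+1)) \<sigma>1 (V + 1) (I n)" unfolding R2(1)
        by (rule run_mono) (use R2(2) bit_size_le[of x] xV in auto)
    qed
    moreover have "bit_size (R1 b) \<le> V + 1" using bit_size_le[of "R1 b"] b2 by linarith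
    ultimately show "R1 b \<noteq> 0 \<and> bit_size (R1 b) \<le> V + 1 \<and> run ?body (R1, S1) (cell_time V + (V + 1)) (I n)"
      using b1 by simp
  qed (auto simp: I_def)
  have "run (push_all s a b) (R, S) ((V + 4) + (length xs * (V + 1 + (cell_time V + (V + 1))) + 1)) (I 0)"
    unfolding push_all_def by (rule run_Seq[OF 1 2])
  moreover have "(V + 4) + (length xs * (V + 1 + (cell_time V + (V + 1))) + 1) \<le> push_time (sz xs)"
    unfolding push_time_def V_def by (intro add_mono mult_le_mono1 order_refl length_le_sz)
  ultimately show ?thesis by (rule run_mono) (auto simp: I_def)
qed

lemma pbd_pop_time: "pbd D F \<Longrightarrow> pbd D (\<lambda>x. pop_time (F x))"
  unfolding pop_time_def by (intro pbd_add pbd_mult pbd_const pbd_cell_time)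

lemma pbd_push_time: "pbd D F \<Longrightarrow> pbd D (\<lambda>x. push_time (F x))"
  unfolding push_time_def by (intro pbd_add pbd_mult pbd_const pbd_cell_time)

section \<open>Running a foreign program as a subroutine\<close>

fun uses_below :: "nat \<Rightarrow> program \<Rightarrow> bool" where
  "uses_below N Skip = True"
| "uses_below N (Load x a) = (x < N)"
| "uses_below N (Op bop x y z) = (x < N \<and> y < N \<and> z < N)"
| "uses_below N (Push s x) = (s < N \<and> x < N)"
| "uses_below N (Pop x s) = (s < N \<and> x < N)"
| "uses_below N (Empty x s) = (s < N \<and> x < N)"
| "uses_below N (Seq c d) = (uses_below N c \<and> uses_below N d)"
| "uses_below N (IfNZ x c d) = (x < N \<and> uses_below N c \<and> uses_below N d)"
| "uses_below N (WhileNZ x c) = (x < N \<and> uses_below N c)"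

lemma uses_below_mono: "uses_below M c \<Longrightarrow> M \<le> N \<Longrightarrow> uses_below N c"
  by (induction c) auto

lemma uses_below_exists: "\<exists>N\<ge>2. uses_below N c"
proof -
  have "\<exists>N. uses_below N c"
  proof (induction c)
    case (Op bop x y z)
    show ?case by (rule exI[of _ "Suc (x + y + z)"]) simp
  next
    case (Push s x)
    show ?case by (rule exI[of _ "Suc (s + x)"]) simp
  next
    case (Pop x s)
    show ?case by (rule exI[of _ "Suc (s + x)"]) simp
  next
    case (Empty x s)
    show ?case by (rule exI[of _ "Suc (s + x)"]) simp
  next
    case (Seq c d)
    then obtain M N where "uses_below M c" "uses_below N d" by blast
    then show ?case using uses_below_mono[of M c "M + N"] uses_below_mono[of N d "M + N"] by auto
  next
    case (IfNZ x c d)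
    then obtain M N where "uses_below M c" "uses_below N d" by blast
    then show ?case using uses_below_mono[of M c "Suc (x + M + N)"] uses_below_mono[of N d "Suc (x + M + N)"]
      by (intro exI[of _ "Suc (x + M + N)"]) auto
  next
    case (WhileNZ x c)
    then obtain M where "uses_below M c" by blast
    then show ?case using uses_below_mono[of M c "Suc (x + M)"] by (intro exI[of _ "Suc (x + M)"]) auto
  qed auto
  then obtain N where "uses_below N c" by blast
  then have "uses_below (N + 2) c" by (rule uses_below_mono) simp
  then show ?thesis by (intro exI[of _ "N + 2"]) simp
qed

text \<open>Registers are moved out of the way while stacks keep their numbers: by the calling
  convention all stacks are empty, so there is nothing on them to protect.\<close>

fun shiftp :: "nat \<Rightarrow> program \<Rightarrow> program" where
  "shiftp b Skip = Skip"
| "shiftp b (Load x a) = Load (x + b) a"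
| "shiftp b (Op bop x y z) = Op bop (x + b) (y + b) (z + b)"
| "shiftp b (Push s x) = Push s (x + b)"
| "shiftp b (Pop x s) = Pop (x + b) s"
| "shiftp b (Empty x s) = Empty (x + b) s"
| "shiftp b (Seq c d) = Seq (shiftp b c) (shiftp b d)"
| "shiftp b (IfNZ x c d) = IfNZ (x + b) (shiftp b c) (shiftp b d)"
| "shiftp b (WhileNZ x c) = WhileNZ (x + b) (shiftp b c)"

lemma exec_shiftp:
  "exec c \<sigma> t \<sigma>' \<Longrightarrow> uses_below N c \<Longrightarrow> \<forall>i<N. R2 (i + b) = fst \<sigma> i \<Longrightarrow>
   \<exists>R2'. exec (shiftp b c) (R2, snd \<sigma>) t (R2', snd \<sigma>') \<and> (\<forall>i<N. R2' (i + b) = fst \<sigma>' i) \<and> (\<forall>i<b. R2' i = R2 i)"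
proof (induction arbitrary: R2 rule: exec.induct)
  case (Skip \<sigma>)
  then show ?case using exec.Skip[of "(R2, snd \<sigma>)"] by (intro exI[of _ R2]) auto
next
  case (Load x a R S)
  have "exec (shiftp b (Load x a)) (R2, snd (R, S)) (bit_size a) (R2(x + b := a), snd (R(x := a), S))"
    using exec.Load by simp
  moreover have "\<forall>i<N. (R2(x + b := a)) (i + b) = fst (R(x := a), S) i" using Load by simp
  moreover have "\<forall>i<b. (R2(x + b := a)) i = R2 i" by simp
  ultimately show ?case by blast
next
  case (Op bop x y z R S)
  let ?R2 = "R2(x + b := binop_val bop (R y) (R z))"
  have "exec (shiftp b (Op bop x y z)) (R2, snd (R, S)) (binop_cost bop (R y) (R z))
      (?R2, snd (R(x := binop_val bop (R y) (R z)), S))"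
    using exec.Op[of bop "x + b" "y + b" "z + b" R2 S] Op by simp
  moreover have "\<forall>i<N. ?R2 (i + b) = fst (R(x := binop_val bop (R y) (R z)), S) i" using Op by simp
  moreover have "\<forall>i<b. ?R2 i = R2 i" by simp
  ultimately show ?case by blast
next
  case (Push s x R S)
  then have "exec (shiftp b (Push s x)) (R2, snd (R, S)) (bit_size (R x)) (R2, snd (R, S(s := R x # S s)))"
    using exec.Push[of s "x + b" R2 S] by simp
  moreover have "\<forall>i<N. R2 (i + b) = fst (R, S(s := R x # S s)) i" using Push by simp
  ultimately show ?case by blast
next
  case (Pop_Nil S s x R)
  have "exec (shiftp b (Pop x s)) (R2, snd (R, S)) 1 (R2(x + b := 0), snd (R(x := 0), S))"
    using exec.Pop_Nil[of S s "x + b" R2] Pop_Nil by simp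
  moreover have "\<forall>i<N. (R2(x + b := 0)) (i + b) = fst (R(x := 0), S) i" using Pop_Nil by simp
  moreover have "\<forall>i<b. (R2(x + b := 0)) i = R2 i" by simp
  ultimately show ?case by blast
next
  case (Pop_Cons S s a as x R)
  have "exec (shiftp b (Pop x s)) (R2, snd (R, S)) (bit_size a) (R2(x + b := a), snd (R(x := a), S(s := as)))"
    using exec.Pop_Cons[of S s a as "x + b" R2] Pop_Cons by simp
  moreover have "\<forall>i<N. (R2(x + b := a)) (i + b) = fst (R(x := a), S(s := as)) i" using Pop_Cons by simp
  moreover have "\<forall>i<b. (R2(x + b := a)) i = R2 i" by simp
  ultimately show ?case by blast
next
  case (Empty x s R S)
  let ?e = "if S s = [] then 1 else 0"
  have "exec (shiftp b (Empty x s)) (R2, snd (R, S)) 1 (R2(x + b := ?e), snd (R(x := ?e), S))"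
    using exec.Empty[of "x + b" s R2 S] by simp
  moreover have "\<forall>i<N. (R2(x + b := ?e)) (i + b) = fst (R(x := ?e), S) i" using Empty by simp
  moreover have "\<forall>i<b. (R2(x + b := ?e)) i = R2 i" by simp
  ultimately show ?case by blast
next
  case (Seq c \<sigma> t \<sigma>' d u \<sigma>'')
  from Seq.prems Seq.IH(1)[of R2] obtain R3 where 3: "exec (shiftp b c) (R2, snd \<sigma>) t (R3, snd \<sigma>')"
    "\<forall>i<N. R3 (i + b) = fst \<sigma>' i" "\<forall>i<b. R3 i = R2 i" by auto
  from Seq.prems 3(2) Seq.IH(2)[of R3] obtain R4 where 4: "exec (shiftp b d) (R3, snd \<sigma>') u (R4, snd \<sigma>'')"
    "\<forall>i<N. R4 (i + b) = fst \<sigma>'' i" "\<forall>i<b. R4 i = R3 i" by auto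
  from exec.Seq[OF 3(1) 4(1)] 3 4 show ?case by auto
next
  case (IfNZ_True R x c S t \<sigma>' d)
  from IfNZ_True.prems IfNZ_True.IH[of R2] obtain R3 where 3: "exec (shiftp b c) (R2, S) t (R3, snd \<sigma>')"
    "\<forall>i<N. R3 (i + b) = fst \<sigma>' i" "\<forall>i<b. R3 i = R2 i" by auto
  have "R2 (x + b) = R x" using IfNZ_True.prems by simp
  then show ?case using exec.IfNZ_True[of R2 "x + b", OF _ 3(1)] IfNZ_True.hyps 3 by auto
next
  case (IfNZ_False R x d S t \<sigma>' c)
  from IfNZ_False.prems IfNZ_False.IH[of R2] obtain R3 where 3: "exec (shiftp b d) (R2, S) t (R3, snd \<sigma>')"
    "\<forall>i<N. R3 (i + b) = fst \<sigma>' i" "\<forall>i<b. R3 i = R2 i" by auto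
  have "R2 (x + b) = R x" using IfNZ_False.prems by simp
  then show ?case using exec.IfNZ_False[of R2 "x + b", OF _ 3(1)] IfNZ_False.hyps 3 by auto
next
  case (WhileNZ_True R x c S t \<sigma>' u \<sigma>'')
  from WhileNZ_True.prems WhileNZ_True.IH(1)[of R2] obtain R3 where 3: "exec (shiftp b c) (R2, S) t (R3, snd \<sigma>')"
    "\<forall>i<N. R3 (i + b) = fst \<sigma>' i" "\<forall>i<b. R3 i = R2 i" by auto
  from WhileNZ_True.prems 3(2) WhileNZ_True.IH(2)[of R3] obtain R4 where
    4: "exec (WhileNZ (x + b) (shiftp b c)) (R3, snd \<sigma>') u (R4, snd \<sigma>'')"
    "\<forall>i<N. R4 (i + b) = fst \<sigma>'' i" "\<forall>i<b. R4 i = R3 i" by auto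
  have "R2 (x + b) = R x" using WhileNZ_True.prems by simp
  then show ?case using exec.WhileNZ_True[of R2 "x + b", OF _ 3(1) 4(1)] WhileNZ_True.hyps 3 4 by auto
next
  case (WhileNZ_False R x c S)
  have "R2 (x + b) = R x" using WhileNZ_False.prems by simp
  then show ?case using exec.WhileNZ_False[of R2 "x + b" "shiftp b c" S] WhileNZ_False by auto
qed

text \<open>Pushing \<open>a\<close> costs \<open>bit_size a\<close> and adds
  \<open>2 * bl a + 1\<close> to the size of the stack, so the running time controls everything left
  on the stacks, in particular the output.\<close>

lemma exec_stacks:
  "exec c \<sigma> t \<sigma>' \<Longrightarrow> uses_below N c \<Longrightarrow> (N \<le> s \<longrightarrow> snd \<sigma>' s = snd \<sigma> s) \<and> sz (snd \<sigma>' s) \<le> sz (snd \<sigma> s) + 3 * t"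
proof (induction rule: exec.induct)
  case (Push k x R S)
  have "2 * bl (R x) + 1 \<le> 3 * bit_size (R x)" by (auto simp: bit_size_def max_def)
  then show ?case using Push by auto
qed auto

text \<open>Whatever a subroutine leaves behind must go, because the calling convention demands
  empty stacks. The contents are popped into a scratch register and forgotten.\<close>

fun clear_stacks :: "nat list \<Rightarrow> nat \<Rightarrow> program" where
  "clear_stacks [] b = Skip"
| "clear_stacks (s # ss) b = Seq (pop_all s b (b + 1)) (clear_stacks ss b)"

lemma run_clear_stacks:
  assumes "\<And>s. sz (S s) \<le> V"
  shows "run (clear_stacks ss b) (R, S) (length ss * pop_time V + 1)
    (\<lambda>(R', S'). S' = (\<lambda>s. if s \<in> set ss then [] else S s) \<and> (\<forall>i<b. R' i = R i))"
  using assms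
proof (induction ss arbitrary: R S)
  case Nil
  then show ?case unfolding run_def using exec.Skip by fastforce
next
  case (Cons s ss)
  have "run (pop_all s b (b + 1)) (R, S) (pop_time V) (post b (b + 1) R (S(s := [])) (enc (rev (S s))))"
    by (rule run_mono[OF run_pop_all]) (use Cons.prems pop_time_mono in auto)
  then have "run (clear_stacks (s # ss) b) (R, S) (pop_time V + (length ss * pop_time V + 1))
    (\<lambda>(R', S'). S' = (\<lambda>k. if k \<in> set ss then [] else (S(s := [])) k) \<and> (\<forall>i<b. R' i = R i))"
    unfolding clear_stacks.simps
  proof (rule run_Seq)
    fix \<sigma> assume "post b (b + 1) R (S(s := [])) (enc (rev (S s))) \<sigma>"
    then obtain R1 where R1: "\<sigma> = (R1, S(s := []))" "\<And>i. i < b + 1 \<Longrightarrow> i \<noteq> b \<Longrightarrow> R1 i = R i" by (rule postE) blast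
    show "run (clear_stacks ss b) \<sigma> (length ss * pop_time V + 1)
      (\<lambda>(R', S'). S' = (\<lambda>k. if k \<in> set ss then [] else (S(s := [])) k) \<and> (\<forall>i<b. R' i = R i))"
      unfolding R1(1) by (rule run_mono[OF Cons.IH]) (use Cons.prems R1(2) in auto)
  qed
  then show ?case by (rule run_mono) (auto simp: fun_eq_iff)
qed

lemma run_zero_regs:
  "run (block (map (\<lambda>i. Load (i + b) 0) [0..<N])) (R, S) (N + 1)
    (\<lambda>\<sigma>. \<exists>R'. \<sigma> = (R', S) \<and> (\<forall>i<N. R' (i + b) = 0) \<and> (\<forall>i<b. R' i = R i))"
proof (rule run_block)
  have "block_cost (map (\<lambda>i. Load (i + b) 0) ks) R = length ks + 1" for ks R
    by (induction ks arbitrary: R) (auto simp: bit_size_def)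
  then show "block_cost (map (\<lambda>i. Load (i + b) 0) [0..<N]) R \<le> N + 1" by simp
  have "fold effect (map (\<lambda>i. Load (i + b) 0) ks) R j = (if j \<ge> b \<and> j - b \<in> set ks then 0 else R j)" for ks R j
    by (induction ks arbitrary: R) auto
  then show "\<exists>R'. (fold effect (map (\<lambda>i. Load (i + b) 0) [0..<N]) R, S) = (R', S) \<and> (\<forall>i<N. R' (i + b) = 0) \<and> (\<forall>i<b. R' i = R i)"
    by auto
qed auto

text \<open>Passes from the stack convention of complete programs to the register convention. Both
  \<open>push_all\<close> and \<open>pop_all\<close> reverse the list, so the former is preceded and
  the latter followed by an explicit reversal.\<close>

lemma pt_call:
  assumes A: "\<And>xs. xs \<in> D \<Longrightarrow> \<exists>t. computes A xs (f xs) t \<and> t \<le> T xs" and T: "pbd D T"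
  shows "pt D f"
proof -
  let ?S = "\<lambda>_ :: nat. [] :: nat list"
  obtain N where N: "N \<ge> 2" "uses_below N A" using uses_below_exists by blast
  have f_sz: "sz (f xs) \<le> sz xs + 3 * T xs" if xs: "xs \<in> D" for xs
  proof -
    obtain t R S where e: "exec A (\<lambda>_. 0, ?S(0 := xs)) t (R, S)" "S 1 = f xs" "t \<le> T xs"
      using A[OF xs] unfolding computes_def by blast
    show ?thesis using exec_stacks[OF e(1) N(2), of 1] e by auto
  qed
  obtain T1 where T1: "pbd UNIV T1"
    "\<And>a z b. a < b \<Longrightarrow> z < b \<Longrightarrow> \<exists>c. \<forall>v\<in>UNIV. \<forall>R. R a = enc v \<longrightarrow>
     run c (R, ?S) (T1 v) (post z b R ?S (enc (rev v :: nat list)))"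
    using pt_rev[OF pt_ident[of UNIV]] by (rule ptE) blast
  define V where "V xs = sz xs + 3 * T xs" for xs
  have V: "pbd D V" unfolding V_def by (intro pbd_intros T)
  have szf: "pbd D (\<lambda>xs. sz (f xs))" by (rule pbd_mono[OF V]) (simp add: V_def f_sz)
  have T1': "pbd D T1" by (rule pbd_subset[OF T1(1)]) simp
  have T1f: "pbd D (\<lambda>xs. T1 (rev (f xs)))" by (rule pbd_comp[OF T1(1)]) (use szf in auto)
  let ?W = "\<lambda>xs. T1 xs + (push_time (sz xs) + ((N + 1) + (T xs + (pop_time (V xs) + (N * pop_time (V xs) + 1 + T1 (rev (f xs)))))))"
  show ?thesis
  proof (rule ptI[OF _ szf])
    show "pbd D ?W" by (intro pbd_intros pbd_push_time pbd_pop_time T1' T1f T V)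
    fix a z b :: nat assume ab: "a < b" "z < b"
    obtain c1 where c1: "\<And>v R. R a = enc v \<Longrightarrow> run c1 (R, ?S) (T1 v) (post b (b + 1) R ?S (enc (rev v)))"
      using T1(2)[of a "b + 1" b] ab by auto
    obtain c2 where c2: "\<And>v R. R b = enc v \<Longrightarrow> run c2 (R, ?S) (T1 v) (post z (b + 1) R ?S (enc (rev v)))"
      using T1(2)[of b "b + 1" z] ab by auto
    \<comment> \<open>\<open>computes\<close> starts from registers that are all zero; here it is
      enough to clear the \<open>N\<close> registers that the program can address.\<close>
    define zr where "zr = block (map (\<lambda>i. Load (i + (b + 1)) 0) [0..<N])"
    define c where "c = Seq c1 (Seq (push_all 0 b (b + 1)) (Seq zr (Seq (shiftp (b + 1) A)
      (Seq (pop_all 1 b (b + 1)) (Seq (clear_stacks [0..<N] (b + 1)) c2)))))"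
    have "run c (R, ?S) (?W xs) (post z b R ?S (enc (f xs)))" if xs: "xs \<in> D" "R a = enc xs" for xs R
    proof -
      obtain t RA SA where e: "exec A (\<lambda>_. 0, ?S(0 := xs)) t (RA, SA)" "SA 1 = f xs" "t \<le> T xs"
        using A[OF xs(1)] unfolding computes_def by blast
      have szA: "sz (SA s) \<le> V xs" for s using exec_stacks[OF e(1) N(2), of s] e(3) by (auto simp: V_def split: if_splits)
      have SA0: "SA s = []" if "s \<ge> N" for s using exec_stacks[OF e(1) N(2), of s] that N(1) by auto
      show ?thesis unfolding c_def
      proof (rule run_Seq[OF c1[of R xs, OF xs(2)]])
        fix \<sigma> assume "post b (b + 1) R ?S (enc (rev xs)) \<sigma>"
        then obtain R1 where R1: "\<sigma> = (R1, ?S)" "R1 b = enc (rev xs)" "\<And>i. i < b + 1 \<Longrightarrow> i \<noteq> b \<Longrightarrow> R1 i = R i"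
          by (rule postE) blast
        show "run (Seq (push_all 0 b (b + 1)) (Seq zr (Seq (shiftp (b + 1) A)
          (Seq (pop_all 1 b (b + 1)) (Seq (clear_stacks [0..<N] (b + 1)) c2))))) \<sigma>
          (push_time (sz xs) + ((N + 1) + (T xs + (pop_time (V xs) + (N * pop_time (V xs) + 1 + T1 (rev (f xs)))))))
          (post z b R ?S (enc (f xs)))" unfolding R1(1)
        proof (rule run_Seq)
          show "run (push_all 0 b (b + 1)) (R1, ?S) (push_time (sz xs))
             (\<lambda>(R', S'). S' = ?S(0 := xs) \<and> (\<forall>i<b+1. R' i = R1 i))"
            by (rule run_mono[OF run_push_all[where R = R1, OF _ R1(2)]]) auto
          fix \<sigma>1 :: state assume "case \<sigma>1 of (R', S') \<Rightarrow> S' = ?S(0 := xs) \<and> (\<forall>i<b+1. R' i = R1 i)"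
          then obtain R2 where R2: "\<sigma>1 = (R2, ?S(0 := xs))" "\<And>i. i < b + 1 \<Longrightarrow> R2 i = R1 i" by (cases \<sigma>1) auto
          show "run (Seq zr (Seq (shiftp (b + 1) A) (Seq (pop_all 1 b (b + 1)) (Seq (clear_stacks [0..<N] (b + 1)) c2)))) \<sigma>1
            ((N + 1) + (T xs + (pop_time (V xs) + (N * pop_time (V xs) + 1 + T1 (rev (f xs))))))
            (post z b R ?S (enc (f xs)))" unfolding R2(1) zr_def
          proof (rule run_Seq[OF run_zero_regs])
            fix \<sigma>2 :: state assume "\<exists>R'. \<sigma>2 = (R', ?S(0 := xs)) \<and> (\<forall>i<N. R' (i + (b + 1)) = 0) \<and> (\<forall>i<b + 1. R' i = R2 i)"
            then obtain R3 where R3: "\<sigma>2 = (R3, ?S(0 := xs))" "\<forall>i<N. R3 (i + (b + 1)) = 0" "\<And>i. i < b + 1 \<Longrightarrow> R3 i = R2 i" by blast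
            obtain R4 where R4: "exec (shiftp (b + 1) A) (R3, ?S(0 := xs)) t (R4, SA)" "\<forall>i<b + 1. R4 i = R3 i"
              using exec_shiftp[OF e(1) N(2), of R3 "b + 1"] R3(2) by auto
            have "run (shiftp (b + 1) A) (R3, ?S(0 := xs)) (T xs) (\<lambda>\<sigma>. \<sigma> = (R4, SA))"
              unfolding run_def using R4(1) e(3) by blast
            then show "run (Seq (shiftp (b + 1) A) (Seq (pop_all 1 b (b + 1)) (Seq (clear_stacks [0..<N] (b + 1)) c2))) \<sigma>2
              (T xs + (pop_time (V xs) + (N * pop_time (V xs) + 1 + T1 (rev (f xs))))) (post z b R ?S (enc (f xs)))" unfolding R3(1)
            proof (rule run_Seq)
              fix \<sigma>3 assume s3: "\<sigma>3 = (R4, SA)"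
              show "run (Seq (pop_all 1 b (b + 1)) (Seq (clear_stacks [0..<N] (b + 1)) c2)) \<sigma>3
                (pop_time (V xs) + (N * pop_time (V xs) + 1 + T1 (rev (f xs)))) (post z b R ?S (enc (f xs)))" unfolding s3
              proof (rule run_Seq)
                show "run (pop_all 1 b (b + 1)) (R4, SA) (pop_time (V xs)) (post b (b + 1) R4 (SA(1 := [])) (enc (rev (f xs))))"
                  using run_pop_all[of b "b + 1" 1 R4 SA] unfolding e(2)
                  by (rule run_mono) (use szA[of 1] e(2) pop_time_mono in auto)
                fix \<sigma>4 assume "post b (b + 1) R4 (SA(1 := [])) (enc (rev (f xs))) \<sigma>4"
                then obtain R5 where R5: "\<sigma>4 = (R5, SA(1 := []))" "R5 b = enc (rev (f xs))" "\<And>i. i < b + 1 \<Longrightarrow> i \<noteq> b \<Longrightarrow> R5 i = R4 i"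
                  by (rule postE) blast
                show "run (Seq (clear_stacks [0..<N] (b + 1)) c2) \<sigma>4 (N * pop_time (V xs) + 1 + T1 (rev (f xs)))
                  (post z b R ?S (enc (f xs)))" unfolding R5(1)
                proof (rule run_Seq)
                  show "run (clear_stacks [0..<N] (b + 1)) (R5, SA(1 := [])) (N * pop_time (V xs) + 1)
                    (\<lambda>(R', S'). S' = ?S \<and> (\<forall>i<b+1. R' i = R5 i))"
                    by (rule run_mono[OF run_clear_stacks[of "SA(1 := [])" "V xs" "[0..<N]" "b + 1" R5]])
                      (use szA SA0 in \<open>auto simp: fun_eq_iff\<close>)
                  fix \<sigma>5 :: state assume "case \<sigma>5 of (R', S') \<Rightarrow> S' = ?S \<and> (\<forall>i<b+1. R' i = R5 i)"
                  then obtain R6 where R6: "\<sigma>5 = (R6, ?S)" "\<And>i. i < b + 1 \<Longrightarrow> R6 i = R5 i" by (cases \<sigma>5) auto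
                  have "R6 b = enc (rev (f xs))" using R6(2)[of b] R5(2) by simp
                  from c2[of R6, OF this] show "run c2 \<sigma>5 (T1 (rev (f xs))) (post z b R ?S (enc (f xs)))"
                    unfolding R6(1)
                    by (rule run_mono) (use R6(2) R5(3) R4(2) R3(3) R2(2) R1(3) in \<open>auto simp: post_def\<close>)
                qed
              qed
            qed
          qed
        qed
      qed
    qed
    then show "\<exists>c. \<forall>v\<in>D. \<forall>R. R a = enc v \<longrightarrow> run c (R, ?S) (?W v) (post z b R ?S (enc (f v)))" by blast
  qed
qed

text \<open>The converse of \<open>pt_call\<close>. Popping the input and pushing the output both
  reverse, hence the detour through \<open>f\<close> conjugated with \<open>rev\<close>.\<close>

lemma pt_computes:
  assumes f: "pt D (f :: nat list \<Rightarrow> nat list)"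
  obtains B T where "pbd D T" "\<And>xs. xs \<in> D \<Longrightarrow> \<exists>t. computes B xs (f xs) t \<and> t \<le> T xs"
proof -
  let ?S = "\<lambda>_ :: nat. [] :: nat list"
  have "pt (rev ` D) (\<lambda>xs. rev (f (rev xs)))"
    by (intro pt_rev pt_comp[OF f] pt_ident) auto
  then obtain T1 where T1: "pbd (rev ` D) T1" "pbd (rev ` D) (\<lambda>xs. sz (rev (f (rev xs))))"
    "\<And>a z b. a < b \<Longrightarrow> z < b \<Longrightarrow> \<exists>c. \<forall>v\<in>rev ` D. \<forall>R. R a = enc v \<longrightarrow>
     run c (R, ?S) (T1 v) (post z b R ?S (enc (rev (f (rev v)))))" by (rule ptE) blast
  obtain c where c: "\<forall>v\<in>rev ` D. \<forall>R. R 0 = enc v \<longrightarrow> run c (R, ?S) (T1 v) (post 1 2 R ?S (enc (rev (f (rev v)))))"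
    using T1(3)[of 0 2 1] by auto
  define B where "B = Seq (pop_all 0 0 1) (Seq c (push_all 1 1 2))"
  define T where "T xs = pop_time (sz xs) + (T1 (rev xs) + push_time (sz (f xs)))" for xs
  have r: "pbd D (\<lambda>xs. G (rev xs))" if "pbd (rev ` D) G" for G :: "nat list \<Rightarrow> nat"
    by (rule pbd_comp[OF that]) (use pbd_sz[of D] in auto)
  have sf: "pbd D (\<lambda>xs. sz (f xs))" using r[OF T1(2)] by simp
  have "pbd D T" unfolding T_def by (intro pbd_add pbd_pop_time pbd_push_time r T1 sf pbd_sz)
  moreover have "\<exists>t. computes B xs (f xs) t \<and> t \<le> T xs" if xs: "xs \<in> D" for xs
  proof -
    have "run B (\<lambda>_. 0, ?S(0 := xs)) (T xs) (\<lambda>(R, S). S 1 = f xs)" unfolding B_def T_def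
    proof (rule run_Seq)
      show "run (pop_all 0 0 1) (\<lambda>_. 0, ?S(0 := xs)) (pop_time (sz xs)) (post 0 1 (\<lambda>_. 0) ?S (enc (rev xs)))"
      proof -
        have "?S(0 := []) = ?S" by auto
        then show ?thesis using run_pop_all[of 0 1 0 "\<lambda>_. 0" "?S(0 := xs)"] by simp
      qed
      fix \<sigma> assume "post 0 1 (\<lambda>_. 0) ?S (enc (rev xs)) \<sigma>"
      then obtain R1 where R1: "\<sigma> = (R1, ?S)" "R1 0 = enc (rev xs)" by (rule postE) blast
      show "run (Seq c (push_all 1 1 2)) \<sigma> (T1 (rev xs) + push_time (sz (f xs))) (\<lambda>(R, S). S 1 = f xs)" unfolding R1(1)
      proof (rule run_Seq)
        have "rev xs \<in> rev ` D" using xs by simp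
        then have "run c (R1, ?S) (T1 (rev xs)) (post 1 2 R1 ?S (enc (rev (f (rev (rev xs))))))" using c R1(2) by blast
        then show "run c (R1, ?S) (T1 (rev xs)) (post 1 2 R1 ?S (enc (rev (f xs))))" by simp
        fix \<sigma>1 assume "post 1 2 R1 ?S (enc (rev (f xs))) \<sigma>1"
        then obtain R2 where R2: "\<sigma>1 = (R2, ?S)" "R2 1 = enc (rev (f xs))" by (rule postE) blast
        show "run (push_all 1 1 2) \<sigma>1 (push_time (sz (f xs))) (\<lambda>(R, S). S 1 = f xs)" unfolding R2(1)
          by (rule run_mono[OF run_push_all[where R = R2, OF _ R2(2)]]) auto
      qed
    qed
    then show ?thesis unfolding run_def computes_def by fastforce
  qed
  ultimately show ?thesis using that by blast
qed

section \<open>Evaluation of polynomials\<close>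

context cring begin

lemma ev_simps [simp]: "ev R [] x = \<zero>" "ev R (a # u) x = a \<oplus> (x \<otimes> ev R u x)"
  by (simp_all add: ev_def)

lemma ev_closed [simp]: "set u \<subseteq> carrier R \<Longrightarrow> x \<in> carrier R \<Longrightarrow> ev R u x \<in> carrier R"
  by (induction u) auto

lemma smul_simps [simp]: "smul R c [] = []" "smul R c (a # u) = (c \<otimes> a) # smul R c u" "length (smul R c u) = length u"
  by (simp_all add: smul_def)

lemma zeros_simps [simp]: "zeros R [] = []" "zeros R (a # u) = \<zero> # zeros R u" "length (zeros R u) = length u"
  "set (zeros R u) \<subseteq> carrier R"
  by (auto simp: zeros_def)

lemma addl_simps [simp]: "addl R [] v = []" "addl R u [] = []" "addl R (a # u) (b # v) = (a \<oplus> b) # addl R u v"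
  "length (addl R u v) = min (length u) (length v)"
  by (simp_all add: addl_def)

lemma sc_simps [simp]: "sc R k [] = []" "sc R k (a # u) = a # smul R k (sc R k u)" "length (sc R k u) = length u"
  by (simp_all add: sc_def, induction u) (simp_all add: sc_def)

lemma smul_closed [simp]: "c \<in> carrier R \<Longrightarrow> set u \<subseteq> carrier R \<Longrightarrow> set (smul R c u) \<subseteq> carrier R"
  by (induction u) auto

lemma sc_closed [simp]: "c \<in> carrier R \<Longrightarrow> set u \<subseteq> carrier R \<Longrightarrow> set (sc R c u) \<subseteq> carrier R"
  by (induction u) auto

lemma addl_closed [simp]: "set u \<subseteq> carrier R \<Longrightarrow> set v \<subseteq> carrier R \<Longrightarrow> set (addl R u v) \<subseteq> carrier R"
  by (induction u v rule: list_induct2') auto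

lemma ev_zeros [simp]: "x \<in> carrier R \<Longrightarrow> ev R (zeros R u) x = \<zero>"
  by (induction u) auto

lemma ev_smul [simp]:
  "c \<in> carrier R \<Longrightarrow> set u \<subseteq> carrier R \<Longrightarrow> x \<in> carrier R \<Longrightarrow> ev R (smul R c u) x = c \<otimes> ev R u x"
  by (induction u) (auto simp: r_distr m_lcomm)

lemma ev_sc [simp]:
  "k \<in> carrier R \<Longrightarrow> set u \<subseteq> carrier R \<Longrightarrow> x \<in> carrier R \<Longrightarrow> ev R (sc R k u) x = ev R u (k \<otimes> x)"
  by (induction u) (auto simp: m_ac)

lemma ev_addl [simp]:
  "length u = length v \<Longrightarrow> set u \<subseteq> carrier R \<Longrightarrow> set v \<subseteq> carrier R \<Longrightarrow> x \<in> carrier R \<Longrightarrow>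
   ev R (addl R u v) x = ev R u x \<oplus> ev R v x"
  by (induction u v rule: list_induct2) (auto simp: r_distr a_ac)

lemma ev_snoc: "set u \<subseteq> carrier R \<Longrightarrow> a \<in> carrier R \<Longrightarrow> x \<in> carrier R \<Longrightarrow>
   ev R (u @ [a]) x = ev R u x \<oplus> (x [^] length u \<otimes> a)"
  by (induction u) (auto simp: r_distr a_ac m_ac)

lemma length_xmul: "length acc = length h \<Longrightarrow> length (xmul R h acc) = length h"
  by (cases acc rule: rev_cases) (auto simp: xmul_def)

lemma xmul_closed: "set h \<subseteq> carrier R \<Longrightarrow> set acc \<subseteq> carrier R \<Longrightarrow> set (xmul R h acc) \<subseteq> carrier R"
  by (cases acc rule: rev_cases) (auto simp: xmul_def intro!: addl_closed[THEN subsetD] smul_closed)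

lemma ev_xmul:
  assumes "set h \<subseteq> carrier R" "set acc \<subseteq> carrier R" "x \<in> carrier R" "length acc = length h" "x [^] length h = ev R h x"
  shows "ev R (xmul R h acc) x = x \<otimes> ev R acc x"
proof (cases acc rule: rev_cases)
  case Nil
  then show ?thesis using assms by (simp add: xmul_def)
next
  case (snoc ls l)
  have l: "length h = Suc (length ls)" "set ls \<subseteq> carrier R" "l \<in> carrier R" using assms snoc by auto
  have "ev R (xmul R h acc) x = (x \<otimes> ev R ls x) \<oplus> (l \<otimes> ev R h x)"
    using assms l by (simp add: xmul_def snoc)
  also have "l \<otimes> ev R h x = x \<otimes> (x [^] length ls \<otimes> l)"
    using assms(3,5) l by (simp add: assms(5)[symmetric] m_ac)
  also have "(x \<otimes> ev R ls x) \<oplus> \<dots> = x \<otimes> ev R acc x"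
    using assms(3) l by (simp add: snoc ev_snoc r_distr)
  finally show ?thesis .
qed

text \<open>Evaluation at points with \<open>x ^ n = h(x)\<close> takes the place of a theory of the
  quotient algebra: what is needed of products modulo \<open>T ^ n - h\<close> is read off from
  their values there. The point is \<open>ev_xmul\<close>, where the top term that the reduction
  replaces by \<open>h\<close> has the same value as its replacement.\<close>

lemma mulm_props:
  assumes "set h \<subseteq> carrier R" "set u \<subseteq> carrier R" "set v \<subseteq> carrier R" "length v = length h"
  shows "length (mulm R h u v) = length h" "set (mulm R h u v) \<subseteq> carrier R"
    "x \<in> carrier R \<Longrightarrow> x [^] length h = ev R h x \<Longrightarrow> ev R (mulm R h u v) x = ev R u x \<otimes> ev R v x"
proof -
  have "length (mulm R h u v) = length h \<and> set (mulm R h u v) \<subseteq> carrier R \<and>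
     (x \<in> carrier R \<longrightarrow> x [^] length h = ev R h x \<longrightarrow> ev R (mulm R h u v) x = ev R u x \<otimes> ev R v x)"
    using assms(2)
  proof (induction u)
    case Nil
    then show ?case using assms by (simp add: mulm_def)
  next
    case (Cons c u)
    have *: "mulm R h (c # u) v = addl R (smul R c v) (xmul R h (mulm R h u v))" by (simp add: mulm_def)
    have IH: "length (mulm R h u v) = length h" "set (mulm R h u v) \<subseteq> carrier R"
      "x \<in> carrier R \<Longrightarrow> x [^] length h = ev R h x \<Longrightarrow> ev R (mulm R h u v) x = ev R u x \<otimes> ev R v x"
      using Cons by auto
    have c: "c \<in> carrier R" "set u \<subseteq> carrier R" using Cons.prems by auto
    show ?case
    proof (intro conjI impI)
      show "length (mulm R h (c # u) v) = length h" using assms IH by (simp add: * length_xmul)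
      show "set (mulm R h (c # u) v) \<subseteq> carrier R"
        unfolding * using assms c IH by (intro addl_closed smul_closed xmul_closed)
      assume x: "x \<in> carrier R" "x [^] length h = ev R h x"
      have "ev R (mulm R h (c # u) v) x = (c \<otimes> ev R v x) \<oplus> (x \<otimes> ev R (mulm R h u v) x)"
        unfolding * using assms c IH(1,2) x
        by (subst ev_addl) (simp_all add: length_xmul xmul_closed ev_xmul)
      also have "\<dots> = ev R (c # u) x \<otimes> ev R v x"
        using assms c x by (simp add: IH(3)[OF x] l_distr m_assoc)
      finally show "ev R (mulm R h (c # u) v) x = ev R (c # u) x \<otimes> ev R v x" .
    qed
  qed
  then show "length (mulm R h u v) = length h" "set (mulm R h u v) \<subseteq> carrier R"
    "x \<in> carrier R \<Longrightarrow> x [^] length h = ev R h x \<Longrightarrow> ev R (mulm R h u v) x = ev R u x \<otimes> ev R v x" by auto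
qed

lemma onel_props:
  shows "length (onel R h) = length h" and "set (onel R h) \<subseteq> carrier R"
    and "h \<noteq> [] \<Longrightarrow> x \<in> carrier R \<Longrightarrow> ev R (onel R h) x = \<one>"
proof -
  show "length (onel R h) = length h" by (cases h) (simp_all add: onel_def)
  show "set (onel R h) \<subseteq> carrier R" by (cases h) (simp_all add: onel_def)
  show "h \<noteq> [] \<Longrightarrow> x \<in> carrier R \<Longrightarrow> ev R (onel R h) x = \<one>"
    by (cases h) (simp_all add: onel_def)
qed

text \<open>Repeated squaring is compared with powers of the image in \<open>R\<close>, where the
  laws of a commutative ring are at hand; of \<open>S\<close> only closure and the two homomorphism
  rules on \<open>C\<close> are asked, which \<open>ext R h\<close> satisfies.\<close>

lemma pw_hom:
  assumes closed: "\<And>a b. a \<in> C \<Longrightarrow> b \<in> C \<Longrightarrow> a \<otimes>\<^bsub>S\<^esub> b \<in> C" "\<one>\<^bsub>S\<^esub> \<in> C"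
    and hom: "\<And>a. a \<in> C \<Longrightarrow> \<phi> a \<in> carrier R" "\<And>a b. a \<in> C \<Longrightarrow> b \<in> C \<Longrightarrow> \<phi> (a \<otimes>\<^bsub>S\<^esub> b) = \<phi> a \<otimes> \<phi> b" "\<phi> \<one>\<^bsub>S\<^esub> = \<one>"
    and a: "a \<in> C"
  shows "pw S a n \<in> C \<and> \<phi> (pw S a n) = \<phi> a [^] n"
proof (induction n rule: less_induct)
  case (less n)
  show ?case
  proof (cases "n = 0")
    case True
    then show ?thesis using closed hom by (simp add: pw_def)
  next
    case False
    define s where "s = pw S a (n div 2)"
    have s: "s \<in> C" "\<phi> s = \<phi> a [^] (n div 2)" using less[of "n div 2"] False by (auto simp: s_def)
    have ss: "\<phi> s \<otimes> \<phi> s = \<phi> a [^] (n div 2 + n div 2)" using s hom(1)[OF a] by (simp add: nat_pow_mult)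
    have step: "pw S a n = (if n mod 2 = 1 then (s \<otimes>\<^bsub>S\<^esub> s) \<otimes>\<^bsub>S\<^esub> a else s \<otimes>\<^bsub>S\<^esub> s)"
      unfolding pw_def s_def bits_rec[OF False] by simp
    show ?thesis
    proof (cases "n mod 2 = 1")
      case True
      then have n: "n = Suc (n div 2 + n div 2)" by presburger
      have "\<phi> a [^] n = \<phi> a [^] (n div 2 + n div 2) \<otimes> \<phi> a" by (subst n) simp
      then show ?thesis using True step s a closed hom ss by simp
    next
      case False
      then have n: "n = n div 2 + n div 2" by presburger
      have "\<phi> a [^] n = \<phi> a [^] (n div 2 + n div 2)" by (subst n) simp
      then show ?thesis using False step s a closed hom ss by simp
    qed
  qed
qed

lemma pw_eq: "a \<in> carrier R \<Longrightarrow> pw R a n = a [^] n"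
  using pw_hom[of "carrier R" R "\<lambda>x. x" a n] by simp

lemma pw_ext_props:
  assumes "h \<noteq> []" "set h \<subseteq> carrier R" "length E = length h" "set E \<subseteq> carrier R"
  shows "length (pw (ext R h) E n) = length h" "set (pw (ext R h) E n) \<subseteq> carrier R"
    "x \<in> carrier R \<Longrightarrow> x [^] length h = ev R h x \<Longrightarrow> ev R (pw (ext R h) E n) x = ev R E x [^] n"
proof -
  let ?C = "{u. length u = length h \<and> set u \<subseteq> carrier R}"
  have c: "a \<otimes>\<^bsub>ext R h\<^esub> b \<in> ?C" if "a \<in> ?C" "b \<in> ?C" for a b
    using that mulm_props(1,2)[OF assms(2)] by (simp add: ext_def)
  have o: "\<one>\<^bsub>ext R h\<^esub> \<in> ?C" by (simp add: ext_def onel_props)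
  have E: "E \<in> ?C" using assms by simp
  \<comment> \<open>The constant map to \<open>\<one>\<close> is multiplicative, and with it
    \<open>pw_hom\<close> yields the closure part alone.\<close>
  have "pw (ext R h) E n \<in> ?C"
    using pw_hom[of ?C "ext R h" "\<lambda>_. \<one>" E n, OF c o _ _ _ E] by simp
  then show "length (pw (ext R h) E n) = length h" "set (pw (ext R h) E n) \<subseteq> carrier R" by auto
  assume x: "x \<in> carrier R" "x [^] length h = ev R h x"
  have "pw (ext R h) E n \<in> ?C \<and> ev R (pw (ext R h) E n) x = ev R E x [^] n"
  proof (rule pw_hom[OF c o])
    show "ev R (a \<otimes>\<^bsub>ext R h\<^esub> b) x = ev R a x \<otimes> ev R b x" if "a \<in> ?C" "b \<in> ?C" for a b
      using that mulm_props(3)[OF assms(2) _ _ _ x] by (simp add: ext_def)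
  qed (use x onel_props(3)[OF assms(1) x(1)] E in \<open>auto simp: ext_def\<close>)
  then show "ev R (pw (ext R h) E n) x = ev R E x [^] n" by simp
qed

lemma ev_addl_pad:
  assumes "set u \<subseteq> carrier R" "set v \<subseteq> carrier R" "x \<in> carrier R" "length u \<le> length v" "length v \<le> length u + length w"
  shows "ev R (addl R (u @ zeros R w) v) x = ev R u x \<oplus> ev R v x"
  using assms
proof (induction u arbitrary: v)
  case Nil
  then have "length v \<le> length w" by simp
  then show ?case using Nil(2,3)
  proof (induction v arbitrary: w)
    case (Cons b v)
    then show ?case by (cases w) auto
  qed simp
next
  case (Cons a u)
  then obtain b v' where v: "v = b # v'" by (cases v) auto
  show ?case using Cons unfolding v by (auto simp: r_distr a_ac)
qed

text \<open>The claim about \<open>last\<close> keeps degrees exact: over a domain, products of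
  lists with nonzero leading coefficient again have one.\<close>

lemma mulL_props:
  assumes "set u \<subseteq> carrier R" "set v \<subseteq> carrier R" "v \<noteq> []"
  shows "length (mulL R u v) = length u + length v - 1" "set (mulL R u v) \<subseteq> carrier R"
    "x \<in> carrier R \<Longrightarrow> ev R (mulL R u v) x = ev R u x \<otimes> ev R v x"
    "u \<noteq> [] \<Longrightarrow> last (mulL R u v) = last u \<otimes> last v"
proof -
  have "length (mulL R u v) = length u + length v - 1 \<and> set (mulL R u v) \<subseteq> carrier R \<and>
    (x \<in> carrier R \<longrightarrow> ev R (mulL R u v) x = ev R u x \<otimes> ev R v x) \<and>
    (u \<noteq> [] \<longrightarrow> last (mulL R u v) = last u \<otimes> last v)"
    using assms(1)
  proof (induction u)
    case Nil
    then show ?case using assms by (simp add: mulL_def)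
  next
    case (Cons c u)
    define acc where "acc = mulL R u v"
    have *: "mulL R (c # u) v = addl R (smul R c v @ zeros R acc) (\<zero> # acc)" by (simp add: mulL_def acc_def)
    have c: "c \<in> carrier R" "set u \<subseteq> carrier R" using Cons.prems by auto
    have acc: "length acc = length u + length v - 1" "set acc \<subseteq> carrier R"
      "x \<in> carrier R \<Longrightarrow> ev R acc x = ev R u x \<otimes> ev R v x" "u \<noteq> [] \<Longrightarrow> last acc = last u \<otimes> last v"
      using Cons.IH c by (auto simp: acc_def)
    have lv: "length v \<ge> 1" using assms(3) by (simp add: Suc_le_eq)
    have len: "length (mulL R (c # u) v) = Suc (length acc)" unfolding * using lv by simp
    show ?case
    proof (intro conjI impI)
      show "length (mulL R (c # u) v) = length (c # u) + length v - 1" using len acc(1) lv by simp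
      show "set (mulL R (c # u) v) \<subseteq> carrier R" unfolding * using c acc assms(2)
        by (intro addl_closed) auto
      show "ev R (mulL R (c # u) v) x = ev R (c # u) x \<otimes> ev R v x" if x: "x \<in> carrier R"
      proof -
        have "ev R (mulL R (c # u) v) x = ev R (smul R c v) x \<oplus> ev R (\<zero> # acc) x"
          unfolding * by (rule ev_addl_pad) (use c acc assms(2) x lv in auto)
        also have "\<dots> = ev R (c # u) x \<otimes> ev R v x"
          using c assms(2) x by (simp add: acc(2) acc(3)[OF x] l_distr m_assoc)
        finally show ?thesis .
      qed
      have "last (mulL R (c # u) v) = mulL R (c # u) v ! length acc"
        using len by (subst last_conv_nth) auto
      also have "\<dots> = (smul R c v @ zeros R acc) ! length acc \<oplus> (\<zero> # acc) ! length acc"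
      proof -
        have z: "zip (smul R c v @ zeros R acc) (\<zero> # acc) ! length acc =
            ((smul R c v @ zeros R acc) ! length acc, (\<zero> # acc) ! length acc)"
          by (rule nth_zip) (use lv in auto)
        show ?thesis unfolding * addl_def using lv by (subst nth_map) (auto simp: z)
      qed
      also have "\<dots> = last (c # u) \<otimes> last v"
      proof (cases "u = []")
        case True
        have z: "acc = zeros R (tl v)" using True by (simp add: acc_def mulL_def)
        have "(\<zero> # acc) ! length acc = \<zero>" unfolding z by (cases "tl v" rule: rev_cases) (auto simp: zeros_def nth_append)
        moreover have "(smul R c v @ zeros R acc) ! length acc = c \<otimes> last v"
          using True acc(1) lv assms(3) by (auto simp: nth_append smul_def last_conv_nth)
        moreover have "last v \<in> carrier R" using assms by auto
        ultimately show ?thesis using True c by simp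
      next
        case False
        then have l: "length v \<le> length acc" "acc \<noteq> []" using acc(1) lv by (cases u; auto)+
        then have "(\<zero> # acc) ! length acc = last acc" by (simp add: last_conv_nth nth_Cons')
        moreover have "(smul R c v @ zeros R acc) ! length acc = \<zero>"
          using l lv by (auto simp: nth_append zeros_def smul_def)
        moreover have "last acc \<in> carrier R" using l acc(2) by auto
        ultimately show ?thesis using False acc(4) by simp
      qed
      finally show "last (mulL R (c # u) v) = last (c # u) \<otimes> last v" .
    qed
  qed
  then show "length (mulL R u v) = length u + length v - 1" "set (mulL R u v) \<subseteq> carrier R"
    "x \<in> carrier R \<Longrightarrow> ev R (mulL R u v) x = ev R u x \<otimes> ev R v x"
    "u \<noteq> [] \<Longrightarrow> last (mulL R u v) = last u \<otimes> last v" by blast+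
qed

end

section \<open>Counting roots\<close>

context cring begin

text \<open>The quotient of \<open>u - u(a)\<close> by \<open>T - a\<close>.\<close>

fun quo :: "'a \<Rightarrow> 'a list \<Rightarrow> 'a list" where
  "quo a (c # d # u) = ev R (d # u) a # quo a (d # u)"
| "quo a _ = []"

lemma quo_closed: "a \<in> carrier R \<Longrightarrow> set u \<subseteq> carrier R \<Longrightarrow> set (quo a u) \<subseteq> carrier R"
  by (induction a u rule: quo.induct) auto

lemma length_quo: "length (quo a u) = length u - 1"
  by (induction a u rule: quo.induct) auto

lemma quo_eq:
  "a \<in> carrier R \<Longrightarrow> set u \<subseteq> carrier R \<Longrightarrow> x \<in> carrier R \<Longrightarrow>
   ev R u x \<ominus> ev R u a = (x \<ominus> a) \<otimes> ev R (quo a u) x"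
proof (induction a u rule: quo.induct)
  case (1 a c d u)
  define A where "A = ev R (d # u) a"
  define B where "B = ev R (d # u) x"
  define Q where "Q = ev R (quo a (d # u)) x"
  have cl: "c \<in> carrier R" "A \<in> carrier R" "B \<in> carrier R" "Q \<in> carrier R" "a \<in> carrier R" "x \<in> carrier R"
    using 1 quo_closed[of a "d # u"] unfolding A_def B_def Q_def by (auto intro!: ev_closed)
  have IH: "B \<ominus> A = (x \<ominus> a) \<otimes> Q" using 1 unfolding A_def B_def Q_def by simp
  have "ev R (c # d # u) x \<ominus> ev R (c # d # u) a = (c \<oplus> x \<otimes> B) \<ominus> (c \<oplus> a \<otimes> A)"
    by (simp add: A_def B_def)
  also have "\<dots> = (x \<ominus> a) \<otimes> A \<oplus> x \<otimes> (B \<ominus> A)" using cl by algebra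
  also have "\<dots> = (x \<ominus> a) \<otimes> (A \<oplus> x \<otimes> Q)" unfolding IH using cl by algebra
  finally show ?case by (simp add: A_def Q_def)
qed (auto simp: minus_eq r_neg)

text \<open>By Horner's scheme the coefficients of the quotient determine those of \<open>u\<close>
  from the top down, except for the constant one.\<close>

lemma quo_zero:
  "a \<in> carrier R \<Longrightarrow> set u \<subseteq> carrier R \<Longrightarrow> set (quo a u) \<subseteq> {\<zero>} \<Longrightarrow> set (tl u) \<subseteq> {\<zero>}"
proof (induction a u rule: quo.induct)
  case (1 a c d u)
  then have u: "set u \<subseteq> {\<zero>}" by simp
  then have "ev R u a = \<zero>" using 1(2) by (induction u) auto
  then show ?case using 1 u by simp
qed auto

end

text \<open>Induction, dividing by \<open>T - a\<close> for one of the roots. The conclusion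
  concerns the coefficients and not the function, which later allows a constant coefficient to be
  identified from values at \<open>r\<close> points.\<close>

lemma (in domain) roots_zero:
  assumes "set u \<subseteq> carrier R" "A \<subseteq> carrier R" "finite A" "length u \<le> card A" "\<And>x. x \<in> A \<Longrightarrow> ev R u x = \<zero>"
  shows "set u \<subseteq> {\<zero>}"
  using assms
proof (induction "length u" arbitrary: u A)
  case (Suc n)
  obtain c u' where u: "u = c # u'" using Suc(2) by (cases u) auto
  have "A \<noteq> {}" using Suc by auto
  then obtain a where a: "a \<in> A" by auto
  have aR: "a \<in> carrier R" using a Suc by auto
  have "set (quo a u) \<subseteq> {\<zero>}"
  proof (rule Suc.hyps(1)[of _ "A - {a}"])
    show "n = length (quo a u)" using Suc(2) by (simp add: length_quo)
    then show "length (quo a u) \<le> card (A - {a})" using Suc a by simp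
    show "set (quo a u) \<subseteq> carrier R" using Suc aR by (intro quo_closed)
    fix x assume x: "x \<in> A - {a}"
    then have xR: "x \<in> carrier R" using Suc by auto
    have "(x \<ominus> a) \<otimes> ev R (quo a u) x = \<zero>"
      using quo_eq[OF aR Suc(3) xR] Suc(7)[of x] Suc(7)[OF a] x by (simp add: minus_eq)
    moreover have "x \<ominus> a \<noteq> \<zero>" using x xR aR by auto
    ultimately show "ev R (quo a u) x = \<zero>"
      using integral xR aR quo_closed[OF aR Suc(3)] by (metis ev_closed minus_closed)
  qed (use Suc in auto)
  then have t: "set u' \<subseteq> {\<zero>}" using quo_zero[OF aR Suc(3)] by (simp add: u)
  then have "ev R u' a = \<zero>" using aR by (induction u') auto
  then have "c = \<zero>" using Suc(7)[OF a] Suc(3) aR by (simp add: u)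
  then show ?case using t by (simp add: u)
qed simp

lemma (in domain) roots_bound:
  assumes "set u \<subseteq> carrier R" "u \<noteq> []" "last u \<noteq> \<zero>" "A \<subseteq> {x \<in> carrier R. ev R u x = \<zero>}"
  shows "finite A \<and> card A < length u"
proof (rule ccontr)
  assume n: "\<not> ?thesis"
  have "\<exists>B. B \<subseteq> A \<and> finite B \<and> length u \<le> card B"
  proof (cases "finite A")
    case True
    then show ?thesis using n by (intro exI[of _ A]) auto
  next
    case False
    then show ?thesis using infinite_arbitrarily_large[of A "length u"] by auto
  qed
  then obtain B where B: "B \<subseteq> A" "finite B" "length u \<le> card B" by blast
  have "set u \<subseteq> {\<zero>}" by (rule roots_zero[of u B]) (use assms B in auto)
  moreover have "last u \<in> set u" using assms(2) by (rule last_in_set)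
  ultimately show False using assms(3) by blast
qed

section \<open>Graeffe transforms\<close>

text \<open>A recursive form of \<open>every\<close>, with an arbitrary offset \<open>j\<close> so
  that all residue classes of exponents modulo \<open>r\<close> can be treated.\<close>

fun pick :: "nat \<Rightarrow> nat \<Rightarrow> 'c list \<Rightarrow> 'c list" where
  "pick r j [] = []"
| "pick r 0 (a # u) = a # pick r (r - 1) u"
| "pick r (Suc j) (a # u) = pick r j u"

lemma every_eq_pick: "every r u = pick r 0 u"
proof -
  have "rev (snd (fold (\<lambda>a s. if fst s = 0 then (r - 1, a # snd s) else (fst s - 1, snd s)) u (j, acc))) =
      rev acc @ pick r j u" for j acc
    by (induction r j u arbitrary: acc rule: pick.induct) simp_all
  then show ?thesis by (simp add: every_def)
qed

lemma set_pick: "set (pick r j u) \<subseteq> set u"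
  by (induction r j u rule: pick.induct) auto

text \<open>For \<open>j = 0\<close>: the product of the \<open>r\<close> conjugates has degree
  \<open>r * deg f\<close>, a multiple of \<open>r\<close>, so its leading coefficient survives the
  selection.\<close>

lemma pick_last: "length u = r * m + j + 1 \<Longrightarrow> j < r \<Longrightarrow> length (pick r j u) = m + 1 \<and> last (pick r j u) = last u"
proof (induction r j u arbitrary: m rule: pick.induct)
  case (2 r a u)
  show ?case
  proof (cases m)
    case 0
    then show ?thesis using 2 by simp
  next
    case (Suc m')
    then have "length u = r * m' + (r - 1) + 1" "r - 1 < r" using 2 by auto
    then show ?thesis using 2(1)[of m'] Suc by (auto split: if_splits)
  qed
next
  case (3 r j a u)
  then have "length u = r * m + j + 1" "j < r" by auto
  then show ?case using 3(1)[of m] by (auto split: if_splits)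
qed auto

context cring begin

text \<open>Sorting terms by exponent modulo \<open>r\<close> gives \<open>u(x)\<close> as the sum
  of \<open>x ^ j * u_j(x ^ r)\<close> over \<open>j < r\<close>. For fixed \<open>c\<close> the
  right-hand side is the remainder of \<open>u\<close> modulo \<open>T ^ r - c\<close>, evaluated at
  \<open>x\<close>.\<close>

lemma ev_pick:
  assumes "r \<ge> 1" "set u \<subseteq> carrier R" "x \<in> carrier R" and c: "c = x [^] r"
  shows "ev R u x = ev R (map (\<lambda>j. ev R (pick r j u) c) [0..<r]) x"
  using assms(2)
proof (induction u)
  case Nil
  have "ev R (map (\<lambda>j. \<zero>) js) x = \<zero>" for js :: "nat list" using assms by (induction js) auto
  then show ?case by simp
next
  case (Cons a u)
  define g where "g j = ev R (pick r j u) c" for j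
  have cR: "c \<in> carrier R" using assms by simp
  have g: "g j \<in> carrier R" for j unfolding g_def
    using set_pick[of r j u] Cons.prems cR by (intro ev_closed) auto
  have r: "[0..<r] = 0 # map Suc [0..<r - 1]" using assms(1) by (simp add: map_Suc_upt upt_conv_Cons)
  have r': "[0..<r] = [0..<r - 1] @ [r - 1]" using assms(1) by (cases r) auto
  have IH: "ev R u x = ev R (map g [0..<r - 1]) x \<oplus> (x [^] (r - 1) \<otimes> g (r - 1))"
    using Cons unfolding g_def[symmetric] r' by (simp add: ev_snoc g assms image_subset_iff)
  have "map (\<lambda>j. ev R (pick r j (a # u)) c) [0..<r] = (a \<oplus> (c \<otimes> g (r - 1))) # map g [0..<r - 1]"
    unfolding r by (simp add: g_def)
  then have "ev R (map (\<lambda>j. ev R (pick r j (a # u)) c) [0..<r]) x =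
     (a \<oplus> (c \<otimes> g (r - 1))) \<oplus> (x \<otimes> ev R (map g [0..<r - 1]) x)" by simp
  also have "\<dots> = ev R (a # u) x"
  proof -
    have cx: "c = x \<otimes> x [^] (r - 1)" using assms(1,3) unfolding c
      by (metis One_nat_def Suc_diff_1 less_le_trans nat_pow_Suc2 zero_less_one)
    show ?thesis using Cons.prems assms(3) g unfolding cx
      by (simp add: IH r_distr a_ac m_assoc image_subset_iff)
  qed
  finally show ?case by simp
qed

lemma graeffe_prod_props:
  assumes "set f \<subseteq> carrier R" "f \<noteq> []" "\<zeta> \<in> carrier R"
  shows "length (graeffe_prod R ks \<zeta> f) = length ks * (length f - 1) + 1"
    "set (graeffe_prod R ks \<zeta> f) \<subseteq> carrier R"
    "x \<in> carrier R \<Longrightarrow> k \<in> set ks \<Longrightarrow> ev R f (\<zeta> [^] k \<otimes> x) = \<zero> \<Longrightarrow> ev R (graeffe_prod R ks \<zeta> f) x = \<zero>"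
proof -
  have "length (graeffe_prod R ks \<zeta> f) = length ks * (length f - 1) + 1 \<and>
    set (graeffe_prod R ks \<zeta> f) \<subseteq> carrier R \<and>
    (x \<in> carrier R \<longrightarrow> k \<in> set ks \<longrightarrow> ev R f (\<zeta> [^] k \<otimes> x) = \<zero> \<longrightarrow> ev R (graeffe_prod R ks \<zeta> f) x = \<zero>)"
  proof (induction ks)
    case Nil
    show ?case by (simp add: graeffe_prod_def)
  next
    case (Cons j ks)
    define P where "P = graeffe_prod R ks \<zeta> f"
    have *: "graeffe_prod R (j # ks) \<zeta> f = mulL R (sc R (\<zeta> [^] j) f) P"
      using assms by (simp add: graeffe_prod_def P_def pw_eq)
    have P: "length P = length ks * (length f - 1) + 1" "set P \<subseteq> carrier R" "P \<noteq> []"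
      using Cons by (auto simp: P_def)
    have s: "set (sc R (\<zeta> [^] j) f) \<subseteq> carrier R" using assms by simp
    note m = mulL_props[OF s P(2,3)]
    have "ev R (graeffe_prod R (j # ks) \<zeta> f) x = \<zero>"
      if "x \<in> carrier R" "k \<in> set (j # ks)" "ev R f (\<zeta> [^] k \<otimes> x) = \<zero>"
    proof -
      have "ev R (graeffe_prod R (j # ks) \<zeta> f) x = ev R f (\<zeta> [^] j \<otimes> x) \<otimes> ev R P x"
        unfolding * using that assms by (simp add: m(3))
      moreover have "ev R f (\<zeta> [^] j \<otimes> x) = \<zero> \<or> ev R P x = \<zero>" using that Cons.IH by (auto simp: P_def)
      moreover have "ev R f (\<zeta> [^] j \<otimes> x) \<in> carrier R" "ev R P x \<in> carrier R"
        using assms P that by (auto intro!: ev_closed)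
      ultimately show ?thesis by auto
    qed
    moreover have "length f \<ge> 1" using assms(2) by (simp add: Suc_le_eq)
    ultimately show ?case using m(1,2) P(1) unfolding * by auto
  qed
  then show "length (graeffe_prod R ks \<zeta> f) = length ks * (length f - 1) + 1"
    "set (graeffe_prod R ks \<zeta> f) \<subseteq> carrier R"
    "x \<in> carrier R \<Longrightarrow> k \<in> set ks \<Longrightarrow> ev R f (\<zeta> [^] k \<otimes> x) = \<zero> \<Longrightarrow> ev R (graeffe_prod R ks \<zeta> f) x = \<zero>"
    by blast+
qed

end

context domain begin

lemma nat_pow_nonzero: "x \<in> carrier R \<Longrightarrow> x \<noteq> \<zero> \<Longrightarrow> x [^] (n::nat) \<noteq> \<zero>"
  by (induction n) (auto simp: integral_iff)

lemma last_sc: "k \<in> carrier R \<Longrightarrow> k \<noteq> \<zero> \<Longrightarrow> set f \<subseteq> carrier R \<Longrightarrow> f \<noteq> [] \<Longrightarrow> last f \<noteq> \<zero> \<Longrightarrow> last (sc R k f) \<noteq> \<zero>"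
proof (induction f)
  case (Cons a f)
  show ?case
  proof (cases "f = []")
    case False
    then have "sc R k f \<noteq> []" by (metis length_0_conv sc_simps(3))
    then have "last (smul R k (sc R k f)) = k \<otimes> last (sc R k f)" by (simp add: smul_def last_map)
    moreover have "last (sc R k f) \<in> carrier R"
      using \<open>sc R k f \<noteq> []\<close> Cons.prems sc_closed[of k f, THEN subsetD, OF _ _ last_in_set] by auto
    moreover have "smul R k (sc R k f) \<noteq> []" using \<open>sc R k f \<noteq> []\<close> by (metis length_0_conv smul_simps(3))
    ultimately show ?thesis using Cons False by (simp add: integral_iff)
  qed (use Cons in simp)
qed simp

lemma graeffe_prod_last:
  assumes "set f \<subseteq> carrier R" "f \<noteq> []" "last f \<noteq> \<zero>" "\<zeta> \<in> carrier R" "\<zeta> \<noteq> \<zero>"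
  shows "last (graeffe_prod R ks \<zeta> f) \<noteq> \<zero>"
proof (induction ks)
  case Nil
  show ?case by (simp add: graeffe_prod_def)
next
  case (Cons j ks)
  define P where "P = graeffe_prod R ks \<zeta> f"
  have *: "graeffe_prod R (j # ks) \<zeta> f = mulL R (sc R (\<zeta> [^] j) f) P"
    using assms by (simp add: graeffe_prod_def P_def pw_eq)
  have P: "length P = length ks * (length f - 1) + 1" "set P \<subseteq> carrier R" "P \<noteq> []"
    using graeffe_prod_props(1,2)[OF assms(1,2,4), of ks] by (auto simp: P_def)
  have s: "set (sc R (\<zeta> [^] j) f) \<subseteq> carrier R" "sc R (\<zeta> [^] j) f \<noteq> []"
    using assms by (simp, metis length_0_conv sc_simps(3))
  have "last (sc R (\<zeta> [^] j) f) \<in> carrier R" "last P \<in> carrier R" using s P by auto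
  moreover have "last (sc R (\<zeta> [^] j) f) \<noteq> \<zero>" using assms nat_pow_nonzero by (intro last_sc) auto
  ultimately show ?case unfolding * using mulL_props(4)[OF s(1) P(2,3) s(2)] Cons.IH by (simp add: integral_iff P_def)
qed

definition prim_root :: "nat \<Rightarrow> 'a \<Rightarrow> bool" where
  "prim_root n z \<longleftrightarrow> z \<in> carrier R \<and> 0 < n \<and> z [^] n = \<one> \<and> (\<forall>k. 0 < k \<and> k < n \<longrightarrow> z [^] k \<noteq> \<one>)"

lemma prim_rootD:
  assumes "prim_root n z"
  shows "z \<in> carrier R" "n > 0" "z [^] n = \<one>" "z \<noteq> \<zero>" "z [^] (k::nat) \<in> carrier R" "z [^] k \<noteq> \<zero>"
proof -
  show z: "z \<in> carrier R" "n > 0" "z [^] n = \<one>" using assms by (auto simp: prim_root_def)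
  show nz: "z \<noteq> \<zero>" using z by (cases n) auto
  show "z [^] k \<in> carrier R" "z [^] k \<noteq> \<zero>" using z nz nat_pow_nonzero by auto
qed

lemma prim_root_mod:
  assumes "prim_root n z"
  shows "z [^] (k::nat) = z [^] (k mod n)"
proof -
  have "z [^] k = z [^] (n * (k div n)) \<otimes> z [^] (k mod n)"
    using prim_rootD[OF assms] by (simp add: nat_pow_mult)
  also have "z [^] (n * (k div n)) = \<one>"
    using prim_rootD[OF assms] by (simp add: nat_pow_pow[symmetric])
  finally show ?thesis using prim_rootD[OF assms] by simp
qed

lemma prim_root_inj:
  assumes "prim_root n z" "i < n" "j < n" "z [^] i = z [^] j"
  shows "i = j"
proof -
  have *: "i = j" if "i \<le> j" "j < n" "z [^] i = z [^] j" for i j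
  proof (rule ccontr)
    assume "i \<noteq> j"
    then have ij: "0 < j - i" "j - i < n" using that by auto
    have "z [^] i \<otimes> z [^] (j - i) = z [^] (i + (j - i))"
      using prim_rootD[OF assms(1)] by (intro nat_pow_mult)
    also have "\<dots> = z [^] i \<otimes> \<one>"
      using that(1,3) prim_rootD[OF assms(1)] by simp
    finally have "z [^] i \<otimes> z [^] (j - i) = z [^] i \<otimes> \<one>" .
    then have "z [^] (j - i) = \<one>" using prim_rootD[OF assms(1)] m_lcancel[of "z [^] i" "z [^] (j - i)" \<one>] by auto
    then show False using assms(1) ij by (auto simp: prim_root_def)
  qed
  show ?thesis using *[of i j] *[of j i] assms by (cases "i \<le> j") auto
qed

lemma prim_root_card:
  assumes "prim_root n z" "y \<in> carrier R" "y \<noteq> \<zero>"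
  shows "card ((\<lambda>k. z [^] k \<otimes> y) ` {..<n}) = n" "(\<lambda>k. z [^] k \<otimes> y) ` {..<n} \<subseteq> carrier R"
    "inj_on (\<lambda>k. z [^] k \<otimes> y) {..<n}"
proof -
  show i: "inj_on (\<lambda>k. z [^] k \<otimes> y) {..<n}"
    using assms prim_rootD[OF assms(1)] prim_root_inj[OF assms(1)] by (auto simp: inj_on_def m_rcancel)
  show "card ((\<lambda>k. z [^] k \<otimes> y) ` {..<n}) = n" using card_image[OF i] by simp
  show "(\<lambda>k. z [^] k \<otimes> y) ` {..<n} \<subseteq> carrier R" using assms prim_rootD[OF assms(1)] by auto
qed

text \<open>All coefficients of \<open>\<Prod>k<r. f(\<zeta>^k x)\<close> except those of powers of \<open>x\<^sup>r\<close> vanish: for a root \<open>\<alpha>\<close> of \<open>f\<close> the product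
  vanishes at the \<open>r\<close> points \<open>\<zeta>^k \<alpha>\<close>, hence so does its remainder modulo \<open>x\<^sup>r - \<alpha>\<^sup>r\<close>.\<close>

lemma graeffe_props:
  assumes "set f \<subseteq> carrier R" "f \<noteq> []" "last f \<noteq> \<zero>" "prim_root r \<zeta>"
  shows "length (graeffe R [0..<r] \<zeta> f) = length f" "set (graeffe R [0..<r] \<zeta> f) \<subseteq> carrier R"
    "last (graeffe R [0..<r] \<zeta> f) \<noteq> \<zero>"
    "x \<in> carrier R \<Longrightarrow> x \<noteq> \<zero> \<Longrightarrow> ev R f x = \<zero> \<Longrightarrow> ev R (graeffe R [0..<r] \<zeta> f) (x [^] r) = \<zero>"
proof -
  note z = prim_rootD[OF assms(4)]
  define P where "P = graeffe_prod R [0..<r] \<zeta> f"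
  have P: "length P = r * (length f - 1) + 1" "set P \<subseteq> carrier R" "last P \<noteq> \<zero>"
    using graeffe_prod_props(1,2)[OF assms(1,2) z(1), of "[0..<r]"] graeffe_prod_last[OF assms(1-3) z(1,4)]
    by (auto simp: P_def)
  have l: "length (every r P) = length f" "last (every r P) = last P"
    using pick_last[of P r "length f - 1" 0] P z(2) assms(2) by (auto simp: every_eq_pick)
  have g: "graeffe R [0..<r] \<zeta> f = every r P"
    using l by (simp add: graeffe_def P_def[symmetric])
  show "length (graeffe R [0..<r] \<zeta> f) = length f" "last (graeffe R [0..<r] \<zeta> f) \<noteq> \<zero>"
    using g l P by auto
  show "set (graeffe R [0..<r] \<zeta> f) \<subseteq> carrier R" using P set_pick[of r 0 P] by (auto simp: g every_eq_pick)
  assume x: "x \<in> carrier R" "x \<noteq> \<zero>" "ev R f x = \<zero>"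
  define c where "c = x [^] r"
  define V where "V = map (\<lambda>j. ev R (pick r j P) c) [0..<r]"
  let ?A = "(\<lambda>k. \<zeta> [^] k \<otimes> x) ` {..<r}"
  have c: "c \<in> carrier R" using x by (simp add: c_def)
  have V: "set V \<subseteq> carrier R" using P set_pick[of r _ P] c by (auto simp: V_def intro!: ev_closed)
  have "set V \<subseteq> {\<zero>}"
  proof (rule roots_zero[of V ?A])
    show "length V \<le> card ?A" using prim_root_card(1)[OF assms(4) x(1,2)] by (simp add: V_def)
    fix t assume "t \<in> ?A"
    then obtain k where k: "k < r" "t = \<zeta> [^] k \<otimes> x" by auto
    have t: "t \<in> carrier R" using k x z by auto
    have "t [^] r = (\<zeta> [^] k) [^] r \<otimes> c" using k x z(5) by (simp add: nat_pow_distrib c_def)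
    also have "(\<zeta> [^] k) [^] r = (\<zeta> [^] r) [^] k" using z(1) by (simp add: nat_pow_pow mult.commute)
    finally have tr: "t [^] r = c" using z(3) c by simp
    \<comment> \<open>The additive inverse of \<open>k\<close> modulo \<open>r\<close>: the factor
      \<open>f(\<zeta> ^ k' T)\<close> of the product takes the value \<open>f(x) = 0\<close> at
      \<open>t = \<zeta> ^ k x\<close>.\<close>
    define k' where "k' = (r - k) mod r"
    have k': "k' < r" using z(2) by (simp add: k'_def)
    have "\<zeta> [^] k' \<otimes> t = \<zeta> [^] (k' + k) \<otimes> x" using k x z by (simp add: m_assoc[symmetric] nat_pow_mult)
    also have "\<zeta> [^] (k' + k) = \<one>"
    proof -
      have "(k' + k) mod r = 0" using k by (cases "k = 0") (auto simp: k'_def)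
      then show ?thesis using prim_root_mod[OF assms(4), of "k' + k"] by simp
    qed
    finally have "ev R f (\<zeta> [^] k' \<otimes> t) = \<zero>" using x by simp
    then have "ev R P t = \<zero>" unfolding P_def
      using k' by (intro graeffe_prod_props(3)[OF assms(1,2) z(1) t, of k']) auto
    then show "ev R V t = \<zero>" using ev_pick[of r P t c] z(2) P(2) t tr by (simp add: V_def)
  qed (use V prim_root_card(2)[OF assms(4) x(1,2)] in auto)
  then have "ev R (pick r 0 P) c = \<zero>" using z(2) by (auto simp: V_def image_subset_iff)
  then show "ev R (graeffe R [0..<r] \<zeta> f) (x [^] r) = \<zero>" by (simp add: g every_eq_pick c_def)
qed

end

section \<open>Extraction of roots\<close>

lemma (in domain) finprod_nonzero:
  assumes "finite A" "f \<in> A \<rightarrow> carrier R" "\<And>x. x \<in> A \<Longrightarrow> f x \<noteq> \<zero>"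
  shows "finprod R f A \<noteq> \<zero>"
  using assms
proof (induction A)
  case (insert a A)
  then have "finprod R f (insert a A) = f a \<otimes> finprod R f A" by (intro finprod_insert) auto
  moreover have "f a \<in> carrier R" "finprod R f A \<in> carrier R" using insert by (auto intro: finprod_closed)
  ultimately show ?case using insert integral_iff by auto
qed simp

text \<open>The orbit already has \<open>r\<close> elements, and \<open>T ^ r - y ^ r\<close> has at
  most \<open>r\<close> roots, so counting gives equality.\<close>

lemma (in domain) orbit_eq:
  assumes "prim_root r \<zeta>" "y \<in> carrier R" "y \<noteq> \<zero>"
  shows "{t \<in> carrier R. t [^] r = y [^] r} = (\<lambda>k. \<zeta> [^] k \<otimes> y) ` {..<r}" (is "?A = ?B")
proof -
  note z = prim_rootD[OF assms(1)]
  let ?f = "(\<ominus> (y [^] r)) # zeros R [0..<r - 1] @ [\<one>]"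
  have ev: "ev R ?f t = \<ominus> (y [^] r) \<oplus> t [^] r" if "t \<in> carrier R" for t
  proof -
    have "t [^] r = t \<otimes> t [^] (r - 1)" using z(2) that
      by (metis One_nat_def Suc_diff_1 nat_pow_Suc2)
    then show ?thesis using that by (simp add: ev_snoc)
  qed
  have "finite ?A \<and> card ?A < length ?f"
  proof (rule roots_bound)
    show "?A \<subseteq> {x \<in> carrier R. ev R ?f x = \<zero>}"
    proof
      fix x assume "x \<in> ?A"
      then show "x \<in> {x \<in> carrier R. ev R ?f x = \<zero>}"
        using ev[of x] assms l_neg[of "y [^] r"] by (simp del: ev_simps)
    qed
  qed (use assms in \<open>auto simp: zeros_def\<close>)
  moreover have "?B \<subseteq> ?A"
  proof
    fix t assume "t \<in> ?B"
    then obtain k :: nat where k: "t = \<zeta> [^] k \<otimes> y" by auto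
    have "t [^] r = (\<zeta> [^] k) [^] r \<otimes> y [^] r" using k assms z(5) by (simp add: nat_pow_distrib)
    also have "(\<zeta> [^] k) [^] r = (\<zeta> [^] r) [^] k" using z(1) by (simp add: nat_pow_pow mult.commute)
    finally show "t \<in> ?A" using k assms z by simp
  qed
  ultimately show ?thesis using prim_root_card(1)[OF assms] z(2)
    by (intro card_seteq[symmetric]) auto
qed

lemma (in domain) root_of_unity:
  assumes "prim_root n z" "t \<in> carrier R" "t [^] n = \<one>"
  obtains k where "k < n" "t = z [^] k"
proof -
  have "t \<in> {t \<in> carrier R. t [^] n = \<one> [^] n}" using assms by simp
  then have "t \<in> (\<lambda>k. z [^] k \<otimes> \<one>) ` {..<n}" using orbit_eq[OF assms(1), of \<one>] by auto
  then show ?thesis using that prim_rootD[OF assms(1)] by auto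
qed

locale fin_field = field R for R (structure) +
  fixes q :: nat
  assumes finite_carrier: "finite (carrier R)" and card_carrier: "card (carrier R) = q"
begin

lemma q_ge_2: "q \<ge> 2"
proof -
  have "card {\<zero>, \<one>} \<le> q" unfolding card_carrier[symmetric] by (rule card_mono[OF finite_carrier]) auto
  then show ?thesis by simp
qed

lemma fermat: "x \<in> carrier R \<Longrightarrow> x \<noteq> \<zero> \<Longrightarrow> x [^] (q - 1) = \<one>"
proof -
  assume x: "x \<in> carrier R" "x \<noteq> \<zero>"
  interpret M: group "Multiplicative_Group.mult_of R" by (rule field_mult_group)
  have "x [^]\<^bsub>Multiplicative_Group.mult_of R\<^esub> order (Multiplicative_Group.mult_of R) = \<one>\<^bsub>Multiplicative_Group.mult_of R\<^esub>"
    by (rule M.pow_order_eq_1) (use x in simp)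
  moreover have "order (Multiplicative_Group.mult_of R) = q - 1"
    using order_mult_of[OF finite_carrier] by (simp add: order_def card_carrier)
  moreover have "x [^]\<^bsub>Multiplicative_Group.mult_of R\<^esub> n = x [^] n" for n :: nat
    by (induction n) simp_all
  ultimately show ?thesis by simp
qed

text \<open>Inverses are powers, so the algorithm manages without a division in the field.\<close>

lemma inverse_pow: "c \<in> carrier R \<Longrightarrow> c \<noteq> \<zero> \<Longrightarrow> c \<otimes> c [^] (q - 2) = \<one>"
proof -
  assume c: "c \<in> carrier R" "c \<noteq> \<zero>"
  have "q - 1 = Suc (q - 2)" using q_ge_2 by simp
  then have "c [^] (q - 1) = c \<otimes> c [^] (q - 2)" using c nat_pow_Suc2[of c "q - 2"] by simp
  then show ?thesis using fermat[OF c] by simp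
qed

end

text \<open>\<open>Y\<close> may be empty here; statements about the roots of \<open>c\<close> take
  a point of \<open>Y\<close> as a premise where they need one.\<close>

locale root_extraction = fin_field +
  fixes r :: nat and \<zeta> c m
  assumes r: "prime r" and \<zeta>: "prim_root r \<zeta>" and c: "c \<in> carrier R" "c \<noteq> \<zero>" and m: "m = \<ominus> \<one>"
begin

abbreviation "rs \<equiv> [0..<r]"
abbreviation "h \<equiv> modl R c rs"
definition "Y = {y \<in> carrier R. y [^] r = c}"

lemmas z = prim_rootD[OF \<zeta>]

lemma r2: "r \<ge> 2" using r by (rule prime_ge_2_nat)

lemma h_props: "length h = r" "set h \<subseteq> carrier R" "h \<noteq> []"
  using r2 c by (auto simp: modl_def zeros_def)

lemma mR: "m \<in> carrier R" "a \<in> carrier R \<Longrightarrow> m \<otimes> a = \<ominus> a"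
  using m by (auto simp: l_minus)

lemma YR: "y \<in> Y \<Longrightarrow> y \<in> carrier R \<and> y \<noteq> \<zero>"
  using c r2 by (auto simp: Y_def nat_pow_zero)

lemma Y_cond: "y \<in> Y \<Longrightarrow> y [^] length h = ev R h y"
  using c unfolding h_props(1) by (simp add: Y_def modl_def)

lemma Y_orbit: "y \<in> Y \<Longrightarrow> Y = (\<lambda>k. \<zeta> [^] k \<otimes> y) ` {..<r}"
  using orbit_eq[OF \<zeta>, of y] YR[of y] by (simp add: Y_def)

lemma Y_mult: "y \<in> Y \<Longrightarrow> \<zeta> [^] (k::nat) \<otimes> y \<in> Y"
  using Y_orbit[of y] prim_root_mod[OF \<zeta>, of k] z(2) by (metis imageI lessThan_iff mod_less_divisor)

lemma Y_mult1: "y \<in> Y \<Longrightarrow> \<zeta> \<otimes> y \<in> Y"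
  using Y_mult[of y 1] z(1) by simp

lemma finite_Y: "finite Y" using finite_carrier by (simp add: Y_def)

lemma card_Y: "y \<in> Y \<Longrightarrow> card Y = r"
  using Y_orbit[of y] prim_root_card(1)[OF \<zeta>, of y] YR[of y] by simp

lemma mulm_h:
  assumes "length u = r" "set u \<subseteq> carrier R" "length v = r" "set v \<subseteq> carrier R"
  shows "length (mulm R h u v) = r" "set (mulm R h u v) \<subseteq> carrier R"
    "y \<in> Y \<Longrightarrow> ev R (mulm R h u v) y = ev R u y \<otimes> ev R v y"
  using mulm_props(1,2)[OF h_props(2) assms(2,4)] mulm_props(3)[OF h_props(2) assms(2,4) _ _ Y_cond] assms YR h_props(1)
  by auto

lemma pw_h:
  assumes "length E = r" "set E \<subseteq> carrier R"
  shows "length (pw (ext R h) E n) = r" "set (pw (ext R h) E n) \<subseteq> carrier R"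
    "y \<in> Y \<Longrightarrow> ev R (pw (ext R h) E n) y = ev R E y [^] n"
  using pw_ext_props(1,2)[OF h_props(3,2)] pw_ext_props(3)[OF h_props(3,2) _ _ _ Y_cond] assms YR h_props(1)
  by auto

lemma linl_props:
  assumes "a \<in> carrier R"
  shows "length (linl R a rs) = r" "set (linl R a rs) \<subseteq> carrier R" "y \<in> Y \<Longrightarrow> ev R (linl R a rs) y = a \<oplus> y"
  using assms r2 YR by (auto simp: linl_def)

lemma norm_list:
  assumes "length \<theta> = r" "set \<theta> \<subseteq> carrier R" "distinct ks"
  defines "\<Theta> \<equiv> foldr (\<lambda>k acc. mulm R h (sc R (pw R \<zeta> k) \<theta>) acc) ks (onel R h)"
  shows "length \<Theta> = r \<and> set \<Theta> \<subseteq> carrier R \<and>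
    (y \<in> Y \<longrightarrow> ev R \<Theta> y = finprod R (\<lambda>k. ev R \<theta> (\<zeta> [^] k \<otimes> y)) (set ks))"
  using assms(3) unfolding \<Theta>_def
proof (induction ks)
  case Nil
  show ?case using onel_props[of h] h_props YR by auto
next
  case (Cons k ks)
  define P where "P = foldr (\<lambda>k acc. mulm R h (sc R (pw R \<zeta> k) \<theta>) acc) ks (onel R h)"
  have P: "length P = r" "set P \<subseteq> carrier R"
    "y \<in> Y \<Longrightarrow> ev R P y = finprod R (\<lambda>k. ev R \<theta> (\<zeta> [^] k \<otimes> y)) (set ks)" using Cons by (auto simp: P_def)
  have s: "length (sc R (\<zeta> [^] k) \<theta>) = r" "set (sc R (\<zeta> [^] k) \<theta>) \<subseteq> carrier R" using assms z by auto
  note mm = mulm_h[OF s P(1,2)]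
  have "ev R (mulm R h (sc R (\<zeta> [^] k) \<theta>) P) y = finprod R (\<lambda>k. ev R \<theta> (\<zeta> [^] k \<otimes> y)) (set (k # ks))" if y: "y \<in> Y"
  proof -
    have cl: "ev R \<theta> (\<zeta> [^] j \<otimes> y) \<in> carrier R" for j :: nat using assms z YR[OF y] by simp
    have "ev R (mulm R h (sc R (\<zeta> [^] k) \<theta>) P) y = ev R \<theta> (\<zeta> [^] k \<otimes> y) \<otimes> ev R P y"
      using mm(3)[OF y] assms z YR[OF y] by simp
    also have "\<dots> = finprod R (\<lambda>k. ev R \<theta> (\<zeta> [^] k \<otimes> y)) (set (k # ks))"
      using Cons.prems cl P(3)[OF y] by (simp add: finprod_insert)
    finally show ?thesis .
  qed
  moreover have "foldr (\<lambda>k acc. mulm R h (sc R (pw R \<zeta> k) \<theta>) acc) (k # ks) (onel R h) = mulm R h (sc R (\<zeta> [^] k) \<theta>) P"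
    using z(1) by (simp add: P_def pw_eq)
  ultimately show ?case using mm(1,2) by simp
qed

text \<open>Multiplication by \<open>\<zeta>\<close> permutes \<open>Y\<close>, so the product of
  the conjugates has the same value \<open>W\<close> at all \<open>r\<close> points. Subtracting
  \<open>W\<close> from the constant coefficient leaves a list of length \<open>r\<close> with
  \<open>r\<close> zeros, which vanishes by \<open>roots_zero\<close>.\<close>

lemma normp_eq:
  assumes \<theta>: "length \<theta> = r" "set \<theta> \<subseteq> carrier R" and "Y \<noteq> {}"
  shows "normp R rs \<zeta> h \<theta> = finprod R (ev R \<theta>) Y"
proof -
  define \<Theta> where "\<Theta> = foldr (\<lambda>k acc. mulm R h (sc R (pw R \<zeta> k) \<theta>) acc) rs (onel R h)"
  define W where "W = finprod R (ev R \<theta>) Y"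
  note n = norm_list[OF \<theta>, of rs, folded \<Theta>_def]
  have evY: "ev R \<theta> \<in> Y \<rightarrow> carrier R" using \<theta> YR by auto
  have W: "W \<in> carrier R" unfolding W_def using evY by (intro finprod_closed)
  have ev: "ev R \<Theta> y = W" if y: "y \<in> Y" for y
  proof -
    have "ev R \<Theta> y = finprod R (\<lambda>k. ev R \<theta> (\<zeta> [^] k \<otimes> y)) {..<r}" using n y by (simp add: atLeast0LessThan)
    also have "\<dots> = finprod R (ev R \<theta>) ((\<lambda>k. \<zeta> [^] k \<otimes> y) ` {..<r})"
      using evY Y_orbit[OF y] prim_root_card(3)[OF \<zeta>, of y] YR[OF y] by (intro finprod_reindex[symmetric]) auto
    finally show ?thesis unfolding W_def Y_orbit[OF y, symmetric] .
  qed
  obtain a t where at: "\<Theta> = a # t" using n r2 by (cases \<Theta>) auto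
  have cl: "a \<in> carrier R" "set t \<subseteq> carrier R" using n at by auto
  have "set ((a \<ominus> W) # t) \<subseteq> {\<zero>}"
  proof (rule roots_zero[of _ Y])
    show "length ((a \<ominus> W) # t) \<le> card Y" using n at card_Y assms(3) by auto
    fix y assume y: "y \<in> Y"
    have tc: "y \<otimes> ev R t y \<in> carrier R" using cl YR[OF y] by simp
    have "a \<oplus> y \<otimes> ev R t y = W" using ev[OF y] at by simp
    then have "(a \<ominus> W) \<oplus> y \<otimes> ev R t y = W \<ominus> W" using cl W tc by algebra
    then show "ev R ((a \<ominus> W) # t) y = \<zero>" using W by (simp add: minus_eq r_neg)
  qed (use cl W finite_Y Y_def in auto)
  then have "a = W" using cl W by auto
  then show ?thesis unfolding normp_def \<Theta>_def[symmetric] at W_def by simp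
qed

lemma sel_props:
  assumes E: "length E = r" "set E \<subseteq> carrier R"
  shows "length (sel R m q rs h E) = r" "set (sel R m q rs h E) \<subseteq> carrier R"
    "y \<in> Y \<Longrightarrow> ev R (sel R m q rs h E) y = (if ev R E y = \<zero> then y else \<one>)"
proof -
  define J where "J = pw (ext R h) E (q - 1)"
  note J = pw_h[OF E, where n = "q - 1", folded J_def]
  define D where "D = addl R (onel R h) (smul R m J)"
  have o: "length (onel R h) = r" "set (onel R h) \<subseteq> carrier R" using onel_props[of h] h_props by simp_all
  have D: "length D = r" "set D \<subseteq> carrier R" unfolding D_def
    using o J(1) by simp (intro addl_closed smul_closed o mR J)
  have D3: "ev R D y = \<one> \<ominus> ev R J y" if "y \<in> Y" for y
    unfolding D_def using o J(1,2) mR YR[OF that] onel_props(3)[OF h_props(3), of y] by (simp add: minus_eq)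
  note M = mulm_h[OF linl_props(1,2)[OF zero_closed] D(1,2)]
  have sel: "sel R m q rs h E = addl R J (mulm R h (linl R \<zero> rs) D)" by (simp add: sel_def J_def D_def Let_def)
  show "length (sel R m q rs h E) = r" "set (sel R m q rs h E) \<subseteq> carrier R"
    unfolding sel using J(1) M(1) by simp (intro addl_closed J M)
  assume y: "y \<in> Y"
  have yR: "y \<in> carrier R" "ev R E y \<in> carrier R" using YR[OF y] E by auto
  have "ev R (sel R m q rs h E) y = ev R J y \<oplus> y \<otimes> (\<one> \<ominus> ev R J y)"
    unfolding sel using J M y YR[OF y] linl_props(3)[OF zero_closed y] D3[OF y] by simp
  \<comment> \<open>The power \<open>q - 1\<close> turns every value into zero or one by Fermat; the
    exponent is positive, so that zero stays zero.\<close>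
  moreover have "ev R J y = (if ev R E y = \<zero> then \<zero> else \<one>)"
    using J(3)[OF y] fermat[OF yR(2)] q_ge_2 by (auto simp: nat_pow_zero)
  ultimately show "ev R (sel R m q rs h E) y = (if ev R E y = \<zero> then y else \<one>)"
    using yR by (auto simp: minus_eq r_neg)
qed

lemma prod_subset:
  assumes "y \<in> Y" "Z \<subseteq> Y"
  shows "\<exists>s::nat. finprod R (\<lambda>t. t) Z = y [^] card Z \<otimes> \<zeta> [^] s"
proof -
  have "finite Z" using finite_Y assms(2) finite_subset by blast
  then show ?thesis using assms(2)
  proof (induction Z)
    case empty
    show ?case by (rule exI[of _ 0]) simp
  next
    case (insert t Z)
    then obtain s :: nat where s: "finprod R (\<lambda>t. t) Z = y [^] card Z \<otimes> \<zeta> [^] s" by auto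
    obtain k :: nat where k: "t = \<zeta> [^] k \<otimes> y" using insert Y_orbit[OF assms(1)] by auto
    have "finprod R (\<lambda>t. t) (insert t Z) = t \<otimes> finprod R (\<lambda>t. t) Z"
      using insert YR by (intro finprod_insert) auto
    also have "\<dots> = y [^] card (insert t Z) \<otimes> \<zeta> [^] (k + s)"
      using insert(1,2) z(1) YR[OF assms(1)] unfolding s k
      by (simp add: nat_pow_mult[symmetric] m_ac)
    finally show ?case by blast
  qed
qed

text \<open>The norm of \<open>sel\<close> is the product over the zero set \<open>Z\<close> of
  \<open>E\<close> in \<open>Y\<close>, that is, \<open>y ^ e\<close> up to a power of
  \<open>\<zeta>\<close>. Both signs of \<open>E\<close> on \<open>Y\<close> are needed to get
  \<open>0 < e < r\<close>, and then primality of \<open>r\<close> makes \<open>e\<close> invertible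
  modulo \<open>r\<close>.\<close>

lemma extraction:
  assumes E: "length E = r" "set E \<subseteq> carrier R"
    and yz: "y1 \<in> Y" "ev R E y1 = \<zero>" "y2 \<in> Y" "ev R E y2 \<noteq> \<zero>" and y: "y \<in> Y"
  shows "y \<in> set (cands R rs \<zeta> (pw R c (q - 2)) (normp R rs \<zeta> h (sel R m q rs h E)))"
proof -
  define Z where "Z = {y \<in> Y. ev R E y = \<zero>}"
  define e where "e = card Z"
  note S = sel_props[OF E]
  have fZ: "finite Z" "finite (Y - Z)" "Z \<subseteq> Y" using finite_Y by (auto simp: Z_def)
  have e: "0 < e" "e < r"
  proof -
    show "0 < e" using yz fZ by (auto simp: e_def card_gt_0_iff Z_def)
    have "Z \<subset> Y" using yz by (auto simp: Z_def)
    then show "e < r" using psubset_card_mono[OF finite_Y] card_Y[OF y] by (simp add: e_def)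
  qed
  obtain s where s: "finprod R (\<lambda>t. t) Z = y [^] e \<otimes> \<zeta> [^] (s::nat)" using prod_subset[OF y fZ(3)] by (auto simp: e_def)
  define W where "W = normp R rs \<zeta> h (sel R m q rs h E)"
  have "W = finprod R (ev R (sel R m q rs h E)) Y" unfolding W_def using y by (intro normp_eq S) auto
  also have "\<dots> = finprod R (\<lambda>t. if t \<in> Z then t else \<one>) Y"
    by (intro finprod_cong') (use S(3) YR in \<open>auto simp: Z_def\<close>)
  also have "\<dots> = finprod R (\<lambda>t. if t \<in> Z then t else \<one>) (Z \<union> (Y - Z))" using fZ(3) by (simp add: Un_absorb1)
  also have "\<dots> = finprod R (\<lambda>t. if t \<in> Z then t else \<one>) Z \<otimes> finprod R (\<lambda>t. if t \<in> Z then t else \<one>) (Y - Z)"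
    by (rule finprod_Un_disjoint) (use fZ YR in auto)
  also have "finprod R (\<lambda>t. if t \<in> Z then t else \<one>) Z = finprod R (\<lambda>t. t) Z"
    by (intro finprod_cong') (use fZ YR in auto)
  also have "finprod R (\<lambda>t. if t \<in> Z then t else \<one>) (Y - Z) = \<one>"
    by (rule finprod_one_eqI) auto
  finally have W: "W = y [^] e \<otimes> \<zeta> [^] s" using s YR[OF y] z by simp
  have "\<not> r dvd e" using e by (auto dest: dvd_imp_le)
  then have "coprime e r" using prime_imp_coprime[OF r] by (simp add: coprime_commute)
  then obtain a0 where a0: "[e * a0 = 1] (mod r)" using cong_solve_coprime_nat[of e r] by auto
  define a where "a = a0 mod r"
  define b where "b = e * a div r"
  have a: "a < r" using r2 by (simp add: a_def)
  have "(e * a) mod r = 1" using a0 r2 by (simp add: a_def cong_def mod_mult_right_eq)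
  then have ea: "e * a = r * b + 1" using mult_div_mod_eq[of r "e * a"] by (simp add: b_def)
  \<comment> \<open>From \<open>e * a < r * r\<close>; this confines \<open>b\<close> to the range
    that \<open>cands\<close> searches.\<close>
  have b: "b < r"
  proof -
    have "e * a < r * r" using e a by (intro mult_strict_mono) auto
    then have "r * b < r * r" using ea by linarith
    then show ?thesis by simp
  qed
  \<comment> \<open>The exponent that cancels the unknown power of \<open>\<zeta>\<close>; the outer
    \<open>mod\<close> covers the case that \<open>s * a\<close> is a multiple of
    \<open>r\<close>.\<close>
  define j where "j = (r - (s * a) mod r) mod r"
  have j: "j < r" "\<zeta> [^] (s * a) \<otimes> \<zeta> [^] j = \<one>"
  proof -
    show "j < r" using r2 by (simp add: j_def)
    have "(s * a + j) mod r = ((s * a) mod r + (r - (s * a) mod r)) mod r" unfolding j_def by (simp add: mod_simps)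
    also have "\<dots> = 0" using r2 by (simp add: less_imp_le)
    finally have "\<zeta> [^] (s * a + j) = \<one>" using prim_root_mod[OF \<zeta>, of "s * a + j"] by simp
    then show "\<zeta> [^] (s * a) \<otimes> \<zeta> [^] j = \<one>" using z by (simp add: nat_pow_mult)
  qed
  define ci where "ci = c [^] (q - 2)"
  have ci: "ci \<in> carrier R" "c \<otimes> ci = \<one>" using c inverse_pow by (auto simp: ci_def)
  have yR: "y \<in> carrier R" "y [^] r = c" using y by (auto simp: Y_def)
  have WR: "W \<in> carrier R" using W yR z by simp
  have "W [^] a = y [^] (e * a) \<otimes> \<zeta> [^] (s * a)"
    using W yR z by (simp add: nat_pow_distrib nat_pow_pow)
  also have "y [^] (e * a) = c [^] b \<otimes> y"
    unfolding ea using yR by (simp add: nat_pow_mult[symmetric] nat_pow_pow[symmetric])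
  finally have "W [^] a \<otimes> ci [^] b \<otimes> \<zeta> [^] j = (c [^] b \<otimes> ci [^] b) \<otimes> y \<otimes> (\<zeta> [^] (s * a) \<otimes> \<zeta> [^] j)"
    using yR ci c z by (simp add: m_ac)
  also have "c [^] b \<otimes> ci [^] b = \<one>" using nat_pow_distrib[OF c(1) ci(1), of b] ci by simp
  finally have "W [^] a \<otimes> ci [^] b \<otimes> \<zeta> [^] j = y" using yR j by simp
  then have "y = (pw R W a \<otimes> pw R (pw R c (q - 2)) b) \<otimes> pw R \<zeta> j"
    using WR ci c z by (simp add: pw_eq ci_def)
  moreover have "a \<in> set rs" "b \<in> set rs" "j \<in> set rs" using a b j(1) by simp_all
  ultimately show ?thesis unfolding cands_def W_def[symmetric] set_concat set_map UN_iff image_image by blast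
qed

end

section \<open>A function of norm one and the powers at which its values meet\<close>

context root_extraction
begin

lemma finprod_power:
  "f \<in> A \<rightarrow> carrier R \<Longrightarrow> finprod R (\<lambda>y. f y [^] (n::nat)) A = finprod R f A [^] n"
proof (induction n)
  case (Suc n)
  have "finprod R (\<lambda>y. f y [^] n \<otimes> f y) A = finprod R (\<lambda>y. f y [^] n) A \<otimes> finprod R f A"
    by (rule finprod_multf) (use Suc.prems in auto)
  then show ?case using Suc by simp
qed simp

lemma finprod_zeta: "finprod R (\<lambda>k. \<zeta> [^] k) {..<n::nat} = \<zeta> [^] (\<Sum>k<n. k)"
proof (induction n)
  case (Suc n)
  have "finprod R (\<lambda>k. \<zeta> [^] k) (insert n {..<n}) = \<zeta> [^] n \<otimes> finprod R (\<lambda>k. \<zeta> [^] k) {..<n}"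
    by (rule finprod_insert) (use z in auto)
  then show ?case using Suc z by (simp add: lessThan_Suc nat_pow_mult add.commute)
qed simp

lemma zeta_image_Y: "(\<lambda>y. \<zeta> \<otimes> y) ` Y = Y" "inj_on (\<lambda>y. \<zeta> \<otimes> y) Y"
proof -
  show i: "inj_on (\<lambda>y. \<zeta> \<otimes> y) Y" using z YR by (auto simp: inj_on_def m_lcancel)
  show "(\<lambda>y. \<zeta> \<otimes> y) ` Y = Y" by (rule endo_inj_surj[OF finite_Y _ i]) (use Y_mult1 in auto)
qed

text \<open>Not constant on the \<open>r\<close>-th roots of \<open>c\<close>, although of norm \<open>1\<close>.\<close>

definition s :: "'a \<Rightarrow> 'a" where "s y = (\<one> \<oplus> y) \<otimes> inv (\<one> \<oplus> \<zeta> \<otimes> y)"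

context
  assumes nm: "\<And>y. y \<in> Y \<Longrightarrow> \<one> \<oplus> y \<noteq> \<zero>"
begin

lemma s_props: assumes "y \<in> Y"
  shows "s y \<in> carrier R" "s y \<noteq> \<zero>" "s y \<otimes> (\<one> \<oplus> \<zeta> \<otimes> y) = \<one> \<oplus> y" "s y [^] (M::nat) \<in> carrier R"
    "s y [^] (M::nat) \<otimes> (\<one> \<oplus> \<zeta> \<otimes> y) [^] M = (\<one> \<oplus> y) [^] M"
proof -
  have c: "\<one> \<oplus> y \<in> carrier R" "\<one> \<oplus> \<zeta> \<otimes> y \<in> carrier R" using YR[OF assms] z by auto
  have "\<one> \<oplus> \<zeta> \<otimes> y \<noteq> \<zero>" using nm[OF Y_mult1[OF assms]] .
  then have u: "\<one> \<oplus> \<zeta> \<otimes> y \<in> Units R" using c field_Units by auto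
  show *: "s y \<in> carrier R" "s y \<otimes> (\<one> \<oplus> \<zeta> \<otimes> y) = \<one> \<oplus> y" using c u by (simp_all add: s_def m_assoc)
  show "s y \<noteq> \<zero>" using * nm[OF assms] c by auto
  show "s y [^] M \<in> carrier R" using * by simp
  show "s y [^] (M::nat) \<otimes> (\<one> \<oplus> \<zeta> \<otimes> y) [^] M = (\<one> \<oplus> y) [^] M"
    using nat_pow_distrib[OF *(1) c(2), of M] *(2) by simp
qed

text \<open>Numerator and denominator of \<open>s\<close> are the values of \<open>1 + T\<close> at
  \<open>y\<close> and at \<open>\<zeta> y\<close>. As multiplication by \<open>\<zeta>\<close>
  permutes \<open>Y\<close>, both have the same product over \<open>Y\<close>, which is nonzero by
  \<open>nm\<close> and cancels.\<close>

lemma s_norm: "finprod R (\<lambda>y. s y [^] (M::nat)) Y = \<one>"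
proof -
  let ?A = "\<lambda>y. \<one> \<oplus> y"
  have A: "?A \<in> Y \<rightarrow> carrier R" and S: "s \<in> Y \<rightarrow> carrier R" using YR s_props by auto
  have "finprod R ?A Y = finprod R (\<lambda>y. s y \<otimes> (\<one> \<oplus> \<zeta> \<otimes> y)) Y"
    by (rule finprod_cong') (use s_props A YR z in auto)
  also have "\<dots> = finprod R s Y \<otimes> finprod R (\<lambda>y. \<one> \<oplus> \<zeta> \<otimes> y) Y"
    by (rule finprod_multf) (use S YR z in auto)
  also have "finprod R (\<lambda>y. \<one> \<oplus> \<zeta> \<otimes> y) Y = finprod R ?A ((\<lambda>y. \<zeta> \<otimes> y) ` Y)"
    by (rule finprod_reindex[symmetric]) (use zeta_image_Y A in auto)
  also have "(\<lambda>y. \<zeta> \<otimes> y) ` Y = Y" by (rule zeta_image_Y)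
  finally have "\<one> \<otimes> finprod R ?A Y = finprod R s Y \<otimes> finprod R ?A Y" using A by (simp add: finprod_closed)
  moreover have nz: "finprod R ?A Y \<noteq> \<zero>" by (rule finprod_nonzero[OF finite_Y A nm])
  ultimately have "\<one> = finprod R s Y"
    using m_rcancel[OF nz finprod_closed[OF A] one_closed finprod_closed[OF S]] by blast
  then have "finprod R s Y = \<one>" by (rule sym)
  then show ?thesis using finprod_power[OF S] by simp
qed

text \<open>A constant value \<open>C\<close>, compared at \<open>y\<close> and
  \<open>\<zeta> y\<close>, gives \<open>(1 - \<zeta>) y (1 - C \<zeta>) = 0\<close>, hence
  \<open>C \<zeta> = 1\<close>. Then \<open>C (1 + \<zeta> y) = 1 + y\<close> reads
  \<open>C + y = 1 + y\<close>, so \<open>C = 1\<close> and \<open>\<zeta> = 1\<close>, which is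
  impossible.\<close>

lemma s_nonconst: assumes "y \<in> Y" shows "\<not> (\<exists>C. \<forall>y\<in>Y. s y = C)"
proof
  assume "\<exists>C. \<forall>y\<in>Y. s y = C"
  then obtain C where C: "\<And>y. y \<in> Y \<Longrightarrow> s y = C" by blast
  have y': "\<zeta> \<otimes> y \<in> Y" using Y_mult1 assms by simp
  have cl: "C \<in> carrier R" "y \<in> carrier R" "\<zeta> \<in> carrier R" using C[OF assms] s_props(1)[OF assms] YR[OF assms] z by auto
  have e1: "C \<otimes> (\<one> \<oplus> \<zeta> \<otimes> y) = \<one> \<oplus> y" using s_props(3)[OF assms] C[OF assms] by simp
  have e2: "C \<otimes> (\<one> \<oplus> \<zeta> \<otimes> (\<zeta> \<otimes> y)) = \<one> \<oplus> \<zeta> \<otimes> y" using s_props(3)[OF y'] C[OF y'] by simp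
  have "((\<one> \<ominus> \<zeta>) \<otimes> y) \<otimes> (\<one> \<ominus> C \<otimes> \<zeta>) =
      ((\<one> \<oplus> y) \<ominus> C \<otimes> (\<one> \<oplus> \<zeta> \<otimes> y)) \<ominus> ((\<one> \<oplus> \<zeta> \<otimes> y) \<ominus> C \<otimes> (\<one> \<oplus> \<zeta> \<otimes> (\<zeta> \<otimes> y)))"
    using cl by algebra
  also have "\<dots> = \<zero>" unfolding e1 e2 using cl by algebra
  finally have "((\<one> \<ominus> \<zeta>) \<otimes> y) \<otimes> (\<one> \<ominus> C \<otimes> \<zeta>) = \<zero>" .
  moreover have z1: "\<zeta> \<noteq> \<one>" using \<zeta> r2 z(1) unfolding prim_root_def by (metis One_nat_def less_le_trans lessI nat_pow_one zero_less_Suc numeral_2_eq_2 nat_pow_eone)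
  then have "\<one> \<ominus> \<zeta> \<noteq> \<zero>" using cl by (metis minus_equality minus_eq minus_minus one_closed r_right_minus_eq)
  ultimately have "\<one> \<ominus> C \<otimes> \<zeta> = \<zero>" using cl YR[OF assms] integral by (metis m_closed minus_closed one_closed)
  then have "C \<otimes> \<zeta> = \<one>" using cl by (metis m_closed one_closed r_right_minus_eq)
  have "C \<otimes> \<one> = (C \<otimes> (\<one> \<oplus> \<zeta> \<otimes> y)) \<ominus> (C \<otimes> \<zeta>) \<otimes> y" using cl by algebra
  also have "\<dots> = \<one>" unfolding e1 \<open>C \<otimes> \<zeta> = \<one>\<close> using cl by algebra
  finally have "C = \<one>" using cl by simp
  then show False using \<open>C \<otimes> \<zeta> = \<one>\<close> cl z1 by simp
qed

text \<open>The norm of \<open>s ^ M\<close> is \<open>1\<close>, so \<open>C ^ r = 1\<close>. If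
  \<open>\<rho> \<noteq> r\<close>, then \<open>C\<close> is a power of \<open>\<zeta>\<close>, the
  \<open>r\<close>-th power of a value is a power of \<open>\<omega>\<close>, and a Bezout relation
  recovers the value. If \<open>\<rho> = r\<close> and \<open>C = 1\<close>, the value is a power of
  \<open>\<zeta>\<close>. If \<open>\<rho> = r\<close> is odd and \<open>C \<noteq> 1\<close>,
  distinct values would be all the \<open>r\<close>-th roots of \<open>C\<close>; their product is
  \<open>C\<close>, in conflict with the norm. For \<open>r = 2\<close> that product is
  \<open>- C\<close> and there is no conflict, but \<open>C ^ 2 = 1\<close> makes the value a fourth
  root of unity.\<close>

lemma link_lemma:
  assumes y0: "y0 \<in> Y" and \<rho>: "prime \<rho>" "prim_root \<rho> \<omega>"
    and C: "\<And>y. y \<in> Y \<Longrightarrow> (s y [^] (M::nat)) [^] \<rho> = C"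
  shows "(\<exists>y\<in>Y. \<exists>a b. s y [^] M = \<zeta> [^] (a::nat) \<otimes> \<omega> [^] (b::nat)) \<or>
     (\<exists>y\<in>Y. \<rho> = 2 \<and> (s y [^] M) [^] (4::nat) = \<one>) \<or>
     (\<exists>y\<in>Y. \<exists>y'\<in>Y. y \<noteq> y' \<and> s y [^] M = s y' [^] M)"
proof (rule ccontr)
  assume n: "\<not> ?thesis"
  define x where "x y = s y [^] M" for y
  note w = prim_rootD[OF \<rho>(2)]
  have xR: "x y \<in> carrier R" "x y \<noteq> \<zero>" if "y \<in> Y" for y
    using s_props[OF that] nat_pow_nonzero by (auto simp: x_def)
  have inj: "inj_on x Y" using n unfolding inj_on_def x_def by blast
  have CR: "C \<in> carrier R" using C[OF y0] xR[OF y0] by (auto simp: x_def)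
  have xC: "x y [^] \<rho> = C" if "y \<in> Y" for y using C[OF that] by (simp add: x_def)
  have "finprod R (\<lambda>y. x y [^] \<rho>) Y = finprod R x Y [^] \<rho>" by (rule finprod_power) (use xR in auto)
  also have nx: "finprod R x Y = \<one>" unfolding x_def by (rule s_norm)
  also have "finprod R (\<lambda>y. x y [^] \<rho>) Y = finprod R (\<lambda>y. C) Y"
    by (rule finprod_cong') (use xC CR in auto)
  also have "\<dots> = C [^] r" using finprod_const[OF CR, of Y] card_Y[OF y0] by simp
  finally have Cr: "C [^] r = \<one>" by simp
  have x0: "x y0 \<in> carrier R" "x y0 \<noteq> \<zero>" "x y0 [^] \<rho> = C" using xR xC y0 by auto
  show False
  proof (cases "\<rho> = r")
    case False
    have "coprime \<rho> r" using False \<rho>(1) r by (simp add: primes_coprime)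
    then obtain u where "[\<rho> * u = 1] (mod r)" using cong_solve_coprime_nat[of \<rho> r] by auto
    then have "(\<rho> * u) mod r = 1" using r2 by (simp add: cong_def)
    then obtain v where uv: "\<rho> * u = r * v + 1" using mult_div_mod_eq[of r "\<rho> * u"] by metis
    obtain a where a: "C = \<zeta> [^] (a::nat)" using root_of_unity[OF \<zeta> CR Cr] by metis
    \<comment> \<open>From \<open>\<rho> u = r v + 1\<close> it follows that
      \<open>C ^ u = D ^ v x\<close>. Division by \<open>D ^ v = \<omega> ^ (b v)\<close> is
      multiplication by the power of \<open>\<omega>\<close> with exponent
      \<open>b v (\<rho> - 1)\<close>.\<close>
    define D where "D = x y0 [^] r"
    have DR: "D \<in> carrier R" using x0 by (simp add: D_def)
    have "D [^] \<rho> = C [^] r" unfolding D_def x0(3)[symmetric] using x0(1) by (simp add: nat_pow_pow mult.commute)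
    then obtain b where b: "D = \<omega> [^] (b::nat)" using root_of_unity[OF \<rho>(2) DR] Cr by metis
    have "\<omega> [^] (b * v) \<otimes> \<omega> [^] (b * v * (\<rho> - 1)) = \<omega> [^] (b * v * \<rho>)"
      using w by (subst nat_pow_mult) (auto simp: algebra_simps intro!: arg_cong[of _ _ "\<lambda>k. \<omega> [^] (k::nat)"] mult_eq_if)
    also have "\<dots> = \<one>" using prim_root_mod[OF \<rho>(2), of "b * v * \<rho>"] by simp
    finally have inv: "\<omega> [^] (b * v) \<otimes> \<omega> [^] (b * v * (\<rho> - 1)) = \<one>" .
    have "C [^] u = x y0 [^] (r * v + 1)" unfolding uv[symmetric] x0(3)[symmetric] using x0(1) by (simp add: nat_pow_pow)
    also have "\<dots> = D [^] v \<otimes> x y0" using x0(1) by (simp add: D_def nat_pow_mult[symmetric] nat_pow_pow[symmetric])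
    also have "D [^] v = \<omega> [^] (b * v)" using w by (simp add: b nat_pow_pow)
    finally have "C [^] u \<otimes> \<omega> [^] (b * v * (\<rho> - 1)) = (\<omega> [^] (b * v) \<otimes> \<omega> [^] (b * v * (\<rho> - 1))) \<otimes> x y0"
      using x0 w by (simp add: m_ac)
    then have "x y0 = C [^] u \<otimes> \<omega> [^] (b * v * (\<rho> - 1))" unfolding inv using x0 by simp
    also have "C [^] u = \<zeta> [^] (a * u)" using z by (simp add: a nat_pow_pow)
    finally show False using n y0 unfolding x_def by blast
  next
    case True
    show False
    proof (cases "C = \<one>")
      case C1: True
      obtain a where "x y0 = \<zeta> [^] (a::nat)" using root_of_unity[OF \<zeta> x0(1)] x0(3) True C1 by metis
      then have "x y0 = \<zeta> [^] a \<otimes> \<omega> [^] (0::nat)" using z by simp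
      then show False using n y0 unfolding x_def by blast
    next
      case C1: False
      show False
      proof (cases "r = 2")
        case req: True
        have "x y0 [^] (4::nat) = (x y0 [^] \<rho>) [^] (2::nat)" using x0(1) True req by (simp add: nat_pow_pow)
        also have "\<dots> = \<one>" unfolding x0(3) using Cr req by simp
        finally show False using n y0 req True unfolding x_def by blast
      next
        case rne: False
        then have odd: "odd r" using prime_odd_nat[OF r] r2 by auto
        let ?T = "{t \<in> carrier R. t [^] r = x y0 [^] r}"
        have T: "?T = (\<lambda>k. \<zeta> [^] k \<otimes> x y0) ` {..<r}" by (rule orbit_eq[OF \<zeta> x0(1,2)])
        \<comment> \<open>Injectivity gives \<open>r\<close> values, all of them \<open>r\<close>-th
          roots of \<open>C\<close>, and there are no more.\<close>
        have "x ` Y = ?T"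
        proof (rule card_subset_eq)
          show "finite ?T" using finite_carrier by simp
          show "x ` Y \<subseteq> ?T" using xR xC x0 True by auto
          show "card (x ` Y) = card ?T"
            using card_image[OF inj] card_Y[OF y0] prim_root_card(1)[OF \<zeta> x0(1,2)] unfolding T by simp
        qed
        have "finprod R x Y = finprod R (\<lambda>t. t) (x ` Y)" by (rule finprod_reindex[symmetric]) (use xR inj in auto)
        also have "\<dots> = finprod R (\<lambda>k. \<zeta> [^] k \<otimes> x y0) {..<r}"
          unfolding \<open>x ` Y = ?T\<close> T
          by (rule finprod_reindex) (use z x0 prim_root_card(3)[OF \<zeta> x0(1,2)] in auto)
        also have "\<dots> = finprod R (\<lambda>k. \<zeta> [^] k) {..<r} \<otimes> finprod R (\<lambda>k. x y0) {..<r}"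
          by (rule finprod_multf) (use z x0 in auto)
        also have "finprod R (\<lambda>k. x y0) {..<r} = x y0 [^] r" using finprod_const[OF x0(1), of "{..<r}"] by simp
        \<comment> \<open>For odd \<open>r\<close> the exponent sum \<open>r (r - 1) / 2\<close> is
          a multiple of \<open>r\<close>; this is the step that fails for
          \<open>r = 2\<close>.\<close>
        also have "finprod R (\<lambda>k. \<zeta> [^] k) {..<r} = \<one>"
        proof -
          obtain k where k: "r = Suc (2 * k)" using odd by (auto elim: oddE)
          have "(\<Sum>k<n. k) * 2 = n * (n - 1)" for n :: nat by (induction n) (auto simp: algebra_simps)
          from this[of r] have "(\<Sum>k<r. k) = r * k" using k by simp
          then show ?thesis unfolding finprod_zeta using prim_root_mod[OF \<zeta>, of "r * k"] by simp
        qed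
        finally show False using nx x0 C1 True CR by simp
      qed
    qed
  qed
qed

end

end

section \<open>Chains of divisors\<close>

context domain
begin

definition valid_link :: "'a link \<Rightarrow> bool" where
  "valid_link l \<longleftrightarrow> prime (length (fst (snd l))) \<and> fst (snd l) = [0..<length (fst (snd l))] \<and>
     prim_root (if length (fst (snd l)) = 2 then 4 else length (fst (snd l))) (snd (snd l))"

fun chain :: "nat \<Rightarrow> 'a link list \<Rightarrow> bool" where
  "chain M [] \<longleftrightarrow> M = 1"
| "chain M (l # ls) \<longleftrightarrow> valid_link l \<and> M = length (fst (snd l)) * fst l \<and> chain (fst l) ls"

lemma chain_valid: "chain M ls \<Longrightarrow> l \<in> set ls \<Longrightarrow> valid_link l"
  by (induction M ls rule: chain.induct) auto

lemma zet_prim_root: "valid_link l \<Longrightarrow> prim_root (length (fst (snd l))) (zet R l)"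
proof (cases "length (fst (snd l)) = 2")
  case True
  assume "valid_link l"
  then have p: "prim_root 4 (snd (snd l))" using True by (simp add: valid_link_def)
  define z where "z = snd (snd l)"
  have z: "z \<in> carrier R" "z [^] (4::nat) = \<one>" "z [^] (2::nat) \<noteq> \<one>" using p by (auto simp: prim_root_def z_def)
  have "z \<otimes> z = z [^] (2::nat)" using z by (simp add: numeral_2_eq_2)
  then have "prim_root 2 (z \<otimes> z)" using z unfolding prim_root_def
    by (auto simp: nat_pow_pow less_2_cases_iff)
  then show ?thesis using True by (simp add: zet_def z_def)
qed (simp add: valid_link_def zet_def)

lemma unity_props:
  assumes "\<And>l. l \<in> set ls \<Longrightarrow> valid_link l"
  shows "set (unity1 R ls) \<subseteq> carrier R" "set (unity2 R ls) \<subseteq> carrier R"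
    "l \<in> set ls \<Longrightarrow> zet R l [^] (a::nat) \<in> set (unity1 R ls)"
    "l \<in> set ls \<Longrightarrow> length (fst (snd l)) = 2 \<Longrightarrow> snd (snd l) [^] (a::nat) \<in> set (unity1 R ls)"
    "u \<in> set (unity1 R ls) \<Longrightarrow> v \<in> set (unity1 R ls) \<Longrightarrow> u \<otimes> v \<in> set (unity2 R ls)"
proof -
  have zR: "snd (snd l) \<in> carrier R" if "l \<in> set ls" for l
    using assms[OF that] by (auto simp: valid_link_def prim_root_def)
  show u1: "set (unity1 R ls) \<subseteq> carrier R" using zR by (auto simp: unity1_def pw_eq)
  then show "set (unity2 R ls) \<subseteq> carrier R" by (auto simp: unity2_def)
  show "u \<in> set (unity1 R ls) \<Longrightarrow> v \<in> set (unity1 R ls) \<Longrightarrow> u \<otimes> v \<in> set (unity2 R ls)"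
    by (auto simp: unity2_def)
  have mem: "snd (snd l) [^] j \<in> set (unity1 R ls)" if l: "l \<in> set ls" and j: "j < 2 * length (fst (snd l))" for j :: nat and l
  proof -
    define n where "n = length (fst (snd l))"
    have rs: "fst (snd l) = [0..<n]" using assms[OF l] by (simp add: valid_link_def n_def)
    have "j \<in> set (fst (snd l) @ map (\<lambda>j. j + length (fst (snd l))) (fst (snd l)))"
    proof (cases "j < n")
      case False
      then have "j = (j - n) + n" "j - n < n" using j by (auto simp: n_def)
      then show ?thesis unfolding rs by auto
    qed (simp add: rs)
    then have "pw R (snd (snd l)) j \<in> set (unity1 R ls)" unfolding unity1_def using l by fastforce
    then show ?thesis using zR[OF l] by (simp add: pw_eq)
  qed
  show four: "snd (snd l) [^] a \<in> set (unity1 R ls)" if "l \<in> set ls" "length (fst (snd l)) = 2" for a :: nat and l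
  proof -
    have p: "prim_root 4 (snd (snd l))" using assms[OF that(1)] that(2) by (simp add: valid_link_def)
    have "a mod 4 < 4" by simp
    then show ?thesis unfolding prim_root_mod[OF p, of a] using that by (intro mem) auto
  qed
  show "zet R l [^] a \<in> set (unity1 R ls)" if l: "l \<in> set ls"
  proof (cases "length (fst (snd l)) = 2")
    case True
    have "zet R l [^] a = snd (snd l) [^] (2 * a)"
      using True zR[OF l] by (simp add: zet_def nat_pow_distrib nat_pow_mult mult_2)
    then show ?thesis using four[OF l True, of "2 * a"] by simp
  next
    case False
    then have p: "prim_root (length (fst (snd l))) (snd (snd l))" using assms[OF l] by (simp add: valid_link_def)
    have "a mod length (fst (snd l)) < 2 * length (fst (snd l))"
      using prim_rootD(2)[OF p] by (metis mod_less_divisor mult_2 trans_less_add1)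
    then show ?thesis using mem[OF l] prim_root_mod[OF p, of a] False by (simp add: zet_def)
  qed
qed

text \<open>The chain leads from a constant power down to \<open>s\<close> itself, so there is a
  first entry whose power is not constant; raising that power to the prime of the entry gives back
  the preceding one, which is.\<close>

lemma chain_first_nonconst:
  assumes "chain M ls" "\<forall>y\<in>Y. s y \<in> carrier R" "\<exists>C. \<forall>y\<in>Y. s y [^] M = C" "\<not> (\<exists>C. \<forall>y\<in>Y. s y = C)"
  shows "\<exists>l\<in>set ls. (\<exists>C. \<forall>y\<in>Y. (s y [^] fst l) [^] length (fst (snd l)) = C) \<and>
     \<not> (\<exists>C. \<forall>y\<in>Y. s y [^] fst l = C)"
  using assms(1,3)
proof (induction M ls rule: chain.induct)
  case (1 M)
  then show ?case using assms(2,4) by auto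
next
  case (2 M l ls)
  show ?case
  proof (cases "\<exists>C. \<forall>y\<in>Y. s y [^] fst l = C")
    case True
    then show ?thesis using 2 by auto
  next
    case False
    have "(s y [^] fst l) [^] length (fst (snd l)) = s y [^] M" if "y \<in> Y" for y
      using assms(2) that 2(2) by (simp add: nat_pow_pow mult.commute)
    then show ?thesis using 2(3) False by auto
  qed
qed

end

section \<open>Correctness of the algorithm\<close>

lemma concat_mapI: "x \<in> set xs \<Longrightarrow> y \<in> set (g x) \<Longrightarrow> y \<in> set (concat (map g xs))"
  by auto

lemma concat_mapE: "y \<in> set (concat (map g xs)) \<Longrightarrow> (\<And>x. x \<in> set xs \<Longrightarrow> y \<in> set (g x) \<Longrightarrow> P) \<Longrightarrow> P"
  by auto

text \<open>Each alternative of \<open>link_lemma\<close> gives an element \<open>E\<close> that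
  splits \<open>Y\<close>, to which \<open>extraction\<close> applies. The quotient
  \<open>s ^ M\<close> is replaced by expressions in \<open>v\<close> without denominators, which is
  harmless since \<open>v\<close> vanishes nowhere on \<open>Y\<close>.\<close>

lemma (in root_extraction) rootc_complete:
  assumes LS: "chain (q - 1) LS" "l \<in> set LS" "\<zeta> = zet R l" and y: "y \<in> Y"
  shows "y \<in> set (rootc R m q (unity2 R LS) (map fst LS) rs \<zeta> c)"
proof (cases "\<exists>y'\<in>Y. \<one> \<oplus> y' = \<zero>")
  \<comment> \<open>If \<open>-1\<close> is one of the roots, a denominator of \<open>s\<close>
    vanishes; but then all roots are of the form \<open>- \<zeta> ^ j\<close>, the first candidates
    of \<open>rootc\<close>.\<close>
  case True
  then obtain y' where y': "y' \<in> Y" "\<one> \<oplus> y' = \<zero>" by blast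
  then have "y' = m" using YR[OF y'(1)] m by (metis a_comm minus_equality one_closed)
  moreover obtain k :: nat where "k < r" "y = \<zeta> [^] k \<otimes> y'" using Y_orbit[OF y'(1)] y by auto
  ultimately have "y = m \<otimes> pw R \<zeta> k" "k \<in> set rs" using z mR(1) by (auto simp: pw_eq m_comm)
  then have "y \<in> set (map (\<lambda>j. m \<otimes> pw R \<zeta> j) rs)" unfolding set_map by blast
  then show ?thesis unfolding rootc_def set_append by blast
next
  case False
  then have nm: "\<And>y. y \<in> Y \<Longrightarrow> \<one> \<oplus> y \<noteq> \<zero>" by blast
  have s: "s y \<in> carrier R" "s y \<noteq> \<zero>" "s y \<otimes> (\<one> \<oplus> \<zeta> \<otimes> y) = \<one> \<oplus> y" "s y [^] (M::nat) \<in> carrier R"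
    "s y [^] (M::nat) \<otimes> (\<one> \<oplus> \<zeta> \<otimes> y) [^] M = (\<one> \<oplus> y) [^] M" if "y \<in> Y" for y M
    by (rule s_props, erule nm, rule that)+
  have nonconst: "\<not> (\<exists>C. \<forall>y\<in>Y. s y = C)" by (rule s_nonconst, erule nm, rule y)
  have "\<forall>y\<in>Y. s y [^] (q - 1) = \<one>" using s fermat by auto
  then obtain l' where l': "l' \<in> set LS" "\<exists>C. \<forall>y\<in>Y. (s y [^] fst l') [^] length (fst (snd l')) = C"
    "\<not> (\<exists>C. \<forall>y\<in>Y. s y [^] fst l' = C)"
    using chain_first_nonconst[OF LS(1), of Y s] s(1) nonconst by blast
  define M where "M = fst l'"
  define \<rho> where "\<rho> = length (fst (snd l'))"
  define \<omega> where "\<omega> = zet R l'"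
  have valid: "valid_link l" if "l \<in> set LS" for l using chain_valid[OF LS(1) that] .
  note U = unity_props[of LS, OF valid]
  have \<rho>: "prime \<rho>" "prim_root \<rho> \<omega>" using valid[OF l'(1)] zet_prim_root[OF valid[OF l'(1)]]
    by (auto simp: valid_link_def \<rho>_def \<omega>_def)
  obtain C where C: "\<And>y. y \<in> Y \<Longrightarrow> (s y [^] M) [^] \<rho> = C" using l'(2) by (auto simp: M_def \<rho>_def)
  have nc: "\<not> (\<exists>C. \<forall>y\<in>Y. s y [^] M = C)" using l'(3) by (simp add: M_def)
  define v where "v = pw (ext R h) (linl R \<one> rs) M"
  note L = linl_props[OF one_closed]
  have v: "length v = r" "set v \<subseteq> carrier R" "\<And>y. y \<in> Y \<Longrightarrow> ev R v y = (\<one> \<oplus> y) [^] M"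
    unfolding v_def using pw_h(1,2)[OF L(1,2)] pw_h(3)[OF L(1,2)] L(3) by auto
  have vs: "ev R v y = s y [^] M \<otimes> ev R v (\<zeta> \<otimes> y)" "ev R v y \<in> carrier R" "ev R v y \<noteq> \<zero>" if "y \<in> Y" for y
    using v(3)[OF that] v(3)[OF Y_mult1[OF that]] s(5)[OF that, of M] nm[OF that] YR[OF that] nat_pow_nonzero[of "\<one> \<oplus> y"]
    by auto
  have fin: "y \<in> set (rootc R m q (unity2 R LS) (map fst LS) rs \<zeta> c)"
    if E: "E \<in> set (rels1 R m (unity2 R LS) \<zeta> v @ rels2 R m rs \<zeta> h v)" "length E = r" "set E \<subseteq> carrier R"
      and Y: "y1 \<in> Y" "ev R E y1 = \<zero>" "y2 \<in> Y" "ev R E y2 \<noteq> \<zero>" for E y1 y2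
  proof -
    have "y \<in> set (cands R rs \<zeta> (pw R c (q - 2)) (normp R rs \<zeta> h (sel R m q rs h E)))"
      by (rule extraction[OF E(2,3) Y y])
    moreover have "M \<in> set (map fst LS)" using l'(1) by (auto simp: M_def)
    ultimately show ?thesis unfolding rootc_def Let_def set_append
      by (intro UnI2 concat_mapI[of M] concat_mapI[of E]) (use E(1)[unfolded v_def] in auto)
  qed
  \<comment> \<open>\<open>E\<close> vanishes where \<open>s ^ M\<close> takes the value
    \<open>\<kappa>\<close> and, \<open>s ^ M\<close> not being constant, does not vanish on all of
    \<open>Y\<close>.\<close>
  have K: ?thesis if k: "\<kappa> \<in> set (unity2 R LS)" "y1 \<in> Y" "s y1 [^] M = \<kappa>" for \<kappa> y1
  proof -
    define E where "E = addl R v (smul R (m \<otimes> \<kappa>) (sc R \<zeta> v))"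
    have kR: "\<kappa> \<in> carrier R" using k U(2) by auto
    have ev: "ev R E y = (s y [^] M \<ominus> \<kappa>) \<otimes> ev R v (\<zeta> \<otimes> y)" if "y \<in> Y" for y
    proof -
      define b where "b = ev R v (\<zeta> \<otimes> y)"
      have bR: "b \<in> carrier R" "s y [^] M \<in> carrier R" unfolding b_def using vs(2)[OF Y_mult1[OF that]] s(4)[OF that] by auto
      have "ev R E y = ev R v y \<oplus> (m \<otimes> \<kappa>) \<otimes> b"
        unfolding E_def b_def using v kR mR YR[OF that] z by simp
      also have "\<dots> = (s y [^] M \<otimes> b) \<oplus> (\<ominus> \<kappa>) \<otimes> b" using vs(1)[OF that] kR mR(2) by (simp add: b_def)
      also have "\<dots> = (s y [^] M \<ominus> \<kappa>) \<otimes> b" using bR kR by algebra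
      finally show ?thesis by (simp add: b_def)
    qed
    obtain y2 where y2: "y2 \<in> Y" "s y2 [^] M \<noteq> \<kappa>" using nc by blast
    have e1: "ev R E y1 = \<zero>" using ev[OF k(2)] k(3) kR vs(2)[OF Y_mult1[OF k(2)]] by (simp add: minus_eq r_neg)
    have "s y2 [^] M \<ominus> \<kappa> \<noteq> \<zero>" using y2 kR s(4)[OF y2(1)] by (simp add: r_right_minus_eq)
    then have e2: "ev R E y2 \<noteq> \<zero>" using ev[OF y2(1)] kR s(4)[OF y2(1)] vs(2,3)[OF Y_mult1[OF y2(1)]]
      by (simp add: integral_iff)
    show ?thesis
    proof (rule fin[of E, OF _ _ _ k(2) e1 y2(1) e2])
      show "E \<in> set (rels1 R m (unity2 R LS) \<zeta> v @ rels2 R m rs \<zeta> h v)"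
        using k(1) by (auto simp: E_def rels1_def)
      show "length E = r" using v by (simp add: E_def)
      show "set E \<subseteq> carrier R" unfolding E_def using v kR mR z by (intro addl_closed smul_closed sc_closed) auto
    qed
  qed
  consider (1) y1 a b where "y1 \<in> Y" "s y1 [^] M = \<zeta> [^] (a::nat) \<otimes> \<omega> [^] (b::nat)"
    | (2) y1 where "y1 \<in> Y" "\<rho> = 2" "(s y1 [^] M) [^] (4::nat) = \<one>"
    | (3) y1 y2 where "y1 \<in> Y" "y2 \<in> Y" "y1 \<noteq> y2" "s y1 [^] M = s y2 [^] M"
  proof -
    have "(\<exists>y\<in>Y. \<exists>a b. s y [^] M = \<zeta> [^] (a::nat) \<otimes> \<omega> [^] (b::nat)) \<or>
       (\<exists>y\<in>Y. \<rho> = 2 \<and> (s y [^] M) [^] (4::nat) = \<one>) \<or>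
       (\<exists>y\<in>Y. \<exists>y'\<in>Y. y \<noteq> y' \<and> s y [^] M = s y' [^] M)"
      by (rule link_lemma, erule nm, rule y, rule \<rho>, rule \<rho>, erule C)
    then show ?thesis using that by blast
  qed
  then show ?thesis
  proof cases
    case 1
    have "\<zeta> [^] a \<otimes> \<omega> [^] b \<in> set (unity2 R LS)"
      unfolding LS(3) \<omega>_def using LS(2) l'(1) by (intro U(3,5))
    then show ?thesis using K 1 by blast
  next
    case 2
    have p: "prim_root 4 (snd (snd l'))" using valid[OF l'(1)] 2 by (simp add: valid_link_def \<rho>_def)
    obtain k where k: "s y1 [^] M = snd (snd l') [^] (k::nat)"
      using root_of_unity[OF p s(4)[OF 2(1)] 2(3)] by metis
    \<comment> \<open>The second factor is \<open>\<one>\<close>; it brings a single power into the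
      shape of the products in \<open>unity2\<close>.\<close>
    have "s y1 [^] M \<otimes> zet R l [^] (0::nat) \<in> set (unity2 R LS)"
      unfolding k using 2 l'(1) LS(2) by (intro U(3-5)) (auto simp: \<rho>_def)
    then show ?thesis using K[OF _ 2(1) refl] s(4)[OF 2(1)] by simp
  next
    case 3
    obtain b where b: "b < r" "y2 = \<zeta> [^] b \<otimes> y1" using Y_orbit[OF 3(1)] 3(2) by auto
    then have b0: "0 < b" using 3(3) YR[OF 3(1)] by (cases b) auto
    define E where "E = addl R (mulm R h v (sc R (\<zeta> [^] b \<otimes> \<zeta>) v)) (smul R m (mulm R h (sc R \<zeta> v) (sc R (\<zeta> [^] b) v)))"
    have scv: "length (sc R k v) = r" "k \<in> carrier R \<Longrightarrow> set (sc R k v) \<subseteq> carrier R" for k using v by simp_all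
    have zb: "\<zeta> [^] b \<in> carrier R" "\<zeta> [^] b \<otimes> \<zeta> \<in> carrier R" "\<zeta> \<in> carrier R" using z by auto
    note m1 = mulm_h[OF v(1,2) scv(1) scv(2)[OF zb(2)]]
    note m2 = mulm_h[OF scv(1) scv(2)[OF zb(3)] scv(1) scv(2)[OF zb(1)]]
    have ev: "ev R E y = (s y [^] M \<ominus> s (\<zeta> [^] b \<otimes> y) [^] M) \<otimes> (ev R v (\<zeta> \<otimes> y) \<otimes> ev R v (\<zeta> \<otimes> (\<zeta> [^] b \<otimes> y)))"
      if y: "y \<in> Y" for y
    proof -
      define u where "u = ev R v (\<zeta> \<otimes> y)"
      define w where "w = ev R v (\<zeta> \<otimes> (\<zeta> [^] b \<otimes> y))"
      have yb: "\<zeta> [^] b \<otimes> y \<in> Y" using Y_mult[OF y] .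
      have cl: "u \<in> carrier R" "w \<in> carrier R" "s y [^] M \<in> carrier R" "s (\<zeta> [^] b \<otimes> y) [^] M \<in> carrier R"
        unfolding u_def w_def using vs(2) Y_mult1 y yb s(4) by auto
      have yR: "y \<in> carrier R" using YR[OF y] by simp
      have e: "(\<zeta> [^] b \<otimes> \<zeta>) \<otimes> y = \<zeta> \<otimes> (\<zeta> [^] b \<otimes> y)" using yR z by (simp add: m_ac)
      have "ev R E y = (ev R v y \<otimes> w) \<oplus> m \<otimes> (u \<otimes> ev R v (\<zeta> [^] b \<otimes> y))"
        unfolding E_def u_def w_def using m1 m2 y yR v zb mR e by simp
      also have "\<dots> = ((s y [^] M \<otimes> u) \<otimes> w) \<oplus> \<ominus> (u \<otimes> (s (\<zeta> [^] b \<otimes> y) [^] M \<otimes> w))"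
        using vs(1)[OF y] vs(1)[OF yb] mR(2) cl by (simp add: u_def w_def)
      also have "\<dots> = (s y [^] M \<ominus> s (\<zeta> [^] b \<otimes> y) [^] M) \<otimes> (u \<otimes> w)" using cl by algebra
      finally show ?thesis by (simp add: u_def w_def)
    qed
    have nz: "ev R v (\<zeta> \<otimes> y) \<otimes> ev R v (\<zeta> \<otimes> (\<zeta> [^] b \<otimes> y)) \<in> carrier R - {\<zero>}" if "y \<in> Y" for y
      using vs(2,3)[OF Y_mult1[OF that]] vs(2,3)[OF Y_mult1[OF Y_mult[OF that, of b]]] by (simp add: integral_iff)
    \<comment> \<open>Otherwise \<open>s ^ M\<close> would be invariant under multiplication by
      \<open>\<zeta> ^ b\<close>. As \<open>r\<close> is prime and \<open>0 < b < r\<close>, the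
      powers of \<open>\<zeta> ^ b\<close> are all powers of \<open>\<zeta>\<close>, and
      \<open>s ^ M\<close> would be constant on \<open>Y\<close>.\<close>
    have "\<exists>y2\<in>Y. s y2 [^] M \<noteq> s (\<zeta> [^] b \<otimes> y2) [^] M"
    proof (rule ccontr)
      assume "\<not> ?thesis"
      then have eq: "s (\<zeta> [^] b \<otimes> t) [^] M = s t [^] M" if "t \<in> Y" for t using that by auto
      have it: "s (\<zeta> [^] (b * k) \<otimes> y1) [^] M = s y1 [^] M" for k :: nat
      proof (induction k)
        case (Suc k)
        have "\<zeta> [^] (b * Suc k) \<otimes> y1 = \<zeta> [^] b \<otimes> (\<zeta> [^] (b * k) \<otimes> y1)"
          using z YR[OF 3(1)] by (simp add: nat_pow_mult[symmetric] m_assoc)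
        then show ?case using eq[OF Y_mult[OF 3(1)]] Suc by simp
      qed (use YR[OF 3(1)] in simp)
      have "\<not> r dvd b" using b b0 by (auto dest: dvd_imp_le)
      then have "coprime b r" using prime_imp_coprime[OF r] by (simp add: coprime_commute)
      then obtain a where a: "[b * a = 1] (mod r)" using cong_solve_coprime_nat[of b r] by auto
      have "s t [^] M = s y1 [^] M" if t: "t \<in> Y" for t
      proof -
        obtain k :: nat where k: "t = \<zeta> [^] k \<otimes> y1" using Y_orbit[OF 3(1)] t by auto
        have "[b * (a * k) = 1 * k] (mod r)" using cong_scalar_right[OF a, of k] by (simp add: mult.assoc)
        then have "\<zeta> [^] (b * (a * k)) = \<zeta> [^] k"
          using prim_root_mod[OF \<zeta>, of "b * (a * k)"] prim_root_mod[OF \<zeta>, of k] by (simp add: cong_def)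
        then show ?thesis using it[of "a * k"] k by simp
      qed
      then show False using nc by blast
    qed
    then obtain y3 where y3: "y3 \<in> Y" "s y3 [^] M \<noteq> s (\<zeta> [^] b \<otimes> y3) [^] M" by blast
    have e1: "ev R E y1 = \<zero>"
      using ev[OF 3(1)] 3(4) nz[OF 3(1)] s(4)[OF 3(2)] b(2) by (simp add: minus_eq r_neg)
    have "s y3 [^] M \<ominus> s (\<zeta> [^] b \<otimes> y3) [^] M \<noteq> \<zero>"
      using y3(2) s(4)[OF y3(1)] s(4)[OF Y_mult[OF y3(1), of b]] by (simp add: r_right_minus_eq)
    then have e2: "ev R E y3 \<noteq> \<zero>"
      using ev[OF y3(1)] nz[OF y3(1)] s(4)[OF y3(1)] s(4)[OF Y_mult[OF y3(1), of b]] by (simp add: integral_iff)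
    show ?thesis
    proof (rule fin[of E, OF _ _ _ 3(1) e1 y3(1) e2])
      have "E \<in> set (rels2 R m rs \<zeta> h v)" unfolding rels2_def E_def using b(1) z(1) by (auto simp: pw_eq)
      then show "E \<in> set (rels1 R m (unity2 R LS) \<zeta> v @ rels2 R m rs \<zeta> h v)" by simp
      show "length E = r" using m1 m2 by (simp add: E_def)
      show "set E \<subseteq> carrier R" unfolding E_def using m1 m2 mR by (intro addl_closed smul_closed) auto
    qed
  qed
qed

text \<open>Stated outside \<open>root_extraction\<close> because the candidates \<open>c\<close>
  met on the way back are not known to be nonzero or to be \<open>r\<close>-th powers.\<close>

lemma (in cring) rootc_closed:
  assumes "r \<ge> 2" "\<zeta> \<in> carrier R" "c \<in> carrier R" "m \<in> carrier R" "set U \<subseteq> carrier R"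
  shows "set (rootc R m q U Ms [0..<r] \<zeta> c) \<subseteq> carrier R"
proof -
  define h where "h = modl R c [0..<r]"
  have h: "length h = r" "set h \<subseteq> carrier R" "h \<noteq> []" using assms by (auto simp: h_def modl_def zeros_def)
  note M = mulm_props(1,2)[OF h(2)] and P = pw_ext_props(1,2)[OF h(3,2)] and O = onel_props(1,2)[of h]
  have L: "length (linl R a [0..<r]) = r" "a \<in> carrier R \<Longrightarrow> set (linl R a [0..<r]) \<subseteq> carrier R" for a
    using assms by (auto simp: linl_def zeros_def)
  have pwR: "a \<in> carrier R \<Longrightarrow> pw R a n \<in> carrier R" for a n by (simp add: pw_eq)
  have sel: "length (sel R m q [0..<r] h E) = r \<and> set (sel R m q [0..<r] h E) \<subseteq> carrier R"
    if E: "length E = r" "set E \<subseteq> carrier R" for E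
  proof -
    define J where "J = pw (ext R h) E (q - 1)"
    have J: "length J = r" "set J \<subseteq> carrier R" using P[of E] E h by (auto simp: J_def)
    define D where "D = addl R (onel R h) (smul R m J)"
    have D: "length D = r" "set D \<subseteq> carrier R"
      unfolding D_def using O J h by simp (intro addl_closed smul_closed O J assms)
    have "length (mulm R h (linl R \<zero> [0..<r]) D) = r" "set (mulm R h (linl R \<zero> [0..<r]) D) \<subseteq> carrier R"
      using M[of "linl R \<zero> [0..<r]" D] L D h by auto
    then show ?thesis unfolding sel_def Let_def J_def[symmetric] D_def[symmetric] using J by (simp add: addl_closed)
  qed
  have np: "normp R [0..<r] \<zeta> h \<theta> \<in> carrier R" if t: "length \<theta> = r" "set \<theta> \<subseteq> carrier R" for \<theta>
  proof -
    have "set (foldr (\<lambda>k acc. mulm R h (sc R (pw R \<zeta> k) \<theta>) acc) ks (onel R h)) \<subseteq> carrier R \<and>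
      length (foldr (\<lambda>k acc. mulm R h (sc R (pw R \<zeta> k) \<theta>) acc) ks (onel R h)) = r" for ks
    proof (induction ks)
      case (Cons k ks)
      have "set (sc R (pw R \<zeta> k) \<theta>) \<subseteq> carrier R" using t pwR assms by (intro sc_closed)
      then show ?case using Cons M h by auto
    qed (use O h in auto)
    from this[of "[0..<r]"] show ?thesis unfolding normp_def by (auto split: list.split)
  qed
  have cd: "set (cands R [0..<r] \<zeta> ci w) \<subseteq> carrier R" if "ci \<in> carrier R" "w \<in> carrier R" for ci w
    using that pwR assms by (auto simp: cands_def)
  have rl: "length E = r \<and> set E \<subseteq> carrier R"
    if v: "length v = r" "set v \<subseteq> carrier R" and E: "E \<in> set (rels1 R m U \<zeta> v @ rels2 R m [0..<r] \<zeta> h v)" for v E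
  proof -
    have s: "k \<in> carrier R \<Longrightarrow> set (sc R k v) \<subseteq> carrier R" "length (sc R k v) = r" for k using v by simp_all
    consider (1) \<kappa> where "\<kappa> \<in> set U" "E = addl R v (smul R (m \<otimes> \<kappa>) (sc R \<zeta> v))"
      | (2) b where "E = addl R (mulm R h v (sc R (pw R \<zeta> b \<otimes> \<zeta>) v)) (smul R m (mulm R h (sc R \<zeta> v) (sc R (pw R \<zeta> b) v)))"
      using E by (auto simp: rels1_def rels2_def)
    then show ?thesis
    proof cases
      case 1
      then have "m \<otimes> \<kappa> \<in> carrier R" using assms by auto
      then show ?thesis unfolding 1 using v s assms by (simp add: addl_closed)
    next
      case 2
      have k: "pw R \<zeta> b \<in> carrier R" "pw R \<zeta> b \<otimes> \<zeta> \<in> carrier R" using pwR assms by auto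
      have "length (mulm R h v (sc R (pw R \<zeta> b \<otimes> \<zeta>) v)) = r" "set (mulm R h v (sc R (pw R \<zeta> b \<otimes> \<zeta>) v)) \<subseteq> carrier R"
        "length (mulm R h (sc R \<zeta> v) (sc R (pw R \<zeta> b) v)) = r" "set (mulm R h (sc R \<zeta> v) (sc R (pw R \<zeta> b) v)) \<subseteq> carrier R"
        using M[of v "sc R (pw R \<zeta> b \<otimes> \<zeta>) v"] M[of "sc R \<zeta> v" "sc R (pw R \<zeta> b) v"]
          s(1)[OF k(1)] s(1)[OF k(2)] s(1)[OF assms(2)] s(2) v h by simp_all
      then show ?thesis unfolding 2 using assms by (simp add: addl_closed)
    qed
  qed
  have "y \<in> carrier R" if y: "y \<in> set (rootc R m q U Ms [0..<r] \<zeta> c)" for y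
  proof -
    let ?v = "\<lambda>k. pw (ext R h) (linl R \<one> [0..<r]) k"
    from y have "y \<in> set (map (\<lambda>j. m \<otimes> pw R \<zeta> j) [0..<r]) \<or>
      y \<in> set (concat (map (\<lambda>k. concat (map (\<lambda>E. cands R [0..<r] \<zeta> (pw R c (q - 2))
        (normp R [0..<r] \<zeta> h (sel R m q [0..<r] h E))) (rels1 R m U \<zeta> (?v k) @ rels2 R m [0..<r] \<zeta> h (?v k)))) Ms))"
      by (simp only: rootc_def Let_def h_def[symmetric] set_append Un_iff)
    then show ?thesis
    proof
      assume "y \<in> set (map (\<lambda>j. m \<otimes> pw R \<zeta> j) [0..<r])"
      then obtain j where "y = m \<otimes> pw R \<zeta> j" unfolding set_map by blast
      then show ?thesis using pwR assms by simp
    next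
      assume "y \<in> set (concat (map (\<lambda>k. concat (map (\<lambda>E. cands R [0..<r] \<zeta> (pw R c (q - 2))
        (normp R [0..<r] \<zeta> h (sel R m q [0..<r] h E))) (rels1 R m U \<zeta> (?v k) @ rels2 R m [0..<r] \<zeta> h (?v k)))) Ms))"
      then show ?thesis
      proof (rule concat_mapE)
        fix k assume "y \<in> set (concat (map (\<lambda>E. cands R [0..<r] \<zeta> (pw R c (q - 2))
          (normp R [0..<r] \<zeta> h (sel R m q [0..<r] h E))) (rels1 R m U \<zeta> (?v k) @ rels2 R m [0..<r] \<zeta> h (?v k))))"
        then show ?thesis
        proof (rule concat_mapE)
          fix E assume E: "E \<in> set (rels1 R m U \<zeta> (?v k) @ rels2 R m [0..<r] \<zeta> h (?v k))"
            and yE: "y \<in> set (cands R [0..<r] \<zeta> (pw R c (q - 2)) (normp R [0..<r] \<zeta> h (sel R m q [0..<r] h E)))"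
          have v: "length (?v k) = r" "set (?v k) \<subseteq> carrier R"
            using P[of "linl R \<one> [0..<r]" k] L[of \<one>] h by simp_all
          have "length E = r" "set E \<subseteq> carrier R" using rl[OF v E] by auto
          then have "normp R [0..<r] \<zeta> h (sel R m q [0..<r] h E) \<in> carrier R" using np sel by blast
          then show ?thesis using cd[OF pwR[OF assms(3)]] yE by blast
        qed
      qed
    qed
  qed
  then show ?thesis by blast
qed

text \<open>The records of \<open>forward\<close> in the order of the chain, the natural direction
  for an induction.\<close>

fun trail :: "('c, 'x) ring_scheme \<Rightarrow> 'c list \<Rightarrow> 'c link list \<Rightarrow> ('c link \<times> 'c list) list" where
  "trail G f [] = []"
| "trail G f (l # ls) = (l, f) # trail G (graeffe G (fst (snd l)) (zet G l) f) ls"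

lemma forward_eq: "snd (forward G ls f) = rev (trail G f ls)"
proof -
  have "snd (fold (\<lambda>l s. (graeffe G (fst (snd l)) (zet G l) (fst s), (l, fst s) # snd s)) ls (f, acc)) = rev (trail G f ls) @ acc" for acc
    by (induction ls arbitrary: f acc) auto
  then show ?thesis by (simp add: forward_def)
qed

context fin_field
begin

text \<open>Induction on the part \<open>ls\<close> of the chain below the current term, while root
  extraction always uses the full chain \<open>LS\<close>. Only an inclusion is claimed: at the
  bottom \<open>\<one>\<close> is offered untested, and the final filter in \<open>solve\<close>
  settles the converse.\<close>

lemma backward:
  assumes LS: "chain (q - 1) LS" and m: "m = \<ominus> \<one>"
    and "set ls \<subseteq> set LS" "chain M ls" "set f \<subseteq> carrier R" "f \<noteq> []" "last f \<noteq> \<zero>"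
  defines "C \<equiv> foldr (backstep R m q (unity2 R LS) (map fst LS)) (trail R f ls) [\<one>]"
  shows "set C \<subseteq> carrier R \<and> {y \<in> carrier R. y \<noteq> \<zero> \<and> y [^] M = \<one> \<and> ev R f y = \<zero>} \<subseteq> set C"
  using assms(3-7) unfolding C_def
proof (induction ls arbitrary: M f)
  case Nil
  then show ?case by auto
next
  case (Cons l ls)
  define r where "r = length (fst (snd l))"
  define \<zeta> where "\<zeta> = zet R l"
  have v: "valid_link l" "M = r * fst l" "chain (fst l) ls" using Cons.prems by (auto simp: r_def)
  have r: "prime r" "fst (snd l) = [0..<r]" "prim_root r \<zeta>"
    using v zet_prim_root[OF v(1)] by (auto simp: valid_link_def r_def \<zeta>_def)
  note z = prim_rootD[OF r(3)]
  define g where "g = graeffe R [0..<r] \<zeta> f"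
  note g = graeffe_props[OF Cons.prems(3,4,5) r(3), folded g_def]
  have gn: "g \<noteq> []" using g(1) Cons.prems by auto
  define C where "C = foldr (backstep R m q (unity2 R LS) (map fst LS)) (trail R g ls) [\<one>]"
  have IH: "set C \<subseteq> carrier R" "\<And>y. y \<in> carrier R \<Longrightarrow> y \<noteq> \<zero> \<Longrightarrow> y [^] fst l = \<one> \<Longrightarrow> ev R g y = \<zero> \<Longrightarrow> y \<in> set C"
    using Cons.IH[of "fst l" g] v Cons.prems g gn unfolding C_def by auto
  define V where "V = remdups (filter (\<lambda>y. ev R f y = \<zero>) (concat (map (\<lambda>c. rootc R m q (unity2 R LS) (map fst LS) [0..<r] \<zeta> c) C)))"
  have mR: "m \<in> carrier R" using m by simp
  have UR: "set (unity2 R LS) \<subseteq> carrier R" using unity_props(2) chain_valid[OF LS] by blast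
  have VR: "set V \<subseteq> carrier R"
  proof
    fix y assume "y \<in> set V"
    then have "y \<in> set (concat (map (\<lambda>c. rootc R m q (unity2 R LS) (map fst LS) [0..<r] \<zeta> c) C))"
      unfolding V_def set_remdups set_filter by blast
    then show "y \<in> carrier R"
    proof (rule concat_mapE)
      fix c assume "c \<in> set C" "y \<in> set (rootc R m q (unity2 R LS) (map fst LS) [0..<r] \<zeta> c)"
      then show ?thesis using rootc_closed[OF prime_ge_2_nat[OF r(1)] z(1) _ mR UR, of c] IH(1) by blast
    qed
  qed
  \<comment> \<open>All members of \<open>V\<close> are roots of \<open>f\<close>, so the cut in
    \<open>backstep\<close> removes nothing.\<close>
  have "card (set V) < length f"
  proof -
    have "set V \<subseteq> {x \<in> carrier R. ev R f x = \<zero>}" using VR unfolding V_def set_remdups set_filter by blast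
    then show ?thesis using roots_bound[OF Cons.prems(3,4,5)] by blast
  qed
  then have "length V \<le> length f" by (simp add: V_def length_remdups_card_conv)
  then have step: "foldr (backstep R m q (unity2 R LS) (map fst LS)) (trail R f (l # ls)) [\<one>] = V"
    by (simp add: backstep_def r(2) \<zeta>_def[symmetric] g_def[symmetric] C_def[symmetric] V_def[symmetric] map_snd_zip_take)
  have "y \<in> set V" if y: "y \<in> carrier R" "y \<noteq> \<zero>" "y [^] M = \<one>" "ev R f y = \<zero>" for y
  proof -
    define c where "c = y [^] r"
    have c: "c \<in> carrier R" "c \<noteq> \<zero>" using y nat_pow_nonzero by (auto simp: c_def)
    have "c [^] fst l = \<one>" using y v(2) by (simp add: c_def nat_pow_pow)
    moreover have "ev R g c = \<zero>" unfolding c_def using g(4) y by blast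
    ultimately have cC: "c \<in> set C" using IH(2) c by blast
    interpret root_extraction R q r \<zeta> c m
      by unfold_locales (use r c m in auto)
    have "y \<in> set (rootc R m q (unity2 R LS) (map fst LS) [0..<r] \<zeta> c)"
    proof (rule rootc_complete[OF LS _ \<zeta>_def])
      show "y \<in> Y" unfolding Y_def using y by (simp add: c_def)
    qed (use Cons.prems in simp)
    then have "y \<in> set (concat (map (\<lambda>c. rootc R m q (unity2 R LS) (map fst LS) [0..<r] \<zeta> c) C))"
      by (rule concat_mapI[OF cC])
    then show ?thesis using y(4) unfolding V_def set_remdups set_filter by blast
  qed
  then show ?case unfolding step using VR by auto
qed

text \<open>At the top of the chain \<open>y ^ (q - 1) = 1\<close> holds for every nonzero
  \<open>y\<close> by Fermat, so \<open>backward\<close> misses no nonzero root.\<close>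

theorem solve_correct:
  assumes LS: "chain (q - 1) LS" and m: "m = \<ominus> \<one>"
    and f: "set f \<subseteq> carrier R" "f \<noteq> []" "last f \<noteq> \<zero>"
  shows "distinct (solve R m q LS f)" "set (solve R m q LS f) = {y \<in> carrier R. ev R f y = \<zero>}"
proof -
  show "distinct (solve R m q LS f)" by (simp add: solve_def)
  define C where "C = foldr (backstep R m q (unity2 R LS) (map fst LS)) (trail R f LS) [\<one>]"
  have "fold (backstep R m q (unity2 R LS) (map fst LS)) (snd (forward R LS f)) [\<one>] = C"
    by (simp add: forward_eq C_def foldr_conv_fold)
  moreover have "set C \<subseteq> carrier R" "{y \<in> carrier R. y \<noteq> \<zero> \<and> y [^] (q - 1) = \<one> \<and> ev R f y = \<zero>} \<subseteq> set C"
    using backward[OF LS m _ LS f] unfolding C_def by auto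
  ultimately show "set (solve R m q LS f) = {y \<in> carrier R. ev R f y = \<zero>}"
    using fermat unfolding solve_def by auto
qed

end

section \<open>The field operations on codes\<close>

text \<open>Reduction modulo \<open>p\<close>; the modulus is written so that it is never zero.\<close>

definition resring :: "nat \<Rightarrow> nat ring" where
  "resring p = \<lparr>carrier = {..<p}, mult = (\<lambda>a b. (a * b) mod Suc (p - 1)), one = 1, zero = 0,
     add = (\<lambda>a b. (a + b) mod Suc (p - 1))\<rparr>"

text \<open>Modulo \<open>g\<close>, the power \<open>X ^ n\<close> is the negative of the lower
  terms of \<open>g\<close>, listed here from the constant one on. The outer \<open>mod\<close>
  sends the negative of zero to zero instead of \<open>p\<close>.\<close>

definition lowpart :: "nat \<Rightarrow> nat list \<Rightarrow> nat list" where
  "lowpart p g = map (\<lambda>a. (p - a) mod p) (rev (tl g))"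

definition codering :: "nat \<times> nat list \<Rightarrow> nat list ring" where
  "codering w = ext (resring (fst w)) (snd w)"

definition minus_one :: "nat \<times> nat list \<Rightarrow> nat list" where
  "minus_one w = (case snd w of [] \<Rightarrow> [] | _ # t \<Rightarrow> (fst w - 1) # map (\<lambda>_. 0) t)"

lemma zeros_map: "i \<zero>\<^bsub>G\<^esub> = \<zero>\<^bsub>F\<^esub> \<Longrightarrow> map i (zeros G u) = zeros F u"
  by (simp add: zeros_def)

locale coeff_hom = G: cring G + F: cring F for G :: "'c ring" and F :: "'f ring" +
  fixes i :: "'c \<Rightarrow> 'f"
  assumes hom: "i \<in> ring_hom G F"
begin

lemma i_simps: "a \<in> carrier G \<Longrightarrow> i a \<in> carrier F"
  "a \<in> carrier G \<Longrightarrow> b \<in> carrier G \<Longrightarrow> i (a \<otimes>\<^bsub>G\<^esub> b) = i a \<otimes>\<^bsub>F\<^esub> i b"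
  "a \<in> carrier G \<Longrightarrow> b \<in> carrier G \<Longrightarrow> i (a \<oplus>\<^bsub>G\<^esub> b) = i a \<oplus>\<^bsub>F\<^esub> i b"
  "i \<one>\<^bsub>G\<^esub> = \<one>\<^bsub>F\<^esub>" "i \<zero>\<^bsub>G\<^esub> = \<zero>\<^bsub>F\<^esub>"
  using hom ring_hom_zero[OF hom G.ring_axioms F.ring_axioms] by (auto simp: ring_hom_def)

lemma map_closed: "set u \<subseteq> carrier G \<Longrightarrow> set (map i u) \<subseteq> carrier F"
  using i_simps(1) by auto

lemma map_smul: "c \<in> carrier G \<Longrightarrow> set u \<subseteq> carrier G \<Longrightarrow> map i (smul G c u) = smul F (i c) (map i u)"
  by (induction u) (auto simp: i_simps)

lemma map_addl: "set u \<subseteq> carrier G \<Longrightarrow> set v \<subseteq> carrier G \<Longrightarrow> map i (addl G u v) = addl F (map i u) (map i v)"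
  by (induction u v rule: list_induct2') (auto simp: i_simps)

lemma map_xmul:
  assumes "set h \<subseteq> carrier G" "set u \<subseteq> carrier G"
  shows "map i (xmul G h u) = xmul F (map i h) (map i u)"
proof (cases u rule: rev_cases)
  case (snoc ls l)
  have "set (\<zero>\<^bsub>G\<^esub> # ls) \<subseteq> carrier G" "set (smul G l h) \<subseteq> carrier G" using assms snoc by (auto intro!: G.smul_closed[THEN subsetD])
  then show ?thesis using assms snoc by (simp add: xmul_def map_addl map_smul i_simps del: F.addl_simps G.addl_simps)
qed (simp add: xmul_def)

lemma map_mulm:
  assumes "set h \<subseteq> carrier G" "set u \<subseteq> carrier G" "set v \<subseteq> carrier G" "length v = length h"
  shows "map i (mulm G h u v) = mulm F (map i h) (map i u) (map i v)"
  using assms(2)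
proof (induction u)
  case Nil
  then show ?case by (simp add: mulm_def zeros_map i_simps) (simp add: zeros_def)
next
  case (Cons c u)
  have c: "c \<in> carrier G" "set u \<subseteq> carrier G" using Cons.prems by auto
  have m: "set (mulm G h u v) \<subseteq> carrier G" using assms c by (intro G.mulm_props)
  have "map i (mulm G h (c # u) v) = map i (addl G (smul G c v) (xmul G h (mulm G h u v)))" by (simp add: mulm_def)
  also have "\<dots> = addl F (map i (smul G c v)) (map i (xmul G h (mulm G h u v)))"
    using assms c m by (intro map_addl G.smul_closed G.xmul_closed)
  also have "\<dots> = mulm F (map i h) (map i (c # u)) (map i v)"
    using assms c m Cons by (simp add: map_smul map_xmul mulm_def)
  finally show ?case .
qed

end

text \<open>Here the two conventions for coefficient lists meet, leading coefficient first in the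
  library and constant one first in the algorithm.\<close>

lemma (in ring) eval_eq_ev:
  assumes "cring R" "set l \<subseteq> carrier R" "x \<in> carrier R"
  shows "eval l x = ev R (rev l) x"
  using assms(2)
proof (induction l)
  case Nil
  show ?case by (simp add: ev_def)
next
  case (Cons a l)
  interpret cring R by fact
  have "ev R (rev l @ [a]) x = ev R (rev l) x \<oplus> (x [^] length (rev l) \<otimes> a)"
    using Cons.prems assms(3) by (intro ev_snoc) auto
  then show ?case using Cons assms(3) by (simp add: a_comm m_comm)
qed

locale presented =
  fixes p :: nat and g :: "nat list" and q :: nat
  assumes pres: "(p, g) \<in> presentations q"
begin

abbreviation "Z \<equiv> residue_ring (int p)"
abbreviation "F \<equiv> Fq (p, g)"
definition "n = length g - 1"
definition "gi = map int g"
definition "h = lowpart p g"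

lemma prime_p: "prime p" and g_carr: "gi \<in> carrier (poly_ring Z)" and hd_g: "hd g = 1"
  and irr: "pirreducible\<^bsub>Z\<^esub> (carrier Z) gi" and q: "q = p ^ n"
  using pres by (auto simp: presentations_def gi_def n_def)

lemma rp: "residues_prime p"
  using prime_p by (simp add: residues_prime_def)

sublocale Zf: field "residue_ring (int p)" by (rule residues_prime.is_field[OF rp])

sublocale rp: residues_prime p "residue_ring (int p)" by (rule rp)

lemma p2: "p \<ge> 2" using prime_p by (rule prime_ge_2_nat)

lemma Z_simps: "carrier Z = {0..int p - 1}" "x \<oplus>\<^bsub>Z\<^esub> y = (x + y) mod int p" "x \<otimes>\<^bsub>Z\<^esub> y = (x * y) mod int p"
  "\<zero>\<^bsub>Z\<^esub> = 0" "\<one>\<^bsub>Z\<^esub> = 1"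
  by (simp_all add: rp.res_carrier_eq rp.res_add_eq rp.res_mult_eq rp.res_zero_eq rp.res_one_eq)

lemma subf: "subfield (carrier Z) Z" by (rule Zf.carrier_is_subfield)
lemma subr: "subring (carrier Z) Z" by (rule Zf.carrier_is_subring)

lemma F_def': "F = Rupt\<^bsub>Z\<^esub> (carrier Z) gi"
  by (simp add: Fq_def gi_def)

sublocale F: field "Fq (p, g)"
  unfolding F_def' using Zf.rupture_is_field_iff_pirreducible[OF subf g_carr] irr by simp

text \<open>The field is generated by the class \<open>xi\<close> of \<open>X\<close> over the prime
  field, which \<open>i\<close> embeds. With these, \<open>field_elem\<close> becomes an evaluation
  at \<open>xi\<close>, and the facts about \<open>ev\<close> and \<open>mulm\<close> apply.\<close>

definition "sj = Zf.rupture_surj (carrier Z) gi"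
definition "i a = sj (Zf.poly_of_const (int a))"
definition "xi = sj (var Z)"

lemma G0: "cring (resring p)"
proof -
  have "nat \<in> ring_iso Z (resring p)"
    unfolding ring_iso_def ring_hom_def
  proof (safe)
    show "bij_betw nat (carrier Z) (carrier (resring p))"
      unfolding Z_simps resring_def using p2
      by (intro bij_betw_byWitness[where f' = int]) auto
  qed (use p2 in \<open>auto simp: Z_simps resring_def nat_mult_distrib nat_add_distrib nat_mod_distrib\<close>)
  from Zf.ring_iso_imp_img_cring[OF this] show ?thesis by (simp add: Z_simps resring_def)
qed

sublocale G0: cring "resring p" by (rule G0)

lemma gi_poly: "set gi \<subseteq> carrier Z" "gi \<noteq> []" "hd gi \<noteq> 0"
proof -
  have ne: "gi \<noteq> []" using irr Zf.pirreducible_degree[OF subf g_carr irr] by auto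
  then show "gi \<noteq> []" "hd gi \<noteq> 0" using hd_g by (auto simp: gi_def hd_map)
  show "set gi \<subseteq> carrier Z"
    using g_carr Zf.polynomial_incl unfolding univ_poly_carrier by blast
qed

lemma n_pos: "n \<ge> 1"
  using Zf.pirreducible_degree[OF subf g_carr irr] by (simp add: gi_def n_def)

lemma carr0: "carrier (resring p) = {..<p}"
  by (simp add: resring_def)

lemma g_eq: "g = 1 # tl g" "length (tl g) = n" "set (tl g) \<subseteq> {..<p}" "set g \<subseteq> {..<p}"
proof -
  have "g \<noteq> []" using gi_poly(2) by (auto simp: gi_def)
  then show "g = 1 # tl g" using hd_g by (cases g) auto
  show "length (tl g) = n" by (simp add: n_def)
  show "set g \<subseteq> {..<p}" using gi_poly(1) by (auto simp: gi_def Z_simps)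
  then show "set (tl g) \<subseteq> {..<p}" by (cases g) auto
qed

lemma sj_hom: "sj \<in> ring_hom (poly_ring Z) F" and sj_hom': "ring_hom_ring (poly_ring Z) F sj"
  using Zf.rupture_surj_hom[OF subr g_carr] by (auto simp: sj_def F_def')

lemma xi_closed: "xi \<in> carrier F"
  unfolding xi_def using ring_hom_closed[OF sj_hom Zf.var_closed(1)[OF subr]] .

lemma i_hom: "i \<in> ring_hom (resring p) F"
proof -
  have h: "sj \<circ> Zf.poly_of_const \<in> ring_hom Z F"
    using Zf.rupture_surj_norm_is_hom[OF subr g_carr] by (simp add: sj_def F_def')
  have c: "a < p \<Longrightarrow> int a \<in> carrier Z" for a by (simp add: Z_simps)
  have m: "int ((a * b) mod p) = int a \<otimes>\<^bsub>Z\<^esub> int b" "int ((a + b) mod p) = int a \<oplus>\<^bsub>Z\<^esub> int b" for a b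
    by (simp_all add: Z_simps zmod_int)
  have "i a = (sj \<circ> Zf.poly_of_const) (int a)" for a by (simp add: i_def)
  moreover have "Suc (p - 1) = p" using p2 by simp
  ultimately show ?thesis using h c ring_hom_mult[OF h] ring_hom_add[OF h] ring_hom_closed[OF h] ring_hom_one[OF h]
    by (intro ring_hom_memI) (auto simp: resring_def m Z_simps(5) simp del: o_apply)
qed

sublocale H: coeff_hom "resring p" "Fq (p, g)" i
  by (intro coeff_hom.intro coeff_hom_axioms.intro G0 F.is_cring i_hom)

lemma sj_eval: "v \<in> carrier (poly_ring Z) \<Longrightarrow> sj v = ring.eval F (map (sj \<circ> Zf.poly_of_const) v) xi"
proof -
  assume v: "v \<in> carrier (poly_ring Z)"
  interpret UP: domain "poly_ring Z" using Zf.univ_poly_is_domain[OF subr] .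
  interpret Hom: ring_hom_ring "poly_ring Z" F sj by (rule sj_hom')
  have "ring.eval F (map (sj \<circ> Zf.poly_of_const) v) xi = sj (UP.eval (map Zf.poly_of_const v) (var Z))"
    unfolding xi_def using Hom.eval_hom[OF UP.carrier_is_subring Zf.var_closed(1)[OF subr]
          Zf.map_norm_in_poly_ring_carrier[OF subr v]] by simp
  also have "\<dots> = sj v" using Zf.eval_rewrite[OF subr v] by simp
  finally show ?thesis by simp
qed

lemma field_elem_eq:
  assumes "set v \<subseteq> {..<p}"
  shows "field_elem (p, g) v = ev F (map i (rev v)) xi"
proof -
  have vc: "set (map int v) \<subseteq> carrier Z" using assms by (auto simp: Z_simps)
  define N where "N = Zf.normalize (map int v)"
  have N: "N \<in> carrier (poly_ring Z)" unfolding N_def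
    using Zf.normalize_gives_polynomial[OF vc] by (simp add: univ_poly_carrier)
  have ic: "set (map i v) \<subseteq> carrier F" using assms H.i_simps(1) by (auto simp: resring_def)
  have "field_elem (p, g) v = sj N" by (simp add: field_elem_def sj_def N_def gi_def)
  also have "\<dots> = ring.eval F (map (sj \<circ> Zf.poly_of_const) N) xi" by (rule sj_eval[OF N])
  \<comment> \<open>Normalization strips leading zeros, which contribute nothing to the
    value.\<close>
  also have "\<dots> = ring.eval F (map i v) xi"
    unfolding N_def using assms
  proof (induction v)
    case (Cons a v)
    have z: "i 0 = \<zero>\<^bsub>F\<^esub>" using H.i_simps(5) by (simp add: resring_def)
    have ev: "ring.eval F (map i v) xi \<in> carrier F"
      using Cons.prems H.i_simps(1) xi_closed by (intro F.eval_in_carrier) (auto simp: resring_def)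
    show ?case
    proof (cases "a = 0")
      case True
      then show ?thesis using Cons z ev xi_closed by (simp add: Z_simps)
    next
      case False
      have "map (sj \<circ> Zf.poly_of_const \<circ> int) l = map i l" for l by (simp add: i_def)
      then show ?thesis using False by (simp add: Z_simps i_def comp_def)
    qed
  qed simp
  also have "\<dots> = ev F (rev (map i v)) xi" by (rule F.eval_eq_ev[OF F.is_cring ic xi_closed])
  finally show ?thesis by (simp add: rev_map)
qed

lemma lengths: "length h = n" "set h \<subseteq> carrier (resring p)" "h \<noteq> []"
proof -
  show l: "length h = n" using g_eq(2) by (simp add: h_def lowpart_def)
  show "set h \<subseteq> carrier (resring p)" using p2 by (auto simp: h_def lowpart_def carr0)
  show "h \<noteq> []" using l n_pos by (cases h) auto
qed

text \<open>This is \<open>g(xi) = 0\<close> solved for the leading term; it makes \<open>xi\<close>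
  a point in the sense of \<open>mulm_props\<close>.\<close>

lemma xi_pow: "xi [^]\<^bsub>F\<^esub> n = ev F (map i h) xi"
proof -
  define L where "L = map i (rev (tl g))"
  have L: "set L \<subseteq> carrier F" "length L = n" using g_eq H.i_simps(1) by (auto simp: L_def resring_def)
  have "\<zero>\<^bsub>F\<^esub> = ring.eval F (map (sj \<circ> Zf.poly_of_const) gi) xi"
    using Zf.polynomial_rupture[OF subr g_carr] by (simp add: sj_def xi_def F_def')
  also have "map (sj \<circ> Zf.poly_of_const) gi = map i g" by (simp add: gi_def i_def)
  also have "ring.eval F (map i g) xi = ev F (rev (map i g)) xi"
    using g_eq(4) H.i_simps(1) by (intro F.eval_eq_ev F.is_cring xi_closed) (auto simp: carr0)
  also have "rev (map i g) = L @ [\<one>\<^bsub>F\<^esub>]"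
    using H.i_simps(4) by (subst g_eq(1)) (simp add: L_def rev_map resring_def)
  also have "ev F \<dots> xi = ev F L xi \<oplus>\<^bsub>F\<^esub> xi [^]\<^bsub>F\<^esub> n"
    using L xi_closed by (simp add: F.ev_snoc)
  finally have e: "ev F L xi \<oplus>\<^bsub>F\<^esub> xi [^]\<^bsub>F\<^esub> n = \<zero>\<^bsub>F\<^esub>" by simp
  have neg: "i ((p - a) mod p) = \<ominus>\<^bsub>F\<^esub> i a" if "a < p" for a
  proof -
    have c: "a \<in> carrier (resring p)" "(p - a) mod p \<in> carrier (resring p)" using that by (auto simp: resring_def)
    have "((p - a) mod p + a) mod p = 0" using that by (simp add: mod_add_left_eq)
    then have "((p - a) mod p) \<oplus>\<^bsub>resring p\<^esub> a = \<zero>\<^bsub>resring p\<^esub>" using that by (simp add: resring_def)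
    then have "i ((p - a) mod p) \<oplus>\<^bsub>F\<^esub> i a = \<zero>\<^bsub>F\<^esub>" using H.i_simps(3)[OF c(2,1)] H.i_simps(5) by simp
    then show ?thesis using H.i_simps(1) c F.minus_equality by simp
  qed
  have "ev F (map (\<lambda>a. \<ominus>\<^bsub>F\<^esub> a) l) xi = \<ominus>\<^bsub>F\<^esub> ev F l xi" if "set l \<subseteq> carrier F" for l
    using that xi_closed by (induction l) (auto simp: F.r_minus F.minus_add)
  moreover have "map i h = map (\<lambda>a. \<ominus>\<^bsub>F\<^esub> a) L"
    using g_eq(3) neg by (auto simp: h_def lowpart_def L_def)
  ultimately have "ev F (map i h) xi = \<ominus>\<^bsub>F\<^esub> ev F L xi" using L by simp
  also have "\<dots> = xi [^]\<^bsub>F\<^esub> n" using e L xi_closed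
    by (metis F.ev_closed F.minus_equality F.minus_minus F.nat_pow_closed F.a_comm)
  finally show ?thesis by simp
qed

definition "G = codering (p, h)"
text \<open>Codes start with the leading coefficient and the lists of the algorithm with the
  constant one, hence the reversal.\<close>

definition "\<phi> u = field_elem (p, g) (rev u)"

lemma G_simps: "carrier G = {u. length u = n \<and> set u \<subseteq> {..<p}}" "u \<otimes>\<^bsub>G\<^esub> v = mulm (resring p) h u v"
  "\<one>\<^bsub>G\<^esub> = onel (resring p) h" "\<zero>\<^bsub>G\<^esub> = zeros (resring p) h"
  "u \<oplus>\<^bsub>G\<^esub> v = map snd (zip h (addl (resring p) u v))"
  by (simp_all add: G_def codering_def ext_def lengths) (simp add: resring_def)

lemma \<phi>_eq: "u \<in> carrier G \<Longrightarrow> \<phi> u = ev F (map i u) xi"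
  by (simp add: \<phi>_def G_simps field_elem_eq)

lemma carrier_codes: "u \<in> carrier G \<longleftrightarrow> rev u \<in> codes (p, g)"
  by (simp add: codes_def G_simps n_def)

lemma \<phi>_hom: "\<phi> \<in> ring_hom G F"
proof -
  have C: "u \<in> carrier G \<Longrightarrow> set u \<subseteq> carrier (resring p) \<and> length u = length h" for u
    by (simp add: G_simps lengths) (simp add: resring_def)
  have C': "set u \<subseteq> carrier (resring p) \<Longrightarrow> length u = length h \<Longrightarrow> u \<in> carrier G" for u
    by (simp add: G_simps lengths) (simp add: resring_def)
  have x: "xi [^]\<^bsub>F\<^esub> length (map i h) = ev F (map i h) xi" using xi_pow lengths by simp
  have m: "u \<otimes>\<^bsub>G\<^esub> v \<in> carrier G" if "u \<in> carrier G" "v \<in> carrier G" for u v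
    unfolding G_simps(2) using C[OF that(1)] C[OF that(2)] G0.mulm_props(1,2)[of h u v] lengths by (intro C') auto
  have ad: "u \<oplus>\<^bsub>G\<^esub> v = addl (resring p) u v" if "u \<in> carrier G" "v \<in> carrier G" for u v
    unfolding G_simps(5) using C[OF that(1)] C[OF that(2)] by simp
  have a: "u \<oplus>\<^bsub>G\<^esub> v \<in> carrier G" if "u \<in> carrier G" "v \<in> carrier G" for u v
    unfolding ad[OF that] using C[OF that(1)] C[OF that(2)] by (intro C' G0.addl_closed) auto
  have o: "\<one>\<^bsub>G\<^esub> \<in> carrier G" unfolding G_simps(3) using G0.onel_props[of h] by (intro C') auto
  show ?thesis
  proof (rule ring_hom_memI)
    fix u v assume u: "u \<in> carrier G" and v: "v \<in> carrier G"
    note cu = C[OF u, THEN conjunct1] and cv = C[OF v, THEN conjunct1]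
    show "\<phi> u \<in> carrier F" unfolding \<phi>_eq[OF u] using H.map_closed cu xi_closed by (intro F.ev_closed)
    have "\<phi> (u \<otimes>\<^bsub>G\<^esub> v) = ev F (mulm F (map i h) (map i u) (map i v)) xi"
      using \<phi>_eq[OF m[OF u v]] cu cv C[OF v] lengths(2) by (simp add: G_simps(2) H.map_mulm)
    also have "\<dots> = ev F (map i u) xi \<otimes>\<^bsub>F\<^esub> ev F (map i v) xi"
      using H.map_closed cu cv lengths(2) C[OF v] x xi_closed by (intro F.mulm_props(3)) auto
    finally show "\<phi> (u \<otimes>\<^bsub>G\<^esub> v) = \<phi> u \<otimes>\<^bsub>F\<^esub> \<phi> v" using u v by (simp add: \<phi>_eq)
    have "\<phi> (u \<oplus>\<^bsub>G\<^esub> v) = ev F (addl F (map i u) (map i v)) xi"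
      unfolding \<phi>_eq[OF a[OF u v]] unfolding ad[OF u v] using cu cv by (simp add: H.map_addl)
    also have "\<dots> = ev F (map i u) xi \<oplus>\<^bsub>F\<^esub> ev F (map i v) xi"
      using H.map_closed cu cv C[OF u] C[OF v] xi_closed by (intro F.ev_addl) auto
    finally show "\<phi> (u \<oplus>\<^bsub>G\<^esub> v) = \<phi> u \<oplus>\<^bsub>F\<^esub> \<phi> v" using u v by (simp add: \<phi>_eq)
  next
    have "map i (onel (resring p) h) = onel F (map i h)"
      using H.i_simps by (cases h) (auto simp: onel_def zeros_map zeros_def)
    then show "\<phi> \<one>\<^bsub>G\<^esub> = \<one>\<^bsub>F\<^esub>"
      unfolding \<phi>_eq[OF o] unfolding G_simps(3) using lengths(3) xi_closed by (simp add: F.onel_props)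
  qed
qed

text \<open>Both sides are compared with the polynomials of length at most \<open>n\<close>, the
  remainders modulo \<open>g\<close>: padding with zeros identifies them with the lists of length
  \<open>n\<close>, and the projection maps them bijectively onto the quotient.\<close>

lemma \<phi>_bij: "bij_betw \<phi> (carrier G) (carrier F)"
proof -
  let ?P = "{r \<in> carrier (poly_ring Z). length r \<le> n}"
  have nz: "gi \<noteq> []" by (rule gi_poly)
  have dg: "length gi - 1 = n" by (simp add: gi_def n_def)
  have P: "(\<lambda>r. Zf.pmod r gi) ` carrier (poly_ring Z) = ?P"
    using Zf.pmod_image_characterization[OF subf g_carr nz] dg by simp
  have b1: "bij_betw sj ?P (carrier F)"
    unfolding bij_betw_def P[symmetric] sj_def F_def'
    using Zf.rupture_surj_inj_on[OF subf g_carr] Zf.rupture_carrier_as_pmod_image[OF subf g_carr] by simp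
  have fe: "\<phi> u = sj (Zf.normalize (map int (rev u)))" for u
    by (simp add: \<phi>_def field_elem_def sj_def gi_def)
  have b2: "bij_betw (\<lambda>u. Zf.normalize (map int (rev u))) (carrier G) ?P"
  proof (rule bij_betw_byWitness[where f' = "\<lambda>r. rev (replicate (n - length r) 0 @ map nat r)"])
    have rep: "map int (replicate k 0 @ map nat r) = replicate k \<zero>\<^bsub>Z\<^esub> @ r" if "set r \<subseteq> carrier Z" for k r
    proof -
      have "map (int \<circ> nat) r = r" using that by (auto simp: Z_simps intro!: map_idI)
      then show ?thesis by (simp add: Z_simps)
    qed
    have strip: "replicate (length v - length (Zf.normalize (map int v))) 0 @ map nat (Zf.normalize (map int v)) = v" for v
    proof (induction v)
      case (Cons a v)
      have "length (Zf.normalize (map int v)) \<le> length v" using Zf.normalize_length_le[of "map int v"] by simp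
      then show ?case using Cons by (cases "a = 0") (auto simp: Z_simps Suc_diff_le comp_def)
    qed simp
    show "\<forall>u\<in>carrier G. rev (replicate (n - length (Zf.normalize (map int (rev u)))) 0 @ map nat (Zf.normalize (map int (rev u)))) = u"
    proof
      fix u assume "u \<in> carrier G"
      then have e: "replicate (n - length (Zf.normalize (map int (rev u)))) 0 @ map nat (Zf.normalize (map int (rev u))) = rev u"
        using strip[of "rev u"] by (simp add: G_simps)
      show "rev (replicate (n - length (Zf.normalize (map int (rev u)))) 0 @ map nat (Zf.normalize (map int (rev u)))) = u"
        unfolding e by simp
    qed
    show "\<forall>r\<in>?P. Zf.normalize (map int (rev (rev (replicate (n - length r) 0 @ map nat r)))) = r"
    proof
      fix r assume r: "r \<in> ?P"
      then have pr: "polynomial\<^bsub>Z\<^esub> (carrier Z) r" by (simp add: univ_poly_carrier)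
      have sr: "set r \<subseteq> carrier Z" using Zf.polynomial_incl[OF pr] .
      show "Zf.normalize (map int (rev (rev (replicate (n - length r) 0 @ map nat r)))) = r"
        unfolding rev_rev_ident rep[OF sr] Zf.normalize_replicate_zero by (rule Zf.normalize_polynomial[OF pr])
    qed
    show "(\<lambda>u. Zf.normalize (map int (rev u))) ` carrier G \<subseteq> ?P"
    proof
      fix r assume "r \<in> (\<lambda>u. Zf.normalize (map int (rev u))) ` carrier G"
      then obtain u where u: "u \<in> carrier G" "r = Zf.normalize (map int (rev u))" by auto
      have "set (map int (rev u)) \<subseteq> carrier Z" using u(1) by (auto simp: G_simps Z_simps)
      then show "r \<in> ?P" using u Zf.normalize_gives_polynomial[of "map int (rev u)"] Zf.normalize_length_le[of "map int (rev u)"]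
        by (auto simp: univ_poly_carrier G_simps)
    qed
    show "(\<lambda>r. rev (replicate (n - length r) 0 @ map nat r)) ` ?P \<subseteq> carrier G"
    proof
      fix u assume "u \<in> (\<lambda>r. rev (replicate (n - length r) 0 @ map nat r)) ` ?P"
      then obtain r where r: "r \<in> ?P" "u = rev (replicate (n - length r) 0 @ map nat r)" by auto
      then have "set r \<subseteq> carrier Z" using Zf.polynomial_incl by (auto simp: univ_poly_carrier)
      then have "nat x < p" if "x \<in> set r" for x using that p2 by (force simp: Z_simps)
      then show "u \<in> carrier G" using r p2 by (auto simp: G_simps)
    qed
  qed
  have "bij_betw (sj \<circ> (\<lambda>u. Zf.normalize (map int (rev u)))) (carrier G) (carrier F)"
    by (rule bij_betw_trans[OF b2 b1])
  then show ?thesis by (rule bij_betw_cong[THEN iffD1, rotated]) (simp add: fe)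
qed

lemma \<phi>_zero: "\<phi> \<zero>\<^bsub>G\<^esub> = \<zero>\<^bsub>F\<^esub>"
proof -
  have "\<zero>\<^bsub>G\<^esub> \<in> carrier G" using p2 by (auto simp: G_simps lengths zeros_def resring_def)
  from \<phi>_eq[OF this] have "\<phi> \<zero>\<^bsub>G\<^esub> = ev F (map i (zeros (resring p) h)) xi" by (simp add: G_simps)
  then show ?thesis using zeros_map[of i "resring p" F h] H.i_simps(5) xi_closed by simp
qed

lemma zero_closed_G: "\<zero>\<^bsub>G\<^esub> \<in> carrier G"
  using p2 by (auto simp: G_simps lengths zeros_def resring_def)

text \<open>The axioms are transported from the quotient. Since the known field has to be the source
  of the isomorphism, it is the inverse of \<open>\<phi>\<close> that is used.\<close>

lemma field_G: "field G"
proof -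
  define \<psi> where "\<psi> = the_inv_into (carrier G) \<phi>"
  have "\<phi> \<in> ring_iso G F" using \<phi>_hom \<phi>_bij by (simp add: ring_iso_def)
  have inj: "inj_on \<phi> (carrier G)" and im: "\<phi> ` carrier G = carrier F" using \<phi>_bij by (auto simp: bij_betw_def)
  have 1: "\<phi> (\<psi> x) = x" "\<psi> x \<in> carrier G" if "x \<in> carrier F" for x
    using f_the_inv_into_f[OF inj] the_inv_into_into[OF inj, of x "carrier G"] im that by (auto simp: \<psi>_def)
  have 2: "\<psi> (\<phi> u) = u" if "u \<in> carrier G" for u using the_inv_into_f_f[OF inj that] by (simp add: \<psi>_def)
  have m: "u \<otimes>\<^bsub>G\<^esub> v \<in> carrier G" "u \<oplus>\<^bsub>G\<^esub> v \<in> carrier G" if "u \<in> carrier G" "v \<in> carrier G" for u v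
  proof -
    have c: "set u \<subseteq> carrier (resring p)" "set v \<subseteq> carrier (resring p)" "length v = length h" "length u = length h"
      using that lengths(1) by (auto simp: G_simps carr0)
    show "u \<otimes>\<^bsub>G\<^esub> v \<in> carrier G" using G0.mulm_props(1,2)[OF lengths(2) c(1-3)] lengths(1) by (simp add: G_simps carr0)
    show "u \<oplus>\<^bsub>G\<^esub> v \<in> carrier G" using G0.addl_closed[OF c(1,2)] c lengths(1) by (simp add: G_simps carr0)
  qed
  have o: "\<one>\<^bsub>G\<^esub> \<in> carrier G" using G0.onel_props[of h] lengths(1) by (simp add: G_simps carr0)
  have "\<psi> \<in> ring_iso F G"
    unfolding ring_iso_def ring_hom_def
  proof safe
    show "bij_betw \<psi> (carrier F) (carrier G)" unfolding \<psi>_def by (rule bij_betw_the_inv_into[OF \<phi>_bij])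
    fix x y assume xy: "x \<in> carrier F" "y \<in> carrier F"
    show "\<psi> (x \<otimes>\<^bsub>F\<^esub> y) = \<psi> x \<otimes>\<^bsub>G\<^esub> \<psi> y"
      using 1 xy ring_hom_mult[OF \<phi>_hom, of "\<psi> x" "\<psi> y"] 2[OF m(1)[of "\<psi> x" "\<psi> y"]] by simp
    show "\<psi> (x \<oplus>\<^bsub>F\<^esub> y) = \<psi> x \<oplus>\<^bsub>G\<^esub> \<psi> y"
      using 1 xy ring_hom_add[OF \<phi>_hom, of "\<psi> x" "\<psi> y"] 2[OF m(2)[of "\<psi> x" "\<psi> y"]] by simp
  next
    show "\<psi> \<one>\<^bsub>F\<^esub> = \<one>\<^bsub>G\<^esub>" using 2[OF o] ring_hom_one[OF \<phi>_hom] by simp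
  qed (use 1 in auto)
  \<comment> \<open>The rule delivers the target with its zero replaced by the image of zero, so the
    two zeros remain to be compared.\<close>
  from F.ring_iso_imp_img_field[OF this] have "field (G\<lparr>zero := \<psi> \<zero>\<^bsub>F\<^esub>\<rparr>)" .
  moreover have "\<psi> \<zero>\<^bsub>F\<^esub> = \<zero>\<^bsub>G\<^esub>" using 2[OF zero_closed_G] \<phi>_zero by simp
  ultimately show ?thesis by simp
qed

lemma finite_G: "finite (carrier G)" "card (carrier G) = q"
proof -
  have c: "carrier G = {u. set u \<subseteq> {..<p} \<and> length u = n}" by (auto simp: G_simps)
  show "finite (carrier G)" unfolding c by (rule finite_lists_length_eq) simp
  show "card (carrier G) = q" unfolding c q by (subst card_lists_length_eq) auto
qed

sublocale G: fin_field G q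
  by (intro fin_field.intro fin_field_axioms.intro field_G finite_G)

lemma minus_one_eq: "minus_one (p, h) = \<ominus>\<^bsub>G\<^esub> \<one>\<^bsub>G\<^esub>"
proof -
  obtain a t where ht: "h = a # t" using lengths(3) by (cases h) auto
  have mc: "minus_one (p, h) \<in> carrier G" using p2 lengths(1) by (auto simp: minus_one_def ht G_simps)
  have o: "\<one>\<^bsub>G\<^esub> = 1 # map (\<lambda>_. 0) t" by (simp add: G_simps onel_def ht zeros_def resring_def)
  have "minus_one (p, h) \<oplus>\<^bsub>G\<^esub> \<one>\<^bsub>G\<^esub> = \<zero>\<^bsub>G\<^esub>"
    unfolding o unfolding G_simps ht zeros_def minus_one_def addl_def using p2
    by (simp add: resring_def zip_map1 zip_map2 comp_def zip_same_conv_map)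
  then show ?thesis using G.minus_equality[OF _ G.one_closed mc] by simp
qed

lemma \<phi>_pow: "u \<in> carrier G \<Longrightarrow> \<phi> (u [^]\<^bsub>G\<^esub> (k::nat)) = \<phi> u [^]\<^bsub>F\<^esub> k"
proof (induction k)
  case 0
  then show ?case using ring_hom_one[OF \<phi>_hom] by simp
next
  case (Suc k)
  then show ?case using ring_hom_mult[OF \<phi>_hom, of "u [^]\<^bsub>G\<^esub> k" u] by simp
qed

lemma \<phi>_ev: "set f \<subseteq> carrier G \<Longrightarrow> x \<in> carrier G \<Longrightarrow> \<phi> (ev G f x) = ev F (map \<phi> f) (\<phi> x)"
proof (induction f)
  case Nil
  then show ?case using \<phi>_zero by simp
next
  case (Cons a f)
  have "ev G f x \<in> carrier G" using Cons by (intro G.ev_closed) auto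
  then show ?case using Cons ring_hom_mult[OF \<phi>_hom] ring_hom_add[OF \<phi>_hom] by simp
qed

lemma \<phi>_eq_iff: "u \<in> carrier G \<Longrightarrow> v \<in> carrier G \<Longrightarrow> \<phi> u = \<phi> v \<longleftrightarrow> u = v"
  using \<phi>_bij by (auto simp: bij_betw_def inj_on_def)

lemma prim_root_iff:
  assumes "v \<in> codes (p, g)" "primitive_root_of_unity F k (field_elem (p, g) v)"
  shows "G.prim_root k (rev v)"
proof -
  have v: "rev v \<in> carrier G" using assms(1) by (simp add: carrier_codes)
  have f: "field_elem (p, g) v = \<phi> (rev v)" by (simp add: \<phi>_def)
  have "rev v [^]\<^bsub>G\<^esub> j = \<one>\<^bsub>G\<^esub> \<longleftrightarrow> \<phi> (rev v) [^]\<^bsub>F\<^esub> j = \<one>\<^bsub>F\<^esub>" for j :: nat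
    using \<phi>_eq_iff[of "rev v [^]\<^bsub>G\<^esub> j" "\<one>\<^bsub>G\<^esub>"] v \<phi>_pow[OF v] ring_hom_one[OF \<phi>_hom] by simp
  then show ?thesis using assms(2) v by (auto simp: primitive_root_of_unity_def G.prim_root_def f)
qed

end

section \<open>The complete program\<close>

text \<open>Results are below the modulus for all arguments, reduced or not. A modulus zero would
  break this, as \<open>a mod 0 = a\<close>.\<close>

lemma ptr_resring: "ptr resring"
  unfolding ptr_def
proof (intro conjI exI allI)
  have eq: "a \<oplus>\<^bsub>resring p\<^esub> b = (a + b) mod (p - 1 + 1)" "a \<otimes>\<^bsub>resring p\<^esub> b = (a * b) mod (p - 1 + 1)" for a b p
    by (simp_all add: resring_def)
  show "pt UNIV (\<lambda>z. fst (snd z) \<oplus>\<^bsub>resring (fst z)\<^esub> snd (snd z))" "pt UNIV (\<lambda>z. fst (snd z) \<otimes>\<^bsub>resring (fst z)\<^esub> snd (snd z))"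
    unfolding eq by (intro pt_nat_ops pt_basic)+
  show "pt UNIV (\<lambda>w. \<zero>\<^bsub>resring w\<^esub>)" "pt UNIV (\<lambda>w. \<one>\<^bsub>resring w\<^esub>)"
    by (simp_all add: resring_def pt_const)
  show "pbd UNIV (\<lambda>p :: nat. sz p + 1)" by (intro pbd_intros)
  have "a mod Suc (p - 1) \<le> p" for a p :: nat using mod_le_divisor[of "Suc (p - 1)" a]
    by (cases p) (auto simp del: mod_le_divisor)
  then have *: "sz (a mod Suc (p - 1)) \<le> sz p + 1" for a p :: nat using bl_mono[of "a mod Suc (p - 1)" p] by simp
  show "sz (a \<oplus>\<^bsub>resring w\<^esub> b) \<le> sz w + 1" "sz (a \<otimes>\<^bsub>resring w\<^esub> b) \<le> sz w + 1" for w a b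
    using *[of _ w] by (simp_all add: resring_def)
qed

lemma ptr_codering: "ptr codering"
  unfolding codering_def by (rule ptr_ext[OF ptr_resring])

lemma pt_minus_one: "pt D w \<Longrightarrow> pt D (\<lambda>e. minus_one (w e))"
  unfolding minus_one_def by (rule pt_case_list) (intro pt_basic pt_map pt_nat_ops pt_lift | simp)+

lemma pt_lowpart: "pt D p \<Longrightarrow> pt D g \<Longrightarrow> pt D (\<lambda>e. lowpart (p e) (g e))"
  unfolding lowpart_def by (intro pt_map pt_list pt_nat_ops pt_lift pt_basic)

section \<open>Reading the input and producing unary loop bounds\<close>

lemma pt_take_drop:
  fixes xs :: "'e::enc \<Rightarrow> 'b::enc list"
  assumes k: "pt D k" and xs: "pt D xs"
  shows "pt D (\<lambda>e. take (k e) (xs e))" "pt D (\<lambda>e. drop (k e) (xs e))"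
proof -
  define h1 :: "'b \<Rightarrow> nat \<times> 'b list \<Rightarrow> nat \<times> 'b list" where "h1 a s = (if fst s = 0 then s else (fst s - 1, a # snd s))" for a s
  define h2 :: "'b \<Rightarrow> nat \<times> 'b list \<Rightarrow> nat \<times> 'b list" where "h2 a s = (if fst s = 0 then (0, a # snd s) else (fst s - 1, snd s))" for a s
  have f1: "fold h1 us (n, acc) = (n - length us, rev (take n us) @ acc)" for us n acc
    by (induction us arbitrary: n acc) (auto simp: h1_def take_Cons' split: nat.split)
  have f2: "fold h2 us (n, acc) = (n - length us, rev (drop n us) @ acc)" for us n acc
    by (induction us arbitrary: n acc) (auto simp: h2_def drop_Cons' split: nat.split)
  have sz: "sz (take n us) \<le> sz us" "sz (drop n us) \<le> sz us" for n and us :: "'b list"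
    using sz_append[of "take n us" "drop n us"] by simp_all
  have bl: "bl (n - m) \<le> bl n" for n m by (rule bl_mono) simp
  have F: "pbd D (\<lambda>e. 2 * sz (k e) + sz (xs e) + 1)" by (intro pbd_intros pt_pbd k xs)
  have "pt D (\<lambda>e. fold h1 (xs e) (k e, []))"
  proof (rule pt_fold[OF xs _ _ F])
    show "sz (fold h1 us (k e, [])) \<le> 2 * sz (k e) + sz (xs e) + 1" if "xs e = us @ vs" for e us vs
      unfolding f1 using sz(1)[of "k e" us] bl[of "k e" "length us"] that by simp
  qed (unfold h1_def, (intro pt_If pt_eq pt_nat_ops pt_basic k)+)
  then have "pt D (\<lambda>e. rev (snd (fold h1 (xs e) (k e, []))))" by (intro pt_rev pt_basic)
  then show "pt D (\<lambda>e. take (k e) (xs e))" by (simp add: f1)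
  have "pt D (\<lambda>e. fold h2 (xs e) (k e, []))"
  proof (rule pt_fold[OF xs _ _ F])
    show "sz (fold h2 us (k e, [])) \<le> 2 * sz (k e) + sz (xs e) + 1" if "xs e = us @ vs" for e us vs
      unfolding f2 using sz(2)[of "k e" us] bl[of "k e" "length us"] that by simp
  qed (unfold h2_def, (intro pt_If pt_eq pt_nat_ops pt_basic k)+)
  then have "pt D (\<lambda>e. rev (snd (fold h2 (xs e) (k e, []))))" by (intro pt_rev pt_basic)
  then show "pt D (\<lambda>e. drop (k e) (xs e))" by (simp add: f2)
qed

definition chunk_step :: "nat \<Rightarrow> 'b \<Rightarrow> 'b list \<times> 'b list list \<Rightarrow> 'b list \<times> 'b list list" where
  "chunk_step n a s = (if length (a # fst s) = n then ([], (a # fst s) # snd s) else (a # fst s, snd s))"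

definition chunks :: "nat \<Rightarrow> 'b list \<Rightarrow> 'b list list" where
  "chunks n us = snd (fold (chunk_step n) us ([], []))"

text \<open>Both reversals are welcome: the input lists coefficients and digits of field elements
  from the top, the algorithm wants the constant terms first.\<close>

lemma chunks_concat:
  assumes "\<forall>c\<in>set cs. length c = n" "n > 0"
  shows "chunks n (concat cs) = rev (map rev cs)"
proof -
  have 1: "fold (chunk_step n) us (b, acc) = ([], (rev us @ b) # acc)" if "length us + length b = n" "us \<noteq> []" for us b :: "'a list" and acc
    using that
  proof (induction us arbitrary: b)
    case (Cons u us)
    then show ?case by (cases "us = []") (auto simp: chunk_step_def)
  qed simp
  have "fold (chunk_step n) (concat cs) ([], acc) = ([], rev (map rev cs) @ acc)" for acc
    using assms(1)
  proof (induction cs arbitrary: acc)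
    case (Cons c cs)
    then show ?case using 1[of c "[]" acc] assms(2) by fastforce
  qed simp
  then show ?thesis by (simp add: chunks_def)
qed

lemma pt_chunks:
  fixes xs :: "'e::enc \<Rightarrow> 'b::enc list"
  assumes k: "pt D k" and xs: "pt D xs"
  shows "pt D (\<lambda>e. chunks (k e) (xs e))"
proof -
  have s: "2 * sz (fst s) + sz (snd s) + length (fst s) \<le> 9 * sz us" if "s = fold (chunk_step n) us ([], [])" for s n and us :: "'b list"
    using that
  proof (induction us arbitrary: s rule: rev_induct)
    case (snoc u us)
    define s' where "s' = fold (chunk_step n) us ([], [])"
    have "2 * sz (fst s') + sz (snd s') + length (fst s') \<le> 9 * sz us" using snoc.IH s'_def by blast
    then show ?case unfolding snoc.prems by (simp add: s'_def[symmetric] chunk_step_def)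
  qed simp
  have "pt D (\<lambda>e. fold (chunk_step (k e)) (xs e) ([], []))"
  proof (rule pt_fold[OF xs pt_const])
    show "pbd D (\<lambda>e. 9 * sz (xs e) + 1)" by (intro pbd_intros pt_pbd xs)
    show "sz (fold (chunk_step (k e)) us ([], [])) \<le> 9 * sz (xs e) + 1" if "xs e = us @ vs" for e us vs
    proof -
      obtain a b where ab: "fold (chunk_step (k e)) us ([], []) = (a, b)" by fastforce
      show ?thesis using s[OF refl, of "k e" us] that unfolding ab by simp
    qed
  qed (unfold chunk_step_def, intro pt_If pt_eq pt_length pt_basic pt_lift k)
  then show ?thesis unfolding chunks_def by (intro pt_basic)
qed

text \<open>The exponent is given in unary, as the length of a list; with a binary exponent the
  result could be exponentially long.\<close>

lemma pt_prime_power: "pt D p \<Longrightarrow> pt D h \<Longrightarrow> pt D (\<lambda>e. p e ^ length (h e))"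
  for p :: "'e::enc \<Rightarrow> nat" and h :: "'e \<Rightarrow> 'b::enc list"
proof -
  assume p: "pt D p" and h: "pt D h"
  have *: "fold (\<lambda>_ a. a * b) us c = c * b ^ length us" for us :: "'b list" and b c :: nat
    by (induction us arbitrary: c) auto
  have bp: "bl (b ^ j) \<le> j * bl b + 1" for b j 
  proof (induction j)
    case (Suc j)
    then show ?case using bl_mult[of b "b ^ j"] by simp
  qed simp
  have "pt D (\<lambda>e. fold (\<lambda>_ a. a * p e) (h e) 1)"
  proof (rule pt_fold[OF h pt_const])
    show "pbd D (\<lambda>e. length (h e) * sz (p e) + 1)" by (intro pbd_intros pbd_length h pt_pbd p)
    show "sz (fold (\<lambda>_ a. a * p e) us (1::nat)) \<le> length (h e) * sz (p e) + 1" if "h e = us @ vs" for e us vs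
      
    proof -
      have "length us * bl (p e) \<le> length (h e) * bl (p e)" by (rule mult_le_mono1) (simp add: that)
      then have "bl (p e ^ length us) \<le> length (h e) * bl (p e) + 1" using bp[of "p e" "length us"] by linarith
      then show ?thesis unfolding * by simp
    qed
  qed (intro pt_nat_ops pt_basic pt_lift p)
  then show ?thesis by (simp add: *)
qed

text \<open>A unary clock for a fixed exponent \<open>k\<close>: only the length of the result
  matters. It bounds the range of trial division.\<close>

fun ticks :: "nat \<Rightarrow> 'b list \<Rightarrow> nat list" where
  "ticks 0 u = [0]"
| "ticks (Suc k) u = concat (map (\<lambda>_. ticks k u) u)"

lemma length_ticks [simp]: "length (ticks k u) = length u ^ k"
proof (induction k)
  case (Suc k)
  have "length (concat (map (\<lambda>_. xs) u)) = length u * length xs" for xs :: "nat list" by (induction u) auto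
  then show ?case using Suc by simp
qed simp

lemma pt_ticks:
  fixes u :: "'e::enc \<Rightarrow> 'b::enc list"
  assumes u: "pt D u"
  shows "pt D (\<lambda>e. ticks k (u e))"
proof (induction k)
  case (Suc k)
  then show ?case unfolding ticks.simps by (intro pt_concat pt_map pt_lift u)
qed (simp add: pt_const)

lemma pt_range:
  fixes u :: "'e::enc \<Rightarrow> 'b::enc list"
  assumes u: "pt D u"
  shows "pt D (\<lambda>e. [0..<length (u e)])"
proof -
  have *: "fold (\<lambda>_ acc. length acc # acc) us (rev [0..<m]) = rev [0..<m + length us]" for us :: "'b list" and m
  proof (induction us arbitrary: m)
    case (Cons a us)
    show ?case using Cons.IH[of "Suc m"] by simp
  qed simp
  have **: "fold (\<lambda>_ acc. length acc # acc) us [] = rev [0..<length us]" for us :: "'b list" using *[of us 0] by simp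
  have "pt D (\<lambda>e. fold (\<lambda>_ acc. length acc # acc) (u e) [])"
  proof (rule pt_fold[OF u pt_const])
    show "pbd D (\<lambda>e. length (u e) * (2 * length (u e) + 1))" by (intro pbd_intros pbd_length u)
    show "sz (fold (\<lambda>_ acc. length acc # acc) us []) \<le> length (u e) * (2 * length (u e) + 1)" if "u e = us @ vs" for e us vs
      unfolding ** sz_rev
    proof (rule sz_list_bound)
      show "\<forall>x\<in>set [0..<length us]. sz x \<le> length (u e)"
      proof
        fix x assume "x \<in> set [0..<length us]"
        then show "sz x \<le> length (u e)" using bl_le_self[of x] that by simp
      qed
    qed (use that in auto)
  qed (intro pt_length pt_basic)
  then have "pt D (\<lambda>e. rev (fold (\<lambda>_ acc. length acc # acc) (u e) []))" by (rule pt_rev)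
  then show ?thesis by (simp add: **)
qed

section \<open>Trial division\<close>

definition div_step :: "nat \<Rightarrow> nat \<times> (nat \<times> nat) list \<Rightarrow> nat \<times> (nat \<times> nat) list" where
  "div_step r s = (if 2 - r = 0 then if fst s mod r = 0 then (fst s div r, (fst s div r, r) # snd s) else s else s)"

text \<open>Every trial divisor is repeated as often as \<open>u\<close> is long, enough to remove
  its full power. The condition \<open>2 \<le> r\<close> appears in \<open>div_step\<close> as
  \<open>2 - r = 0\<close>, since \<open>pt_eq\<close> is the test at hand.\<close>

definition trial :: "nat list \<Rightarrow> 'b list \<Rightarrow> nat \<Rightarrow> nat \<times> (nat \<times> nat) list" where
  "trial w u m = fold div_step (concat (map (\<lambda>r. map (\<lambda>_. r) u) w)) (m, [])"

text \<open>The entries \<open>(M, r)\<close> record successive divisions, each \<open>M\<close> being the quotient that is left.\<close>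

fun dchain :: "nat \<Rightarrow> (nat \<times> nat) list \<Rightarrow> nat \<Rightarrow> bool" where
  "dchain a [] b \<longleftrightarrow> a = b"
| "dchain a ((M, r) # l) b \<longleftrightarrow> a = r * M \<and> dchain M l b"

lemma dchain_snoc: "dchain a l b \<Longrightarrow> b = r * M \<Longrightarrow> dchain a (l @ [(M, r)]) M"
  by (induction a l b rule: dchain.induct) auto

definition divided :: "nat \<Rightarrow> nat \<Rightarrow> nat \<times> (nat \<times> nat) list \<Rightarrow> bool" where
  "divided m0 k s \<longleftrightarrow> dchain m0 (rev (snd s)) (fst s) \<and> fst s > 0 \<and> fst s dvd m0 \<and>
     (\<forall>(M, r)\<in>set (snd s). prime r \<and> r dvd m0) \<and> (\<forall>p. prime p \<longrightarrow> p dvd fst s \<longrightarrow> k \<le> p)"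

text \<open>If \<open>r \<ge> 2\<close> divides what is left, then \<open>r\<close> is prime, for a
  smaller prime factor of it would have been removed before; no primality test is called
  for.\<close>

lemma divided_step:
  assumes "divided m0 r s"
  shows "divided m0 r (div_step r s)"
proof (cases "2 \<le> r \<and> r dvd fst s")
  case True
  obtain m acc where s: "s = (m, acc)" by fastforce
  have m: "m = r * (m div r)" using True s by simp
  have r: "prime r"
  proof -
    obtain p where p: "prime p" "p dvd r" using prime_factor_nat[of r] True by auto
    then have "r \<le> p" using assms True s by (auto simp: divided_def intro: dvd_trans)
    then show ?thesis using p True dvd_imp_le[OF p(2)] by (metis le_antisym not_numeral_le_zero gr0I)
  qed
  have "dchain m0 (rev acc @ [(m div r, r)]) (m div r)"
    using assms m by (intro dchain_snoc[of _ _ m]) (auto simp: divided_def s)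
  moreover have "div_step r s = (m div r, (m div r, r) # acc)" using True s by (auto simp: div_step_def)
  moreover have "m > 0" "m dvd m0" using assms by (auto simp: divided_def s)
  then have "m div r > 0" using m by (metis gr0I mult_0_right)
  moreover have "m div r dvd m" by (subst (2) m) simp
  moreover have "m div r dvd m0" "r dvd m0" using \<open>m dvd m0\<close> \<open>m div r dvd m\<close> True s by (auto elim: dvd_trans)
  moreover have "r \<le> p" if "prime p" "p dvd m div r" for p
    using assms that dvd_trans[OF that(2) \<open>m div r dvd m\<close>] by (auto simp: divided_def s)
  ultimately show ?thesis using assms r s by (auto simp: divided_def)
next
  case False
  then have "div_step r s = s" by (auto simp: div_step_def)
  then show ?thesis using assms by simp
qed

text \<open>Every successful division at least halves the number, so \<open>length u\<close>
  attempts exhaust the factor \<open>r\<close>.\<close>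

lemma divided_block:
  assumes "divided m0 r s" "fst s < 2 ^ length u"
  shows "divided m0 (Suc r) (fold div_step (map (\<lambda>_. r) u) s)"
proof -
  let ?s = "fold div_step (map (\<lambda>_. r) u) s"
  have "divided m0 r ?s \<and> (2 \<le> r \<longrightarrow> \<not> r dvd fst ?s)"
    using assms
  proof (induction u arbitrary: s)
    case Nil
    then show ?case by (simp add: divided_def)
  next
    case (Cons a u)
    have d: "divided m0 r (div_step r s)" by (rule divided_step[OF Cons.prems(1)])
    show ?case
    proof (cases "2 \<le> r \<and> r dvd fst s")
      case True
      have "fst (div_step r s) = fst s div r" using True by (auto simp: div_step_def)
      also have "\<dots> \<le> fst s div 2" using True by (intro div_le_mono2) auto
      also have "\<dots> < 2 ^ length u" using Cons.prems(2) by auto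
      finally show ?thesis using Cons.IH[OF d] by simp
    next
      case False
      then have *: "div_step r s = s" by (auto simp: div_step_def)
      have "fold div_step (map (\<lambda>_. r) v) s = s" for v :: "'a list" by (induction v) (use * in auto)
      then show ?thesis using False Cons.prems(1) * by simp
    qed
  qed
  then have d: "divided m0 r ?s" and nd: "2 \<le> r \<Longrightarrow> \<not> r dvd fst ?s" by blast+
  have "Suc r \<le> p" if "prime p" "p dvd fst ?s" for p
  proof -
    have "r \<le> p" using d that unfolding divided_def by blast
    moreover have "p \<noteq> r" using nd that prime_ge_2_nat by blast
    ultimately show ?thesis by simp
  qed
  then show ?thesis using d unfolding divided_def by blast
qed

lemma trial_correct:
  assumes "0 < m" "m < 2 ^ length u" "\<And>p. prime p \<Longrightarrow> p dvd m \<Longrightarrow> p < W" "trial [0..<W] u m = (m', acc)"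
  shows "dchain m (rev acc) 1" "\<forall>(M, r)\<in>set acc. prime r \<and> r dvd m"
proof -
  have "divided m k (trial [0..<k] u m)" for k
  proof (induction k)
    case 0
    then show ?case using assms(1) by (simp add: divided_def trial_def)
  next
    case (Suc k)
    have "fst (trial [0..<k] u m) \<le> m" using Suc assms(1) by (auto simp: divided_def dvd_imp_le)
    then show ?case using divided_block[OF Suc, of u] assms(2) by (simp add: trial_def)
  qed
  from this[of W] have d: "dchain m (rev acc) m'" "m' dvd m" "\<forall>(M, r)\<in>set acc. prime r \<and> r dvd m"
    "\<And>p. prime p \<Longrightarrow> p dvd m' \<Longrightarrow> W \<le> p"
    unfolding assms(4) divided_def fst_conv snd_conv by blast+
  \<comment> \<open>A prime factor of the rest would be at least \<open>W\<close>, yet it divides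
    \<open>m\<close>.\<close>
  have "m' = 1"
  proof (rule ccontr)
    assume "m' \<noteq> 1"
    then obtain p where p: "prime p" "p dvd m'" using prime_factor_nat by blast
    from d(4)[OF p] assms(3)[OF p(1) dvd_trans[OF p(2) d(2)]] show False by simp
  qed
  then show "dchain m (rev acc) 1" "\<forall>(M, r)\<in>set acc. prime r \<and> r dvd m" using d(1,3) by simp_all
qed

lemma pt_trial:
  fixes w :: "'e::enc \<Rightarrow> nat list" and u :: "'e \<Rightarrow> 'b::enc list" and m :: "'e \<Rightarrow> nat"
  assumes w: "pt D w" and u: "pt D u" and m: "pt D m"
  shows "pt D (\<lambda>e. trial (w e) (u e) (m e))"
proof -
  define L where "L e = concat (map (\<lambda>r. map (\<lambda>_. r) (u e)) (w e))" for e
  have L: "pt D L" unfolding L_def by (intro pt_concat pt_map pt_lift w u pt_basic)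
  have b: "fst (fold div_step us (n, [])) \<le> n \<and> length (snd (fold div_step us (n, []))) \<le> length us \<and>
    (\<forall>x\<in>set (snd (fold div_step us (n, []))). sz x \<le> 2 * bl n + sz us + 1)" for us n
  proof (induction us rule: rev_induct)
    case (snoc r us)
    obtain k acc where s: "fold div_step us (n, []) = (k, acc)" by fastforce
    have IH: "k \<le> n" "length acc \<le> length us" "\<And>x. x \<in> set acc \<Longrightarrow> sz x \<le> 2 * bl n + sz us + 1"
      using snoc.IH s by auto
    have k: "k div r \<le> n" using IH(1) by (meson div_le_dividend le_trans)
    then have "sz (k div r, r) \<le> 2 * bl n + sz (us @ [r]) + 1" using bl_mono[OF k] by simp
    moreover have "sz x \<le> 2 * bl n + sz (us @ [r]) + 1" if "x \<in> set acc" for x using IH(3)[OF that] by simp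
    moreover have "div_step r (k, acc) = (k, acc) \<or> div_step r (k, acc) = (k div r, (k div r, r) # acc)"
      by (auto simp: div_step_def)
    ultimately show ?case using IH(1,2) k by (auto simp: s simp del: sz_simps sz_append)
  qed simp
  have "pt D (\<lambda>e. fold div_step (L e) (m e, []))"
  proof (rule pt_fold[OF L])
    let ?B = "\<lambda>e. 2 * sz (m e) + sz (L e) + 1"
    show "pt D (\<lambda>e. (m e, [] :: (nat \<times> nat) list))" by (intro pt_basic m)
    show "pbd D (\<lambda>e. 2 * sz (m e) + length (L e) * (2 * ?B e + 1) + 1)" by (intro pbd_intros pt_pbd pbd_length L m)
    fix e us vs assume e: "L e = us @ vs"
    obtain k acc where s: "fold div_step us (m e, []) = (k, acc)" by fastforce
    have "sz acc \<le> length (L e) * (2 * ?B e + 1)"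
    proof (rule sz_list_bound)
      have "\<forall>x\<in>set acc. sz x \<le> 2 * bl (m e) + sz us + 1" "length acc \<le> length us" using b[of us "m e"] s by auto
      moreover have "sz us \<le> sz (L e)" "length us \<le> length (L e)" using e by simp_all
      ultimately show "\<forall>x\<in>set acc. sz x \<le> ?B e" "length acc \<le> length (L e)" by (auto intro: order_trans)
    qed
    moreover have "bl k \<le> bl (m e)" using b[of us "m e"] s by (intro bl_mono) simp
    ultimately show "sz (fold div_step us (m e, [])) \<le> 2 * sz (m e) + length (L e) * (2 * ?B e + 1) + 1"
      unfolding s by simp
  qed (unfold div_step_def, intro pt_If pt_eq pt_nat_ops pt_basic)
  then show ?thesis unfolding trial_def L_def .
qed

text \<open>Turns the real polynomials of the hypotheses into powers of natural numbers, the form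
  that \<open>pbd\<close> and \<open>ticks\<close> can handle.\<close>

lemma poly_bound:
  "\<exists>k. \<forall>x (N::nat). 0 \<le> x \<longrightarrow> x \<le> real N \<longrightarrow> poly P x \<le> real ((N + 2) ^ k)"
proof (induction P)
  case 0
  show ?case by simp
next
  case (pCons a P)
  then obtain k where k: "\<And>x N. 0 \<le> x \<Longrightarrow> x \<le> real N \<Longrightarrow> poly P x \<le> real ((N + 2) ^ k)" by blast
  obtain j where j: "\<bar>a\<bar> < 2 ^ j" using real_arch_pow[of 2 "\<bar>a\<bar>"] by auto
  have "poly (pCons a P) x \<le> real ((N + 2) ^ (max j (k + 1) + 1))" if x: "0 \<le> x" "x \<le> real N" for x N
  proof -
    have "(2::real) ^ j \<le> (real N + 2) ^ j" by (intro power_mono) auto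
    also have "\<dots> \<le> (real N + 2) ^ max j (k + 1)" by (intro power_increasing) auto
    finally have 1: "a \<le> (real N + 2) ^ max j (k + 1)" using j by linarith
    have "x * poly P x \<le> x * (real N + 2) ^ k" using k[OF x] x(1) by (intro mult_left_mono) (auto simp: add.commute)
    also have "\<dots> \<le> (real N + 2) * (real N + 2) ^ k" using x by (intro mult_right_mono) auto
    also have "\<dots> \<le> (real N + 2) ^ max j (k + 1)" unfolding power_Suc[symmetric] by (intro power_increasing) auto
    finally have "poly (pCons a P) x \<le> 2 * (real N + 2) ^ max j (k + 1)" using 1 by simp
    also have "\<dots> \<le> (real N + 2) * (real N + 2) ^ max j (k + 1)" by (intro mult_right_mono) auto
    finally show ?thesis by (simp add: algebra_simps)
  qed
  then show ?case by blast
qed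

definition first :: "nat list \<Rightarrow> nat" where
  "first xs = (case xs of [] \<Rightarrow> 0 | a # _ \<Rightarrow> a)"

definition get_n :: "nat list \<Rightarrow> nat" where "get_n xs = first (tl xs)"

definition get_h :: "nat list \<Rightarrow> nat list" where
  "get_h xs = lowpart (first xs) (take (get_n xs + 1) (tl (tl xs)))"

definition get_q :: "nat list \<Rightarrow> nat" where "get_q xs = first xs ^ length (get_h xs)"

definition get_f :: "nat list \<Rightarrow> nat list list" where
  "get_f xs = chunks (get_n xs) (tl (drop (get_n xs + 1) (tl (tl xs))))"

text \<open>The two added zeros give the clock the length \<open>(bl q + 2) ^ k\<close>, the form in
  which \<open>poly_bound\<close> delivers the bound on the primes.\<close>

definition get_divs :: "nat \<Rightarrow> nat list \<Rightarrow> (nat \<times> nat) list" where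
  "get_divs k xs = rev (snd (trial [0..<length (ticks k (0 # 0 # bits (get_q xs)))] (bits (get_q xs)) (get_q xs - 1)))"

text \<open>\<open>i + 1 - r = 0\<close> says \<open>i < r\<close> in truncated subtraction, so the
  filter writes \<open>r\<close> in unary. The argument of \<open>Z\<close> repeats the first
  \<open>n + 3\<close> numbers of the input, namely \<open>p\<close>, \<open>n\<close> and the
  \<open>n + 1\<close> coefficients of \<open>g\<close>.\<close>

definition get_links :: "nat \<Rightarrow> (nat list \<Rightarrow> nat list) \<Rightarrow> nat list \<Rightarrow> nat list link list" where
  "get_links k Z xs = map (\<lambda>Mr. (fst Mr, filter (\<lambda>i. i + 1 - snd Mr = 0) [0..<length (ticks k (0 # 0 # bits (get_q xs)))],
     rev (Z (take (get_n xs + 3) xs @ [snd Mr])))) (get_divs k xs)"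

definition root_codes :: "nat \<Rightarrow> (nat list \<Rightarrow> nat list) \<Rightarrow> nat list \<Rightarrow> nat list list" where
  "root_codes k Z xs = map rev (solve (codering (first xs, get_h xs)) (minus_one (first xs, get_h xs)) (get_q xs)
     (get_links k Z xs) (get_f xs))"

lemma pt_first: "pt D f \<Longrightarrow> pt D (\<lambda>e. first (f e))"
  unfolding first_def by (rule pt_case_list) (assumption | intro pt_basic)+

text \<open>The subroutine is known to work on \<open>DA\<close> only, so already the time bound
  depends on the correctness of trial division, which enters through the second premise.\<close>

lemma pt_root_codes:
  assumes Z: "pt DA Z" and DA: "\<And>xs M r. xs \<in> D \<Longrightarrow> (M, r) \<in> set (get_divs k xs) \<Longrightarrow> take (get_n xs + 3) xs @ [r] \<in> DA"
  shows "pt D (\<lambda>xs. concat (root_codes k Z xs))"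
proof -
  note ptl = pt_first pt_tl pt_basic
  have n: "pt D' (\<lambda>e. get_n (f e))" if "pt D' f" for D' and f :: "'e::enc \<Rightarrow> nat list"
    unfolding get_n_def by (intro ptl that)
  have h: "pt D' (\<lambda>e. get_h (f e))" if "pt D' f" for D' and f :: "'e::enc \<Rightarrow> nat list"
    unfolding get_h_def by (intro pt_lowpart pt_take_drop pt_nat_ops n ptl that)
  have q: "pt D' (\<lambda>e. get_q (f e))" if "pt D' f" for D' and f :: "'e::enc \<Rightarrow> nat list"
    unfolding get_q_def by (intro pt_prime_power h ptl that)
  have w: "pt D' (\<lambda>e. [0..<length (ticks k (0 # 0 # bits (get_q (f e))))])" if "pt D' f" for D' and f :: "'e::enc \<Rightarrow> nat list"
    by (intro pt_range pt_ticks pt_Cons pt_const pt_bits q that)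
  have d: "pt D (\<lambda>xs. get_divs k xs)"
    unfolding get_divs_def by (intro pt_rev pt_snd pt_trial w pt_bits q pt_nat_ops pt_basic)
  have "pt {z. fst z \<in> D \<and> snd z \<in> set (get_divs k (fst z))} (\<lambda>z. Z (take (get_n (fst z) + 3) (fst z) @ [snd (snd z)]))"
  proof (rule pt_comp[OF Z])
    show "pt {z. fst z \<in> D \<and> snd z \<in> set (get_divs k (fst z))} (\<lambda>z. take (get_n (fst z) + 3) (fst z) @ [snd (snd z)])"
      by (intro pt_append pt_take_drop pt_nat_ops n pt_basic)
  qed (use DA in \<open>auto simp: split_paired_all\<close>)
  then have l: "pt D (\<lambda>xs. get_links k Z xs)"
    unfolding get_links_def by (intro pt_map d pt_Pair pt_filter pt_rev w pt_eq pt_nat_ops pt_basic)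
  show ?thesis unfolding root_codes_def get_f_def
    by (intro pt_concat pt_map pt_rev pt_solve[OF ptr_codering] pt_minus_one pt_chunks pt_take_drop pt_nat_ops l q h n ptl)
qed

lemma chain_of_dchain:
  assumes "dchain m l 1" "\<forall>(M, r)\<in>set l. prime r \<and> domain.prim_root R (if r = 2 then 4 else r) (z r)" "domain R"
  shows "domain.chain R m (map (\<lambda>Mr. (fst Mr, [0..<snd Mr], z (snd Mr))) l)"
proof -
  interpret domain R by fact
  show ?thesis using assms(1,2)
    by (induction m l "1 :: nat" rule: dchain.induct) (auto simp: valid_link_def)
qed

section \<open>Correctness and size estimates for a presented field\<close>

context presented begin

lemma parse:
  assumes f: "f \<in> poly_codes (p, g)" and xs: "xs = input_field (p, g) @ input_poly f"
  shows "first xs = p" "get_n xs = n" "get_h xs = h" "get_q xs = q" "get_f xs = rev (map rev f)"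
    "take (get_n xs + 3) xs = input_field (p, g)"
proof -
  have lg: "length g = n + 1" using g_eq by (cases g) auto
  have x: "xs = p # n # g @ (length f - 1) # concat f" by (simp add: xs input_field_def input_poly_def n_def)
  show 1: "first xs = p" "get_n xs = n" by (simp_all add: x first_def get_n_def)
  show 2: "get_h xs = h" unfolding get_h_def 1 by (simp add: x h_def lg)
  show "get_q xs = q" unfolding get_q_def 1 2 by (simp add: q lengths)
  have "\<forall>c\<in>set f. length c = n" using f unfolding poly_codes_def codes_def n_def by auto
  moreover have "drop (n + 1) (tl (tl xs)) = (length f - 1) # concat f" unfolding x using lg by simp
  ultimately show "get_f xs = rev (map rev f)" unfolding get_f_def 1
    using chunks_concat[of f n] n_pos by simp
  have "length (input_field (p, g)) = n + 3" by (simp add: input_field_def lg)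
  then show "take (get_n xs + 3) xs = input_field (p, g)" unfolding 1 unfolding xs by simp
qed

lemma root_codes_correct:
  assumes f: "f \<in> poly_codes (p, g)" and xs: "xs = input_field (p, g) @ input_poly f"
    and \<zeta>: "\<And>r. prime r \<Longrightarrow> r dvd q - 1 \<Longrightarrow> r < (bl q + 2) ^ k \<and> \<zeta> (input_field (p, g) @ [r]) \<in> codes (p, g) \<and>
      primitive_root_of_unity (Fq (p, g)) (if r = 2 then 4 else r) (field_elem (p, g) (\<zeta> (input_field (p, g) @ [r])))"
  shows "distinct (root_codes k \<zeta> xs)" "set (root_codes k \<zeta> xs) \<subseteq> codes (p, g)"
    "field_elem (p, g) ` set (root_codes k \<zeta> xs) =
      {x \<in> carrier (Fq (p, g)). ring.eval (Fq (p, g)) (map (field_elem (p, g)) f) x = \<zero>\<^bsub>Fq (p, g)\<^esub>}"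
    "\<forall>(M, r)\<in>set (get_divs k xs). prime r \<and> r dvd q - 1"
proof -
  define W where "W = (bl q + 2) ^ k"
  have w: "[0..<length (ticks k (0 # 0 # bits (get_q xs)))] = [0..<W]"
    by (simp add: W_def parse[OF f xs])
  have q2: "q \<ge> 2" using q n_pos p2 self_le_power[of p n] by linarith
  obtain m' acc where tr: "trial [0..<W] (bits q) (q - 1) = (m', acc)" by fastforce
  have "q - 1 < 2 ^ length (bits q)" using less_power_bl[of q] by simp
  then have d: "dchain (q - 1) (rev acc) 1" "\<forall>(M, r)\<in>set acc. prime r \<and> r dvd q - 1"
    using trial_correct[OF _ _ _ tr] \<zeta> q2 unfolding W_def by auto
  have divs: "get_divs k xs = rev acc" unfolding get_divs_def w unfolding parse[OF f xs] tr by simp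
  show "\<forall>(M, r)\<in>set (get_divs k xs). prime r \<and> r dvd q - 1" using d(2) by (simp add: divs)
  define z where "z r = rev (\<zeta> (input_field (p, g) @ [r]))" for r
  have "filter (\<lambda>i. i + 1 - r = 0) [0..<W] = [0..<r]" if "r < W" for r
  proof -
    have "[0..<W] = [0..<r] @ [r..<W]" using upt_add_eq_append[of 0 r "W - r"] that by simp
    then show ?thesis by (auto simp: filter_empty_conv filter_id_conv)
  qed
  note range = this
  have links: "get_links k \<zeta> xs = map (\<lambda>Mr. (fst Mr, [0..<snd Mr], z (snd Mr))) (rev acc)"
    unfolding get_links_def divs w parse(6)[OF f xs] z_def
  proof (rule map_cong[OF refl])
    fix Mr assume "Mr \<in> set (rev acc)"
    then have "prime (snd Mr) \<and> snd Mr dvd q - 1" using bspec[OF d(2), of Mr] by (simp add: case_prod_unfold)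
    then have "snd Mr < W" using \<zeta>[of "snd Mr"] unfolding W_def by blast
    from range[OF this] show "(fst Mr, filter (\<lambda>i. i + 1 - snd Mr = 0) [0..<W], rev (\<zeta> (input_field (p, g) @ [snd Mr]))) =
        (fst Mr, [0..<snd Mr], rev (\<zeta> (input_field (p, g) @ [snd Mr])))" by (simp only:)
  qed
  have "\<forall>(M, r)\<in>set (rev acc). prime r \<and> G.prim_root (if r = 2 then 4 else r) (z r)"
  proof (intro ballI case_prodI2)
    fix Mr M r assume "Mr \<in> set (rev acc)" "Mr = (M, r)"
    then have r: "prime r" "r dvd q - 1" using bspec[OF d(2), of Mr] by simp_all
    then show "prime r \<and> G.prim_root (if r = 2 then 4 else r) (z r)"
      using \<zeta>[OF r] prim_root_iff unfolding z_def by blast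
  qed
  then have ch: "G.chain (q - 1) (get_links k \<zeta> xs)"
    unfolding links by (intro chain_of_dchain[OF d(1)] G.domain_axioms)
  define fl where "fl = rev (map rev f)"
  have fl: "set fl \<subseteq> carrier G" using f by (auto simp: fl_def carrier_codes poly_codes_def)
  have f0: "f \<noteq> []" using f by (simp add: poly_codes_def)
  have map_fl: "map \<phi> fl = rev (map (field_elem (p, g)) f)" by (simp add: fl_def \<phi>_def rev_map o_def)
  have pc: "map (field_elem (p, g)) f \<in> carrier (poly_ring F)" using f by (simp add: poly_codes_def)
  then have pf: "set (map (field_elem (p, g)) f) \<subseteq> carrier F" "hd (map (field_elem (p, g)) f) \<noteq> \<zero>\<^bsub>F\<^esub>"
    using f0 unfolding univ_poly_carrier[symmetric] polynomial_def by auto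
  have "\<phi> (last fl) = hd (map (field_elem (p, g)) f)" using f0 by (simp add: fl_def last_rev hd_map \<phi>_def)
  then have lz: "last fl \<noteq> \<zero>\<^bsub>G\<^esub>" using pf(2) \<phi>_zero by auto
  define ys where "ys = solve G (minus_one (p, h)) q (get_links k \<zeta> xs) fl"
  have ys: "distinct ys" "set ys = {y \<in> carrier G. ev G fl y = \<zero>\<^bsub>G\<^esub>}"
    using G.solve_correct[OF ch minus_one_eq fl _ lz] f0 by (simp_all add: ys_def fl_def)
  have vs: "root_codes k \<zeta> xs = map rev ys" by (simp add: root_codes_def parse[OF f xs] ys_def G_def fl_def)
  show "distinct (root_codes k \<zeta> xs)" using ys(1) by (simp add: vs distinct_map inj_on_def)
  show "set (root_codes k \<zeta> xs) \<subseteq> codes (p, g)" using ys(2) carrier_codes by (auto simp: vs)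
  have ev: "\<phi> (ev G fl y) = F.eval (map (field_elem (p, g)) f) (\<phi> y)" if "y \<in> carrier G" for y
    using \<phi>_ev[OF fl that] F.eval_eq_ev[OF F.is_cring pf(1)] \<phi>_bij that by (simp add: map_fl bij_betwE)
  have "field_elem (p, g) ` set (root_codes k \<zeta> xs) = \<phi> ` set ys" by (simp add: vs image_image \<phi>_def[abs_def])
  also have "\<dots> = {x \<in> carrier F. F.eval (map (field_elem (p, g)) f) x = \<zero>\<^bsub>F\<^esub>}"
  proof -
    have c: "ev G fl y \<in> carrier G" if "y \<in> carrier G" for y using fl that by (rule G.ev_closed)
    have iff: "ev G fl y = \<zero>\<^bsub>G\<^esub> \<longleftrightarrow> F.eval (map (field_elem (p, g)) f) (\<phi> y) = \<zero>\<^bsub>F\<^esub>" if "y \<in> carrier G" for y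
      unfolding ev[OF that, symmetric] \<phi>_zero[symmetric] by (rule \<phi>_eq_iff[symmetric]) (use c[OF that] zero_closed_G in auto)
    have im: "\<phi> ` carrier G = carrier F" using \<phi>_bij by (simp add: bij_betw_def)
    show ?thesis
    proof (intro equalityI subsetI)
      fix x assume "x \<in> \<phi> ` set ys"
      then obtain y where y: "x = \<phi> y" "y \<in> set ys" by (rule imageE)
      then have "y \<in> carrier G" "ev G fl y = \<zero>\<^bsub>G\<^esub>" using ys(2) by simp_all
      then show "x \<in> {x \<in> carrier F. F.eval (map (field_elem (p, g)) f) x = \<zero>\<^bsub>F\<^esub>}"
        using iff[of y] imageI[of y "carrier G" \<phi>] y(1) unfolding im by simp
    next
      fix x assume x: "x \<in> {x \<in> carrier F. F.eval (map (field_elem (p, g)) f) x = \<zero>\<^bsub>F\<^esub>}"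
      then have "x \<in> \<phi> ` carrier G" unfolding im by simp
      then obtain y where y: "x = \<phi> y" "y \<in> carrier G" by (rule imageE)
      then have "y \<in> set ys" using x iff[of y] ys(2) by simp
      then show "x \<in> \<phi> ` set ys" using y(1) by (rule rev_image_eqI)
    qed
  qed
  finally show "field_elem (p, g) ` set (root_codes k \<zeta> xs) =
      {x \<in> carrier F. F.eval (map (field_elem (p, g)) f) x = \<zero>\<^bsub>F\<^esub>}" .
qed

lemma log_q: "log 2 q = n * log 2 p" "log 2 p \<ge> 1" "real n \<le> log 2 q" "log 2 q \<le> real n * real (bl p)" "log 2 q \<le> real (bl q)"
  "real (bl p) \<le> log 2 q + 1"
proof -
  show 1: "log 2 q = n * log 2 p" using p2 by (simp add: q log_nat_power)
  show 2: "log 2 p \<ge> 1" using p2 by simp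
  show "real n \<le> log 2 q" unfolding 1 using mult_left_mono[OF 2, of "real n"] by simp
  have l: "log 2 m \<le> bl m" if "m > 0" for m :: nat
  proof -
    have "real m < 2 ^ bl m" using less_power_bl[of m] by (metis of_nat_less_iff of_nat_numeral of_nat_power)
    then show ?thesis using that log_less_iff[of 2 "real m" "real (bl m)"] by (simp add: powr_realpow)
  qed
  show "log 2 q \<le> real n * real (bl p)" unfolding 1 using l[of p] p2 by (intro mult_left_mono) auto
  show "log 2 q \<le> real (bl q)" using l[of q] p2 by (simp add: q)
  have "real (bl p) = \<lfloor>log 2 p\<rfloor> + 1" using p2 by (simp add: floorlog_def)
  also have "\<dots> \<le> log 2 p + 1" by simp
  also have "log 2 p \<le> log 2 q" unfolding 1 using n_pos 2 mult_right_mono[of 1 "real n" "log 2 p"] by simp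
  finally show "real (bl p) \<le> log 2 q + 1" by simp
qed

text \<open>Links the two measures: the given program is timed in \<open>log q\<close>, the closure
  properties in the size of the input. As \<open>q = p ^ n\<close>, and both \<open>n\<close> and
  the length of \<open>p\<close> are at most that size, its square suffices.\<close>

lemma log_q_sz: "log 2 q \<le> real (sz (input_field (p, g) @ ys) * sz (input_field (p, g) @ ys))"
proof -
  let ?s = "sz (input_field (p, g) @ ys)"
  have "n \<le> ?s" using length_le_sz[of g] by (simp add: input_field_def n_def)
  moreover have "bl p \<le> ?s" by (simp add: input_field_def)
  ultimately have "n * bl p \<le> ?s * ?s" by (rule mult_le_mono)
  then have "real n * real (bl p) \<le> real (?s * ?s)" unfolding of_nat_mult[symmetric] of_nat_le_iff .
  then show ?thesis using log_q(4) by linarith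
qed

text \<open>\<open>65 = 7 * 9 + 2\<close>: the input has at most \<open>7 * x\<close> entries of
  cost at most \<open>9 * x\<close> each, and \<open>2 \<le> 2 * x\<^sup>2\<close>. The maximum with
  \<open>1\<close> in \<open>x\<close> keeps \<open>x \<ge> 1\<close> for constant
  polynomials.\<close>

lemma input_size:
  assumes f: "f \<in> poly_codes (p, g)" and x: "x = real (max 1 (length f - 1)) * log 2 q"
  shows "real (sz (input_field (p, g) @ input_poly f) + 2) \<le> 65 * x\<^sup>2"
proof -
  let ?xs = "input_field (p, g) @ input_poly f"
  define d B where "d = length f - 1" and "B = bl p + n + d"
  have lg: "length g = n + 1" using g_eq by (cases g) auto
  have lf: "length f = d + 1" using f by (cases f) (auto simp: d_def poly_codes_def)
  have cf: "length c = n" "set c \<subseteq> {..<p}" if "c \<in> set f" for c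
    using f that unfolding poly_codes_def codes_def n_def by auto
  have "length (concat f) = (d + 1) * n"
    using cf(1) unfolding lf[symmetric] by (induction f) auto
  then have len: "length ?xs = n + 4 + (d + 1) * n" by (simp add: input_field_def input_poly_def lg)
  have elems: "\<forall>a\<in>set ?xs. sz a \<le> B"
  proof
    fix a assume "a \<in> set ?xs"
    then have "a \<le> p \<or> a = n \<or> a = d"
      using g_eq(4) less_imp_le[OF lessThan_iff[THEN iffD1, OF subsetD[OF cf(2)]]]
      by (auto simp: input_field_def input_poly_def n_def d_def)
    then show "sz a \<le> B" using bl_mono[of a p] bl_le_self[of a] by (auto simp: B_def)
  qed
  have s: "sz ?xs \<le> (n + 4 + (d + 1) * n) * (2 * B + 1)"
    by (rule sz_list_bound[OF elems eq_refl[OF len]])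
  let ?y = "log 2 q"
  have y: "1 \<le> ?y" "real n \<le> ?y" "real (bl p) \<le> ?y + 1" using log_q n_pos by linarith+
  have D: "1 \<le> real (max 1 d)" "real d \<le> real (max 1 d)" by auto
  have x1: "x = real (max 1 d) * ?y" by (simp add: x d_def)
  have xy: "?y \<le> x" unfolding x1 using mult_right_mono[OF D(1), of ?y] y by simp
  have xd: "real (max 1 d) \<le> x" unfolding x1 using mult_left_mono[OF y(1), of "real (max 1 d)"] by simp
  have "real ((d + 1) * n) = real d * real n + real n" by (simp add: algebra_simps)
  also have "real d * real n \<le> real (max 1 d) * ?y" using D y by (intro mult_mono) auto
  finally have "real ((d + 1) * n) \<le> 2 * x" using x1 y xy by linarith
  then have 1: "real (n + 4 + (d + 1) * n) \<le> 7 * x" using y xy by simp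
  have 2: "real (2 * B + 1) \<le> 9 * x" using y xy xd D by (simp add: B_def)
  have "real (sz ?xs) \<le> real (n + 4 + (d + 1) * n) * real (2 * B + 1)" using s unfolding of_nat_mult[symmetric] of_nat_le_iff .
  also have "\<dots> \<le> (7 * x) * (9 * x)" using 1 2 y xy by (intro mult_mono) auto
  finally have 3: "real (sz ?xs) \<le> 63 * x\<^sup>2" by (simp add: power2_eq_square)
  have "1 \<le> x\<^sup>2" using y xy by simp
  then show ?thesis using 3 by (simp del: sz_append)
qed

end

lemma computes_deterministic: "computes A xs v t \<Longrightarrow> computes A xs v' t' \<Longrightarrow> v = v'"
  unfolding computes_def using exec_deterministic by blast

lemma prime_divisor_of_prod:
  assumes "prime r" "r dvd (\<Prod>j\<in>J. a j ^ e j)" "finite J" "\<And>j. j \<in> J \<Longrightarrow> prime (a j)"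
  obtains j where "j \<in> J" "r = (a j :: nat)"
proof -
  obtain j where j: "j \<in> J" "r dvd a j ^ e j" using prime_dvd_prod_iff[OF assms(3,1)] assms(2) by auto
  have "r dvd a j" by (rule prime_dvd_power[OF assms(1) j(2)])
  then have "r = a j" by (rule primes_dvd_imp_eq[OF assms(1) assms(4)[OF j(1)]])
  with j(1) show ?thesis by (rule that)
qed

theorem theorem2p4:
  fixes Q1 :: "nat set" and pres :: "nat \<Rightarrow> presentation set"
  assumes "\<forall>q\<in>Q1. primepow q"
    and "\<forall>q\<in>Q1. pres q \<subseteq> presentations q"
    and "\<exists>(A :: program) (T :: real poly) (S :: real poly). \<forall>q\<in>Q1.
      \<exists>(m :: nat) (r :: nat \<Rightarrow> nat) (e :: nat \<Rightarrow> nat).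
        inj_on r {1..m} \<and> (\<forall>j\<in>{1..m}. prime (r j) \<and> 1 \<le> e j) \<and>
        q = (\<Prod>j=1..m. r j ^ e j) + 1 \<and>
        real (\<Sum>j=1..m. r j) \<le> poly S (log 2 (real q)) \<and>
        (\<forall>j\<in>{1..m}. \<forall>K\<in>pres q. \<exists>v t.
           computes A (input_field K @ [r j]) v t \<and>
           v \<in> codes K \<and>
           primitive_root_of_unity (Fq K) (if r j = 2 then 4 else r j) (field_elem K v) \<and>
           real t \<le> poly T (log 2 (real q)))"
  shows "\<exists>(B :: program) (P :: real poly) (k :: nat). \<forall>q\<in>Q1. \<forall>K\<in>pres q. \<forall>f\<in>poly_codes K.
      \<exists>vs t.
        computes B (input_field K @ input_poly f) (concat vs) t \<and>
        distinct vs \<and> set vs \<subseteq> codes K \<and>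
        field_elem K ` set vs =
          {x \<in> carrier (Fq K). ring.eval (Fq K) (map (field_elem K) f) x = \<zero>\<^bsub>Fq K\<^esub>} \<and>
        real t \<le> soft_poly_bound P k (real (max 1 (length f - 1)) * log 2 (real q))"
proof -
  obtain A and T S :: "real poly" where H: "\<forall>q\<in>Q1.
      \<exists>(m :: nat) (r :: nat \<Rightarrow> nat) (e :: nat \<Rightarrow> nat).
        inj_on r {1..m} \<and> (\<forall>j\<in>{1..m}. prime (r j) \<and> 1 \<le> e j) \<and>
        q = (\<Prod>j=1..m. r j ^ e j) + 1 \<and>
        real (\<Sum>j=1..m. r j) \<le> poly S (log 2 (real q)) \<and>
        (\<forall>j\<in>{1..m}. \<forall>K\<in>pres q. \<exists>v t.
           computes A (input_field K @ [r j]) v t \<and>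
           v \<in> codes K \<and>
           primitive_root_of_unity (Fq K) (if r j = 2 then 4 else r j) (field_elem K v) \<and>
           real t \<le> poly T (log 2 (real q)))"
    using assms(3) by blast
  have presented: "presented (fst K) (snd K) q" if "q \<in> Q1" "K \<in> pres q" for q K
    using assms(2) that by unfold_locales auto
  obtain kS where kS: "\<And>x N. 0 \<le> x \<Longrightarrow> x \<le> real N \<Longrightarrow> poly S x \<le> real ((N + 2) ^ kS)" using poly_bound[of S] by blast
  obtain kT where kT: "\<And>x N. 0 \<le> x \<Longrightarrow> x \<le> real N \<Longrightarrow> poly T x \<le> real ((N + 2) ^ kT)" using poly_bound[of T] by blast
  \<comment> \<open>By determinism the output of the given program is a function of its input, so
    the program can be treated as a subroutine that computes \<open>\<zeta>\<close>.\<close>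
  define \<zeta> where "\<zeta> xs = (THE v. \<exists>t. computes A xs v t)" for xs
  have key: "r < (bl q + 2) ^ (kS + 1)" "\<zeta> (input_field K @ [r]) \<in> codes K"
    "primitive_root_of_unity (Fq K) (if r = 2 then 4 else r) (field_elem K (\<zeta> (input_field K @ [r])))"
    "\<exists>t. computes A (input_field K @ [r]) (\<zeta> (input_field K @ [r])) t \<and> t \<le> (sz (input_field K @ [r]) * sz (input_field K @ [r]) + 2) ^ kT"
    if Q: "q \<in> Q1" and K: "K \<in> pres q" and r: "prime r" "r dvd q - 1" for q K r
  proof -
    interpret presented "fst K" "snd K" q by (rule presented[OF Q K])
    let ?xs = "input_field K @ [r]"
    obtain m :: nat and s e :: "nat \<Rightarrow> nat" where s: "\<forall>j\<in>{1..m}. prime (s j)" and qs: "q = (\<Prod>j=1..m. s j ^ e j) + 1"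
      and sum: "real (\<Sum>j=1..m. s j) \<le> poly S (log 2 (real q))"
      and comp: "\<And>j. j \<in> {1..m} \<Longrightarrow> \<exists>v t. computes A (input_field K @ [s j]) v t \<and> v \<in> codes K \<and>
           primitive_root_of_unity (Fq K) (if s j = 2 then 4 else s j) (field_elem K v) \<and> real t \<le> poly T (log 2 (real q))"
    proof -
      from bspec[OF H Q] K show thesis
        by - (elim exE conjE, rule that[rotated], assumption, assumption, blast, blast)
    qed
    have "r dvd (\<Prod>j=1..m. s j ^ e j)" using r(2) qs by simp
    with r(1) obtain j where j: "j \<in> {1..m}" "r = s j" by (rule prime_divisor_of_prod) (use s in auto)
    have lq: "0 \<le> log 2 (real q)" using log_q(3) by linarith
    have "s j \<le> (\<Sum>j=1..m. s j)" using j(1) by (intro member_le_sum) auto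
    then have "real r \<le> poly S (log 2 (real q))" using sum j(2) by linarith
    also have "\<dots> \<le> real ((bl q + 2) ^ kS)" by (rule kS[OF lq log_q(5)])
    finally have "r \<le> (bl q + 2) ^ kS" by (simp only: of_nat_le_iff)
    \<comment> \<open>The additional exponent buys strictness, since trial division runs over the
      numbers below its bound.\<close>
    also have "\<dots> < (bl q + 2) ^ (kS + 1)" by (intro power_strict_increasing) auto
    finally show "r < (bl q + 2) ^ (kS + 1)" .
    obtain v t where v: "computes A ?xs v t" "v \<in> codes K"
      "primitive_root_of_unity (Fq K) (if r = 2 then 4 else r) (field_elem K v)" "real t \<le> poly T (log 2 (real q))"
      using comp[OF j(1)] unfolding j(2)[symmetric] by blast
    have \<zeta>: "\<zeta> ?xs = v" unfolding \<zeta>_def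
      by (rule the_equality) (use v(1) computes_deterministic in blast)+
    show "\<zeta> ?xs \<in> codes K" "primitive_root_of_unity (Fq K) (if r = 2 then 4 else r) (field_elem K (\<zeta> ?xs))"
      unfolding \<zeta> by (rule v)+
    have "poly T (log 2 (real q)) \<le> real ((sz ?xs * sz ?xs + 2) ^ kT)"
      by (rule kT[OF lq]) (use log_q_sz[of "[r]"] in \<open>simp del: sz_append\<close>)
    from order_trans[OF v(4) this] have "t \<le> (sz ?xs * sz ?xs + 2) ^ kT" by (simp only: of_nat_le_iff)
    then show "\<exists>t. computes A ?xs (\<zeta> ?xs) t \<and> t \<le> (sz ?xs * sz ?xs + 2) ^ kT" using v(1) unfolding \<zeta> by blast
  qed
  define DA where "DA = {input_field K @ [r] |q K r. q \<in> Q1 \<and> K \<in> pres q \<and> prime r \<and> r dvd q - 1}"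
  have "pt DA \<zeta>"
  proof (rule pt_call)
    show "\<exists>t. computes A xs (\<zeta> xs) t \<and> t \<le> (sz xs * sz xs + 2) ^ kT" if "xs \<in> DA" for xs
      using that key(4) unfolding DA_def by blast
    show "pbd DA (\<lambda>xs. (sz xs * sz xs + 2) ^ kT)" by (intro pbd_intros)
  qed
  define D where "D = {input_field K @ input_poly f |q K f. q \<in> Q1 \<and> K \<in> pres q \<and> f \<in> poly_codes K}"
  let ?k = "kS + 1"
  have correct: "distinct (root_codes ?k \<zeta> xs)" "set (root_codes ?k \<zeta> xs) \<subseteq> codes K"
    "field_elem K ` set (root_codes ?k \<zeta> xs) =
      {x \<in> carrier (Fq K). ring.eval (Fq K) (map (field_elem K) f) x = \<zero>\<^bsub>Fq K\<^esub>}"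
    "\<forall>(M, r)\<in>set (get_divs ?k xs). prime r \<and> r dvd q - 1"
    "take (get_n xs + 3) xs = input_field K" "real (sz xs + 2) \<le> 65 * (real (max 1 (length f - 1)) * log 2 (real q))\<^sup>2"
    if Q: "q \<in> Q1" and K: "K \<in> pres q" and f: "f \<in> poly_codes K" and xs: "xs = input_field K @ input_poly f" for q K f xs
  proof -
    interpret presented "fst K" "snd K" q by (rule presented[OF Q K])
    have 1: "r < (bl q + 2) ^ ?k \<and> \<zeta> (input_field (fst K, snd K) @ [r]) \<in> codes (fst K, snd K) \<and>
      primitive_root_of_unity (Fq (fst K, snd K)) (if r = 2 then 4 else r) (field_elem (fst K, snd K) (\<zeta> (input_field (fst K, snd K) @ [r])))"
      if "prime r" "r dvd q - 1" for r using key(1-3)[OF Q K that] by simp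
    have 2: "f \<in> poly_codes (fst K, snd K)" "xs = input_field (fst K, snd K) @ input_poly f" using f xs by simp_all
    show "distinct (root_codes ?k \<zeta> xs)" "\<forall>(M, r)\<in>set (get_divs ?k xs). prime r \<and> r dvd q - 1"
      using root_codes_correct(1,4)[OF 2 1] by blast+
    show "set (root_codes ?k \<zeta> xs) \<subseteq> codes K" using root_codes_correct(2)[OF 2 1] by simp
    show "field_elem K ` set (root_codes ?k \<zeta> xs) =
      {x \<in> carrier (Fq K). ring.eval (Fq K) (map (field_elem K) f) x = \<zero>\<^bsub>Fq K\<^esub>}"
      using root_codes_correct(3)[OF 2 1] unfolding prod.collapse .
    show "take (get_n xs + 3) xs = input_field K" using parse(6)[OF 2] unfolding prod.collapse .
    show "real (sz xs + 2) \<le> 65 * (real (max 1 (length f - 1)) * log 2 (real q))\<^sup>2"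
      using input_size[OF 2(1) refl] unfolding 2(2) .
  qed
  have "pt D (\<lambda>xs. concat (root_codes ?k \<zeta> xs))"
  proof (rule pt_root_codes[OF \<open>pt DA \<zeta>\<close>])
    fix xs M r assume "xs \<in> D" and Mr: "(M, r) \<in> set (get_divs ?k xs)"
    then obtain q K f where qKf: "q \<in> Q1" "K \<in> pres q" "f \<in> poly_codes K" "xs = input_field K @ input_poly f"
      unfolding D_def by blast
    have "prime r \<and> r dvd q - 1" using bspec[OF correct(4)[OF qKf] Mr] by simp
    then show "take (get_n xs + 3) xs @ [r] \<in> DA"
      unfolding correct(5)[OF qKf] DA_def using qKf by blast
  qed
  then obtain B U where B: "pbd D U" "\<And>xs. xs \<in> D \<Longrightarrow> \<exists>t. computes B xs (concat (root_codes ?k \<zeta> xs)) t \<and> t \<le> U xs"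
    by (rule pt_computes) blast
  then obtain l where l: "\<And>xs. xs \<in> D \<Longrightarrow> U xs \<le> (sz xs + 2) ^ l" unfolding pbd_def by blast
  \<comment> \<open>\<open>[:0, 0, 65:]\<close> is \<open>65 * X\<^sup>2\<close>, the bound of
    \<open>input_size\<close>. The time is polynomial in \<open>x\<close> outright, so the logarithm
    gets exponent \<open>0\<close> below.\<close>
  define P where "P = [:0, 0, 65 :: real:] ^ l"
  show ?thesis
  proof (intro exI[of _ B] exI[of _ P] exI[of _ 0] ballI)
    fix q K f assume qKf: "q \<in> Q1" "K \<in> pres q" "f \<in> poly_codes K"
    let ?xs = "input_field K @ input_poly f" and ?x = "real (max 1 (length f - 1)) * log 2 (real q)"
    note c = correct[OF qKf refl]
    have "?xs \<in> D" unfolding D_def using qKf by blast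
    from B(2)[OF this] l[OF this] obtain t where t: "computes B ?xs (concat (root_codes ?k \<zeta> ?xs)) t" "t \<le> (sz ?xs + 2) ^ l"
      by (meson order_trans)
    have "real t \<le> real (sz ?xs + 2) ^ l" using t(2) unfolding of_nat_power[symmetric] of_nat_le_iff .
    also have "\<dots> \<le> (65 * ?x\<^sup>2) ^ l" by (rule power_mono[OF c(6)]) simp
    also have "\<dots> = soft_poly_bound P 0 ?x" by (simp add: soft_poly_bound_def P_def power2_eq_square mult_ac)
    finally have "real t \<le> soft_poly_bound P 0 ?x" .
    then show "\<exists>vs t. computes B ?xs (concat vs) t \<and> distinct vs \<and> set vs \<subseteq> codes K \<and>
        field_elem K ` set vs = {x \<in> carrier (Fq K). ring.eval (Fq K) (map (field_elem K) f) x = \<zero>\<^bsub>Fq K\<^esub>} \<and>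
        real t \<le> soft_poly_bound P 0 ?x"
      using t(1) c(1-3) by blast
  qed
qed

end
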